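(* Let $L$ be an $\mathbb N$-graded Lie algebra over a field $K$, let $m\ge 0$ be an integer, and let $N$ be a graded ideal of $L$ such that $U(L/N)$ is left and right Noetherian. Then $L$ is graded $FP_m$ if and only if $H_i(N,K)$ is finitely generated as a $U(L/N)$-module for every $i\le m$. Consequently, for $\mathbb N$-graded Lie algebras, graded $FP_m$ and ordinary $FP_m$ are the same property.
   Context: A Lie algebra $L$ over $K$ is $\mathbb{N}$-graded if $L=\bigoplus_{i\ge1}L_i$ with $[L_i,L_j]\subseteq L_{i+j}$. An ideal $N$ of $L$ is graded if $N=\bigoplus_{i\ge1}(N\cap L_i)$. The enveloping algebra $R=U(L)$ has an induced $\mathbb N_0$-grading with $R_0=K\cdot 1$ and $R_i=\sum_{j\ge 1,\ i_1+\dots+i_j=i}L_{i_1}\cdots L_{i_j}$. Modules are right modules; a graded $R$-module is $V=\bigoplus_{i\ge0}V_i$ with $V_iR_j\subseteq V_{i+j}$, and a graded homomorphism is an $R$-module homomorphism $\varphi: V\to W$ with $\varphi(V_i)\subseteq W_i$. $L$ is of (ordinary) type $FP_m$ if the trivial $U(L)$-module $K$ has a projective resolution with finitely generated projectives in dimensions $\le m$; $L$ is graded $FP_m$ if there is such a resolution consisting of graded $U(L)$-modules and graded homomorphisms. *)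

theory Defs
  imports "HOL-Algebra.Module" "HOL-Algebra.QuotRing" "HOL-Algebra.Generated_Groups"
begin

section \<open>Right modules over a ring\<close>

text \<open>
  The record type \<^type>\<open>module\<close> and the locale \<^locale>\<open>submodule\<close> of the library are reused for
  right modules over a noncommutative ring: \<open>r \<odot> x\<close> stands for the product
  \<open>x r\<close>, which is why the associativity law below reverses the factors. The fields
  \<open>mult\<close> and \<open>one\<close> of the record are never used.
\<close>

locale right_module = R?: ring R + M?: abelian_group M
  for R :: "('r, 'b) ring_scheme" (structure) and M :: "('r, 'v, 'm) module_scheme" (structure) +
  assumes closed: "\<lbrakk>r \<in> carrier R; x \<in> carrier M\<rbrakk> \<Longrightarrow> r \<odot>\<^bsub>M\<^esub> x \<in> carrier M"
    and add_scalar: "\<lbrakk>r \<in> carrier R; s \<in> carrier R; x \<in> carrier M\<rbrakk> \<Longrightarrow>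
      (r \<oplus>\<^bsub>R\<^esub> s) \<odot>\<^bsub>M\<^esub> x = r \<odot>\<^bsub>M\<^esub> x \<oplus>\<^bsub>M\<^esub> s \<odot>\<^bsub>M\<^esub> x"
    and add_vector: "\<lbrakk>r \<in> carrier R; x \<in> carrier M; y \<in> carrier M\<rbrakk> \<Longrightarrow>
      r \<odot>\<^bsub>M\<^esub> (x \<oplus>\<^bsub>M\<^esub> y) = r \<odot>\<^bsub>M\<^esub> x \<oplus>\<^bsub>M\<^esub> r \<odot>\<^bsub>M\<^esub> y"
    and right_assoc: "\<lbrakk>r \<in> carrier R; s \<in> carrier R; x \<in> carrier M\<rbrakk> \<Longrightarrow>
      (r \<otimes>\<^bsub>R\<^esub> s) \<odot>\<^bsub>M\<^esub> x = s \<odot>\<^bsub>M\<^esub> (r \<odot>\<^bsub>M\<^esub> x)"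
    and unit: "x \<in> carrier M \<Longrightarrow> \<one>\<^bsub>R\<^esub> \<odot>\<^bsub>M\<^esub> x = x"

definition rmod_hom ::
  "('r, 'b) ring_scheme \<Rightarrow> ('r, 'v) module \<Rightarrow> ('r, 'w) module \<Rightarrow> ('v \<Rightarrow> 'w) set" where
  "rmod_hom R M M' = {h \<in> carrier M \<rightarrow> carrier M'.
     (\<forall>x\<in>carrier M. \<forall>y\<in>carrier M. h (x \<oplus>\<^bsub>M\<^esub> y) = h x \<oplus>\<^bsub>M'\<^esub> h y) \<and>
     (\<forall>r\<in>carrier R. \<forall>x\<in>carrier M. h (r \<odot>\<^bsub>M\<^esub> x) = r \<odot>\<^bsub>M'\<^esub> h x)}"

definition rmod_kernel :: "('r, 'v) module \<Rightarrow> ('r, 'w) module \<Rightarrow> ('v \<Rightarrow> 'w) \<Rightarrow> 'v set" where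
  "rmod_kernel M M' h = {x \<in> carrier M. h x = \<zero>\<^bsub>M'\<^esub>}"

definition fin_gen :: "('r, 'b) ring_scheme \<Rightarrow> ('r, 'v) module \<Rightarrow> bool" where
  "fin_gen R M \<longleftrightarrow> (\<exists>S. finite S \<and> S \<subseteq> carrier M \<and>
     carrier M = \<Inter>{H. submodule H R M \<and> S \<subseteq> H})"

text \<open>
  Projectivity is the lifting property against surjections \<open>g : A \<rightarrow> B\<close>. The
  types of \<open>A\<close> and \<open>B\<close> have to be fixed. The choice made here loses
  nothing: it includes \<open>B = P\<close> with \<open>A\<close> the free module of finitely supported
  functions from \<open>P\<close> to \<open>R\<close>, so the property forces \<open>P\<close> to be a direct summand
  of a free module.
\<close>

definition projective :: "('r, 'b) ring_scheme \<Rightarrow> ('r, 'v) module \<Rightarrow> bool" where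
  "projective R P \<longleftrightarrow> right_module R P \<and>
     (\<forall>(A :: ('r, 'v \<Rightarrow> 'r) module) (B :: ('r, 'v) module) g f.
        right_module R A \<longrightarrow> right_module R B \<longrightarrow>
        g \<in> rmod_hom R A B \<longrightarrow> g ` carrier A = carrier B \<longrightarrow> f \<in> rmod_hom R P B \<longrightarrow>
        (\<exists>h \<in> rmod_hom R P A. \<forall>x\<in>carrier P. g (h x) = f x))"

definition restrict_scalars :: "('s \<Rightarrow> 'r) \<Rightarrow> ('r, 'v) module \<Rightarrow> ('s, 'v) module" where
  "restrict_scalars \<theta> M = \<lparr>carrier = carrier M, mult = mult M, one = one M,
     zero = zero M, add = add M, smult = (\<lambda>s x. \<theta> s \<odot>\<^bsub>M\<^esub> x)\<rparr>"

definition quot_module :: "('r, 'v) module \<Rightarrow> 'v set \<Rightarrow> ('r, 'v set) module" where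
  "quot_module M H = \<lparr>carrier = a_rcosets\<^bsub>M\<^esub> H, mult = undefined, one = undefined,
     zero = H, add = set_add M, smult = (\<lambda>r X. \<Union>x\<in>X. H +>\<^bsub>M\<^esub> (r \<odot>\<^bsub>M\<^esub> x))\<rparr>"

definition right_ideal :: "'r set \<Rightarrow> ('r, 'b) ring_scheme \<Rightarrow> bool" where
  "right_ideal I R \<longleftrightarrow> additive_subgroup I R \<and> (\<forall>x\<in>I. \<forall>r\<in>carrier R. x \<otimes>\<^bsub>R\<^esub> r \<in> I)"

definition left_ideal :: "'r set \<Rightarrow> ('r, 'b) ring_scheme \<Rightarrow> bool" where
  "left_ideal I R \<longleftrightarrow> additive_subgroup I R \<and> (\<forall>x\<in>I. \<forall>r\<in>carrier R. r \<otimes>\<^bsub>R\<^esub> x \<in> I)"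

text \<open>The library's locale \<open>noetherian_ring\<close> is about two-sided ideals and is too weak here.\<close>

definition right_noetherian :: "('r, 'b) ring_scheme \<Rightarrow> bool" where
  "right_noetherian R \<longleftrightarrow> ring R \<and> (\<forall>I. right_ideal I R \<longrightarrow>
     (\<exists>S. finite S \<and> S \<subseteq> carrier R \<and> I = \<Inter>{J. right_ideal J R \<and> S \<subseteq> J}))"

definition left_noetherian :: "('r, 'b) ring_scheme \<Rightarrow> bool" where
  "left_noetherian R \<longleftrightarrow> ring R \<and> (\<forall>I. left_ideal I R \<longrightarrow>
     (\<exists>S. finite S \<and> S \<subseteq> carrier R \<and> I = \<Inter>{J. left_ideal J R \<and> S \<subseteq> J}))"


section \<open>Projective resolutions, homology and gradings\<close>

text \<open>The complex \<open>\<dots> \<rightarrow> P 1 \<rightarrow> P 0 \<rightarrow> T \<rightarrow> 0\<close> with \<open>d i : P (i + 1) \<rightarrow> P i\<close> and \<open>e : P 0 \<rightarrow> T\<close>.\<close>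

definition projective_resolution ::
  "('r, 'b) ring_scheme \<Rightarrow> ('r, 't) module \<Rightarrow>
   (nat \<Rightarrow> ('r, 'v) module) \<Rightarrow> (nat \<Rightarrow> 'v \<Rightarrow> 'v) \<Rightarrow> ('v \<Rightarrow> 't) \<Rightarrow> bool" where
  "projective_resolution R T P d e \<longleftrightarrow>
     (\<forall>i. projective R (P i)) \<and>
     (\<forall>i. d i \<in> rmod_hom R (P (Suc i)) (P i)) \<and>
     e \<in> rmod_hom R (P 0) T \<and>
     e ` carrier (P 0) = carrier T \<and>
     d 0 ` carrier (P 1) = rmod_kernel (P 0) T e \<and>
     (\<forall>i. d (Suc i) ` carrier (P (Suc (Suc i))) = rmod_kernel (P (Suc i)) (P i) (d i))"

definition cycles ::
  "(nat \<Rightarrow> ('r, 'v) module) \<Rightarrow> (nat \<Rightarrow> 'v \<Rightarrow> 'v) \<Rightarrow> nat \<Rightarrow> 'v set" where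
  "cycles C d i = (case i of 0 \<Rightarrow> carrier (C 0)
     | Suc j \<Rightarrow> rmod_kernel (C (Suc j)) (C j) (d j))"

definition homology ::
  "(nat \<Rightarrow> ('r, 'v) module) \<Rightarrow> (nat \<Rightarrow> 'v \<Rightarrow> 'v) \<Rightarrow> nat \<Rightarrow> ('r, 'v set) module" where
  "homology C d i = quot_module ((C i)\<lparr>carrier := cycles C d i\<rparr>) (d i ` carrier (C (Suc i)))"

definition internal_direct_sum ::
  "('a, 'b) ring_scheme \<Rightarrow> nat set \<Rightarrow> (nat \<Rightarrow> 'a set) \<Rightarrow> bool" where
  "internal_direct_sum M I A \<longleftrightarrow>
     (\<forall>i\<in>I. additive_subgroup (A i) M) \<and>
     (\<forall>x\<in>carrier M. \<exists>!c. (\<forall>i\<in>I. c i \<in> A i) \<and> (\<forall>i. i \<notin> I \<longrightarrow> c i = \<zero>\<^bsub>M\<^esub>) \<and>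
        finite {i. c i \<noteq> \<zero>\<^bsub>M\<^esub>} \<and> x = (\<Oplus>\<^bsub>M\<^esub>i\<in>{i. c i \<noteq> \<zero>\<^bsub>M\<^esub>}. c i))"

definition graded_module ::
  "('r, 'b) ring_scheme \<Rightarrow> (nat \<Rightarrow> 'r set) \<Rightarrow> ('r, 'v) module \<Rightarrow> (nat \<Rightarrow> 'v set) \<Rightarrow> bool" where
  "graded_module R Rgr V Vgr \<longleftrightarrow> right_module R V \<and> internal_direct_sum V UNIV Vgr \<and>
     (\<forall>i j. \<forall>x\<in>Vgr i. \<forall>r\<in>Rgr j. r \<odot>\<^bsub>V\<^esub> x \<in> Vgr (i + j))"

text \<open>
  The existential quantifiers over resolutions range over modules whose elements are lists over
  the type of the ring. This type is infinite and contains a copy of \<open>R\<close>. Finitely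
  generated modules, and free modules on the elements of a kernel, have at most \<open>max |R| \<aleph>\<^sub>0\<close>
  elements, so every resolution of the kind considered can be replaced by one in this type.
\<close>

definition type_FP ::
  "('r, 'b) ring_scheme \<Rightarrow> ('r, 't) module \<Rightarrow> nat \<Rightarrow> bool" where
  "type_FP R T m \<longleftrightarrow> (\<exists>(P :: nat \<Rightarrow> ('r, 'r list) module) d e.
     projective_resolution R T P d e \<and> (\<forall>i\<le>m. fin_gen R (P i)))"

definition graded_type_FP ::
  "('r, 'b) ring_scheme \<Rightarrow> (nat \<Rightarrow> 'r set) \<Rightarrow> ('r, 't) module \<Rightarrow> (nat \<Rightarrow> 't set) \<Rightarrow> nat \<Rightarrow> bool" where
  "graded_type_FP R Rgr T Tgr m \<longleftrightarrow>
     (\<exists>(P :: nat \<Rightarrow> ('r, 'r list) module) (Pgr :: nat \<Rightarrow> nat \<Rightarrow> 'r list set) d e.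
        projective_resolution R T P d e \<and> (\<forall>i\<le>m. fin_gen R (P i)) \<and>
        (\<forall>i. graded_module R Rgr (P i) (Pgr i)) \<and>
        (\<forall>i j. d i ` Pgr (Suc i) j \<subseteq> Pgr i j) \<and>
        (\<forall>j. e ` Pgr 0 j \<subseteq> Tgr j))"


section \<open>Lie algebras\<close>

record ('k, 'l) lie = "('k, 'l) module" +
  bracket :: "'l \<Rightarrow> 'l \<Rightarrow> 'l"

locale lie_algebra = K?: field K + L?: module K L
  for K :: "('k, 'b) ring_scheme" (structure) and L :: "('k, 'l, 'm) lie_scheme" (structure) +
  assumes bracket_closed:
      "\<lbrakk>x \<in> carrier L; y \<in> carrier L\<rbrakk> \<Longrightarrow> bracket L x y \<in> carrier L"
    and bracket_add_left: "\<lbrakk>x \<in> carrier L; y \<in> carrier L; z \<in> carrier L\<rbrakk> \<Longrightarrow>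
      bracket L (x \<oplus>\<^bsub>L\<^esub> y) z = bracket L x z \<oplus>\<^bsub>L\<^esub> bracket L y z"
    and bracket_add_right: "\<lbrakk>x \<in> carrier L; y \<in> carrier L; z \<in> carrier L\<rbrakk> \<Longrightarrow>
      bracket L x (y \<oplus>\<^bsub>L\<^esub> z) = bracket L x y \<oplus>\<^bsub>L\<^esub> bracket L x z"
    and bracket_smult_left: "\<lbrakk>a \<in> carrier K; x \<in> carrier L; y \<in> carrier L\<rbrakk> \<Longrightarrow>
      bracket L (a \<odot>\<^bsub>L\<^esub> x) y = a \<odot>\<^bsub>L\<^esub> bracket L x y"
    and bracket_smult_right: "\<lbrakk>a \<in> carrier K; x \<in> carrier L; y \<in> carrier L\<rbrakk> \<Longrightarrow>
      bracket L x (a \<odot>\<^bsub>L\<^esub> y) = a \<odot>\<^bsub>L\<^esub> bracket L x y"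
    and alternating: "x \<in> carrier L \<Longrightarrow> bracket L x x = \<zero>\<^bsub>L\<^esub>"
    and jacobi: "\<lbrakk>x \<in> carrier L; y \<in> carrier L; z \<in> carrier L\<rbrakk> \<Longrightarrow>
      bracket L x (bracket L y z) \<oplus>\<^bsub>L\<^esub> bracket L y (bracket L z x)
        \<oplus>\<^bsub>L\<^esub> bracket L z (bracket L x y) = \<zero>\<^bsub>L\<^esub>"

definition graded_lie_algebra ::
  "('k, 'b) ring_scheme \<Rightarrow> ('k, 'l, 'm) lie_scheme \<Rightarrow> (nat \<Rightarrow> 'l set) \<Rightarrow> bool" where
  "graded_lie_algebra K L G \<longleftrightarrow> lie_algebra K L \<and>
     (\<forall>i\<ge>1. submodule (G i) K L) \<and> internal_direct_sum L {1..} G \<and>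
     (\<forall>i\<ge>1. \<forall>j\<ge>1. \<forall>x\<in>G i. \<forall>y\<in>G j. bracket L x y \<in> G (i + j))"

definition lie_ideal ::
  "'l set \<Rightarrow> ('k, 'b) ring_scheme \<Rightarrow> ('k, 'l, 'm) lie_scheme \<Rightarrow> bool" where
  "lie_ideal N K L \<longleftrightarrow> submodule N K L \<and> (\<forall>x\<in>carrier L. \<forall>n\<in>N. bracket L x n \<in> N)"

definition graded_lie_ideal ::
  "'l set \<Rightarrow> ('k, 'b) ring_scheme \<Rightarrow> ('k, 'l, 'm) lie_scheme \<Rightarrow> (nat \<Rightarrow> 'l set) \<Rightarrow> bool" where
  "graded_lie_ideal N K L G \<longleftrightarrow> lie_ideal N K L \<and>
     internal_direct_sum (L\<lparr>carrier := N\<rparr>) {1..} (\<lambda>i. N \<inter> G i)"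

definition lie_quotient :: "('k, 'l, 'm) lie_scheme \<Rightarrow> 'l set \<Rightarrow> ('k, 'l set) lie" where
  "lie_quotient L N = \<lparr>carrier = a_rcosets\<^bsub>L\<^esub> N, mult = undefined, one = undefined,
     zero = N, add = set_add L, smult = (\<lambda>a X. \<Union>x\<in>X. N +>\<^bsub>L\<^esub> (a \<odot>\<^bsub>L\<^esub> x)),
     bracket = (\<lambda>X Y. \<Union>x\<in>X. \<Union>y\<in>Y. N +>\<^bsub>L\<^esub> bracket L x y)\<rparr>"


section \<open>The universal enveloping algebra\<close>

text \<open>
  The free associative algebra on a set \<open>X\<close>: finitely supported functions on words over
  \<open>X\<close>, multiplied by convolution along the splittings of a word. \<open>U(L)\<close> is its
  quotient by the relations making \<open>L \<rightarrow> U(L)\<close> linear and compatible with brackets, that is,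
  the tensor algebra of \<open>L\<close> modulo \<open>x y - y x - [x, y]\<close>.
\<close>

definition monomial :: "('k, 'b) ring_scheme \<Rightarrow> 'k \<Rightarrow> 'l list \<Rightarrow> 'l list \<Rightarrow> 'k" where
  "monomial K a w = (\<lambda>v. if v = w then a else \<zero>\<^bsub>K\<^esub>)"

definition free_algebra :: "('k, 'b) ring_scheme \<Rightarrow> 'l set \<Rightarrow> ('l list \<Rightarrow> 'k) ring" where
  "free_algebra K X = \<lparr>
     carrier = {f. range f \<subseteq> carrier K \<and> finite {w. f w \<noteq> \<zero>\<^bsub>K\<^esub>} \<and> {w. f w \<noteq> \<zero>\<^bsub>K\<^esub>} \<subseteq> lists X},
     mult = (\<lambda>f g w. \<Oplus>\<^bsub>K\<^esub>i\<in>{..length w}. f (take i w) \<otimes>\<^bsub>K\<^esub> g (drop i w)),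
     one = monomial K \<one>\<^bsub>K\<^esub> [],
     zero = (\<lambda>w. \<zero>\<^bsub>K\<^esub>),
     add = (\<lambda>f g w. f w \<oplus>\<^bsub>K\<^esub> g w)\<rparr>"

definition env_relations ::
  "('k, 'b) ring_scheme \<Rightarrow> ('k, 'l, 'm) lie_scheme \<Rightarrow> ('l list \<Rightarrow> 'k) set" where
  "env_relations K L = (let F = free_algebra K (carrier L); X = (\<lambda>w. monomial K \<one>\<^bsub>K\<^esub> w) in
     {X [x \<oplus>\<^bsub>L\<^esub> y] \<ominus>\<^bsub>F\<^esub> (X [x] \<oplus>\<^bsub>F\<^esub> X [y]) |x y. x \<in> carrier L \<and> y \<in> carrier L} \<union>
     {X [a \<odot>\<^bsub>L\<^esub> x] \<ominus>\<^bsub>F\<^esub> monomial K a [x] |a x. a \<in> carrier K \<and> x \<in> carrier L} \<union>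
     {X [bracket L x y] \<ominus>\<^bsub>F\<^esub> (X [x] \<otimes>\<^bsub>F\<^esub> X [y] \<ominus>\<^bsub>F\<^esub> X [y] \<otimes>\<^bsub>F\<^esub> X [x])
       |x y. x \<in> carrier L \<and> y \<in> carrier L})"

definition env_ideal ::
  "('k, 'b) ring_scheme \<Rightarrow> ('k, 'l, 'm) lie_scheme \<Rightarrow> ('l list \<Rightarrow> 'k) set" where
  "env_ideal K L = Idl\<^bsub>free_algebra K (carrier L)\<^esub> (env_relations K L)"

definition env_class ::
  "('k, 'b) ring_scheme \<Rightarrow> ('k, 'l, 'm) lie_scheme \<Rightarrow> ('l list \<Rightarrow> 'k) \<Rightarrow> ('l list \<Rightarrow> 'k) set" where
  "env_class K L f = env_ideal K L +>\<^bsub>free_algebra K (carrier L)\<^esub> f"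

definition env :: "('k, 'b) ring_scheme \<Rightarrow> ('k, 'l, 'm) lie_scheme \<Rightarrow> ('l list \<Rightarrow> 'k) set ring" where
  "env K L = free_algebra K (carrier L) Quot env_ideal K L"

definition env_scalar ::
  "('k, 'b) ring_scheme \<Rightarrow> ('k, 'l, 'm) lie_scheme \<Rightarrow> 'k \<Rightarrow> ('l list \<Rightarrow> 'k) set" where
  "env_scalar K L a = env_class K L (monomial K a [])"

definition env_incl ::
  "('k, 'b) ring_scheme \<Rightarrow> ('k, 'l, 'm) lie_scheme \<Rightarrow> 'l \<Rightarrow> ('l list \<Rightarrow> 'k) set" where
  "env_incl K L x = env_class K L (monomial K \<one>\<^bsub>K\<^esub> [x])"

text \<open>The ring homomorphism \<open>U(L) \<rightarrow> U(L')\<close> induced by a Lie algebra homomorphism \<open>\<phi> : L \<rightarrow> L'\<close>.\<close>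

definition env_map ::
  "('k, 'b) ring_scheme \<Rightarrow> ('k, 'l2, 'm2) lie_scheme \<Rightarrow> ('l \<Rightarrow> 'l2) \<Rightarrow>
   ('l list \<Rightarrow> 'k) set \<Rightarrow> ('l2 list \<Rightarrow> 'k) set" where
  "env_map K L' \<phi> u = (\<Union>f\<in>u. env_class K L'
     (\<lambda>w. \<Oplus>\<^bsub>K\<^esub>v\<in>{v. f v \<noteq> \<zero>\<^bsub>K\<^esub> \<and> map \<phi> v = w}. f v))"

text \<open>
  The relations have no constant term, so all representatives of \<open>u \<in> U(L)\<close> have the same
  coefficient at the empty word; this is the augmentation \<open>U(L) \<rightarrow> K\<close> killing \<open>L\<close>.
\<close>

definition env_augmentation :: "('l list \<Rightarrow> 'k) set \<Rightarrow> 'k" where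
  "env_augmentation u = the_elem ((\<lambda>f. f []) ` u)"

definition trivial_module :: "('k, 'b) ring_scheme \<Rightarrow> (('l list \<Rightarrow> 'k) set, 'k) module" where
  "trivial_module K = \<lparr>carrier = carrier K, mult = mult K, one = one K, zero = zero K, add = add K,
     smult = (\<lambda>u a. a \<otimes>\<^bsub>K\<^esub> env_augmentation u)\<rparr>"

definition env_grading ::
  "('k, 'b) ring_scheme \<Rightarrow> ('k, 'l, 'm) lie_scheme \<Rightarrow> (nat \<Rightarrow> 'l set) \<Rightarrow>
   nat \<Rightarrow> ('l list \<Rightarrow> 'k) set set" where
  "env_grading K L G i =
     (if i = 0 then env_scalar K L ` carrier K
      else generate (add_monoid (env K L))
        {foldr (\<lambda>p u. env_incl K L (fst p) \<otimes>\<^bsub>env K L\<^esub> u) ps \<one>\<^bsub>env K L\<^esub> |ps.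
           ps \<noteq> [] \<and> (\<forall>(x, j)\<in>set ps. 1 \<le> j \<and> x \<in> G j) \<and> sum_list (map snd ps) = i})"

definition lie_FP :: "('k, 'b) ring_scheme \<Rightarrow> ('k, 'l, 'm) lie_scheme \<Rightarrow> nat \<Rightarrow> bool" where
  "lie_FP K L m \<longleftrightarrow> type_FP (env K L) (trivial_module K) m"

definition graded_lie_FP ::
  "('k, 'b) ring_scheme \<Rightarrow> ('k, 'l, 'm) lie_scheme \<Rightarrow> (nat \<Rightarrow> 'l set) \<Rightarrow> nat \<Rightarrow> bool" where
  "graded_lie_FP K L G m \<longleftrightarrow> graded_type_FP (env K L) (env_grading K L G) (trivial_module K)
     (\<lambda>j. if j = 0 then carrier K else {\<zero>\<^bsub>K\<^esub>}) m"


section \<open>Homology of an ideal as a module over the enveloping algebra of the quotient\<close>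

text \<open>
  For an ideal \<open>N\<close> of \<open>L\<close> and a right \<open>U(L)\<close>-module \<open>M\<close>, the tensor product of \<open>M\<close> with
  the trivial module \<open>K\<close> over \<open>U(N)\<close> is \<open>M / M N\<close>. It is a right
  \<open>U(L/N)\<close>-module: \<open>s\<close> acts by any \<open>u \<in> U(L)\<close> that the
  canonical map \<open>U(L) \<rightarrow> U(L/N)\<close> sends to \<open>s\<close>.
\<close>

definition lie_times ::
  "('k, 'b) ring_scheme \<Rightarrow> ('k, 'l, 'm) lie_scheme \<Rightarrow> 'l set \<Rightarrow>
   (('l list \<Rightarrow> 'k) set, 'v) module \<Rightarrow> 'v set" where
  "lie_times K L N M = generate (add_monoid M)
     {env_incl K L n \<odot>\<^bsub>M\<^esub> x |n x. n \<in> N \<and> x \<in> carrier M}"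

definition coinvariants ::
  "('k, 'b) ring_scheme \<Rightarrow> ('k, 'l, 'm) lie_scheme \<Rightarrow> 'l set \<Rightarrow>
   (('l list \<Rightarrow> 'k) set, 'v) module \<Rightarrow> (('l set list \<Rightarrow> 'k) set, 'v set) module" where
  "coinvariants K L N M = restrict_scalars
     (\<lambda>s. SOME u. u \<in> carrier (env K L) \<and> env_map K (lie_quotient L N) (\<lambda>x. N +>\<^bsub>L\<^esub> x) u = s)
     (quot_module M (lie_times K L N M))"

definition coinvariants_map ::
  "('k, 'b) ring_scheme \<Rightarrow> ('k, 'l, 'm) lie_scheme \<Rightarrow> 'l set \<Rightarrow>
   (('l list \<Rightarrow> 'k) set, 'w) module \<Rightarrow> ('v \<Rightarrow> 'w) \<Rightarrow> 'v set \<Rightarrow> 'w set" where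
  "coinvariants_map K L N M' h X = (\<Union>x\<in>X. lie_times K L N M' +>\<^bsub>M'\<^esub> h x)"

text \<open>
  \<open>H\<^sub>i(N, K)\<close> is \<open>Tor\<^sub>i(K, K)\<close> over \<open>U(N)\<close>. To see the action of \<open>U(L/N)\<close> on it,
  one computes it from a projective \<open>U(N)\<close>-resolution of \<open>K\<close> that is the
  restriction of a projective \<open>U(L)\<close>-resolution. (By the Poincare-Birkhoff-Witt theorem the
  restriction of a projective module is always projective.) The resulting module does not
  depend on the resolution up to isomorphism.
\<close>

definition lie_resolution ::
  "('k, 'b) ring_scheme \<Rightarrow> ('k, 'l, 'm) lie_scheme \<Rightarrow> 'l set \<Rightarrow>
   (nat \<Rightarrow> (('l list \<Rightarrow> 'k) set, 'v) module) \<Rightarrow> (nat \<Rightarrow> 'v \<Rightarrow> 'v) \<Rightarrow> ('v \<Rightarrow> 'k) \<Rightarrow> bool" where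
  "lie_resolution K L N P d e \<longleftrightarrow>
     projective_resolution (env K L) (trivial_module K) P d e \<and>
     projective_resolution (env K (L\<lparr>carrier := N\<rparr>)) (trivial_module K)
       (\<lambda>i. restrict_scalars (env_map K L (\<lambda>x. x)) (P i)) d e"

definition lie_homology ::
  "('k, 'b) ring_scheme \<Rightarrow> ('k, 'l, 'm) lie_scheme \<Rightarrow> 'l set \<Rightarrow> nat \<Rightarrow>
   (('l set list \<Rightarrow> 'k) set, ('l list \<Rightarrow> 'k) set list set set) module" where
  "lie_homology K L N i =
     (let (P, d, e) = (SOME (P, d, e). lie_resolution K L N P d e)
      in homology (\<lambda>j. coinvariants K L N (P j)) (\<lambda>j. coinvariants_map K L N (P j) (d j)) i)"

end

theory Submission
  imports Defs "HOL-Algebra.UnivPoly"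
begin

text \<open>
  Let \<open>J\<close> be the kernel of \<open>U(L) \<rightarrow> U(L/N)\<close>. The annihilator of \<open>M / M N\<close> contains \<open>J\<close>, so
  \<open>M N = M J\<close> and the homology \<open>H\<^sub>i(N, K)\<close> is that of \<open>P / P J\<close> for any projective \<open>U(L)\<close>-resolution \<open>P\<close>
  of \<open>K\<close>: by the Poincare-Birkhoff-Witt theorem \<open>U(L)\<close> is free over \<open>U(N)\<close>, and chain homotopies make the finite
  generation of this homology independent of \<open>P\<close>. If \<open>P\<close> is finitely generated in degree \<open>i\<close>, then so is the
  homology, because \<open>U(L/N)\<close> is Noetherian.

  Conversely, one builds a graded free resolution degree by degree, choosing finitely many
  homogeneous generators of the kernel \<open>Z\<close> whenever this is possible. If \<open>P i\<close> is
  finitely generated and the next homology group is too, then \<open>Z / Z J\<close> is finitely generated,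
  again since \<open>U(L/N)\<close> is Noetherian. As \<open>J\<close> lies in the augmentation ideal, which is concentrated in
  positive degrees, the graded Nakayama lemma shows that \<open>Z\<close> is finitely generated.

  The argument uses about \<open>J\<close> only that it is contained in the augmentation ideal and that \<open>U(L) / J\<close>
  is right Noetherian. Taking for \<open>J\<close> the augmentation ideal itself, with quotient \<open>K\<close>, compares the
  graded and the ordinary finiteness property.
\<close>

text \<open>The Poincare-Birkhoff-Witt theorem enters at one place: \<open>lie_homology\<close> is
  computed from a triple picked by \<open>SOME\<close> among the resolutions that stay projective
  over U(N), and only the freeness of U(L) over U(N) guarantees that such a triple exists. The
  grading of U(L) is obtained independently of it: directness of the sum is read off from a
  homomorphism of U(L) into polynomials over U(L) that sends x of degree i to x t^i. Coinvariants
  and homology are built from cosets and chosen representatives, so the argument runs with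
  \<open>homology_fg\<close>, a condition on elements of P itself, and the passage to the quotients
  is made once, through semilinear surjections. The finiteness properties are compared in a cycle on
  one fixed resolution P: graded FP gives ordinary FP by forgetting the grading, ordinary FP gives
  finite generation of the homology of P / PJ by comparing resolutions, and this gives graded FP by
  Nakayama. P does not depend on m, since each of its steps takes a finite generating set whenever
  there is one.\<close>

definition additive_map :: "('a, 'm) ring_scheme \<Rightarrow> ('b, 'n) ring_scheme \<Rightarrow> ('a \<Rightarrow> 'b) \<Rightarrow> bool" where
  "additive_map A B h \<longleftrightarrow> h \<in> carrier A \<rightarrow> carrier B \<and>
     (\<forall>x\<in>carrier A. \<forall>y\<in>carrier A. h (x \<oplus>\<^bsub>A\<^esub> y) = h x \<oplus>\<^bsub>B\<^esub> h y)"

lemma additive_mapI: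
  assumes "\<And>x. x \<in> carrier A \<Longrightarrow> h x \<in> carrier B"
    and "\<And>x y. \<lbrakk>x \<in> carrier A; y \<in> carrier A\<rbrakk> \<Longrightarrow> h (x \<oplus>\<^bsub>A\<^esub> y) = h x \<oplus>\<^bsub>B\<^esub> h y"
  shows "additive_map A B h"
  using assms by (auto simp: additive_map_def)

lemma additive_map_closed: "\<lbrakk>additive_map A B h; x \<in> carrier A\<rbrakk> \<Longrightarrow> h x \<in> carrier B"
  by (auto simp: additive_map_def)

lemma additive_map_add:
  "\<lbrakk>additive_map A B h; x \<in> carrier A; y \<in> carrier A\<rbrakk> \<Longrightarrow> h (x \<oplus>\<^bsub>A\<^esub> y) = h x \<oplus>\<^bsub>B\<^esub> h y"
  by (auto simp: additive_map_def)

lemma additive_map_zero: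
  assumes "abelian_group A" "abelian_group B" "additive_map A B h"
  shows "h \<zero>\<^bsub>A\<^esub> = \<zero>\<^bsub>B\<^esub>"
proof -
  interpret A: abelian_group A by fact
  interpret B: abelian_group B by fact
  have "h \<zero>\<^bsub>A\<^esub> \<oplus>\<^bsub>B\<^esub> h \<zero>\<^bsub>A\<^esub> = h \<zero>\<^bsub>A\<^esub>"
    using additive_map_add[OF assms(3), of "\<zero>\<^bsub>A\<^esub>" "\<zero>\<^bsub>A\<^esub>"] by simp
  then show ?thesis
    using additive_map_closed[OF assms(3) A.zero_closed] by simp
qed

lemma additive_map_neg:
  assumes "abelian_group A" "abelian_group B" "additive_map A B h" "x \<in> carrier A"
  shows "h (\<ominus>\<^bsub>A\<^esub> x) = \<ominus>\<^bsub>B\<^esub> h x"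
proof -
  interpret A: abelian_group A by fact
  interpret B: abelian_group B by fact
  have "h (\<ominus>\<^bsub>A\<^esub> x) \<oplus>\<^bsub>B\<^esub> h x = \<zero>\<^bsub>B\<^esub>"
    using additive_map_add[OF assms(3), of "\<ominus>\<^bsub>A\<^esub> x" x] additive_map_zero[OF assms(1-3)] assms(4)
    by (simp add: A.l_neg)
  then show ?thesis
    using additive_map_closed[OF assms(3)] assms(4) by (simp add: B.minus_equality)
qed

lemma additive_map_diff:
  assumes "abelian_group A" "abelian_group B" "additive_map A B h" "x \<in> carrier A" "y \<in> carrier A"
  shows "h (x \<ominus>\<^bsub>A\<^esub> y) = h x \<ominus>\<^bsub>B\<^esub> h y"
  using assms by (simp add: a_minus_def additive_map_add additive_map_neg abelian_group.a_inv_closed)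

lemma additive_map_finsum:
  assumes "abelian_group A" "abelian_group B" "additive_map A B h" "f \<in> I \<rightarrow> carrier A"
  shows "h (finsum A f I) = finsum B (\<lambda>i. h (f i)) I"
  using assms(4)
proof (induction I rule: infinite_finite_induct)
  \<comment> \<open>\<open>finsum\<close> over an infinite index set is zero by convention, so this
    case reduces to preservation of zero.\<close>
  case (infinite I)
  then show ?case using additive_map_zero[OF assms(1-3)]
    by (simp add: finsum_def finprod_def)
next
  case empty
  then show ?case using additive_map_zero[OF assms(1-3)]
    by (simp add: abelian_monoid.finsum_empty abelian_group.axioms(1) assms(1,2))
next
  case (insert i I)
  interpret A: abelian_group A by fact
  interpret B: abelian_group B by fact
  have *: "f i \<in> carrier A" "f \<in> I \<rightarrow> carrier A" "(\<lambda>i. h (f i)) \<in> I \<rightarrow> carrier B"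
    using insert.prems additive_map_closed[OF assms(3)] by auto
  then show ?case
    using insert.hyps insert.IH additive_map_add[OF assms(3)] additive_map_closed[OF assms(3)]
    by simp
qed

section \<open>Homomorphisms and submodules of right modules\<close>

lemma rmod_homI:
  assumes "\<And>x. x \<in> carrier M \<Longrightarrow> h x \<in> carrier M'"
    and "\<And>x y. \<lbrakk>x \<in> carrier M; y \<in> carrier M\<rbrakk> \<Longrightarrow> h (x \<oplus>\<^bsub>M\<^esub> y) = h x \<oplus>\<^bsub>M'\<^esub> h y"
    and "\<And>r x. \<lbrakk>r \<in> carrier R; x \<in> carrier M\<rbrakk> \<Longrightarrow> h (r \<odot>\<^bsub>M\<^esub> x) = r \<odot>\<^bsub>M'\<^esub> h x"
  shows "h \<in> rmod_hom R M M'"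
  using assms by (auto simp: rmod_hom_def)

lemma rmod_hom_closed: "\<lbrakk>h \<in> rmod_hom R M M'; x \<in> carrier M\<rbrakk> \<Longrightarrow> h x \<in> carrier M'"
  by (auto simp: rmod_hom_def)

lemma rmod_hom_add:
  "\<lbrakk>h \<in> rmod_hom R M M'; x \<in> carrier M; y \<in> carrier M\<rbrakk> \<Longrightarrow> h (x \<oplus>\<^bsub>M\<^esub> y) = h x \<oplus>\<^bsub>M'\<^esub> h y"
  by (auto simp: rmod_hom_def)

lemma rmod_hom_smult:
  "\<lbrakk>h \<in> rmod_hom R M M'; r \<in> carrier R; x \<in> carrier M\<rbrakk> \<Longrightarrow> h (r \<odot>\<^bsub>M\<^esub> x) = r \<odot>\<^bsub>M'\<^esub> h x"
  by (auto simp: rmod_hom_def)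

lemma rmod_hom_additive: "h \<in> rmod_hom R M M' \<Longrightarrow> additive_map M M' h"
  by (auto simp: rmod_hom_def additive_map_def)

lemma rmod_hom_comp:
  "\<lbrakk>f \<in> rmod_hom R M M'; g \<in> rmod_hom R M' M''\<rbrakk> \<Longrightarrow> (\<lambda>x. g (f x)) \<in> rmod_hom R M M''"
  by (auto simp: rmod_hom_def Pi_iff)

lemma rmod_hom_id: "(\<lambda>x. x) \<in> rmod_hom R M M"
  by (auto simp: rmod_hom_def)

context right_module
begin

lemmas smult_closed [simp, intro] = closed

lemma smult_zero_left [simp]:
  assumes x: "x \<in> carrier M"
  shows "\<zero> \<odot>\<^bsub>M\<^esub> x = \<zero>\<^bsub>M\<^esub>"
proof -
  have "\<zero> \<odot>\<^bsub>M\<^esub> x \<oplus>\<^bsub>M\<^esub> \<zero> \<odot>\<^bsub>M\<^esub> x = \<zero> \<odot>\<^bsub>M\<^esub> x"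
    using add_scalar[of \<zero> \<zero> x] x by simp
  then show ?thesis using closed[OF R.zero_closed x] by simp
qed

lemma smult_additive: "r \<in> carrier R \<Longrightarrow> additive_map M M (\<lambda>x. r \<odot>\<^bsub>M\<^esub> x)"
  by (auto simp: additive_map_def add_vector)

lemma abelian_group_M: "abelian_group M" ..

lemma ring_R: "ring R" ..

lemma smult_zero_right [simp]: "r \<in> carrier R \<Longrightarrow> r \<odot>\<^bsub>M\<^esub> \<zero>\<^bsub>M\<^esub> = \<zero>\<^bsub>M\<^esub>"
  using additive_map_zero[OF abelian_group_M abelian_group_M smult_additive] .

lemma smult_neg_one:
  assumes x: "x \<in> carrier M"
  shows "(\<ominus> \<one>) \<odot>\<^bsub>M\<^esub> x = \<ominus>\<^bsub>M\<^esub> x"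
proof -
  have "(\<ominus> \<one>) \<odot>\<^bsub>M\<^esub> x \<oplus>\<^bsub>M\<^esub> x = ((\<ominus> \<one>) \<oplus> \<one>) \<odot>\<^bsub>M\<^esub> x"
    using x by (simp add: add_scalar unit)
  also have "\<dots> = \<zero>\<^bsub>M\<^esub>" using x by (simp add: R.l_neg)
  finally show ?thesis using x by (simp add: M.minus_equality)
qed

text \<open>Closure under negatives comes from the action of -1.\<close>

lemma submoduleI:
  assumes sub: "H \<subseteq> carrier M" and zero: "\<zero>\<^bsub>M\<^esub> \<in> H"
    and add: "\<And>x y. \<lbrakk>x \<in> H; y \<in> H\<rbrakk> \<Longrightarrow> x \<oplus>\<^bsub>M\<^esub> y \<in> H"
    and smult: "\<And>r x. \<lbrakk>r \<in> carrier R; x \<in> H\<rbrakk> \<Longrightarrow> r \<odot>\<^bsub>M\<^esub> x \<in> H"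
  shows "submodule H R M"
proof (intro submodule.intro subgroup.intro submodule_axioms.intro)
  fix x assume x: "x \<in> H"
  then have "\<ominus>\<^bsub>M\<^esub> x \<in> H" using smult[of "\<ominus> \<one>" x] sub by (auto simp: smult_neg_one)
  then show "inv\<^bsub>add_monoid M\<^esub> x \<in> H" by (simp add: a_inv_def)
qed (use assms in auto)

lemma submoduleD:
  assumes "submodule H R M"
  shows "H \<subseteq> carrier M" "\<zero>\<^bsub>M\<^esub> \<in> H" "\<And>x y. \<lbrakk>x \<in> H; y \<in> H\<rbrakk> \<Longrightarrow> x \<oplus>\<^bsub>M\<^esub> y \<in> H"
    "\<And>r x. \<lbrakk>r \<in> carrier R; x \<in> H\<rbrakk> \<Longrightarrow> r \<odot>\<^bsub>M\<^esub> x \<in> H" "\<And>x. x \<in> H \<Longrightarrow> \<ominus>\<^bsub>M\<^esub> x \<in> H"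
    "\<And>x y. \<lbrakk>x \<in> H; y \<in> H\<rbrakk> \<Longrightarrow> x \<ominus>\<^bsub>M\<^esub> y \<in> H"
proof -
  interpret submodule H R M by fact
  show 1: "H \<subseteq> carrier M" "\<zero>\<^bsub>M\<^esub> \<in> H" and 2: "\<And>x y. \<lbrakk>x \<in> H; y \<in> H\<rbrakk> \<Longrightarrow> x \<oplus>\<^bsub>M\<^esub> y \<in> H"
    and "\<And>r x. \<lbrakk>r \<in> carrier R; x \<in> H\<rbrakk> \<Longrightarrow> r \<odot>\<^bsub>M\<^esub> x \<in> H"
    using subset one_closed m_closed by auto
  show 3: "\<And>x. x \<in> H \<Longrightarrow> \<ominus>\<^bsub>M\<^esub> x \<in> H" using m_inv_closed by (auto simp: a_inv_def)
  show "\<And>x y. \<lbrakk>x \<in> H; y \<in> H\<rbrakk> \<Longrightarrow> x \<ominus>\<^bsub>M\<^esub> y \<in> H" using 2 3 by (auto simp: a_minus_def)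
qed

lemma submodule_finsum:
  assumes "submodule H R M" "f \<in> I \<rightarrow> H"
  shows "finsum M f I \<in> H"
  using assms(2)
proof (induction I rule: infinite_finite_induct)
  case (insert i I)
  then have "f i \<in> H" "f \<in> I \<rightarrow> H" by auto
  moreover have "f i \<in> carrier M" "f \<in> I \<rightarrow> carrier M"
    using insert.prems submoduleD(1)[OF assms(1)] by auto
  ultimately show ?case using insert submoduleD(3)[OF assms(1)] by simp
qed (use submoduleD(2)[OF assms(1)] in \<open>auto simp: finsum_def finprod_def\<close>)

lemma carrier_submodule: "submodule (carrier M) R M"
  by (rule submoduleI) auto

lemma submodule_inter:
  assumes "submodule H R M" "submodule H' R M"
  shows "submodule (H \<inter> H') R M"
  using submoduleD[OF assms(1)] submoduleD[OF assms(2)] by (intro submoduleI) auto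

end

section \<open>Submodules spanned by a set\<close>

definition rspan :: "('r, 'b) ring_scheme \<Rightarrow> ('r, 'v) module \<Rightarrow> 'v set \<Rightarrow> 'v set" where
  "rspan R M S = \<Inter>{H. submodule H R M \<and> S \<subseteq> H}"

lemma fin_gen_iff: "fin_gen R M \<longleftrightarrow> (\<exists>S. finite S \<and> S \<subseteq> carrier M \<and> carrier M = rspan R M S)"
  by (auto simp: fin_gen_def rspan_def)

lemma rspan_least: "\<lbrakk>submodule H R M; S \<subseteq> H\<rbrakk> \<Longrightarrow> rspan R M S \<subseteq> H"
  by (auto simp: rspan_def)

lemma rspan_incl: "S \<subseteq> rspan R M S"
  by (auto simp: rspan_def)

lemma rspan_mono: "S \<subseteq> T \<Longrightarrow> rspan R M S \<subseteq> rspan R M T"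
  by (auto simp: rspan_def)

context
  fixes R :: "('r, 'b) ring_scheme" and M :: "('r, 'v) module"
  assumes M: "right_module R M"
begin

interpretation right_module R M by (rule M)

lemma rspan_submodule:
  assumes "S \<subseteq> carrier M"
  shows "submodule (rspan R M S) R M"
proof (rule submoduleI)
  show "rspan R M S \<subseteq> carrier M" using carrier_submodule assms by (auto simp: rspan_def)
qed (auto simp: rspan_def submoduleD)

lemma rspan_subset: "S \<subseteq> carrier M \<Longrightarrow> rspan R M S \<subseteq> carrier M"
  using submoduleD(1)[OF rspan_submodule] .

lemma rspan_sub_rspan:
  assumes "T \<subseteq> carrier M" "S \<subseteq> rspan R M T"
  shows "rspan R M S \<subseteq> rspan R M T"
  using rspan_least[OF rspan_submodule] assms by blast

end

lemma submodule_vimage: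
  assumes M: "right_module R M" and M': "right_module R M'" and h: "h \<in> rmod_hom R M M'"
    and H: "submodule H R M'"
  shows "submodule {x \<in> carrier M. h x \<in> H} R M"
proof -
  interpret M: right_module R M by fact
  interpret M': right_module R M' by fact
  have "h \<zero>\<^bsub>M\<^esub> = \<zero>\<^bsub>M'\<^esub>"
    using additive_map_zero[OF M.abelian_group_M M'.abelian_group_M rmod_hom_additive[OF h]] .
  then show ?thesis
    by (intro M.submoduleI) (auto simp: M'.submoduleD[OF H] rmod_hom_add[OF h] rmod_hom_smult[OF h])
qed

lemma submodule_image:
  assumes M: "right_module R M" and M': "right_module R M'" and h: "h \<in> rmod_hom R M M'"
    and H: "submodule H R M"
  shows "submodule (h ` H) R M'"
proof -
  interpret M: right_module R M by fact
  interpret M': right_module R M' by fact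
  note H' = M.submoduleD[OF H]
  have z: "h \<zero>\<^bsub>M\<^esub> = \<zero>\<^bsub>M'\<^esub>"
    using additive_map_zero[OF M.abelian_group_M M'.abelian_group_M rmod_hom_additive[OF h]] .
  show ?thesis
  proof (rule M'.submoduleI)
    show "h ` H \<subseteq> carrier M'" using H' rmod_hom_closed[OF h] by auto
    show "\<zero>\<^bsub>M'\<^esub> \<in> h ` H" using z H' by (metis imageI)
  next
    fix x y assume "x \<in> h ` H" "y \<in> h ` H"
    then obtain a b where "a \<in> H" "b \<in> H" "x = h a" "y = h b" by auto
    then show "x \<oplus>\<^bsub>M'\<^esub> y \<in> h ` H"
      using H' rmod_hom_add[OF h, of a b] by (metis imageI subsetD)
  next
    fix r x assume "r \<in> carrier R" "x \<in> h ` H"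
    then obtain a where "a \<in> H" "x = h a" by auto
    then show "r \<odot>\<^bsub>M'\<^esub> x \<in> h ` H"
      using \<open>r \<in> carrier R\<close> H' rmod_hom_smult[OF h, of r a] by (metis imageI subsetD)
  qed
qed

lemma rmod_hom_zero:
  assumes "right_module R M" "right_module R M'" "h \<in> rmod_hom R M M'"
  shows "h \<zero>\<^bsub>M\<^esub> = \<zero>\<^bsub>M'\<^esub>"
  using additive_map_zero rmod_hom_additive assms right_module.abelian_group_M by metis

lemma rmod_hom_diff:
  assumes "right_module R M" "right_module R M'" "h \<in> rmod_hom R M M'"
    "x \<in> carrier M" "y \<in> carrier M"
  shows "h (x \<ominus>\<^bsub>M\<^esub> y) = h x \<ominus>\<^bsub>M'\<^esub> h y"
  using additive_map_diff rmod_hom_additive assms right_module.abelian_group_M by metis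

lemma submodule_zero: "right_module R M \<Longrightarrow> submodule {\<zero>\<^bsub>M\<^esub>} R M"
proof -
  assume "right_module R M"
  then interpret right_module R M .
  show ?thesis by (rule submoduleI) auto
qed

lemma rmod_kernel_submodule:
  assumes "right_module R M" "right_module R M'" "h \<in> rmod_hom R M M'"
  shows "submodule (rmod_kernel M M' h) R M"
  using submodule_vimage[OF assms submodule_zero[OF assms(2)]] by (simp add: rmod_kernel_def)

text \<open>The preimage of a submodule is a submodule, so the inclusion may be tested on the
  generators.\<close>

lemma rspan_image:
  assumes M: "right_module R M" and M': "right_module R M'" and h: "h \<in> rmod_hom R M M'"
    and S: "S \<subseteq> carrier M" and T: "T \<subseteq> carrier M'" "h ` S \<subseteq> rspan R M' T"
  shows "h ` rspan R M S \<subseteq> rspan R M' T"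
proof -
  have "rspan R M S \<subseteq> {x \<in> carrier M. h x \<in> rspan R M' T}"
    using submodule_vimage[OF M M' h rspan_submodule[OF M' T(1)]] S T
    by (intro rspan_least) auto
  then show ?thesis by auto
qed

lemma rmod_hom_sub:
  assumes M: "right_module R M" and M': "right_module R M'"
    and f: "f \<in> rmod_hom R M M'" and g: "g \<in> rmod_hom R M M'"
  shows "(\<lambda>x. f x \<ominus>\<^bsub>M'\<^esub> g x) \<in> rmod_hom R M M'"
proof -
  interpret M: right_module R M by fact
  interpret M': right_module R M' by fact
  note [simp] = rmod_hom_closed[OF f] rmod_hom_closed[OF g]
  show ?thesis
  proof (rule rmod_homI)
    fix x y assume "x \<in> carrier M" "y \<in> carrier M"
    then show "f (x \<oplus>\<^bsub>M\<^esub> y) \<ominus>\<^bsub>M'\<^esub> g (x \<oplus>\<^bsub>M\<^esub> y) = f x \<ominus>\<^bsub>M'\<^esub> g x \<oplus>\<^bsub>M'\<^esub> (f y \<ominus>\<^bsub>M'\<^esub> g y)"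
      by (simp add: rmod_hom_add[OF f] rmod_hom_add[OF g] a_minus_def M'.minus_add M'.a_ac)
  next
    fix r x assume *: "r \<in> carrier R" "x \<in> carrier M"
    then show "f (r \<odot>\<^bsub>M\<^esub> x) \<ominus>\<^bsub>M'\<^esub> g (r \<odot>\<^bsub>M\<^esub> x) = r \<odot>\<^bsub>M'\<^esub> (f x \<ominus>\<^bsub>M'\<^esub> g x)"
      using additive_map_diff[OF M'.abelian_group_M M'.abelian_group_M M'.smult_additive[OF *(1)]]
      by (simp add: rmod_hom_smult[OF f] rmod_hom_smult[OF g])
  qed simp
qed

section \<open>Free modules\<close>

definition single :: "('r, 'b) ring_scheme \<Rightarrow> 'r \<Rightarrow> 'i \<Rightarrow> 'i \<Rightarrow> 'r" where
  "single R a i = (\<lambda>j. if j = i then a else \<zero>\<^bsub>R\<^esub>)"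

text \<open>The functions live on the whole index type and X only limits their supports. Zero,
  addition and action therefore do not depend on X, and for X \<subseteq> Y the free module on X is
  literally a submodule of the one on Y.\<close>

definition freemod :: "('r, 'b) ring_scheme \<Rightarrow> 'i set \<Rightarrow> ('r, 'i \<Rightarrow> 'r) module" where
  "freemod R X = \<lparr>carrier = {f. range f \<subseteq> carrier R \<and> finite {i. f i \<noteq> \<zero>\<^bsub>R\<^esub>} \<and> {i. f i \<noteq> \<zero>\<^bsub>R\<^esub>} \<subseteq> X},
     mult = undefined, one = undefined, zero = (\<lambda>i. \<zero>\<^bsub>R\<^esub>), add = (\<lambda>f g i. f i \<oplus>\<^bsub>R\<^esub> g i),
     smult = (\<lambda>r f i. f i \<otimes>\<^bsub>R\<^esub> r)\<rparr>"

text \<open>The linear extension to the free module of the map that sends the i-th basis vector to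
  \<open>x i\<close>.\<close>

definition lsum :: "('r, 'b) ring_scheme \<Rightarrow> ('r, 'v) module \<Rightarrow> ('i \<Rightarrow> 'v) \<Rightarrow> ('i \<Rightarrow> 'r) \<Rightarrow> 'v" where
  "lsum R M x f = (\<Oplus>\<^bsub>M\<^esub>i\<in>{i. f i \<noteq> \<zero>\<^bsub>R\<^esub>}. f i \<odot>\<^bsub>M\<^esub> x i)"

lemma freemod_simps:
  "zero (freemod R X) = (\<lambda>i. \<zero>\<^bsub>R\<^esub>)"
  "f \<oplus>\<^bsub>freemod R X\<^esub> g = (\<lambda>i. f i \<oplus>\<^bsub>R\<^esub> g i)"
  "r \<odot>\<^bsub>freemod R X\<^esub> f = (\<lambda>i. f i \<otimes>\<^bsub>R\<^esub> r)"
  by (auto simp: freemod_def)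

lemma freemodI:
  assumes "\<And>i. f i \<in> carrier R" "finite {i. f i \<noteq> \<zero>\<^bsub>R\<^esub>}" "\<And>i. i \<notin> X \<Longrightarrow> f i = \<zero>\<^bsub>R\<^esub>"
  shows "f \<in> carrier (freemod R X)"
  using assms by (auto simp: freemod_def)

lemma freemodD:
  assumes "f \<in> carrier (freemod R X)"
  shows "f i \<in> carrier R" "finite {i. f i \<noteq> \<zero>\<^bsub>R\<^esub>}" "f i \<noteq> \<zero>\<^bsub>R\<^esub> \<Longrightarrow> i \<in> X" "i \<notin> X \<Longrightarrow> f i = \<zero>\<^bsub>R\<^esub>"
  using assms by (auto simp: freemod_def)

context
  fixes R :: "('r, 'b) ring_scheme" (structure)
  assumes R: "ring R"
begin

interpretation ring R by (rule R)

lemma freemod_add_closed: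
  assumes "f \<in> carrier (freemod R X)" "g \<in> carrier (freemod R X)"
  shows "(\<lambda>i. f i \<oplus> g i) \<in> carrier (freemod R X)"
proof (rule freemodI)
  show "finite {i. f i \<oplus> g i \<noteq> \<zero>}"
    by (rule finite_subset[of _ "{i. f i \<noteq> \<zero>} \<union> {i. g i \<noteq> \<zero>}"])
      (use freemodD(2)[OF assms(1)] freemodD(2)[OF assms(2)] in auto)
qed (simp_all add: freemodD(1,4)[OF assms(1)] freemodD(1,4)[OF assms(2)])

lemma freemod_smult_closed:
  assumes "f \<in> carrier (freemod R X)" "r \<in> carrier R"
  shows "(\<lambda>i. f i \<otimes> r) \<in> carrier (freemod R X)"
proof (rule freemodI)
  show "finite {i. f i \<otimes> r \<noteq> \<zero>}"
    by (rule finite_subset[of _ "{i. f i \<noteq> \<zero>}"]) (use freemodD(2)[OF assms(1)] assms(2) in auto)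
qed (simp_all add: freemodD(1,4)[OF assms(1)] assms(2))

lemma freemod_right_module: "right_module R (freemod R X)"
proof (intro right_module.intro right_module_axioms.intro R)
  show "abelian_group (freemod R X)"
  proof (rule abelian_groupI)
    fix x y assume "x \<in> carrier (freemod R X)" "y \<in> carrier (freemod R X)"
    then show "x \<oplus>\<^bsub>freemod R X\<^esub> y \<in> carrier (freemod R X)"
      using freemod_add_closed by (simp add: freemod_simps)
  next
    fix x assume x: "x \<in> carrier (freemod R X)"
    have "(\<lambda>i. \<ominus> x i) \<in> carrier (freemod R X)"
    proof (rule freemodI)
      show "finite {i. \<ominus> x i \<noteq> \<zero>}"
        by (rule finite_subset[of _ "{i. x i \<noteq> \<zero>}"]) (use freemodD(2)[OF x] in auto)
    qed (simp_all add: freemodD(1,4)[OF x])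
    then show "\<exists>y\<in>carrier (freemod R X). y \<oplus>\<^bsub>freemod R X\<^esub> x = \<zero>\<^bsub>freemod R X\<^esub>"
      using freemodD(1)[OF x] by (intro bexI[of _ "\<lambda>i. \<ominus> x i"]) (auto simp: freemod_simps l_neg)
  qed (auto simp: freemod_simps freemodD(1) a_assoc a_comm a_lcomm intro!: freemodI)
qed (auto simp: freemod_simps freemodD(1) l_distr r_distr m_assoc freemod_smult_closed)

lemma single_closed: "\<lbrakk>a \<in> carrier R; i \<in> X\<rbrakk> \<Longrightarrow> single R a i \<in> carrier (freemod R X)"
  by (rule freemodI) (auto simp: single_def split: if_splits)

text \<open>Induction on the support: splitting off one entry writes f as a \<open>single\<close>
  plus an element of smaller support.\<close>

lemma freemod_induct:
  assumes f: "f \<in> carrier (freemod R X)"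
    and zero: "P (\<lambda>i. \<zero>)"
    and single: "\<And>a i. \<lbrakk>a \<in> carrier R; i \<in> X\<rbrakk> \<Longrightarrow> P (single R a i)"
    and add: "\<And>f g. \<lbrakk>f \<in> carrier (freemod R X); g \<in> carrier (freemod R X); P f; P g\<rbrakk> \<Longrightarrow>
      P (\<lambda>i. f i \<oplus> g i)"
  shows "P f"
proof -
  have "finite {i. f i \<noteq> \<zero>}" using freemodD(2)[OF f] .
  then show ?thesis using f
  proof (induction "{i. f i \<noteq> \<zero>}" arbitrary: f rule: finite_induct)
    case empty
    then have "f = (\<lambda>i. \<zero>)" by auto
    then show ?case using zero by simp
  next
    case (insert i F)
    let ?g = "f(i := \<zero>)"
    have sup: "{j. ?g j \<noteq> \<zero>} = F" using insert.hyps by auto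
    have g: "?g \<in> carrier (freemod R X)"
    proof (rule freemodI)
      show "finite {j. ?g j \<noteq> \<zero>}" using sup insert.hyps by simp
    qed (auto simp: freemodD(1,4)[OF insert.prems])
    have i: "f i \<in> carrier R" "i \<in> X"
      using freemodD(1,3)[OF insert.prems, of i] insert.hyps(4) by auto
    have "P ?g" using insert.hyps(3)[OF _ g] sup by simp
    moreover have "f = (\<lambda>j. single R (f i) i j \<oplus> ?g j)"
      using freemodD(1)[OF insert.prems] by (auto simp: single_def)
    ultimately show ?case using add[OF single_closed[OF i] g single[OF i]] by simp
  qed
qed

lemma single_add: "\<lbrakk>a \<in> carrier R; b \<in> carrier R\<rbrakk> \<Longrightarrow>
  single R (a \<oplus> b) i = (\<lambda>j. single R a i j \<oplus> single R b i j)"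
  by (auto simp: single_def)

lemma freemod_mono: "X \<subseteq> Y \<Longrightarrow> carrier (freemod R X) \<subseteq> carrier (freemod R Y)"
  by (auto simp: freemod_def)

end

text \<open>The support of a sum is not the union of the supports. Over a common finite index set
  the sums can be added termwise, which is how additivity of \<open>lsum\<close> is
  obtained.\<close>

lemma lsum_superset:
  fixes R (structure)
  assumes M: "right_module R M" and f: "f \<in> carrier (freemod R X)" and x: "x \<in> X \<rightarrow> carrier M"
    and A: "finite A" "{i. f i \<noteq> \<zero>\<^bsub>R\<^esub>} \<subseteq> A" "A \<subseteq> X"
  shows "lsum R M x f = (\<Oplus>\<^bsub>M\<^esub>i\<in>A. f i \<odot>\<^bsub>M\<^esub> x i)"
proof -
  interpret right_module R M by fact
  have cl: "x i \<in> carrier M" if "i \<in> A" for i using that A(3) x by blast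
  show ?thesis unfolding lsum_def
    by (rule M.add.finprod_mono_neutral_cong_left) 
      (use A(1,2) in \<open>simp_all add: freemodD(1)[OF f] cl Pi_iff\<close>)
qed

lemma lsum_hom:
  fixes R (structure)
  assumes M: "right_module R M" and x: "x \<in> X \<rightarrow> carrier M"
  shows "lsum R M x \<in> rmod_hom R (freemod R X) M"
proof -
  interpret right_module R M by fact
  note fr = freemod_right_module[OF R.ring_axioms, of X]
  interpret F: right_module R "freemod R X" by (rule fr)
  show ?thesis
  proof (rule rmod_homI)
    fix f assume f: "f \<in> carrier (freemod R X)"
    show "lsum R M x f \<in> carrier M" unfolding lsum_def
      by (rule M.finsum_closed) (use x freemodD(1,3)[OF f] in \<open>simp add: Pi_iff\<close>)
    fix g assume g: "g \<in> carrier (freemod R X)"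
    define A where "A = {i. f i \<noteq> \<zero>} \<union> {i. g i \<noteq> \<zero>}"
    have A: "finite A" "{i. f i \<noteq> \<zero>} \<subseteq> A" "{i. g i \<noteq> \<zero>} \<subseteq> A" "A \<subseteq> X" "{i. f i \<oplus> g i \<noteq> \<zero>} \<subseteq> A"
      using freemodD(2,3)[OF f] freemodD(2,3)[OF g] by (auto simp: A_def)
    have fg: "(\<lambda>i. f i \<oplus> g i) \<in> carrier (freemod R X)"
      using freemod_add_closed[OF R.ring_axioms f g] .
    have cl: "\<And>i. i \<in> A \<Longrightarrow> x i \<in> carrier M" using A(4) x by blast
    show "lsum R M x (f \<oplus>\<^bsub>freemod R X\<^esub> g) = lsum R M x f \<oplus>\<^bsub>M\<^esub> lsum R M x g"
      unfolding freemod_simps lsum_superset[OF M f x A(1,2,4)] lsum_superset[OF M g x A(1,3,4)]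
        lsum_superset[OF M fg x A(1,5,4)]
      by (subst M.finsum_addf[symmetric])
        (simp_all add: cl freemodD(1)[OF f] freemodD(1)[OF g] Pi_iff add_scalar cong: M.finsum_cong)
  next
    fix r f assume r: "r \<in> carrier R" and f: "f \<in> carrier (freemod R X)"
    have rf: "(\<lambda>i. f i \<otimes> r) \<in> carrier (freemod R X)"
      using freemod_smult_closed[OF R.ring_axioms f r] .
    have A: "finite {i. f i \<noteq> \<zero>}" "{i. f i \<otimes> r \<noteq> \<zero>} \<subseteq> {i. f i \<noteq> \<zero>}" "{i. f i \<noteq> \<zero>} \<subseteq> X"
      using freemodD(2,3)[OF f] r by auto
    show "lsum R M x (r \<odot>\<^bsub>freemod R X\<^esub> f) = r \<odot>\<^bsub>M\<^esub> lsum R M x f"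
      unfolding freemod_simps lsum_superset[OF M rf x A]
      unfolding lsum_def
      by (subst additive_map_finsum[OF abelian_group_M abelian_group_M smult_additive[OF r]])
        (use x r freemodD(1,3)[OF f] in \<open>simp_all add: Pi_iff right_assoc cong: M.finsum_cong\<close>)
  qed
qed

lemma lsum_single:
  assumes M: "right_module R M" and x: "x i \<in> carrier M" and a: "a \<in> carrier R"
  shows "lsum R M x (single R a i) = a \<odot>\<^bsub>M\<^esub> x i"
proof -
  interpret right_module R M by fact
  have "lsum R M x (single R a i) = (\<Oplus>\<^bsub>M\<^esub>j\<in>{i}. single R a i j \<odot>\<^bsub>M\<^esub> x j)"
    by (rule lsum_superset[OF M single_closed[OF R.ring_axioms a, of i "{i}"]])
      (use x in \<open>auto simp: single_def\<close>)
  then show ?thesis using x a by (simp add: single_def)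
qed

text \<open>Stated for additive maps and hence tested on every \<open>single R a i\<close>: the
  target may then carry another ring of scalars, as when a free K-module is mapped to U(L).\<close>

lemma freemod_hom_eqI:
  assumes R: "ring R" and M: "abelian_group M"
    and f: "additive_map (freemod R X) M f" and g: "additive_map (freemod R X) M g"
    and eq: "\<And>a i. \<lbrakk>a \<in> carrier R; i \<in> X\<rbrakk> \<Longrightarrow> f (single R a i) = g (single R a i)"
    and y: "y \<in> carrier (freemod R X)"
  shows "f y = g y"
proof (rule freemod_induct[OF R y])
  note F = right_module.abelian_group_M[OF freemod_right_module[OF R, of X]]
  show "f (\<lambda>i. \<zero>\<^bsub>R\<^esub>) = g (\<lambda>i. \<zero>\<^bsub>R\<^esub>)"
    using additive_map_zero[OF F M f] additive_map_zero[OF F M g] by (simp add: freemod_simps)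
next
  fix a i assume "a \<in> carrier R" "i \<in> X"
  then show "f (single R a i) = g (single R a i)" by (rule eq)
next
  fix u v assume "u \<in> carrier (freemod R X)" "v \<in> carrier (freemod R X)" "f u = g u" "f v = g v"
  then show "f (\<lambda>i. u i \<oplus>\<^bsub>R\<^esub> v i) = g (\<lambda>i. u i \<oplus>\<^bsub>R\<^esub> v i)"
    using additive_map_add[OF f, of u v] additive_map_add[OF g, of u v] by (simp add: freemod_simps)
qed

text \<open>Preimages of the images of the basis vectors are chosen and extended linearly. The
  condition is an inclusion of images instead of surjectivity of g, because exactness of a complex
  supplies it in that form.\<close>

lemma free_lift:
  assumes A: "right_module R A" and B: "right_module R B"
    and g: "g \<in> rmod_hom R A B" and f: "f \<in> rmod_hom R (freemod R X) B"
    and sub: "f ` carrier (freemod R X) \<subseteq> g ` carrier A"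
  shows "\<exists>h \<in> rmod_hom R (freemod R X) A. \<forall>y\<in>carrier (freemod R X). g (h y) = f y"
proof -
  interpret A: right_module R A by fact
  interpret B: right_module R B by fact
  note R = A.ring_R
  have "\<forall>i\<in>X. \<exists>a. a \<in> carrier A \<and> g a = f (single R \<one>\<^bsub>R\<^esub> i)"
  proof
    fix i assume "i \<in> X"
    then have "f (single R \<one>\<^bsub>R\<^esub> i) \<in> g ` carrier A"
      using subsetD[OF sub imageI[OF single_closed[OF R A.R.one_closed, of i X]]] by simp
    then show "\<exists>a. a \<in> carrier A \<and> g a = f (single R \<one>\<^bsub>R\<^esub> i)" by (metis imageE)
  qed
  then obtain x where x: "\<And>i. i \<in> X \<Longrightarrow> x i \<in> carrier A \<and> g (x i) = f (single R \<one>\<^bsub>R\<^esub> i)"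
    by metis
  then have x': "x \<in> X \<rightarrow> carrier A" by auto
  note h = lsum_hom[OF A x']
  have "g (lsum R A x y) = f y" if y: "y \<in> carrier (freemod R X)" for y
  proof (rule freemod_hom_eqI[OF R B.abelian_group_M rmod_hom_additive[OF rmod_hom_comp[OF h g]]
        rmod_hom_additive[OF f] _ y])
    fix a i assume a: "a \<in> carrier R" and i: "i \<in> X"
    have "single R a i = a \<odot>\<^bsub>freemod R X\<^esub> single R \<one>\<^bsub>R\<^esub> i"
      using a by (auto simp: freemod_simps single_def)
    then have "f (single R a i) = a \<odot>\<^bsub>B\<^esub> f (single R \<one>\<^bsub>R\<^esub> i)"
      using rmod_hom_smult[OF f a single_closed[OF R A.R.one_closed i]] by simp
    then show "g (lsum R A x (single R a i)) = f (single R a i)"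
      using x[OF i] a by (simp add: lsum_single[OF A] rmod_hom_smult[OF g])
  qed
  then show ?thesis using h by blast
qed

section \<open>Projective modules\<close>

text \<open>An explicit presentation of P as a direct summand of a free module. In contrast to the
  lifting property in \<open>projective\<close>, which is tied to two fixed types, it gives liftings
  against modules of any type and can be carried along a restriction of scalars.\<close>

definition free_retract ::
  "('r, 'b) ring_scheme \<Rightarrow> ('r, 'v) module \<Rightarrow> 'i set \<Rightarrow> ('v \<Rightarrow> 'i \<Rightarrow> 'r) \<Rightarrow> (('i \<Rightarrow> 'r) \<Rightarrow> 'v) \<Rightarrow> bool" where
  "free_retract R P X s e \<longleftrightarrow> s \<in> rmod_hom R P (freemod R X) \<and> e \<in> rmod_hom R (freemod R X) P \<and>
     (\<forall>p\<in>carrier P. e (s p) = p)"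

lemma free_retract_lift:
  assumes P: "free_retract R P X s e"
    and A: "right_module R A" and B: "right_module R B"
    and g: "g \<in> rmod_hom R A B" and f: "f \<in> rmod_hom R P B"
    and sub: "f ` carrier P \<subseteq> g ` carrier A"
  shows "\<exists>h \<in> rmod_hom R P A. \<forall>y\<in>carrier P. g (h y) = f y"
proof -
  have s: "s \<in> rmod_hom R P (freemod R X)" and e: "e \<in> rmod_hom R (freemod R X) P"
    and es: "\<And>p. p \<in> carrier P \<Longrightarrow> e (s p) = p"
    using P by (auto simp: free_retract_def)
  have "(\<lambda>y. f (e y)) ` carrier (freemod R X) \<subseteq> g ` carrier A"
    using sub rmod_hom_closed[OF e] by auto
  then obtain h where h: "h \<in> rmod_hom R (freemod R X) A"
    and eq: "\<forall>y\<in>carrier (freemod R X). g (h y) = f (e y)"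
    using free_lift[OF A B g rmod_hom_comp[OF e f]] by blast
  show ?thesis
    using rmod_hom_comp[OF s h] eq es rmod_hom_closed[OF s] by (intro bexI[of _ "\<lambda>y. h (s y)"]) auto
qed

lemma projectiveI:
  assumes "right_module R P" "free_retract R P X s e"
  shows "projective R P"
  unfolding projective_def
  using assms(1)
proof (intro conjI allI impI)
  fix A :: "('a, 'c \<Rightarrow> 'a) module" and B :: "('a, 'c) module" and g f
  assume *: "right_module R A" "right_module R B" "g \<in> rmod_hom R A B" "g ` carrier A = carrier B"
    "f \<in> rmod_hom R P B"
  then show "\<exists>h\<in>rmod_hom R P A. \<forall>x\<in>carrier P. g (h x) = f x"
    using rmod_hom_closed[OF *(5)] by (intro free_retract_lift[OF assms(2) *(1,2,3,5)]) auto
qed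

lemma projective_right_module: "projective R P \<Longrightarrow> right_module R P"
  by (simp add: projective_def)

text \<open>The identity of P is lifted along the canonical surjection from the free module on the
  elements of P. This is exactly the instance for which the types in \<open>projective\<close> are
  chosen.\<close>

lemma projectiveD:
  assumes "projective R P"
  shows "\<exists>s e. free_retract R P (carrier P) s e"
proof -
  note P = projective_right_module[OF assms]
  interpret P: right_module R P by (rule P)
  let ?F = "freemod R (carrier P)"
  define e where "e = lsum R P (\<lambda>p. p)"
  have e: "e \<in> rmod_hom R ?F P" unfolding e_def by (rule lsum_hom[OF P]) auto
  have "e ` carrier ?F = carrier P"
  proof
    show "e ` carrier ?F \<subseteq> carrier P" using rmod_hom_closed[OF e] by auto
    show "carrier P \<subseteq> e ` carrier ?F"
    proof
      fix p assume p: "p \<in> carrier P"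
      have "e (single R \<one>\<^bsub>R\<^esub> p) = p" using p by (simp add: e_def lsum_single[OF P] P.unit)
      then show "p \<in> e ` carrier ?F"
        using single_closed[OF P.ring_R P.R.one_closed p] by (metis imageI)
    qed
  qed
  then obtain s where "s \<in> rmod_hom R P ?F" "\<forall>x\<in>carrier P. e (s x) = x"
    using assms freemod_right_module[OF P.ring_R, of "carrier P"] P e rmod_hom_id[of R P]
    unfolding projective_def by blast
  then show ?thesis using e by (auto simp: free_retract_def)
qed

text \<open>Passing through a free retract frees the types of A and B, which the definition of
  \<open>projective\<close> fixes.\<close>

lemma projective_lift:
  assumes P: "projective R P"
    and A: "right_module R A" and B: "right_module R B"
    and g: "g \<in> rmod_hom R A B" and f: "f \<in> rmod_hom R P B"
    and sub: "f ` carrier P \<subseteq> g ` carrier A"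
  shows "\<exists>h \<in> rmod_hom R P A. \<forall>y\<in>carrier P. g (h y) = f y"
  using projectiveD[OF P] free_retract_lift[OF _ A B g f sub] by blast

lemma (in abelian_group) add_diff_cancel:
  assumes "a \<in> carrier G" "b \<in> carrier G"
  shows "(a \<oplus> b) \<ominus> a = b"
proof -
  have "(a \<oplus> b) \<ominus> a = (b \<oplus> a) \<oplus> \<ominus> a" using assms by (simp add: a_minus_def a_comm)
  also have "\<dots> = b" using assms by (simp add: a_assoc r_neg)
  finally show ?thesis .
qed

section \<open>Comparison of resolutions\<close>

lemma resolutionD:
  assumes "projective_resolution R T P d e"
  shows "\<And>i. projective R (P i)" "\<And>i. right_module R (P i)"
    "\<And>i. d i \<in> rmod_hom R (P (Suc i)) (P i)" "e \<in> rmod_hom R (P 0) T"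
    "e ` carrier (P 0) = carrier T" "d 0 ` carrier (P 1) = rmod_kernel (P 0) T e"
    "\<And>i. d (Suc i) ` carrier (P (Suc (Suc i))) = rmod_kernel (P (Suc i)) (P i) (d i)"
  using assms projective_right_module by (auto simp: projective_resolution_def)

lemma resolution_complex:
  assumes "projective_resolution R T P d e"
  shows "x \<in> carrier (P 1) \<Longrightarrow> e (d 0 x) = \<zero>\<^bsub>T\<^esub>"
    "y \<in> carrier (P (Suc (Suc i))) \<Longrightarrow> d i (d (Suc i) y) = \<zero>\<^bsub>P i\<^esub>"
proof -
  show "x \<in> carrier (P 1) \<Longrightarrow> e (d 0 x) = \<zero>\<^bsub>T\<^esub>"
  proof -
    assume "x \<in> carrier (P 1)"
    then have "d 0 x \<in> rmod_kernel (P 0) T e"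
      unfolding resolutionD(6)[OF assms, symmetric] by (rule imageI)
    then show ?thesis by (simp add: rmod_kernel_def)
  qed
  show "y \<in> carrier (P (Suc (Suc i))) \<Longrightarrow> d i (d (Suc i) y) = \<zero>\<^bsub>P i\<^esub>"
  proof -
    assume "y \<in> carrier (P (Suc (Suc i)))"
    then have "d (Suc i) y \<in> rmod_kernel (P (Suc i)) (P i) (d i)"
      unfolding resolutionD(7)[OF assms, symmetric] by (rule imageI)
    then show ?thesis by (simp add: rmod_kernel_def)
  qed
qed

text \<open>The augmentation takes the place of the differential in degree 0, so that exactness has
  one form in all degrees.\<close>

definition res_kernel ::
  "('r, 't) module \<Rightarrow> (nat \<Rightarrow> ('r, 'v) module) \<Rightarrow> (nat \<Rightarrow> 'v \<Rightarrow> 'v) \<Rightarrow> ('v \<Rightarrow> 't) \<Rightarrow> nat \<Rightarrow> 'v set" where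
  "res_kernel T P d e n = (case n of 0 \<Rightarrow> rmod_kernel (P 0) T e
     | Suc j \<Rightarrow> rmod_kernel (P (Suc j)) (P j) (d j))"

lemma res_kernel_eq:
  assumes "projective_resolution R T P d e"
  shows "d n ` carrier (P (Suc n)) = res_kernel T P d e n"
  using resolutionD(6,7)[OF assms] by (cases n) (auto simp: res_kernel_def)

text \<open>Built degree by degree by projective lifting. The induction predicate \<open>A\<close>
  records in addition that f n carries kernels into kernels, because this is the inclusion of images
  that the lift in degree n + 1 requires.\<close>

lemma chain_map_exists:
  assumes T: "right_module R T" and P: "projective_resolution R T P d e"
    and P': "projective_resolution R T P' d' e'"
  obtains f where "\<And>i. f i \<in> rmod_hom R (P i) (P' i)"
    "\<And>x. x \<in> carrier (P 0) \<Longrightarrow> e' (f 0 x) = e x"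
    "\<And>i x. x \<in> carrier (P (Suc i)) \<Longrightarrow> d' i (f (Suc i) x) = f i (d i x)"
proof -
  note D = resolutionD[OF P] and D' = resolutionD[OF P']
  define A where "A n f \<longleftrightarrow> f \<in> rmod_hom R (P n) (P' n) \<and>
    f ` res_kernel T P d e n \<subseteq> res_kernel T P' d' e' n \<and>
    (n = 0 \<longrightarrow> (\<forall>x\<in>carrier (P 0). e' (f x) = e x))" for n f
  define B where "B n f g \<longleftrightarrow> (\<forall>x\<in>carrier (P (Suc n)). d' n (g x) = f (d n x))" for n f g
  have "\<exists>f. \<forall>n. A n (f n) \<and> B n (f n) (f (Suc n))"
  proof (rule dependent_nat_choice)
    obtain f where f: "f \<in> rmod_hom R (P 0) (P' 0)" "\<forall>x\<in>carrier (P 0). e' (f x) = e x"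
      using projective_lift[OF D(1) D'(2) T D'(4) D(4)] D(5) D'(5) by blast
    then show "\<exists>f. A 0 f"
      using rmod_hom_closed[OF f(1)]
      by (intro exI[of _ f]) (auto simp: A_def res_kernel_def rmod_kernel_def)
  next
    fix f n assume "A n f"
    then have f: "f \<in> rmod_hom R (P n) (P' n)" and k: "f ` res_kernel T P d e n \<subseteq> res_kernel T P' d' e' n"
      by (auto simp: A_def)
    have "(\<lambda>x. f (d n x)) ` carrier (P (Suc n)) = f ` res_kernel T P d e n"
      unfolding res_kernel_eq[OF P, symmetric] by auto
    then have "(\<lambda>x. f (d n x)) ` carrier (P (Suc n)) \<subseteq> d' n ` carrier (P' (Suc n))"
      using k unfolding res_kernel_eq[OF P'] by simp
    then obtain g where g: "g \<in> rmod_hom R (P (Suc n)) (P' (Suc n))"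
      "\<forall>x\<in>carrier (P (Suc n)). d' n (g x) = f (d n x)"
      using projective_lift[OF D(1) D'(2) D'(2) D'(3) rmod_hom_comp[OF D(3) f]] by blast
    have "A (Suc n) g"
      using g(1) g(2) rmod_hom_closed[OF g(1)] rmod_hom_zero[OF D(2) D'(2) f]
      by (auto simp: A_def res_kernel_def rmod_kernel_def)
    then show "\<exists>g. A (Suc n) g \<and> B n f g" using g by (auto simp: B_def)
  qed
  then obtain f where "\<And>n. A n (f n)" "\<And>n. B n (f n) (f (Suc n))" by blast
  then show ?thesis using that[of f] by (auto simp: A_def B_def)
qed

text \<open>The predicate \<open>A\<close> records that d s = k on cycles. It holds in degree 0
  because all elements are cycles there, and it is what makes the next lifting problem
  solvable.\<close>

lemma null_homotopy_exists:
  assumes T: "right_module R T" and P: "projective_resolution R T P d e"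
    and k: "\<And>i. k i \<in> rmod_hom R (P i) (P i)"
    and k0: "\<And>x. x \<in> carrier (P 0) \<Longrightarrow> e (k 0 x) = \<zero>\<^bsub>T\<^esub>"
    and kd: "\<And>i x. x \<in> carrier (P (Suc i)) \<Longrightarrow> d i (k (Suc i) x) = k i (d i x)"
  obtains s where "\<And>i. s i \<in> rmod_hom R (P i) (P (Suc i))"
    "\<And>x. x \<in> carrier (P 0) \<Longrightarrow> k 0 x = d 0 (s 0 x)"
    "\<And>i x. x \<in> carrier (P (Suc i)) \<Longrightarrow>
       k (Suc i) x = d (Suc i) (s (Suc i) x) \<oplus>\<^bsub>P (Suc i)\<^esub> s i (d i x)"
proof -
  note D = resolutionD[OF P]
  define A where "A n s \<longleftrightarrow> s \<in> rmod_hom R (P n) (P (Suc n)) \<and>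
    (\<forall>x\<in>cycles P d n. d n (s x) = k n x)" for n s
  define B where "B n s s' \<longleftrightarrow> (\<forall>x\<in>carrier (P (Suc n)).
    k (Suc n) x = d (Suc n) (s' x) \<oplus>\<^bsub>P (Suc n)\<^esub> s (d n x))" for n s s'
  have "\<exists>s. \<forall>n. A n (s n) \<and> B n (s n) (s (Suc n))"
  proof (rule dependent_nat_choice)
    have "k 0 ` carrier (P 0) \<subseteq> d 0 ` carrier (P (Suc 0))"
      using k0 rmod_hom_closed[OF k] D(6) by (auto simp: rmod_kernel_def)
    then obtain s where "s \<in> rmod_hom R (P 0) (P (Suc 0))" "\<forall>x\<in>carrier (P 0). d 0 (s x) = k 0 x"
      using projective_lift[OF D(1) D(2) D(2) D(3) k] by blast
    then show "\<exists>s. A 0 s" by (auto simp: A_def cycles_def)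
  next
    fix s n assume "A n s"
    then have s: "s \<in> rmod_hom R (P n) (P (Suc n))"
      and ds: "\<And>x. x \<in> cycles P d n \<Longrightarrow> d n (s x) = k n x" by (auto simp: A_def)
    interpret Pn: right_module R "P n" by (rule D(2))
    interpret Ps: right_module R "P (Suc n)" by (rule D(2))
    \<comment> \<open>The next homotopy is a lift of this defect k - s d. The differential kills it:
      d k x = k d x, and d s = k at the cycle d x.\<close>
    define g where "g x = k (Suc n) x \<ominus>\<^bsub>P (Suc n)\<^esub> s (d n x)" for x
    have g: "g \<in> rmod_hom R (P (Suc n)) (P (Suc n))"
      unfolding g_def by (rule rmod_hom_sub[OF D(2) D(2) k rmod_hom_comp[OF D(3) s]])
    have dcyc: "d n x \<in> cycles P d n" if x: "x \<in> carrier (P (Suc n))" for x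
      using resolution_complex[OF P] rmod_hom_closed[OF D(3) x] x
      by (cases n) (auto simp: cycles_def rmod_kernel_def)
    have "d n (g x) = \<zero>\<^bsub>P n\<^esub>" if x: "x \<in> carrier (P (Suc n))" for x
    proof -
      have c: "k n (d n x) \<in> carrier (P n)" "k (Suc n) x \<in> carrier (P (Suc n))"
        "s (d n x) \<in> carrier (P (Suc n))"
        using x rmod_hom_closed[OF D(3)] rmod_hom_closed[OF k] rmod_hom_closed[OF s] by auto
      have "d n (g x) = d n (k (Suc n) x) \<ominus>\<^bsub>P n\<^esub> d n (s (d n x))"
        unfolding g_def using rmod_hom_diff[OF D(2) D(2) D(3) c(2,3)] .
      also have "\<dots> = \<zero>\<^bsub>P n\<^esub>" using kd[OF x] ds[OF dcyc[OF x]] c by (simp add: Pn.r_neg a_minus_def)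
      finally show ?thesis .
    qed
    then have "g ` carrier (P (Suc n)) \<subseteq> d (Suc n) ` carrier (P (Suc (Suc n)))"
      using rmod_hom_closed[OF g] D(7)[of n] by (auto simp: rmod_kernel_def)
    then obtain t where t: "t \<in> rmod_hom R (P (Suc n)) (P (Suc (Suc n)))"
      and dt: "\<forall>x\<in>carrier (P (Suc n)). d (Suc n) (t x) = g x"
      using projective_lift[OF D(1) D(2) D(2) D(3) g] by blast
    have "k (Suc n) x = d (Suc n) (t x) \<oplus>\<^bsub>P (Suc n)\<^esub> s (d n x)" if x: "x \<in> carrier (P (Suc n))" for x
      using dt x rmod_hom_closed[OF D(3)] rmod_hom_closed[OF k] rmod_hom_closed[OF s]
      by (simp add: g_def a_minus_def Ps.a_assoc Ps.l_neg)
    moreover have "d (Suc n) (t x) = k (Suc n) x" if x: "x \<in> cycles P d (Suc n)" for x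
    proof -
      have x': "x \<in> carrier (P (Suc n))" "d n x = \<zero>\<^bsub>P n\<^esub>"
        using x by (auto simp: cycles_def rmod_kernel_def)
      have kc: "k (Suc n) x \<in> carrier (P (Suc n))" using x' rmod_hom_closed[OF k] by auto
      show ?thesis using dt x' kc rmod_hom_zero[OF D(2) D(2) s] by (simp add: g_def a_minus_def)
    qed
    ultimately show "\<exists>t. A (Suc n) t \<and> B n s t" using t by (auto simp: A_def B_def)
  qed
  then obtain s where A: "\<And>n. A n (s n)" and B: "\<And>n. B n (s n) (s (Suc n))" by blast
  show ?thesis
  proof (rule that[of s])
    show "s i \<in> rmod_hom R (P i) (P (Suc i))" for i using A by (auto simp: A_def)
    show "k 0 x = d 0 (s 0 x)" if "x \<in> carrier (P 0)" for x
      using A[of 0] that by (auto simp: A_def cycles_def)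
    show "k (Suc i) x = d (Suc i) (s (Suc i) x) \<oplus>\<^bsub>P (Suc i)\<^esub> s i (d i x)"
      if "x \<in> carrier (P (Suc i))" for i x using B that by (auto simp: B_def)
  qed
qed

section \<open>Finite generation of homology modulo an ideal\<close>

text \<open>The submodule Z J in right-module notation.\<close>

definition ideal_mult :: "('r, 'b) ring_scheme \<Rightarrow> ('r, 'v) module \<Rightarrow> 'r set \<Rightarrow> 'v set \<Rightarrow> 'v set" where
  "ideal_mult R M J Z = rspan R M {r \<odot>\<^bsub>M\<^esub> x |r x. r \<in> J \<and> x \<in> Z}"

text \<open>The preimage in \<open>P i\<close> of the i-cycles of the complex P / PJ.\<close>

definition rel_cycles ::
  "('r, 'b) ring_scheme \<Rightarrow> 'r set \<Rightarrow> (nat \<Rightarrow> ('r, 'v) module) \<Rightarrow> (nat \<Rightarrow> 'v \<Rightarrow> 'v) \<Rightarrow> nat \<Rightarrow> 'v set" where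
  "rel_cycles R J P d i = {x \<in> carrier (P i). case i of 0 \<Rightarrow> True
     | Suc j \<Rightarrow> d j x \<in> ideal_mult R (P j) J (carrier (P j))}"

text \<open>Elementwise form of: the \<open>i\<close>-th homology of the complex \<open>P / P J\<close> is finitely generated.\<close>

definition homology_fg ::
  "('r, 'b) ring_scheme \<Rightarrow> 'r set \<Rightarrow> (nat \<Rightarrow> ('r, 'v) module) \<Rightarrow> (nat \<Rightarrow> 'v \<Rightarrow> 'v) \<Rightarrow> nat \<Rightarrow> bool" where
  "homology_fg R J P d i \<longleftrightarrow> (\<exists>T. finite T \<and> T \<subseteq> rel_cycles R J P d i \<and>
     rel_cycles R J P d i \<subseteq>
       rspan R (P i) (T \<union> ideal_mult R (P i) J (carrier (P i)) \<union> d i ` carrier (P (Suc i))))"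

lemma ideal_mult_gens:
  assumes "right_module R M" "J \<subseteq> carrier R" "Z \<subseteq> carrier M"
  shows "{r \<odot>\<^bsub>M\<^esub> x |r x. r \<in> J \<and> x \<in> Z} \<subseteq> carrier M"
  using assms(2,3) by (auto intro!: right_module.closed[OF assms(1)])

lemma ideal_mult_submodule:
  assumes "right_module R M" "J \<subseteq> carrier R" "Z \<subseteq> carrier M"
  shows "submodule (ideal_mult R M J Z) R M"
  unfolding ideal_mult_def by (rule rspan_submodule[OF assms(1) ideal_mult_gens[OF assms]])

lemma ideal_mult_subset:
  assumes "right_module R M" "J \<subseteq> carrier R" "Z \<subseteq> carrier M"
  shows "ideal_mult R M J Z \<subseteq> carrier M"
  unfolding ideal_mult_def by (rule rspan_subset[OF assms(1) ideal_mult_gens[OF assms]])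

lemma ideal_multI: "\<lbrakk>r \<in> J; x \<in> Z\<rbrakk> \<Longrightarrow> r \<odot>\<^bsub>M\<^esub> x \<in> ideal_mult R M J Z"
  unfolding ideal_mult_def by (rule subsetD[OF rspan_incl]) auto

lemma ideal_mult_least:
  assumes "submodule H R M" "\<And>r x. \<lbrakk>r \<in> J; x \<in> Z\<rbrakk> \<Longrightarrow> r \<odot>\<^bsub>M\<^esub> x \<in> H"
  shows "ideal_mult R M J Z \<subseteq> H"
  unfolding ideal_mult_def using assms by (intro rspan_least) auto

lemma ideal_mult_image:
  assumes M: "right_module R M" and M': "right_module R M'" and J: "J \<subseteq> carrier R"
    and h: "h \<in> rmod_hom R M M'" and Z: "Z \<subseteq> carrier M" "h ` Z \<subseteq> Z'" "Z' \<subseteq> carrier M'"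
  shows "h ` ideal_mult R M J Z \<subseteq> ideal_mult R M' J Z'"
  unfolding ideal_mult_def
proof (rule rspan_image[OF M M' h ideal_mult_gens[OF M J Z(1)] ideal_mult_gens[OF M' J Z(3)]])
  show "h ` {r \<odot>\<^bsub>M\<^esub> x |r x. r \<in> J \<and> x \<in> Z} \<subseteq> rspan R M' {r \<odot>\<^bsub>M'\<^esub> x |r x. r \<in> J \<and> x \<in> Z'}"
  proof clarify
    fix r x assume "r \<in> J" "x \<in> Z"
    then have "h (r \<odot>\<^bsub>M\<^esub> x) = r \<odot>\<^bsub>M'\<^esub> h x" "h x \<in> Z'"
      using rmod_hom_smult[OF h] J Z by auto
    then show "h (r \<odot>\<^bsub>M\<^esub> x) \<in> rspan R M' {r \<odot>\<^bsub>M'\<^esub> x |r x. r \<in> J \<and> x \<in> Z'}"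
      using \<open>r \<in> J\<close> by (intro subsetD[OF rspan_incl]) auto
  qed
qed

lemma rel_cycles_submodule:
  assumes P: "\<And>i. right_module R (P i)" and d: "\<And>i. d i \<in> rmod_hom R (P (Suc i)) (P i)"
    and J: "J \<subseteq> carrier R"
  shows "submodule (rel_cycles R J P d i) R (P i)"
proof (cases i)
  case 0
  then show ?thesis using right_module.carrier_submodule[OF P, of 0] by (simp add: rel_cycles_def)
next
  case (Suc j)
  then show ?thesis
    using submodule_vimage[OF P P d ideal_mult_submodule[OF P J, of "carrier (P j)" j]]
    by (simp add: rel_cycles_def)
qed

text \<open>Chain maps f and g between the two resolutions and a homotopy s from f g to the identity
  respect the submodules P J, being homomorphisms. For a relative cycle z of P' one has z = f (g z)
  - k z with k z = d s z + s d z. The first summand of k z is a boundary, and the second lies in P'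
  J because d z does. Hence the f-images of generators for P are generators for P'.\<close>

lemma homology_fg_transfer:
  assumes T: "right_module R T" and P: "projective_resolution R T P d e"
    and P': "projective_resolution R T P' d' e'" and J: "J \<subseteq> carrier R"
    and fg: "homology_fg R J P d i"
  shows "homology_fg R J P' d' i"
proof -
  note D = resolutionD[OF P] and D' = resolutionD[OF P']
  obtain f where f: "\<And>i. f i \<in> rmod_hom R (P i) (P' i)"
    and fe: "\<And>x. x \<in> carrier (P 0) \<Longrightarrow> e' (f 0 x) = e x"
    and fd: "\<And>i x. x \<in> carrier (P (Suc i)) \<Longrightarrow> d' i (f (Suc i) x) = f i (d i x)"
    using chain_map_exists[OF T P P'] by metis
  obtain g where g: "\<And>i. g i \<in> rmod_hom R (P' i) (P i)"
    and ge: "\<And>x. x \<in> carrier (P' 0) \<Longrightarrow> e (g 0 x) = e' x"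
    and gd: "\<And>i x. x \<in> carrier (P' (Suc i)) \<Longrightarrow> d i (g (Suc i) x) = g i (d' i x)"
    using chain_map_exists[OF T P' P] by metis
  note fc = rmod_hom_closed[OF f] and gc = rmod_hom_closed[OF g]
  define k where "k i x = f i (g i x) \<ominus>\<^bsub>P' i\<^esub> x" for i x
  interpret T: right_module R T by fact
  have k: "k i \<in> rmod_hom R (P' i) (P' i)" for i
    unfolding k_def by (rule rmod_hom_sub[OF D'(2) D'(2) rmod_hom_comp[OF g f] rmod_hom_id])
  have k0: "e' (k 0 x) = \<zero>\<^bsub>T\<^esub>" if x: "x \<in> carrier (P' 0)" for x
    unfolding k_def using rmod_hom_diff[OF D'(2) T D'(4) fc[OF gc[OF x]] x] fe[OF gc[OF x]] ge[OF x]
      rmod_hom_closed[OF D'(4) x] by (simp add: T.r_neg a_minus_def)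
  have kd: "d' i (k (Suc i) x) = k i (d' i x)" if x: "x \<in> carrier (P' (Suc i))" for i x
    unfolding k_def using rmod_hom_diff[OF D'(2) D'(2) D'(3) fc[OF gc[OF x]] x] fd[OF gc[OF x]] gd[OF x]
    by simp
  obtain s where s: "\<And>i. s i \<in> rmod_hom R (P' i) (P' (Suc i))"
    and s0: "\<And>x. x \<in> carrier (P' 0) \<Longrightarrow> k 0 x = d' 0 (s 0 x)"
    and sS: "\<And>i x. x \<in> carrier (P' (Suc i)) \<Longrightarrow>
       k (Suc i) x = d' (Suc i) (s (Suc i) x) \<oplus>\<^bsub>P' (Suc i)\<^esub> s i (d' i x)"
    using null_homotopy_exists[OF T P' k k0 kd] by metis
  let ?Z = "rel_cycles R J P d i" and ?Z' = "rel_cycles R J P' d' i"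
  let ?J = "\<lambda>i. ideal_mult R (P i) J (carrier (P i))" and ?J' = "\<lambda>i. ideal_mult R (P' i) J (carrier (P' i))"
  obtain S where S: "finite S" "S \<subseteq> ?Z" "?Z \<subseteq> rspan R (P i) (S \<union> ?J i \<union> d i ` carrier (P (Suc i)))"
    using fg by (auto simp: homology_fg_def)
  have fJ: "f j ` ?J j \<subseteq> ?J' j" for j
    by (rule ideal_mult_image[OF D(2) D'(2) J f]) (use fc in auto)
  have gJ: "g j ` ?J' j \<subseteq> ?J j" for j
    by (rule ideal_mult_image[OF D'(2) D(2) J g]) (use gc in auto)
  have sJ: "s j ` ?J' j \<subseteq> ?J' (Suc j)" for j
    by (rule ideal_mult_image[OF D'(2) D'(2) J s]) (use rmod_hom_closed[OF s] in auto)
  have fZ: "f i ` ?Z \<subseteq> ?Z'"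
  proof (cases i)
    case (Suc j)
    then show ?thesis using fJ[of j] fc fd by (auto simp: rel_cycles_def)
  qed (use fc in \<open>auto simp: rel_cycles_def\<close>)
  have gZ: "g i ` ?Z' \<subseteq> ?Z"
  proof (cases i)
    case (Suc j)
    then show ?thesis using gJ[of j] gc gd by (auto simp: rel_cycles_def)
  qed (use gc in \<open>auto simp: rel_cycles_def\<close>)
  let ?X = "S \<union> ?J i \<union> d i ` carrier (P (Suc i))"
  let ?Y = "f i ` S \<union> ?J' i \<union> d' i ` carrier (P' (Suc i))"
  have Z'sub: "?Z' \<subseteq> carrier (P' i)" by (auto simp: rel_cycles_def)
  have J'sub: "?J' j \<subseteq> carrier (P' j)" for j by (rule ideal_mult_subset[OF D'(2) J]) simp
  have X: "?X \<subseteq> carrier (P i)"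
    using S(2) ideal_mult_subset[OF D(2) J, of "carrier (P i)" i] rmod_hom_closed[OF D(3)]
    by (auto simp: rel_cycles_def)
  have Y: "?Y \<subseteq> carrier (P' i)"
    using S(2) fZ Z'sub J'sub[of i] rmod_hom_closed[OF D'(3)] by blast
  interpret P'i: right_module R "P' i" by (rule D'(2))
  have sub: "submodule (rspan R (P' i) ?Y) R (P' i)" by (rule rspan_submodule[OF D'(2) Y])
  note sub = P'i.submoduleD[OF sub]
  have img: "f i ` rspan R (P i) ?X \<subseteq> rspan R (P' i) ?Y"
  proof (rule rspan_image[OF D(2) D'(2) f X Y])
    have "f i ` d i ` carrier (P (Suc i)) \<subseteq> d' i ` carrier (P' (Suc i))"
    proof clarify
      fix x assume x: "x \<in> carrier (P (Suc i))"
      show "f i (d i x) \<in> d' i ` carrier (P' (Suc i))"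
        unfolding fd[OF x, symmetric] by (rule imageI[OF fc[OF x]])
    qed
    then have "f i ` ?X \<subseteq> ?Y" using fJ[of i] by blast
    then show "f i ` ?X \<subseteq> rspan R (P' i) ?Y" by (rule order_trans[OF _ rspan_incl])
  qed
  have fg_in: "f i (g i z) \<in> rspan R (P' i) ?Y" if "z \<in> ?Z'" for z
    using subsetD[OF img imageI[OF subsetD[OF S(3) subsetD[OF gZ imageI[OF that]]]]] .
  have Yin: "y \<in> rspan R (P' i) ?Y" if "y \<in> ?J' i \<or> y \<in> d' i ` carrier (P' (Suc i))" for y
    by (rule subsetD[OF rspan_incl]) (use that in simp)
  have k_in: "k i z \<in> rspan R (P' i) ?Y" if z: "z \<in> ?Z'" for z
  proof (cases i)
    case 0
    have z0: "z \<in> carrier (P' 0)" using z Z'sub 0 by auto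
    then have "k i z \<in> d' i ` carrier (P' (Suc i))"
      using s0[OF z0] rmod_hom_closed[OF s z0] 0 by auto
    then show ?thesis using Yin by simp
  next
    case (Suc j)
    then have zc: "z \<in> carrier (P' (Suc j))" "d' j z \<in> ?J' j" using z by (auto simp: rel_cycles_def)
    have "s j (d' j z) \<in> ?J' i" using sJ[of j] zc Suc by auto
    moreover have "d' i (s i z) \<in> d' i ` carrier (P' (Suc i))"
      using rmod_hom_closed[OF s zc(1)] Suc by auto
    ultimately have "s j (d' j z) \<in> rspan R (P' i) ?Y" "d' i (s i z) \<in> rspan R (P' i) ?Y"
      using Yin by simp_all
    then show ?thesis using sS[OF zc(1)] sub(3) Suc by auto
  qed
  have "z \<in> rspan R (P' i) ?Y" if z: "z \<in> ?Z'" for z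
  proof -
    have zc: "z \<in> carrier (P' i)" using z Z'sub by auto
    have c: "f i (g i z) \<in> carrier (P' i)" using zc fc gc by auto
    have "z = f i (g i z) \<ominus>\<^bsub>P' i\<^esub> k i z"
      using zc c by (simp add: k_def a_minus_def P'i.minus_add P'i.a_assoc[symmetric] P'i.r_neg)
    then show ?thesis using sub(6)[OF fg_in[OF z] k_in[OF z]] by simp
  qed
  then show ?thesis
    unfolding homology_fg_def using S(1,2) fZ by (intro exI[of _ "f i ` S"]) blast
qed

section \<open>Noetherian rings modulo an ideal\<close>

text \<open>R as a right module over itself; its submodules are the right ideals.\<close>

definition regmod :: "('r, 'b) ring_scheme \<Rightarrow> ('r, 'r) module" where
  "regmod R = \<lparr>carrier = carrier R, mult = undefined, one = undefined, zero = zero R, add = add R,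
     smult = (\<lambda>r x. x \<otimes>\<^bsub>R\<^esub> r)\<rparr>"

lemma regmod_simps [simp]:
  "carrier (regmod R) = carrier R" "zero (regmod R) = zero R" "add (regmod R) = add R"
  "r \<odot>\<^bsub>regmod R\<^esub> x = x \<otimes>\<^bsub>R\<^esub> r"
  by (auto simp: regmod_def)

lemma regmod_right_module:
  fixes R (structure)
  assumes "ring R"
  shows "right_module R (regmod R)"
proof -
  interpret ring R by fact
  show ?thesis
  proof (intro right_module.intro right_module_axioms.intro assms abelian_groupI)
    fix x assume "x \<in> carrier (regmod R)"
    then show "\<exists>y\<in>carrier (regmod R). y \<oplus>\<^bsub>regmod R\<^esub> x = \<zero>\<^bsub>regmod R\<^esub>"
      by (auto intro!: bexI[of _ "\<ominus> x"] simp: l_neg)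
  qed (auto simp: a_ac l_distr r_distr m_assoc)
qed

text \<open>For a two-sided ideal J this says that R / J is right Noetherian, without forming the
  quotient.\<close>

definition noetherian_over :: "('r, 'b) ring_scheme \<Rightarrow> 'r set \<Rightarrow> bool" where
  "noetherian_over R J \<longleftrightarrow> (\<forall>I. submodule I R (regmod R) \<longrightarrow> J \<subseteq> I \<longrightarrow>
     (\<exists>T. finite T \<and> T \<subseteq> I \<and> I \<subseteq> rspan R (regmod R) (T \<union> J)))"

lemma rspan_un_decomp:
  assumes M: "right_module R M" and A: "submodule A R M" and B: "submodule B R M"
    and x: "x \<in> rspan R M (A \<union> B)"
  obtains a b where "a \<in> A" "b \<in> B" "x = a \<oplus>\<^bsub>M\<^esub> b"
proof -
  interpret right_module R M by fact
  note a = submoduleD[OF A] and b = submoduleD[OF B]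
  let ?H = "{a \<oplus>\<^bsub>M\<^esub> b |a b. a \<in> A \<and> b \<in> B}"
  have "submodule ?H R M"
  proof (rule submoduleI)
    show "?H \<subseteq> carrier M" using a(1) b(1) by auto
    show "\<zero>\<^bsub>M\<^esub> \<in> ?H" using a(2) b(2) by (intro CollectI exI[of _ "\<zero>\<^bsub>M\<^esub>"]) auto
  next
    fix x y assume "x \<in> ?H" "y \<in> ?H"
    then obtain p q r s where *: "p \<in> A" "q \<in> B" "r \<in> A" "s \<in> B" "x = p \<oplus>\<^bsub>M\<^esub> q" "y = r \<oplus>\<^bsub>M\<^esub> s"
      by auto
    then have "x \<oplus>\<^bsub>M\<^esub> y = (p \<oplus>\<^bsub>M\<^esub> r) \<oplus>\<^bsub>M\<^esub> (q \<oplus>\<^bsub>M\<^esub> s)"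
      using a(1) b(1) by (auto simp: M.a_ac subset_iff)
    then show "x \<oplus>\<^bsub>M\<^esub> y \<in> ?H" using * a(3) b(3) by blast
  next
    fix r x assume r: "r \<in> carrier R" and "x \<in> ?H"
    then obtain p q where *: "p \<in> A" "q \<in> B" "x = p \<oplus>\<^bsub>M\<^esub> q" by auto
    then have "r \<odot>\<^bsub>M\<^esub> x = r \<odot>\<^bsub>M\<^esub> p \<oplus>\<^bsub>M\<^esub> r \<odot>\<^bsub>M\<^esub> q" using r a(1) b(1) add_vector by blast
    then show "r \<odot>\<^bsub>M\<^esub> x \<in> ?H" using * r a(4) b(4) by blast
  qed
  moreover have "A \<union> B \<subseteq> ?H"
  proof
    fix y assume "y \<in> A \<union> B"
    then show "y \<in> ?H"
    proof
      assume "y \<in> A"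
      then show ?thesis using b(2) a(1) by (intro CollectI exI[of _ y] exI[of _ "\<zero>\<^bsub>M\<^esub>"]) auto
    next
      assume "y \<in> B"
      then show ?thesis using a(2) b(1) by (intro CollectI exI[of _ "\<zero>\<^bsub>M\<^esub>"] exI[of _ y]) auto
    qed
  qed
  ultimately have "rspan R M (A \<union> B) \<subseteq> ?H" by (rule rspan_least)
  then show thesis using x that by blast
qed

lemma rspan_single_decomp:
  assumes M: "right_module R M" and s: "s \<in> carrier M" and x: "x \<in> rspan R M {s}"
  obtains r where "r \<in> carrier R" "x = r \<odot>\<^bsub>M\<^esub> s"
proof -
  interpret right_module R M by fact
  have hom: "(\<lambda>r. r \<odot>\<^bsub>M\<^esub> s) \<in> rmod_hom R (regmod R) M"
    using s by (intro rmod_homI) (auto simp: add_scalar right_assoc)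
  have "submodule ((\<lambda>r. r \<odot>\<^bsub>M\<^esub> s) ` carrier (regmod R)) R M"
    by (rule submodule_image[OF regmod_right_module[OF ring_R] M hom
        right_module.carrier_submodule[OF regmod_right_module[OF ring_R]]])
  moreover have "s \<in> (\<lambda>r. r \<odot>\<^bsub>M\<^esub> s) ` carrier (regmod R)"
    using unit[OF s] by (auto intro!: image_eqI[of _ _ "\<one>\<^bsub>R\<^esub>"])
  ultimately have "rspan R M {s} \<subseteq> (\<lambda>r. r \<odot>\<^bsub>M\<^esub> s) ` carrier (regmod R)"
    by (intro rspan_least) auto
  then show thesis using x that by auto
qed

text \<open>Over a Noetherian ring, submodules of finitely generated modules are finitely generated;
  here relative to J and to a submodule M0 that contains M J. The induction removes a generator s.
  Generators of Z come from the coefficients that s can have in elements of Z, and from the part of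
  Z that lies in the span of the remaining generators.\<close>

lemma noetherian_over_submodule_fg:
  assumes M: "right_module R M" and noe: "noetherian_over R J" and J: "J \<subseteq> carrier R"
    and M0: "submodule M0 R M" and kill: "\<And>j x. \<lbrakk>j \<in> J; x \<in> carrier M\<rbrakk> \<Longrightarrow> j \<odot>\<^bsub>M\<^esub> x \<in> M0"
    and S: "finite S" "S \<subseteq> carrier M"
    and Z: "submodule Z R M" "M0 \<subseteq> Z" "Z \<subseteq> rspan R M (S \<union> M0)"
  shows "\<exists>T. finite T \<and> T \<subseteq> Z \<and> Z \<subseteq> rspan R M (T \<union> M0)"
  using S Z
proof (induction S arbitrary: Z rule: finite_induct)
  case empty
  then show ?case by (intro exI[of _ "{}"]) auto
next
  case (insert s S)
  interpret right_module R M by fact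
  note reg = regmod_right_module[OF ring_R]
  interpret reg: right_module R "regmod R" by (rule reg)
  have s: "s \<in> carrier M" "S \<subseteq> carrier M" using insert.prems by auto
  note M0' = submoduleD[OF M0] and Z' = submoduleD[OF insert.prems(2)]
  define W where "W = rspan R M (S \<union> M0)"
  have W: "submodule W R M" unfolding W_def by (rule rspan_submodule[OF M]) (use s M0' in auto)
  note W' = submoduleD[OF W]
  have M0W: "M0 \<subseteq> W" using rspan_incl[of "S \<union> M0" R M] by (auto simp: W_def)
  \<comment> \<open>The right ideal of leading coefficients at s of the elements of Q, modulo the
    span W of the other generators. It is formed for Z and again for the span Q of the proposed
    generators.\<close>
  have ideal: "submodule {r \<in> carrier R. \<exists>w\<in>W. r \<odot>\<^bsub>M\<^esub> s \<oplus>\<^bsub>M\<^esub> w \<in> Q} R (regmod R)"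
    (is "submodule (?I Q) R _")
    if Q: "submodule Q R M" for Q
  proof (rule reg.submoduleI)
    note Q' = submoduleD[OF Q]
    show "?I Q \<subseteq> carrier (regmod R)" by auto
    show "\<zero>\<^bsub>regmod R\<^esub> \<in> ?I Q" using s Q'(2) W'(2) by (auto intro!: bexI[of _ "\<zero>\<^bsub>M\<^esub>"])
    fix x y assume "x \<in> ?I Q" "y \<in> ?I Q"
    then obtain v w where *: "x \<in> carrier R" "y \<in> carrier R" "v \<in> W" "w \<in> W"
      "x \<odot>\<^bsub>M\<^esub> s \<oplus>\<^bsub>M\<^esub> v \<in> Q" "y \<odot>\<^bsub>M\<^esub> s \<oplus>\<^bsub>M\<^esub> w \<in> Q" by auto
    then have "v \<in> carrier M" "w \<in> carrier M" using W'(1) by auto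
    then have "(x \<oplus>\<^bsub>R\<^esub> y) \<odot>\<^bsub>M\<^esub> s \<oplus>\<^bsub>M\<^esub> (v \<oplus>\<^bsub>M\<^esub> w) = (x \<odot>\<^bsub>M\<^esub> s \<oplus>\<^bsub>M\<^esub> v) \<oplus>\<^bsub>M\<^esub> (y \<odot>\<^bsub>M\<^esub> s \<oplus>\<^bsub>M\<^esub> w)"
      using * s by (simp add: add_scalar M.a_ac)
    then show "x \<oplus>\<^bsub>regmod R\<^esub> y \<in> ?I Q"
      using * Q'(3) W'(3)[of v w] by (auto intro!: bexI[of _ "v \<oplus>\<^bsub>M\<^esub> w"])
  next
    note Q' = submoduleD[OF Q]
    fix r x assume r: "r \<in> carrier R" and "x \<in> ?I Q"
    then obtain v where *: "x \<in> carrier R" "v \<in> W" "x \<odot>\<^bsub>M\<^esub> s \<oplus>\<^bsub>M\<^esub> v \<in> Q" by auto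
    then have "v \<in> carrier M" using W'(1) by auto
    then have "(x \<otimes>\<^bsub>R\<^esub> r) \<odot>\<^bsub>M\<^esub> s \<oplus>\<^bsub>M\<^esub> (r \<odot>\<^bsub>M\<^esub> v) = r \<odot>\<^bsub>M\<^esub> (x \<odot>\<^bsub>M\<^esub> s \<oplus>\<^bsub>M\<^esub> v)"
      using * s r by (simp add: add_vector right_assoc)
    then show "r \<odot>\<^bsub>regmod R\<^esub> x \<in> ?I Q"
      using * r Q'(4) W'(4)[of r v] by (auto intro!: bexI[of _ "r \<odot>\<^bsub>M\<^esub> v"])
  qed
  have JI: "J \<subseteq> ?I Q" if "submodule Q R M" "M0 \<subseteq> Q" for Q
  proof
    fix j assume j: "j \<in> J"
    then have "j \<odot>\<^bsub>M\<^esub> s \<in> Q" "j \<odot>\<^bsub>M\<^esub> s \<in> carrier M" using kill s(1) that(2) M0'(1) by blast+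
    then show "j \<in> ?I Q" using j J W'(2) by (auto intro!: bexI[of _ "\<zero>\<^bsub>M\<^esub>"])
  qed
  obtain T0 where T0: "finite T0" "T0 \<subseteq> ?I Z" "?I Z \<subseteq> rspan R (regmod R) (T0 \<union> J)"
    using noe[unfolded noetherian_over_def, rule_format, OF ideal[OF insert.prems(2)]
      JI[OF insert.prems(2,3)]] by blast
  have "\<forall>t\<in>T0. \<exists>w. w \<in> W \<and> t \<odot>\<^bsub>M\<^esub> s \<oplus>\<^bsub>M\<^esub> w \<in> Z" using T0(2) by auto
  then obtain w where w: "\<And>t. t \<in> T0 \<Longrightarrow> w t \<in> W \<and> t \<odot>\<^bsub>M\<^esub> s \<oplus>\<^bsub>M\<^esub> w t \<in> Z" by metis
  have ZW: "submodule (Z \<inter> W) R M" by (rule submodule_inter[OF insert.prems(2) W])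
  obtain T1 where T1: "finite T1" "T1 \<subseteq> Z \<inter> W" "Z \<inter> W \<subseteq> rspan R M (T1 \<union> M0)"
    using insert.IH[OF s(2) ZW] M0W insert.prems(3) by (auto simp: W_def)
  define T where "T = T1 \<union> (\<lambda>t. t \<odot>\<^bsub>M\<^esub> s \<oplus>\<^bsub>M\<^esub> w t) ` T0"
  define Q where "Q = rspan R M (T \<union> M0)"
  have TZ: "T \<subseteq> Z" using T1(2) w by (auto simp: T_def)
  then have TM0: "T \<union> M0 \<subseteq> carrier M" using Z'(1) M0'(1) by auto
  have Q: "submodule Q R M" unfolding Q_def by (rule rspan_submodule[OF M TM0])
  note Q' = submoduleD[OF Q]
  have TQ: "T \<union> M0 \<subseteq> Q" unfolding Q_def by (rule rspan_incl)
  have QZ: "Q \<subseteq> Z" unfolding Q_def by (rule rspan_least[OF insert.prems(2)]) (use TZ insert.prems(3) in auto)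
  have T1Q: "rspan R M (T1 \<union> M0) \<subseteq> Q" unfolding Q_def by (rule rspan_mono) (auto simp: T_def)
  have "T0 \<subseteq> ?I Q"
  proof
    fix t assume t: "t \<in> T0"
    then have "t \<odot>\<^bsub>M\<^esub> s \<oplus>\<^bsub>M\<^esub> w t \<in> Q" using TQ by (auto simp: T_def)
    then show "t \<in> ?I Q" using t T0(2) w[OF t] by auto
  qed
  then have "rspan R (regmod R) (T0 \<union> J) \<subseteq> ?I Q"
    using JI[OF Q] TQ by (intro rspan_least[OF ideal[OF Q]]) auto
  then have I: "?I Z \<subseteq> ?I Q" using T0(3) by blast
  have "Z \<subseteq> Q"
  proof
    fix z assume z: "z \<in> Z"
    have s': "submodule (rspan R M {s}) R M" using s(1) by (intro rspan_submodule[OF M]) auto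
    have "insert s S \<union> M0 \<subseteq> rspan R M {s} \<union> W"
      using rspan_incl[of "{s}" R M] rspan_incl[of "S \<union> M0" R M] by (auto simp: W_def)
    then have "z \<in> rspan R M (rspan R M {s} \<union> W)"
      using subsetD[OF rspan_mono subsetD[OF insert.prems(4) z]] by blast
    then obtain a v where a: "a \<in> rspan R M {s}" and v: "v \<in> W" and zav: "z = a \<oplus>\<^bsub>M\<^esub> v"
      using rspan_un_decomp[OF M s' W] by metis
    obtain r where r: "r \<in> carrier R" "a = r \<odot>\<^bsub>M\<^esub> s" using rspan_single_decomp[OF M s(1) a] .
    \<comment> \<open>By the inclusion of leading ideals some element r s + u lies in Q. Subtracting
      it from z leaves v - u, an element of Z \<inter> W, and these are spanned by T1 and
      M0.\<close>
    have "r \<in> ?I Z" using r zav v z by auto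
    then obtain u where u: "u \<in> W" "r \<odot>\<^bsub>M\<^esub> s \<oplus>\<^bsub>M\<^esub> u \<in> Q" using I by blast
    have c: "v \<in> carrier M" "u \<in> carrier M" "r \<odot>\<^bsub>M\<^esub> s \<in> carrier M" using u v W'(1) r s by auto
    have eq: "z = (r \<odot>\<^bsub>M\<^esub> s \<oplus>\<^bsub>M\<^esub> u) \<oplus>\<^bsub>M\<^esub> (v \<ominus>\<^bsub>M\<^esub> u)"
    proof -
      have "(r \<odot>\<^bsub>M\<^esub> s \<oplus>\<^bsub>M\<^esub> u) \<oplus>\<^bsub>M\<^esub> (v \<ominus>\<^bsub>M\<^esub> u) = (r \<odot>\<^bsub>M\<^esub> s \<oplus>\<^bsub>M\<^esub> v) \<oplus>\<^bsub>M\<^esub> (u \<oplus>\<^bsub>M\<^esub> \<ominus>\<^bsub>M\<^esub> u)"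
        using c by (simp add: a_minus_def M.a_ac del: M.r_neg)
      then show ?thesis using c by (simp add: zav r M.r_neg)
    qed
    have "v \<ominus>\<^bsub>M\<^esub> u = z \<ominus>\<^bsub>M\<^esub> (r \<odot>\<^bsub>M\<^esub> s \<oplus>\<^bsub>M\<^esub> u)"
      unfolding eq using c by (intro M.add_diff_cancel[symmetric]) auto
    then have "v \<ominus>\<^bsub>M\<^esub> u \<in> Z" using z u(2) QZ Z'(6) by auto
    then have "v \<ominus>\<^bsub>M\<^esub> u \<in> Q" using W'(6)[OF v u(1)] T1(3) T1Q by auto
    then show "z \<in> Q" using eq u(2) Q'(3) by simp
  qed
  then show ?case using TZ T0(1) T1(1) by (intro exI[of _ T]) (auto simp: T_def Q_def)
qed

text \<open>\<open>P i\<close> modulo P J is finitely generated and killed by J, so already the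
  relative cycles are finitely generated modulo P J, before boundaries are divided out.\<close>

lemma fin_gen_homology_fg:
  assumes P: "\<And>i. right_module R (P i)" and d: "\<And>i. d i \<in> rmod_hom R (P (Suc i)) (P i)"
    and J: "J \<subseteq> carrier R" and noe: "noetherian_over R J" and fg: "fin_gen R (P i)"
  shows "homology_fg R J P d i"
proof -
  let ?J = "ideal_mult R (P i) J (carrier (P i))" and ?Z = "rel_cycles R J P d i"
  have M0: "submodule ?J R (P i)" by (rule ideal_mult_submodule[OF P J]) simp
  note Z = rel_cycles_submodule[of R P d J i, OF P d J]
  obtain S where S: "finite S" "S \<subseteq> carrier (P i)" "carrier (P i) = rspan R (P i) S"
    using fg by (auto simp: fin_gen_iff)
  have JZ: "?J \<subseteq> ?Z"
  proof (cases i)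
    case 0
    then show ?thesis using ideal_mult_subset[OF P J, of "carrier (P 0)" 0] by (auto simp: rel_cycles_def)
  next
    case (Suc j)
    have "d j ` ?J \<subseteq> ideal_mult R (P j) J (carrier (P j))"
      unfolding Suc by (rule ideal_mult_image[OF P P J d]) (use rmod_hom_closed[OF d] in auto)
    then show ?thesis
      using Suc ideal_mult_subset[OF P J, of "carrier (P i)" i] by (auto simp: rel_cycles_def)
  qed
  have "?Z \<subseteq> carrier (P i)" by (auto simp: rel_cycles_def)
  also have "carrier (P i) \<subseteq> rspan R (P i) (S \<union> ?J)" using S(3) rspan_mono[of S "S \<union> ?J"] by auto
  finally have "?Z \<subseteq> rspan R (P i) (S \<union> ?J)" .
  then obtain T where "finite T" "T \<subseteq> ?Z" "?Z \<subseteq> rspan R (P i) (T \<union> ?J)"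
    using noetherian_over_submodule_fg[OF P noe J M0 ideal_multI S(1,2) Z JZ] by blast
  moreover have "rspan R (P i) (T \<union> ?J) \<subseteq> rspan R (P i) (T \<union> ?J \<union> d i ` carrier (P (Suc i)))"
    by (rule rspan_mono) auto
  ultimately show ?thesis unfolding homology_fg_def by blast
qed

text \<open>Z / ZJ is squeezed between two finitely generated pieces. The image of Z in
  \<open>P i\<close> modulo P J is finitely generated by the Noetherian property. The remaining
  piece, Z \<inter> PJ modulo Z J, is the image under d of the homology of P / PJ in degree i +
  1.\<close>

lemma image_fg_mod_ideal:
  assumes P: "projective_resolution R T P d e" and J: "J \<subseteq> carrier R"
    and noe: "noetherian_over R J" and fg: "fin_gen R (P i)" and hfg: "homology_fg R J P d (Suc i)"
  defines "Z \<equiv> d i ` carrier (P (Suc i))"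
  shows "\<exists>S. finite S \<and> S \<subseteq> Z \<and> Z \<subseteq> rspan R (P i) (S \<union> ideal_mult R (P i) J Z)"
proof -
  note D = resolutionD[OF P]
  interpret M: right_module R "P i" by (rule D(2))
  let ?J = "\<lambda>i. ideal_mult R (P i) J (carrier (P i))"
  let ?ZJ = "ideal_mult R (P i) J Z"
  have Z: "submodule Z R (P i)" unfolding Z_def
    by (rule submodule_image[OF D(2) D(2) D(3) right_module.carrier_submodule[OF D(2)]])
  note Z' = M.submoduleD[OF Z]
  have M0: "submodule (?J i) R (P i)" by (rule ideal_mult_submodule[OF D(2) J]) simp
  note M0' = M.submoduleD[OF M0]
  define Y where "Y = rspan R (P i) (Z \<union> ?J i)"
  have Y: "submodule Y R (P i)" unfolding Y_def using Z' M0' by (intro rspan_submodule[OF D(2)]) auto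
  obtain S0 where S0: "finite S0" "S0 \<subseteq> carrier (P i)" "carrier (P i) = rspan R (P i) S0"
    using fg by (auto simp: fin_gen_iff)
  have Ysub: "?J i \<subseteq> Y" "Z \<subseteq> Y" using rspan_incl[of "Z \<union> ?J i" R "P i"] by (auto simp: Y_def)
  have "Y \<subseteq> rspan R (P i) (S0 \<union> ?J i)"
    using M.submoduleD(1)[OF Y] S0(3) rspan_mono[of S0 "S0 \<union> ?J i" R "P i"] by auto
  then obtain U where U: "finite U" "U \<subseteq> Y" "Y \<subseteq> rspan R (P i) (U \<union> ?J i)"
    using noetherian_over_submodule_fg[OF D(2) noe J M0 ideal_multI S0(1,2) Y Ysub(1)] by blast
  \<comment> \<open>The generators of Z + PJ are replaced by their Z-components, which still
    generate modulo P J.\<close>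
  have "\<forall>u\<in>U. \<exists>z. z \<in> Z \<and> (\<exists>y\<in>?J i. u = z \<oplus>\<^bsub>P i\<^esub> y)"
    using U(2) rspan_un_decomp[OF D(2) Z M0] unfolding Y_def by (metis subsetD)
  then obtain z where z: "\<And>u. u \<in> U \<Longrightarrow> z u \<in> Z \<and> (\<exists>y\<in>?J i. u = z u \<oplus>\<^bsub>P i\<^esub> y)" by metis
  have zU: "z ` U \<subseteq> carrier (P i)" using z Z'(1) by auto
  have "U \<subseteq> rspan R (P i) (z ` U \<union> ?J i)"
  proof
    fix u assume u: "u \<in> U"
    then obtain y where y: "y \<in> ?J i" "u = z u \<oplus>\<^bsub>P i\<^esub> y" using z by blast
    have sub: "submodule (rspan R (P i) (z ` U \<union> ?J i)) R (P i)"
      using zU M0'(1) by (intro rspan_submodule[OF D(2)]) auto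
    have "z u \<in> rspan R (P i) (z ` U \<union> ?J i)" "y \<in> rspan R (P i) (z ` U \<union> ?J i)"
      using u y rspan_incl[of "z ` U \<union> ?J i" R "P i"] by auto
    then show "u \<in> rspan R (P i) (z ` U \<union> ?J i)" using M.submoduleD(3)[OF sub] y(2) by metis
  qed
  then have "rspan R (P i) (U \<union> ?J i) \<subseteq> rspan R (P i) (z ` U \<union> ?J i)"
    using rspan_incl[of "z ` U \<union> ?J i" R "P i"] zU M0'(1)
    by (intro rspan_sub_rspan[OF D(2)]) auto
  then have Yz: "Y \<subseteq> rspan R (P i) (z ` U \<union> ?J i)" using U(3) by blast
  obtain V where V: "finite V" "V \<subseteq> rel_cycles R J P d (Suc i)"
    "rel_cycles R J P d (Suc i) \<subseteq>
      rspan R (P (Suc i)) (V \<union> ?J (Suc i) \<union> d (Suc i) ` carrier (P (Suc (Suc i))))"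
    using hfg by (auto simp: homology_fg_def)
  let ?W = "rspan R (P i) (z ` U \<union> d i ` V \<union> ?ZJ)"
  have V': "V \<subseteq> carrier (P (Suc i))" using V(2) by (auto simp: rel_cycles_def)
  have ZJ: "?ZJ \<subseteq> carrier (P i)" by (rule ideal_mult_subset[OF D(2) J Z'(1)])
  have dV: "d i ` V \<subseteq> Z" using V' by (auto simp: Z_def)
  have Wgen: "z ` U \<union> d i ` V \<union> ?ZJ \<subseteq> carrier (P i)" using zU dV Z'(1) ZJ by auto
  have W: "submodule ?W R (P i)" by (rule rspan_submodule[OF D(2) Wgen])
  have "d i ` rspan R (P (Suc i)) (V \<union> ?J (Suc i) \<union> d (Suc i) ` carrier (P (Suc (Suc i)))) \<subseteq> ?W"
  proof (rule rspan_image[OF D(2) D(2) D(3) _ Wgen])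
    show "V \<union> ?J (Suc i) \<union> d (Suc i) ` carrier (P (Suc (Suc i))) \<subseteq> carrier (P (Suc i))"
      using V' ideal_mult_subset[OF D(2) J, of "carrier (P (Suc i))" "Suc i"] rmod_hom_closed[OF D(3)]
      by auto
    have "d i ` ?J (Suc i) \<subseteq> ?ZJ"
      by (rule ideal_mult_image[OF D(2) D(2) J D(3)]) (use Z'(1) in \<open>auto simp: Z_def\<close>)
    moreover have "d i ` d (Suc i) ` carrier (P (Suc (Suc i))) \<subseteq> {\<zero>\<^bsub>P i\<^esub>}"
      using resolution_complex(2)[OF P] by auto
    ultimately have "d i ` (V \<union> ?J (Suc i) \<union> d (Suc i) ` carrier (P (Suc (Suc i)))) \<subseteq>
        (z ` U \<union> d i ` V \<union> ?ZJ) \<union> {\<zero>\<^bsub>P i\<^esub>}" by (simp only: image_Un) blast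
    also have "\<dots> \<subseteq> ?W"
      using rspan_incl[of "z ` U \<union> d i ` V \<union> ?ZJ" R "P i"] M.submoduleD(2)[OF W] by simp
    finally show "d i ` (V \<union> ?J (Suc i) \<union> d (Suc i) ` carrier (P (Suc (Suc i)))) \<subseteq> ?W" .
  qed
  \<comment> \<open>An element of Z that lies in P J is d of a relative cycle. Relative cycles are
    spanned by V, P J and boundaries, and d sends these to d V, to Z J and to zero.\<close>
  then have key: "x \<in> ?W" if "x \<in> Z" "x \<in> ?J i" for x
    using that V(3) by (auto simp: Z_def rel_cycles_def subset_iff)
  have "Z \<subseteq> ?W"
  proof
    fix x assume x: "x \<in> Z"
    have A: "submodule (rspan R (P i) (z ` U)) R (P i)" by (rule rspan_submodule[OF D(2) zU])
    have "z ` U \<union> ?J i \<subseteq> rspan R (P i) (z ` U) \<union> ?J i" using rspan_incl[of "z ` U" R "P i"] by auto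
    then have "x \<in> rspan R (P i) (rspan R (P i) (z ` U) \<union> ?J i)"
      using subsetD[OF rspan_mono subsetD[OF Yz subsetD[OF Ysub(2) x]]] by blast
    then obtain a b where ab: "a \<in> rspan R (P i) (z ` U)" "b \<in> ?J i" "x = a \<oplus>\<^bsub>P i\<^esub> b"
      using rspan_un_decomp[OF D(2) A M0] by metis
    have aZ: "a \<in> Z" using rspan_least[OF Z, of "z ` U"] z ab(1) by auto
    have aW: "a \<in> ?W" using rspan_mono[of "z ` U" "z ` U \<union> d i ` V \<union> ?ZJ" R "P i"] ab(1) by auto
    have "b = x \<ominus>\<^bsub>P i\<^esub> a"
      unfolding ab(3) using ab(2) aZ Z'(1) M0'(1) by (intro M.add_diff_cancel[symmetric]) auto
    then have "b \<in> Z" using x aZ Z'(6) by auto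
    then have "b \<in> ?W" using key ab(2) by blast
    then show "x \<in> ?W" using aW ab(3) M.submoduleD(3)[OF W] by simp
  qed
  then show ?thesis using z dV U(1) V(1)
    by (intro exI[of _ "z ` U \<union> d i ` V"]) auto
qed

lemma (in abelian_group) diff_zero_imp_eq:
  assumes "a \<in> carrier G" "b \<in> carrier G" "a \<ominus> b = \<zero>"
  shows "a = b"
proof -
  have "a = (a \<ominus> b) \<oplus> b" using assms(1,2) by (simp add: a_minus_def a_assoc l_neg)
  then show ?thesis using assms by simp
qed

section \<open>The free algebra\<close>

lemma monomial_eq_single: "monomial K a w = single K a w"
  by (simp add: monomial_def single_def)

lemma free_algebra_simps:
  "carrier (free_algebra K X) = carrier (freemod K (lists X))"
  "zero (free_algebra K X) = (\<lambda>w. \<zero>\<^bsub>K\<^esub>)"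
  "one (free_algebra K X) = single K \<one>\<^bsub>K\<^esub> []"
  "f \<oplus>\<^bsub>free_algebra K X\<^esub> g = (\<lambda>w. f w \<oplus>\<^bsub>K\<^esub> g w)"
  "f \<otimes>\<^bsub>free_algebra K X\<^esub> g = (\<lambda>w. \<Oplus>\<^bsub>K\<^esub>i\<in>{..length w}. f (take i w) \<otimes>\<^bsub>K\<^esub> g (drop i w))"
  by (auto simp: free_algebra_def freemod_def monomial_eq_single)

context
  fixes K :: "('k, 'b) ring_scheme" (structure) and X :: "'l set"
  assumes K: "ring K"
begin

interpretation ring K by (rule K)

abbreviation (input) "FA \<equiv> free_algebra K X"

lemma free_algebra_abelian_group: "abelian_group FA"
proof -
  interpret M: right_module K "freemod K (lists X)" by (rule freemod_right_module[OF K])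
  have [simp]: "carrier FA = carrier (freemod K (lists X))" "zero FA = zero (freemod K (lists X))"
    "add FA = add (freemod K (lists X))"
    by (simp_all add: free_algebra_def freemod_def)
  show ?thesis
  proof (rule abelian_groupI)
    fix x assume "x \<in> carrier FA"
    then show "\<exists>y\<in>carrier FA. y \<oplus>\<^bsub>FA\<^esub> x = \<zero>\<^bsub>FA\<^esub>"
      by (auto intro!: bexI[of _ "\<ominus>\<^bsub>freemod K (lists X)\<^esub> x"] simp: M.M.l_neg)
  qed (auto simp: M.M.a_assoc M.M.a_comm M.M.a_lcomm)
qed

text \<open>A word at which the product does not vanish is a concatenation of a word in the support
  of f with one in the support of g; this bounds the support and keeps it over X.\<close>

lemma free_algebra_mult_closed:
  assumes f: "f \<in> carrier FA" and g: "g \<in> carrier FA"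
  shows "f \<otimes>\<^bsub>FA\<^esub> g \<in> carrier FA"
proof -
  note f = f[unfolded free_algebra_simps] and g = g[unfolded free_algebra_simps]
  let ?h = "\<lambda>w. \<Oplus>i\<in>{..length w}. f (take i w) \<otimes> g (drop i w)"
  have nz: "\<exists>u v. w = u @ v \<and> f u \<noteq> \<zero> \<and> g v \<noteq> \<zero>" if "?h w \<noteq> \<zero>" for w
  proof (rule ccontr)
    assume neg: "\<not> ?thesis"
    have "f (take i w) \<otimes> g (drop i w) = \<zero>" for i
    proof (cases "f (take i w) = \<zero>")
      case True
      then show ?thesis using freemodD(1)[OF g] by simp
    next
      case False
      then have "g (drop i w) = \<zero>" using neg append_take_drop_id[of i w] by metis
      then show ?thesis using freemodD(1)[OF f] by simp
    qed
    then show False using that by simp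
  qed
  have "?h \<in> carrier (freemod K (lists X))"
  proof (rule freemodI)
    show "?h w \<in> carrier K" for w
      by (rule finsum_closed) (simp add: freemodD(1)[OF f] freemodD(1)[OF g])
    show "finite {w. ?h w \<noteq> \<zero>}"
    proof (rule finite_subset)
      show "{w. ?h w \<noteq> \<zero>} \<subseteq> (\<lambda>(u, v). u @ v) ` ({u. f u \<noteq> \<zero>} \<times> {v. g v \<noteq> \<zero>})"
        using nz by force
      show "finite ((\<lambda>(u, v). u @ v) ` ({u. f u \<noteq> \<zero>} \<times> {v. g v \<noteq> \<zero>}))"
        using freemodD(2)[OF f] freemodD(2)[OF g] by simp
    qed
    show "?h w = \<zero>" if w: "w \<notin> lists X" for w
    proof (rule ccontr)
      assume "?h w \<noteq> \<zero>"
      then obtain u v where "w = u @ v" "f u \<noteq> \<zero>" "g v \<noteq> \<zero>" using nz by blast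
      then show False using w freemodD(3)[OF f, of u] freemodD(3)[OF g, of v] by simp
    qed
  qed
  then show ?thesis by (simp add: free_algebra_simps)
qed

text \<open>The only splitting with a nonzero term is the cut of \<open>u @ v\<close> at
  \<open>length u\<close>.\<close>

lemma free_algebra_single_mult:
  assumes a: "a \<in> carrier K" and b: "b \<in> carrier K"
  shows "single K a u \<otimes>\<^bsub>FA\<^esub> single K b v = single K (a \<otimes> b) (u @ v)"
proof
  fix w
  let ?t = "\<lambda>i. single K a u (take i w) \<otimes> single K b v (drop i w)"
  have "(\<Oplus>i\<in>{..length w}. ?t i) = single K (a \<otimes> b) (u @ v) w"
  proof (cases "w = u @ v")
    case True
    have "(\<Oplus>i\<in>{..length w}. ?t i) = (\<Oplus>i\<in>{..length w}. if length u = i then a \<otimes> b else \<zero>)"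
    proof (rule finsum_cong')
      fix i assume "i \<in> {..length w}"
      then have "take i w = u \<longleftrightarrow> length u = i" using True
        by (metis append_eq_conv_conj atMost_iff length_take min.absorb2)
      then show "?t i = (if length u = i then a \<otimes> b else \<zero>)"
        using a b True by (auto simp: single_def)
    qed (use a b in auto)
    also have "\<dots> = a \<otimes> b" using a b True by (intro finsum_singleton) auto
    finally show ?thesis using True by (simp add: single_def)
  next
    case False
    then have "?t i = \<zero>" for i
      using a b by (auto simp: single_def)
    then show ?thesis using False by (simp add: single_def)
  qed
  then show "(single K a u \<otimes>\<^bsub>FA\<^esub> single K b v) w = single K (a \<otimes> b) (u @ v) w"
    by (simp add: free_algebra_simps)
qed

lemma free_algebra_l_distr:
  assumes f: "f \<in> carrier FA" and g: "g \<in> carrier FA" and h: "h \<in> carrier FA"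
  shows "(f \<oplus>\<^bsub>FA\<^esub> g) \<otimes>\<^bsub>FA\<^esub> h = f \<otimes>\<^bsub>FA\<^esub> h \<oplus>\<^bsub>FA\<^esub> g \<otimes>\<^bsub>FA\<^esub> h"
proof -
  note [simp] = freemodD(1)[OF f[unfolded free_algebra_simps]] freemodD(1)[OF g[unfolded free_algebra_simps]]
    freemodD(1)[OF h[unfolded free_algebra_simps]]
  show ?thesis by (simp add: free_algebra_simps l_distr finsum_addf)
qed

lemma free_algebra_r_distr:
  assumes f: "f \<in> carrier FA" and g: "g \<in> carrier FA" and h: "h \<in> carrier FA"
  shows "h \<otimes>\<^bsub>FA\<^esub> (f \<oplus>\<^bsub>FA\<^esub> g) = h \<otimes>\<^bsub>FA\<^esub> f \<oplus>\<^bsub>FA\<^esub> h \<otimes>\<^bsub>FA\<^esub> g"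
proof -
  note [simp] = freemodD(1)[OF f[unfolded free_algebra_simps]] freemodD(1)[OF g[unfolded free_algebra_simps]]
    freemodD(1)[OF h[unfolded free_algebra_simps]]
  show ?thesis by (simp add: free_algebra_simps r_distr finsum_addf)
qed

lemma free_algebra_induct:
  assumes f: "f \<in> carrier FA"
    and zero: "P \<zero>\<^bsub>FA\<^esub>"
    and single: "\<And>a w. \<lbrakk>a \<in> carrier K; w \<in> lists X\<rbrakk> \<Longrightarrow> P (single K a w)"
    and add: "\<And>f g. \<lbrakk>f \<in> carrier FA; g \<in> carrier FA; P f; P g\<rbrakk> \<Longrightarrow> P (f \<oplus>\<^bsub>FA\<^esub> g)"
  shows "P f"
  using f[unfolded free_algebra_simps] zero[unfolded free_algebra_simps] single
    add[unfolded free_algebra_simps]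
  by (rule freemod_induct[OF K])

lemma free_algebra_single_closed: "\<lbrakk>a \<in> carrier K; w \<in> lists X\<rbrakk> \<Longrightarrow> single K a w \<in> carrier FA"
  unfolding free_algebra_simps by (rule single_closed[OF K])

text \<open>By distributivity the ring laws reduce to monomials, where associativity is that of
  concatenation.\<close>

lemma free_algebra_ring: "ring FA"
proof -
  interpret F: abelian_group FA by (rule free_algebra_abelian_group)
  note [simp] = free_algebra_mult_closed free_algebra_single_closed
  have zl: "\<zero>\<^bsub>FA\<^esub> \<otimes>\<^bsub>FA\<^esub> f = \<zero>\<^bsub>FA\<^esub>" and zr: "f \<otimes>\<^bsub>FA\<^esub> \<zero>\<^bsub>FA\<^esub> = \<zero>\<^bsub>FA\<^esub>" if "f \<in> carrier FA" for f
    using freemodD(1)[OF that[unfolded free_algebra_simps]] by (simp_all add: free_algebra_simps)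
  have one: "\<one>\<^bsub>FA\<^esub> \<in> carrier FA" by (simp add: free_algebra_simps(3))
  have l_one: "\<one>\<^bsub>FA\<^esub> \<otimes>\<^bsub>FA\<^esub> f = f" if f: "f \<in> carrier FA" for f
    using f by (rule free_algebra_induct)
      (use one in \<open>auto simp: zr free_algebra_r_distr\<close>,
        simp add: free_algebra_simps(3) free_algebra_single_mult)
  have r_one: "f \<otimes>\<^bsub>FA\<^esub> \<one>\<^bsub>FA\<^esub> = f" if f: "f \<in> carrier FA" for f
    using f by (rule free_algebra_induct)
      (use one in \<open>auto simp: zl free_algebra_l_distr\<close>,
        simp add: free_algebra_simps(3) free_algebra_single_mult)
  have assoc: "f \<otimes>\<^bsub>FA\<^esub> g \<otimes>\<^bsub>FA\<^esub> h = f \<otimes>\<^bsub>FA\<^esub> (g \<otimes>\<^bsub>FA\<^esub> h)"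
    if f: "f \<in> carrier FA" and g: "g \<in> carrier FA" and h: "h \<in> carrier FA" for f g h
    using f
  proof (rule free_algebra_induct)
    fix a u assume au: "a \<in> carrier K" "u \<in> lists X"
    show "single K a u \<otimes>\<^bsub>FA\<^esub> g \<otimes>\<^bsub>FA\<^esub> h = single K a u \<otimes>\<^bsub>FA\<^esub> (g \<otimes>\<^bsub>FA\<^esub> h)"
      using g
    proof (rule free_algebra_induct)
      fix b v assume bv: "b \<in> carrier K" "v \<in> lists X"
      show "single K a u \<otimes>\<^bsub>FA\<^esub> single K b v \<otimes>\<^bsub>FA\<^esub> h = single K a u \<otimes>\<^bsub>FA\<^esub> (single K b v \<otimes>\<^bsub>FA\<^esub> h)"
        using h
        by (rule free_algebra_induct)
          (use au bv in \<open>auto simp: zr free_algebra_r_distr free_algebra_single_mult m_assoc\<close>)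
    qed (use h au in \<open>auto simp: zl zr free_algebra_l_distr free_algebra_r_distr\<close>)
  qed (use g h in \<open>auto simp: zl free_algebra_l_distr\<close>)
  show ?thesis
    by (rule ringI)
      (use one l_one r_one assoc free_algebra_abelian_group in
        \<open>auto intro!: monoidI simp: free_algebra_l_distr free_algebra_r_distr\<close>)
qed

end

section \<open>The enveloping algebra\<close>

text \<open>The construction of U(L) and its universal property rest on closure of the three
  operations. In this form the locale applies to \<open>lie_quotient L N\<close> once closure is
  checked there.\<close>

locale env_setup = K?: cring K for K :: "('k, 'b) ring_scheme" (structure) +
  fixes L :: "('k, 'l, 'm) lie_scheme"
  assumes L_add: "\<lbrakk>x \<in> carrier L; y \<in> carrier L\<rbrakk> \<Longrightarrow> x \<oplus>\<^bsub>L\<^esub> y \<in> carrier L"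
    and L_smult: "\<lbrakk>a \<in> carrier K; x \<in> carrier L\<rbrakk> \<Longrightarrow> a \<odot>\<^bsub>L\<^esub> x \<in> carrier L"
    and L_bracket: "\<lbrakk>x \<in> carrier L; y \<in> carrier L\<rbrakk> \<Longrightarrow> bracket L x y \<in> carrier L"
begin

abbreviation "F \<equiv> free_algebra K (carrier L)"
abbreviation "U \<equiv> env K L"
abbreviation "cls \<equiv> env_class K L"
abbreviation "inc \<equiv> env_incl K L"
abbreviation "sca \<equiv> env_scalar K L"

lemma K_ring: "ring K" ..

sublocale F: ring F by (rule free_algebra_ring[OF K_ring])

lemmas F_single = free_algebra_single_closed[OF K_ring, of _ _ "carrier L"]
lemmas F_single_mult = free_algebra_single_mult[OF K_ring, of _ _ "carrier L"]
lemmas F_induct = free_algebra_induct[OF K_ring, of _ "carrier L", consumes 1]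

lemma env_relations_closed: "env_relations K L \<subseteq> carrier F"
  by (auto simp: env_relations_def Let_def monomial_eq_single intro!: F.minus_closed F.a_closed F.m_closed F_single
      L_add L_smult L_bracket)

lemma env_ideal_ideal: "ideal (env_ideal K L) F"
  unfolding env_ideal_def by (rule F.genideal_ideal[OF env_relations_closed])

sublocale I: ideal "env_ideal K L" F by (rule env_ideal_ideal)

lemma cls_eq: "cls = (+>\<^bsub>F\<^esub>) (env_ideal K L)"
  by (rule ext) (simp add: env_class_def)

lemma cls_ring_hom: "cls \<in> ring_hom F U"
  unfolding cls_eq env_def by (rule I.rcos_ring_hom)

sublocale U: ring U unfolding env_def by (rule I.quotient_is_ring)

lemma cls_closed [simp, intro]: "f \<in> carrier F \<Longrightarrow> cls f \<in> carrier U"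
  using ring_hom_closed[OF cls_ring_hom] .

lemma cls_add: "\<lbrakk>f \<in> carrier F; g \<in> carrier F\<rbrakk> \<Longrightarrow> cls (f \<oplus>\<^bsub>F\<^esub> g) = cls f \<oplus>\<^bsub>U\<^esub> cls g"
  using ring_hom_add[OF cls_ring_hom] .

lemma cls_mult: "\<lbrakk>f \<in> carrier F; g \<in> carrier F\<rbrakk> \<Longrightarrow> cls (f \<otimes>\<^bsub>F\<^esub> g) = cls f \<otimes>\<^bsub>U\<^esub> cls g"
  using ring_hom_mult[OF cls_ring_hom] .

lemma cls_one: "cls \<one>\<^bsub>F\<^esub> = \<one>\<^bsub>U\<^esub>"
  using ring_hom_one[OF cls_ring_hom] .

lemma cls_additive: "additive_map F U cls"
  by (auto simp: additive_map_def cls_add)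

lemma cls_surj:
  assumes "u \<in> carrier U"
  obtains f where "f \<in> carrier F" "u = cls f"
proof -
  have "u \<in> a_rcosets\<^bsub>F\<^esub> env_ideal K L" using assms by (simp add: env_def FactRing_def)
  then show thesis using that by (auto simp: A_RCOSETS_def' cls_eq)
qed

lemma cls_self: "f \<in> carrier F \<Longrightarrow> f \<in> cls f"
  unfolding cls_eq by (rule I.a_rcos_self)

lemma cls_eqI: "\<lbrakk>f \<in> carrier F; g \<in> cls f\<rbrakk> \<Longrightarrow> g \<in> carrier F \<and> cls g = cls f"
  unfolding cls_eq using I.a_repr_independence' I.a_elemrcos_carrier by metis

lemma cls_eq_iff:
  assumes "f \<in> carrier F" "g \<in> carrier F"
  shows "cls f = cls g \<longleftrightarrow> f \<ominus>\<^bsub>F\<^esub> g \<in> env_ideal K L"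
  unfolding cls_eq using F.quotient_eq_iff_same_a_r_cos[OF env_ideal_ideal assms] by simp

lemma inc_eq: "inc x = cls (single K \<one> [x])" and sca_eq: "sca a = cls (single K a [])"
  by (simp_all add: env_incl_def env_scalar_def monomial_eq_single)

lemma inc_closed [simp, intro]: "x \<in> carrier L \<Longrightarrow> inc x \<in> carrier U"
  and sca_closed [simp, intro]: "a \<in> carrier K \<Longrightarrow> sca a \<in> carrier U"
  by (auto simp: inc_eq sca_eq intro!: F_single)

lemma relation_cls:
  assumes "f \<in> carrier F" "g \<in> carrier F" "f \<ominus>\<^bsub>F\<^esub> g \<in> env_relations K L"
  shows "cls f = cls g"
  using assms F.genideal_self[OF env_relations_closed] by (auto simp: cls_eq_iff env_ideal_def)

lemma cls_monomial_Cons: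
  assumes "a \<in> carrier K" "x \<in> carrier L" "w \<in> lists (carrier L)"
  shows "cls (single K a (x # w)) = inc x \<otimes>\<^bsub>U\<^esub> cls (single K a w)"
  using assms F_single_mult[of \<one> a "[x]" w] by (simp add: inc_eq cls_mult[symmetric] F_single)

lemma cls_monomial_scalar:
  assumes "a \<in> carrier K" "w \<in> lists (carrier L)"
  shows "cls (single K a w) = sca a \<otimes>\<^bsub>U\<^esub> cls (single K \<one> w)"
  using assms F_single_mult[of a \<one> "[]" w] by (simp add: sca_eq cls_mult[symmetric] F_single)

lemma inc_add:
  assumes "x \<in> carrier L" "y \<in> carrier L"
  shows "inc (x \<oplus>\<^bsub>L\<^esub> y) = inc x \<oplus>\<^bsub>U\<^esub> inc y"
proof -
  have "cls (single K \<one> [x \<oplus>\<^bsub>L\<^esub> y]) = cls (single K \<one> [x] \<oplus>\<^bsub>F\<^esub> single K \<one> [y])"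
    by (rule relation_cls)
      (use assms in \<open>auto simp: env_relations_def Let_def monomial_eq_single intro!: F_single L_add F.a_closed\<close>)
  then show ?thesis using assms by (simp add: inc_eq cls_add F_single)
qed

lemma inc_smult:
  assumes "a \<in> carrier K" "x \<in> carrier L"
  shows "inc (a \<odot>\<^bsub>L\<^esub> x) = sca a \<otimes>\<^bsub>U\<^esub> inc x"
proof -
  have "cls (single K \<one> [a \<odot>\<^bsub>L\<^esub> x]) = cls (single K a [x])"
    by (rule relation_cls)
      (use assms in \<open>auto simp: env_relations_def Let_def monomial_eq_single intro!: F_single L_smult\<close>)
  then show ?thesis using assms cls_monomial_scalar[of a "[x]"] by (simp add: inc_eq)
qed

lemma inc_bracket:
  assumes "x \<in> carrier L" "y \<in> carrier L"
  shows "inc (bracket L x y) = inc x \<otimes>\<^bsub>U\<^esub> inc y \<ominus>\<^bsub>U\<^esub> inc y \<otimes>\<^bsub>U\<^esub> inc x"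
proof -
  let ?X = "\<lambda>x. single K \<one> [x]"
  have "cls (?X (bracket L x y)) = cls (?X x \<otimes>\<^bsub>F\<^esub> ?X y \<ominus>\<^bsub>F\<^esub> ?X y \<otimes>\<^bsub>F\<^esub> ?X x)"
  proof (rule relation_cls)
    show "?X (bracket L x y) \<in> carrier F" "?X x \<otimes>\<^bsub>F\<^esub> ?X y \<ominus>\<^bsub>F\<^esub> ?X y \<otimes>\<^bsub>F\<^esub> ?X x \<in> carrier F"
      using assms by (simp_all add: F_single L_bracket F.minus_closed)
    show "?X (bracket L x y) \<ominus>\<^bsub>F\<^esub> (?X x \<otimes>\<^bsub>F\<^esub> ?X y \<ominus>\<^bsub>F\<^esub> ?X y \<otimes>\<^bsub>F\<^esub> ?X x) \<in> env_relations K L"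
      unfolding env_relations_def Let_def monomial_eq_single using assms by (intro UnI2) blast
  qed
  then show ?thesis using assms
    by (simp add: inc_eq cls_mult F_single
        additive_map_diff[OF F.is_abelian_group U.is_abelian_group cls_additive])
qed

lemma single_zero: "single K \<zero> w = \<zero>\<^bsub>F\<^esub>"
  by (auto simp: single_def free_algebra_simps)

lemma sca_hom: "sca \<in> ring_hom K U"
proof (rule ring_hom_memI)
  show "sca \<one> = \<one>\<^bsub>U\<^esub>" using cls_one by (simp add: sca_eq free_algebra_simps)
  fix a b assume "a \<in> carrier K" "b \<in> carrier K"
  then show "sca (a \<otimes> b) = sca a \<otimes>\<^bsub>U\<^esub> sca b"
    using F_single_mult[of a b "[]" "[]"] by (simp add: sca_eq cls_mult[symmetric] F_single)
  show "sca (a \<oplus> b) = sca a \<oplus>\<^bsub>U\<^esub> sca b"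
  proof -
    have "single K (a \<oplus> b) [] = single K a [] \<oplus>\<^bsub>F\<^esub> single K b []"
      by (auto simp: single_def free_algebra_simps)
    then show ?thesis using \<open>a \<in> carrier K\<close> \<open>b \<in> carrier K\<close> by (simp add: sca_eq F_single cls_add)
  qed
qed auto

lemma sca_zero: "sca \<zero> = \<zero>\<^bsub>U\<^esub>"
  using additive_map_zero[OF F.is_abelian_group U.is_abelian_group cls_additive]
  by (simp add: sca_eq single_zero)

lemma inc_sca_commute:
  assumes "a \<in> carrier K" "x \<in> carrier L"
  shows "sca a \<otimes>\<^bsub>U\<^esub> inc x = inc x \<otimes>\<^bsub>U\<^esub> sca a"
  using assms F_single_mult[of a \<one> "[]" "[x]"] F_single_mult[of \<one> a "[x]" "[]"]
  by (simp add: sca_eq inc_eq cls_mult[symmetric] F_single)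

text \<open>Scalars and L generate U(L) as a ring, since every class of a monomial is a scalar
  multiplied from the left by letters.\<close>

lemma env_induct [consumes 1, case_names scalar incl add mult]:
  assumes u: "u \<in> carrier U"
    and sca: "\<And>a. a \<in> carrier K \<Longrightarrow> P (sca a)"
    and inc: "\<And>x. x \<in> carrier L \<Longrightarrow> P (inc x)"
    and add: "\<And>u v. \<lbrakk>u \<in> carrier U; v \<in> carrier U; P u; P v\<rbrakk> \<Longrightarrow> P (u \<oplus>\<^bsub>U\<^esub> v)"
    and mult: "\<And>u v. \<lbrakk>u \<in> carrier U; v \<in> carrier U; P u; P v\<rbrakk> \<Longrightarrow> P (u \<otimes>\<^bsub>U\<^esub> v)"
  shows "P u"
proof -
  have mono: "P (cls (single K a w))" if "a \<in> carrier K" "w \<in> lists (carrier L)" for a w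
    using that(2)
  proof (induction w)
    case Nil
    then show ?case using sca[OF that(1)] by (simp add: sca_eq)
  next
    case (Cons x w)
    then show ?case using that(1) inc mult[of "inc x" "cls (single K a w)"]
      by (simp add: cls_monomial_Cons F_single)
  qed
  obtain f where f: "f \<in> carrier F" "u = cls f" using cls_surj[OF u] .
  have "P (cls f)" using f(1)
  proof (induction rule: F_induct)
    case 1
    show ?case using sca[of \<zero>] by (simp add: sca_eq single_zero)
  qed (use mono add in \<open>auto simp: cls_add\<close>)
  then show ?thesis using f by simp
qed

lemma sca_central: "\<lbrakk>a \<in> carrier K; u \<in> carrier U\<rbrakk> \<Longrightarrow> sca a \<otimes>\<^bsub>U\<^esub> u = u \<otimes>\<^bsub>U\<^esub> sca a"
proof -
  assume a: "a \<in> carrier K" and u: "u \<in> carrier U"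
  show ?thesis using u
  proof (induction rule: env_induct)
    case (scalar b)
    then show ?case using a ring_hom_mult[OF sca_hom, symmetric] by (simp add: m_comm)
  next
    case (incl x)
    then show ?case using inc_sca_commute a by simp
  next
    case (add u v)
    then show ?case using a by (simp add: U.l_distr U.r_distr)
  next
    case (mult u v)
    have "sca a \<otimes>\<^bsub>U\<^esub> (u \<otimes>\<^bsub>U\<^esub> v) = (u \<otimes>\<^bsub>U\<^esub> sca a) \<otimes>\<^bsub>U\<^esub> v"
      using mult a U.m_assoc[of "sca a" u v] by simp
    also have "\<dots> = u \<otimes>\<^bsub>U\<^esub> (v \<otimes>\<^bsub>U\<^esub> sca a)" using mult a U.m_assoc[of u "sca a" v] by simp
    also have "\<dots> = (u \<otimes>\<^bsub>U\<^esub> v) \<otimes>\<^bsub>U\<^esub> sca a" using mult a by (simp add: U.m_assoc)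
    finally show ?case .
  qed
qed

lemma env_hom_unique:
  assumes A: "ring A" and h: "h \<in> ring_hom U A" and h': "h' \<in> ring_hom U A"
    and "\<And>a. a \<in> carrier K \<Longrightarrow> h (sca a) = h' (sca a)"
    and "\<And>x. x \<in> carrier L \<Longrightarrow> h (inc x) = h' (inc x)"
    and u: "u \<in> carrier U"
  shows "h u = h' u"
  using u
  by (induction rule: env_induct)
    (use assms(4,5) ring_hom_add[OF h] ring_hom_add[OF h'] ring_hom_mult[OF h] ring_hom_mult[OF h'] in auto)

text \<open>The linear extension of products of letters is multiplicative on the free algebra and
  kills the relations, so it descends. A may be noncommutative; \<open>comm\<close> is what allows
  scalars to be moved past products of letters.\<close>

lemma env_universal:
  assumes A: "ring A" and s: "s \<in> ring_hom K A" and \<phi>: "\<And>x. x \<in> carrier L \<Longrightarrow> \<phi> x \<in> carrier A"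
    and comm: "\<And>a x. \<lbrakk>a \<in> carrier K; x \<in> carrier L\<rbrakk> \<Longrightarrow> s a \<otimes>\<^bsub>A\<^esub> \<phi> x = \<phi> x \<otimes>\<^bsub>A\<^esub> s a"
    and add: "\<And>x y. \<lbrakk>x \<in> carrier L; y \<in> carrier L\<rbrakk> \<Longrightarrow> \<phi> (x \<oplus>\<^bsub>L\<^esub> y) = \<phi> x \<oplus>\<^bsub>A\<^esub> \<phi> y"
    and smult: "\<And>a x. \<lbrakk>a \<in> carrier K; x \<in> carrier L\<rbrakk> \<Longrightarrow> \<phi> (a \<odot>\<^bsub>L\<^esub> x) = s a \<otimes>\<^bsub>A\<^esub> \<phi> x"
    and brk: "\<And>x y. \<lbrakk>x \<in> carrier L; y \<in> carrier L\<rbrakk> \<Longrightarrow>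
      \<phi> (bracket L x y) = \<phi> x \<otimes>\<^bsub>A\<^esub> \<phi> y \<ominus>\<^bsub>A\<^esub> \<phi> y \<otimes>\<^bsub>A\<^esub> \<phi> x"
  obtains h where "h \<in> ring_hom U A" "\<And>a. a \<in> carrier K \<Longrightarrow> h (sca a) = s a"
    "\<And>x. x \<in> carrier L \<Longrightarrow> h (inc x) = \<phi> x"
proof -
  interpret A: ring A by fact
  note sc [simp] = ring_hom_closed[OF s]
  note [simp] = \<phi>
  \<comment> \<open>A as a K-module through s, so that the extension to the free algebra is an
    instance of \<open>lsum\<close>.\<close>
  define M where "M = \<lparr>carrier = carrier A, mult = mult A, one = one A, zero = zero A, add = add A,
     smult = (\<lambda>a x. s a \<otimes>\<^bsub>A\<^esub> x)\<rparr>"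
  have Msimps [simp]: "carrier M = carrier A" "zero M = zero A" "add M = add A" "a \<odot>\<^bsub>M\<^esub> x = s a \<otimes>\<^bsub>A\<^esub> x" for a x
    by (auto simp: M_def)
  have Mab: "abelian_group M"
  proof (rule abelian_groupI)
    fix x assume "x \<in> carrier M"
    then show "\<exists>y\<in>carrier M. y \<oplus>\<^bsub>M\<^esub> x = \<zero>\<^bsub>M\<^esub>" by (auto intro!: bexI[of _ "\<ominus>\<^bsub>A\<^esub> x"] simp: A.l_neg)
  qed (auto simp: A.a_ac)
  have M: "right_module K M"
  proof (intro right_module.intro right_module_axioms.intro K_ring Mab)
    fix r t x assume *: "r \<in> carrier K" "t \<in> carrier K" "x \<in> carrier M"
    have "r \<otimes> t = t \<otimes> r" using * m_comm by simp
    then show "r \<otimes> t \<odot>\<^bsub>M\<^esub> x = t \<odot>\<^bsub>M\<^esub> (r \<odot>\<^bsub>M\<^esub> x)"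
      using * by (simp add: ring_hom_mult[OF s] A.m_assoc)
  qed (auto simp: ring_hom_add[OF s] ring_hom_one[OF s] A.l_distr A.r_distr)
  define pr where "pr w = foldr (\<lambda>x u. \<phi> x \<otimes>\<^bsub>A\<^esub> u) w \<one>\<^bsub>A\<^esub>" for w
  have pr_closed [simp]: "pr w \<in> carrier A" if "w \<in> lists (carrier L)" for w
    using that by (induction w) (auto simp: pr_def)
  have pr_append: "pr (v @ w) = pr v \<otimes>\<^bsub>A\<^esub> pr w" if "v \<in> lists (carrier L)" "w \<in> lists (carrier L)" for v w
    using that(1)
  proof (induction v)
    case Nil
    then show ?case using that(2) pr_closed[OF that(2)] by (simp add: pr_def)
  next
    case (Cons x v)
    then show ?case using that(2) pr_closed[of v] pr_closed[of w] A.m_assoc[of "\<phi> x" "pr v" "pr w"]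
      by (simp add: pr_def)
  qed
  have pr_comm: "s a \<otimes>\<^bsub>A\<^esub> pr w = pr w \<otimes>\<^bsub>A\<^esub> s a" if a: "a \<in> carrier K" and w: "w \<in> lists (carrier L)" for a w
    using w
  proof (induction w)
    case Nil
    then show ?case using a by (simp add: pr_def)
  next
    case (Cons x w)
    have "s a \<otimes>\<^bsub>A\<^esub> pr (x # w) = (s a \<otimes>\<^bsub>A\<^esub> \<phi> x) \<otimes>\<^bsub>A\<^esub> pr w"
      using Cons a pr_closed[of w] by (simp add: pr_def A.m_assoc)
    also have "\<dots> = \<phi> x \<otimes>\<^bsub>A\<^esub> (pr w \<otimes>\<^bsub>A\<^esub> s a)"
      using Cons a comm[of a x] pr_closed[of w] by (simp add: A.m_assoc)
    also have "\<dots> = pr (x # w) \<otimes>\<^bsub>A\<^esub> s a"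
      using Cons a pr_closed[of w] by (simp add: pr_def A.m_assoc)
    finally show ?case .
  qed
  define H where "H = lsum K M pr"
  have H: "H \<in> rmod_hom K (freemod K (lists (carrier L))) M"
    unfolding H_def by (rule lsum_hom[OF M]) auto
  have H_closed [simp]: "H f \<in> carrier A" if "f \<in> carrier F" for f
    using rmod_hom_closed[OF H] that by (simp add: free_algebra_simps)
  have H_add: "H (f \<oplus>\<^bsub>F\<^esub> g) = H f \<oplus>\<^bsub>A\<^esub> H g" if "f \<in> carrier F" "g \<in> carrier F" for f g
    using rmod_hom_add[OF H] that by (simp add: free_algebra_simps freemod_simps)
  have H_additive: "additive_map F A H" by (auto simp: additive_map_def H_add)
  note H_zero = additive_map_zero[OF F.is_abelian_group A.is_abelian_group H_additive]
  have H_single: "H (single K a w) = s a \<otimes>\<^bsub>A\<^esub> pr w" if "a \<in> carrier K" "w \<in> lists (carrier L)" for a w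
    unfolding H_def using lsum_single[OF M, of pr w a] that by simp
  have H_mult: "H (f \<otimes>\<^bsub>F\<^esub> g) = H f \<otimes>\<^bsub>A\<^esub> H g" if f: "f \<in> carrier F" and g: "g \<in> carrier F" for f g
    using f
  proof (induction rule: F_induct)
    case (2 a u)
    note au = this
    show ?case using g
    proof (induction rule: F_induct)
      case (2 b v)
      have "H (single K a u \<otimes>\<^bsub>F\<^esub> single K b v) = (s a \<otimes>\<^bsub>A\<^esub> s b) \<otimes>\<^bsub>A\<^esub> (pr u \<otimes>\<^bsub>A\<^esub> pr v)"
        using au 2 by (simp add: F_single_mult H_single ring_hom_mult[OF s] pr_append)
      also have "\<dots> = s a \<otimes>\<^bsub>A\<^esub> (s b \<otimes>\<^bsub>A\<^esub> pr u) \<otimes>\<^bsub>A\<^esub> pr v" using au 2 by (simp add: A.m_assoc)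
      also have "\<dots> = s a \<otimes>\<^bsub>A\<^esub> (pr u \<otimes>\<^bsub>A\<^esub> s b) \<otimes>\<^bsub>A\<^esub> pr v" using au 2 pr_comm by simp
      also have "\<dots> = (s a \<otimes>\<^bsub>A\<^esub> pr u) \<otimes>\<^bsub>A\<^esub> (s b \<otimes>\<^bsub>A\<^esub> pr v)" using au 2 by (simp add: A.m_assoc)
      finally show ?case using au 2 by (simp add: H_single)
    qed (use au in \<open>auto simp: H_zero F_single F.r_distr A.r_distr H_add\<close>)
  qed (use g in \<open>auto simp: H_zero F.l_distr A.l_distr H_add\<close>)
  have H_one: "H \<one>\<^bsub>F\<^esub> = \<one>\<^bsub>A\<^esub>"
    using H_single[of \<one> "[]"] by (simp add: free_algebra_simps(3) ring_hom_one[OF s] pr_def)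
  have "H \<in> ring_hom F A" by (rule ring_hom_memI) (auto simp: H_add H_mult H_one)
  then interpret H: ring_hom_ring F A H by (intro ring_hom_ringI2 F.ring_axioms A)
  have H_inc: "H (single K \<one> [x]) = \<phi> x" if "x \<in> carrier L" for x
    using that H_single[of \<one> "[x]"] by (simp add: pr_def ring_hom_one[OF s])
  note H_diff = additive_map_diff[OF F.is_abelian_group A.is_abelian_group H_additive]
  have "env_relations K L \<subseteq> a_kernel F A H"
  proof
    fix f assume f: "f \<in> env_relations K L"
    then have fc: "f \<in> carrier F" using env_relations_closed by auto
    from f consider x y where "x \<in> carrier L" "y \<in> carrier L"
        "f = single K \<one> [x \<oplus>\<^bsub>L\<^esub> y] \<ominus>\<^bsub>F\<^esub> (single K \<one> [x] \<oplus>\<^bsub>F\<^esub> single K \<one> [y])"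
      | a x where "a \<in> carrier K" "x \<in> carrier L"
        "f = single K \<one> [a \<odot>\<^bsub>L\<^esub> x] \<ominus>\<^bsub>F\<^esub> single K a [x]"
      | x y where "x \<in> carrier L" "y \<in> carrier L"
        "f = single K \<one> [bracket L x y] \<ominus>\<^bsub>F\<^esub> (single K \<one> [x] \<otimes>\<^bsub>F\<^esub> single K \<one> [y]
           \<ominus>\<^bsub>F\<^esub> single K \<one> [y] \<otimes>\<^bsub>F\<^esub> single K \<one> [x])"
      by (auto simp: env_relations_def Let_def monomial_eq_single)
    then have "H f = \<zero>\<^bsub>A\<^esub>"
    proof cases
      case 1
      then show ?thesis
        by (simp add: H_diff H_add H_inc F_single L_add add a_minus_def A.r_neg)
    next
      case 2
      then show ?thesis
        using H_single[of a "[x]"]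
        by (simp add: H_diff H_inc F_single L_smult smult pr_def) (simp add: a_minus_def A.r_neg)
    next
      case 3
      then show ?thesis
        by (simp add: H_diff H_mult H_inc F_single L_bracket brk F.minus_closed)
          (simp add: a_minus_def A.r_neg)
    qed
    then show "f \<in> a_kernel F A H" unfolding a_kernel_def' using fc by blast
  qed
  then have ker: "env_ideal K L \<subseteq> a_kernel F A H"
    unfolding env_ideal_def using H.kernel_is_ideal by (intro F.genideal_minimal) auto
  have H_wd: "H f = H g" if "f \<in> carrier F" "g \<in> carrier F" "cls f = cls g" for f g
  proof -
    have "f \<ominus>\<^bsub>F\<^esub> g \<in> a_kernel F A H" using that ker by (auto simp: cls_eq_iff)
    then have "H (f \<ominus>\<^bsub>F\<^esub> g) = \<zero>\<^bsub>A\<^esub>" unfolding a_kernel_def' by blast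
    then have "H f \<ominus>\<^bsub>A\<^esub> H g = \<zero>\<^bsub>A\<^esub>" using that H_diff by simp
    then show ?thesis using that A.diff_zero_imp_eq[of "H f" "H g"] by simp
  qed
  \<comment> \<open>A representative is picked for every class; by \<open>H_wd\<close> its choice
    does not affect the value.\<close>
  define h where "h u = H (inv_into (carrier F) cls u)" for u
  have h_cls: "h (cls f) = H f" if "f \<in> carrier F" for f
    unfolding h_def
    by (rule H_wd) (use that inv_into_into[of "cls f" cls "carrier F"] f_inv_into_f[of "cls f" cls "carrier F"] in auto)
  show thesis
  proof (rule that[of h])
    show "h \<in> ring_hom U A"
    proof (rule ring_hom_memI)
      fix u v assume "u \<in> carrier U" "v \<in> carrier U"
      then obtain f g where fg: "f \<in> carrier F" "g \<in> carrier F" "u = cls f" "v = cls g"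
        using cls_surj by metis
      show "h u \<in> carrier A" using fg by (simp add: h_cls)
      show "h (u \<otimes>\<^bsub>U\<^esub> v) = h u \<otimes>\<^bsub>A\<^esub> h v"
        using fg cls_mult[of f g, symmetric] by (simp add: h_cls H_mult)
      show "h (u \<oplus>\<^bsub>U\<^esub> v) = h u \<oplus>\<^bsub>A\<^esub> h v"
        using fg cls_add[of f g, symmetric] by (simp add: h_cls H_add)
    qed (use h_cls[of "\<one>\<^bsub>F\<^esub>"] in \<open>simp_all add: cls_one H_one\<close>)
    show "h (sca a) = s a" if "a \<in> carrier K" for a
      using that h_cls[of "single K a []"] H_single[of a "[]"] by (simp add: sca_eq F_single pr_def)
    show "h (inc x) = \<phi> x" if "x \<in> carrier L" for x
      using that h_cls[of "single K \<one> [x]"] H_inc by (simp add: inc_eq F_single)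
  qed
qed


text \<open>The empty word splits only into two empty words, so the constant coefficient is
  multiplicative.\<close>

lemma coeff_Nil_hom: "(\<lambda>f. f []) \<in> ring_hom F K"
proof (rule ring_hom_memI)
  fix f g assume "f \<in> carrier F" "g \<in> carrier F"
  then have c: "f [] \<in> carrier K" "g [] \<in> carrier K"
    unfolding free_algebra_simps by (auto intro: freemodD(1))
  show "f [] \<in> carrier K" by (rule c(1))
  show "(f \<otimes>\<^bsub>F\<^esub> g) [] = f [] \<otimes> g []" using c by (simp add: free_algebra_simps)
qed (simp_all add: free_algebra_simps single_def)

text \<open>The kernel of the constant coefficient is an ideal, and it contains the relations, which
  have no constant term.\<close>

lemma env_ideal_coeff_Nil:
  assumes "f \<in> env_ideal K L"
  shows "f [] = \<zero>"
proof -
  interpret h: ring_hom_ring F K "\<lambda>f. f []"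
    by (intro ring_hom_ringI2 F.ring_axioms K_ring coeff_Nil_hom)
  have zero: "(f \<ominus>\<^bsub>F\<^esub> g) [] = f [] \<ominus> g []" if "f \<in> carrier F" "g \<in> carrier F" for f g
    using additive_map_diff[OF F.is_abelian_group is_abelian_group _ that, of "\<lambda>f. f []"] h.hom_add
    by (auto simp: additive_map_def)
  have "env_relations K L \<subseteq> a_kernel F K (\<lambda>f. f [])"
  proof
    fix f assume f: "f \<in> env_relations K L"
    from f consider x y where "x \<in> carrier L" "y \<in> carrier L"
        "f = single K \<one> [x \<oplus>\<^bsub>L\<^esub> y] \<ominus>\<^bsub>F\<^esub> (single K \<one> [x] \<oplus>\<^bsub>F\<^esub> single K \<one> [y])"
      | a x where "a \<in> carrier K" "x \<in> carrier L"
        "f = single K \<one> [a \<odot>\<^bsub>L\<^esub> x] \<ominus>\<^bsub>F\<^esub> single K a [x]"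
      | x y where "x \<in> carrier L" "y \<in> carrier L"
        "f = single K \<one> [bracket L x y] \<ominus>\<^bsub>F\<^esub> (single K \<one> [x] \<otimes>\<^bsub>F\<^esub> single K \<one> [y]
           \<ominus>\<^bsub>F\<^esub> single K \<one> [y] \<otimes>\<^bsub>F\<^esub> single K \<one> [x])"
      by (auto simp: env_relations_def Let_def monomial_eq_single)
    then have "f [] = \<zero>"
    proof cases
      case 1
      then show ?thesis by (simp add: zero F_single L_add) (simp add: single_def free_algebra_simps a_minus_def)
    next
      case 2
      then show ?thesis by (simp add: zero F_single L_smult) (simp add: single_def a_minus_def)
    next
      case 3
      then show ?thesis
        by (simp add: zero F_single L_bracket F_single_mult F.minus_closed) (simp add: single_def a_minus_def)
    qed
    then show "f \<in> a_kernel F K (\<lambda>f. f [])"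
      unfolding a_kernel_def' using f env_relations_closed by blast
  qed
  then have "env_ideal K L \<subseteq> a_kernel F K (\<lambda>f. f [])"
    unfolding env_ideal_def using h.kernel_is_ideal by (intro F.genideal_minimal) auto
  then show ?thesis using assms unfolding a_kernel_def' by blast
qed

lemma augmentation_cls:
  assumes f: "f \<in> carrier F"
  shows "env_augmentation (cls f) = f []"
proof -
  have "g [] = f []" if g: "g \<in> cls f" for g
  proof -
    have g': "g \<in> carrier F" "cls g = cls f" using cls_eqI[OF f g] by auto
    then have "(g \<ominus>\<^bsub>F\<^esub> f) [] = \<zero>" using env_ideal_coeff_Nil f by (simp add: cls_eq_iff)
    moreover have "(g \<ominus>\<^bsub>F\<^esub> f) [] = g [] \<ominus> f []"
      using additive_map_diff[OF F.is_abelian_group is_abelian_group _ g'(1) f, of "\<lambda>f. f []"]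
        ring_hom_add[OF coeff_Nil_hom] ring_hom_closed[OF coeff_Nil_hom] by (auto simp: additive_map_def)
    ultimately show ?thesis
      using ring_hom_closed[OF coeff_Nil_hom g'(1)] ring_hom_closed[OF coeff_Nil_hom f]
        diff_zero_imp_eq[of "g []" "f []"] by simp
  qed
  then have "(\<lambda>g. g []) ` cls f = (\<lambda>g. f []) ` cls f" by (intro image_cong) simp_all
  also have "\<dots> = {f []}" using cls_self[OF f] by auto
  finally have "(\<lambda>g. g []) ` cls f = {f []}" .
  then show ?thesis by (simp add: env_augmentation_def)
qed

lemma augmentation_hom: "env_augmentation \<in> ring_hom U K"
proof (rule ring_hom_memI)
  fix u v assume "u \<in> carrier U" "v \<in> carrier U"
  then obtain f g where fg: "f \<in> carrier F" "g \<in> carrier F" "u = cls f" "v = cls g"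
    using cls_surj by metis
  show "env_augmentation u \<in> carrier K"
    using fg ring_hom_closed[OF coeff_Nil_hom] by (simp add: augmentation_cls)
  show "env_augmentation (u \<otimes>\<^bsub>U\<^esub> v) = env_augmentation u \<otimes> env_augmentation v"
    using fg ring_hom_mult[OF coeff_Nil_hom, of f g] cls_mult[of f g, symmetric]
    by (simp add: augmentation_cls)
  show "env_augmentation (u \<oplus>\<^bsub>U\<^esub> v) = env_augmentation u \<oplus> env_augmentation v"
    using fg ring_hom_add[OF coeff_Nil_hom, of f g] cls_add[of f g, symmetric]
    by (simp add: augmentation_cls)
qed (simp add: cls_one[symmetric] augmentation_cls ring_hom_one[OF coeff_Nil_hom])

lemma augmentation_inc: "x \<in> carrier L \<Longrightarrow> env_augmentation (inc x) = \<zero>"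
  and augmentation_sca: "a \<in> carrier K \<Longrightarrow> env_augmentation (sca a) = a"
  by (simp_all add: inc_eq sca_eq augmentation_cls F_single) (simp_all add: single_def)

lemma trivial_module_simps:
  "carrier (trivial_module K) = carrier K" "zero (trivial_module K) = \<zero>"
  "add (trivial_module K) = add K" "u \<odot>\<^bsub>trivial_module K\<^esub> a = a \<otimes> env_augmentation u"
  by (simp_all add: trivial_module_def)

lemma trivial_right_module: "right_module U (trivial_module K)"
proof (intro right_module.intro right_module_axioms.intro U.ring_axioms)
  note [simp] = trivial_module_simps ring_hom_closed[OF augmentation_hom]
  show "abelian_group (trivial_module K :: (('l list \<Rightarrow> 'k) set, 'k) module)"
  proof (rule abelian_groupI)
    fix x assume "x \<in> carrier (trivial_module K :: (('l list \<Rightarrow> 'k) set, 'k) module)"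
    then show "\<exists>y\<in>carrier (trivial_module K :: (('l list \<Rightarrow> 'k) set, 'k) module).
        y \<oplus>\<^bsub>(trivial_module K :: (('l list \<Rightarrow> 'k) set, 'k) module)\<^esub> x =
        \<zero>\<^bsub>(trivial_module K :: (('l list \<Rightarrow> 'k) set, 'k) module)\<^esub>"
      by (auto intro!: bexI[of _ "\<ominus> x"] simp: l_neg)
  qed (auto simp: a_ac)
qed (auto simp: trivial_module_simps ring_hom_closed[OF augmentation_hom] ring_hom_add[OF augmentation_hom]
    ring_hom_mult[OF augmentation_hom] ring_hom_one[OF augmentation_hom] l_distr r_distr m_assoc)

end

section \<open>Functoriality of the enveloping algebra\<close>

lemma push_forward_eq_lsum:
  fixes K (structure)
  assumes K: "ring K" and f: "f \<in> carrier (freemod K (lists X))" and \<phi>: "\<And>x. x \<in> X \<Longrightarrow> \<phi> x \<in> X'"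
  shows "(\<lambda>w. \<Oplus>v\<in>{v. f v \<noteq> \<zero> \<and> map \<phi> v = w}. f v) =
    lsum K (freemod K (lists X')) (\<lambda>v. single K \<one> (map \<phi> v)) f" (is "?l = ?r")
proof
  fix w
  interpret ring K by fact
  let ?M = "freemod K (lists X')"
  interpret M: right_module K ?M by (rule freemod_right_module[OF K])
  have ev: "additive_map ?M K (\<lambda>g. g w)"
    by (rule additive_mapI) (auto simp: freemod_simps freemodD(1))
  have sup: "v \<in> lists X" if "f v \<noteq> \<zero>" for v using freemodD(3)[OF f that] .
  have sc: "single K \<one> (map \<phi> v) \<in> carrier ?M" if "f v \<noteq> \<zero>" for v
    using sup[OF that] \<phi> by (intro single_closed[OF K]) auto
  have "?r w = (\<Oplus>v\<in>{v. f v \<noteq> \<zero>}. (f v \<odot>\<^bsub>?M\<^esub> single K \<one> (map \<phi> v)) w)"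
    unfolding lsum_def
    by (rule additive_map_finsum[OF M.abelian_group_M is_abelian_group ev])
      (use sc freemodD(1)[OF f] in auto)
  also have "\<dots> = ?l w"
    by (rule add.finprod_mono_neutral_cong_left[symmetric])
      (use freemodD(1,2)[OF f] in \<open>auto simp: freemod_simps single_def\<close>)
  finally show "?l w = ?r w" by simp
qed

locale env_morphism = A: env_setup K L + B: env_setup K L'
  for K :: "('k, 'b) ring_scheme" (structure) and L :: "('k, 'l, 'm) lie_scheme"
    and L' :: "('k, 'l2, 'm2) lie_scheme" +
  fixes \<phi> :: "'l \<Rightarrow> 'l2"
  assumes phi_closed: "x \<in> carrier L \<Longrightarrow> \<phi> x \<in> carrier L'"
    and phi_add: "\<lbrakk>x \<in> carrier L; y \<in> carrier L\<rbrakk> \<Longrightarrow> \<phi> (x \<oplus>\<^bsub>L\<^esub> y) = \<phi> x \<oplus>\<^bsub>L'\<^esub> \<phi> y"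
    and phi_smult: "\<lbrakk>a \<in> carrier K; x \<in> carrier L\<rbrakk> \<Longrightarrow> \<phi> (a \<odot>\<^bsub>L\<^esub> x) = a \<odot>\<^bsub>L'\<^esub> \<phi> x"
    and phi_bracket: "\<lbrakk>x \<in> carrier L; y \<in> carrier L\<rbrakk> \<Longrightarrow>
      \<phi> (bracket L x y) = bracket L' (\<phi> x) (\<phi> y)"
begin

text \<open>The universal property yields a homomorphism h with the right values on generators. The
  coefficient formula in \<open>env_map\<close> is a linear extension by
  \<open>push_forward_eq_lsum\<close> and agrees with h on monomials. Hence every representative of
  u contributes the same class h u, and the union in \<open>env_map\<close> is that class.\<close>

lemma env_map_properties:
  shows env_map_hom: "env_map K L' \<phi> \<in> ring_hom (env K L) (env K L')"
    and env_map_scalar: "\<And>a. a \<in> carrier K \<Longrightarrow> env_map K L' \<phi> (env_scalar K L a) = env_scalar K L' a"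
    and env_map_incl: "\<And>x. x \<in> carrier L \<Longrightarrow> env_map K L' \<phi> (env_incl K L x) = env_incl K L' (\<phi> x)"
proof -
  obtain h where h: "h \<in> ring_hom A.U B.U" and hs: "\<And>a. a \<in> carrier K \<Longrightarrow> h (A.sca a) = B.sca a"
    and hi: "\<And>x. x \<in> carrier L \<Longrightarrow> h (A.inc x) = B.inc (\<phi> x)"
  proof (rule A.env_universal[OF B.U.ring_axioms B.sca_hom, of "\<lambda>x. B.inc (\<phi> x)"])
    show "B.inc (\<phi> (x \<oplus>\<^bsub>L\<^esub> y)) = B.inc (\<phi> x) \<oplus>\<^bsub>B.U\<^esub> B.inc (\<phi> y)"
      if "x \<in> carrier L" "y \<in> carrier L" for x y
      using that by (simp add: phi_add phi_closed B.inc_add)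
    show "B.inc (\<phi> (bracket L x y)) =
        B.inc (\<phi> x) \<otimes>\<^bsub>B.U\<^esub> B.inc (\<phi> y) \<ominus>\<^bsub>B.U\<^esub> B.inc (\<phi> y) \<otimes>\<^bsub>B.U\<^esub> B.inc (\<phi> x)"
      if "x \<in> carrier L" "y \<in> carrier L" for x y
      using that by (simp add: phi_bracket phi_closed B.inc_bracket)
  qed (auto simp: phi_smult phi_closed B.inc_smult B.inc_sca_commute)
  let ?p = "\<lambda>f w. \<Oplus>v\<in>{v. f v \<noteq> \<zero> \<and> map \<phi> v = w}. f v"
  let ?X = "lists (carrier L)" and ?X' = "lists (carrier L')"
  let ?s = "\<lambda>v. single K \<one> (map \<phi> v)"
  have FR: "right_module K (freemod K ?X')" by (rule freemod_right_module[OF A.K_ring])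
  have s: "?s \<in> ?X \<rightarrow> carrier (freemod K ?X')"
    using phi_closed by (auto intro!: single_closed[OF A.K_ring])
  have p: "?p f = lsum K (freemod K ?X') ?s f" if "f \<in> carrier A.F" for f
    using that push_forward_eq_lsum[OF A.K_ring _ phi_closed] by (simp add: free_algebra_simps)
  note ls = lsum_hom[OF FR s]
  have cls_p: "B.cls (?p f) = h (A.cls f)" if f: "f \<in> carrier A.F" for f
    unfolding p[OF f]
  proof (rule freemod_hom_eqI[OF A.K_ring B.U.is_abelian_group _ _ _ f[unfolded free_algebra_simps]])
    have BF: "carrier B.F = carrier (freemod K ?X')" "add B.F = add (freemod K ?X')"
      and AF: "carrier A.F = carrier (freemod K ?X)" "add A.F = add (freemod K ?X)"
      by (simp_all add: free_algebra_def freemod_def)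
    show "additive_map (freemod K ?X) B.U (\<lambda>f. B.cls (lsum K (freemod K ?X') ?s f))"
      using rmod_hom_closed[OF ls] rmod_hom_add[OF ls] B.cls_add B.cls_closed
      by (intro additive_mapI) (simp_all add: BF)
    show "additive_map (freemod K ?X) B.U (\<lambda>f. h (A.cls f))"
      using ring_hom_closed[OF h] ring_hom_add[OF h] A.cls_add A.cls_closed
      by (intro additive_mapI) (simp_all add: AF)
    fix a w assume a: "a \<in> carrier K" and w: "w \<in> ?X"
    have "lsum K (freemod K ?X') ?s (single K a w) = single K a (map \<phi> w)"
      using lsum_single[of K "freemod K ?X'" ?s w a, OF FR funcset_mem[OF s w] a] a
      by (auto simp: freemod_simps single_def)
    moreover have "B.cls (single K a (map \<phi> w)) = h (A.cls (single K a w))" using w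
    proof (induction w)
      case Nil
      then show ?case using hs[OF a] by (simp add: A.sca_eq B.sca_eq)
    next
      case (Cons x w)
      have w': "map \<phi> w \<in> ?X'" using Cons phi_closed by auto
      show ?case
        using Cons a w' phi_closed hi[of x] ring_hom_mult[OF h, of "A.inc x" "A.cls (single K a w)"]
        by (simp add: A.cls_monomial_Cons B.cls_monomial_Cons A.F_single)
    qed
    ultimately show "B.cls (lsum K (freemod K ?X') ?s (single K a w)) = h (A.cls (single K a w))" by simp
  qed
  have eq: "env_map K L' \<phi> u = h u" if u: "u \<in> carrier A.U" for u
  proof -
    obtain f where f: "f \<in> carrier A.F" "u = A.cls f" using A.cls_surj[OF u] .
    have "B.cls (?p g) = h u" if "g \<in> u" for g
    proof -
      have "g \<in> carrier A.F \<and> A.cls g = A.cls f" using A.cls_eqI[OF f(1), of g] that f(2) by simp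
      then show ?thesis using cls_p[of g] f(2) by simp
    qed
    moreover have "f \<in> u" using f A.cls_self by simp
    ultimately show ?thesis unfolding env_map_def by auto
  qed
  show "env_map K L' \<phi> \<in> ring_hom A.U B.U"
    using ring_hom_closed[OF h] ring_hom_add[OF h] ring_hom_mult[OF h] ring_hom_one[OF h]
    by (intro ring_hom_memI) (simp_all add: eq)
  show "env_map K L' \<phi> (A.sca a) = B.sca a" if "a \<in> carrier K" for a using that by (simp add: eq hs)
  show "env_map K L' \<phi> (A.inc x) = B.inc (\<phi> x)" if "x \<in> carrier L" for x using that by (simp add: eq hi)
qed

lemma augmentation_env_map:
  assumes u: "u \<in> carrier (env K L)"
  shows "env_augmentation (env_map K L' \<phi> u) = env_augmentation u"
proof (rule A.env_hom_unique[OF A.K_ring _ A.augmentation_hom _ _ u])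
  show "(\<lambda>u. env_augmentation (env_map K L' \<phi> u)) \<in> ring_hom A.U K"
    using ring_hom_trans[OF env_map_hom B.augmentation_hom] by (simp add: comp_def)
qed (simp_all add: env_map_scalar env_map_incl A.augmentation_inc A.augmentation_sca B.augmentation_inc
    B.augmentation_sca phi_closed)

end

section \<open>Vector spaces\<close>

text \<open>Forgets the bracket, so that facts about the plain record type of modules apply to a Lie
  algebra.\<close>

definition vec :: "('k, 'l, 'm) module_scheme \<Rightarrow> ('k, 'l) module" where
  "vec L = \<lparr>carrier = carrier L, mult = mult L, one = one L, zero = zero L, add = add L, smult = smult L\<rparr>"

lemma vec_simps [simp]:
  "carrier (vec L) = carrier L" "zero (vec L) = zero L" "add (vec L) = add L" "smult (vec L) = smult L"
  by (simp_all add: vec_def)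

lemma vec_right_module:
  assumes "module K L"
  shows "right_module K (vec L)"
proof -
  interpret module K L by fact
  show ?thesis
  proof (intro right_module.intro right_module_axioms.intro R.ring_axioms abelian_groupI)
    fix x assume "x \<in> carrier (vec L)"
    then show "\<exists>y\<in>carrier (vec L). y \<oplus>\<^bsub>vec L\<^esub> x = \<zero>\<^bsub>vec L\<^esub>"
      by (auto intro!: bexI[of _ "\<ominus>\<^bsub>L\<^esub> x"] simp: M.l_neg)
  next
    fix r s x assume "r \<in> carrier K" "s \<in> carrier K" "x \<in> carrier (vec L)"
    then show "r \<otimes>\<^bsub>K\<^esub> s \<odot>\<^bsub>vec L\<^esub> x = s \<odot>\<^bsub>vec L\<^esub> (r \<odot>\<^bsub>vec L\<^esub> x)"
      using smult_assoc1[of s r x] R.m_comm by simp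
  qed (auto simp: M.a_assoc M.a_comm M.a_lcomm smult_l_distr smult_r_distr)
qed

definition lin_indep :: "('k, 'b) ring_scheme \<Rightarrow> ('k, 'v) module \<Rightarrow> 'v set \<Rightarrow> bool" where
  "lin_indep K V B \<longleftrightarrow> B \<subseteq> carrier V \<and>
     (\<forall>f\<in>carrier (freemod K B). lsum K V (\<lambda>v. v) f = \<zero>\<^bsub>V\<^esub> \<longrightarrow> f = (\<lambda>v. \<zero>\<^bsub>K\<^esub>))"

text \<open>Zorn's lemma: a linear relation over the union of a chain involves finitely many vectors
  and thus lives in one member. The extension form is what enlarges a basis of the ideal N to one of
  L.\<close>

lemma basis_extension:
  fixes K (structure)
  assumes K: "field K" and V: "right_module K V" and A: "lin_indep K V A"
  obtains B where "A \<subseteq> B" "lin_indep K V B" "lsum K V (\<lambda>v. v) ` carrier (freemod K B) = carrier V"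
proof -
  interpret K: field K by fact
  interpret V: right_module K V by fact
  define \<A> where "\<A> = {B. A \<subseteq> B \<and> lin_indep K V B}"
  have "\<exists>M\<in>\<A>. \<forall>X\<in>\<A>. M \<subseteq> X \<longrightarrow> X = M"
  proof (rule subset_Zorn_nonempty)
    show "\<A> \<noteq> {}" using A by (auto simp: \<A>_def)
    fix \<C> assume ne: "\<C> \<noteq> {}" and ch: "subset.chain \<A> \<C>"
    have sub: "C \<in> \<A>" if "C \<in> \<C>" for C using ch that by (auto simp: subset.chain_def)
    have "f = (\<lambda>v. \<zero>)" if f: "f \<in> carrier (freemod K (\<Union>\<C>))" and z: "lsum K V (\<lambda>v. v) f = \<zero>\<^bsub>V\<^esub>" for f
    proof -
      have "finite {v. f v \<noteq> \<zero>}" "{v. f v \<noteq> \<zero>} \<subseteq> \<Union>\<C>" using freemodD(2,3)[OF f] by auto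
      then obtain C where C: "C \<in> \<C>" "{v. f v \<noteq> \<zero>} \<subseteq> C"
        using finite_subset_Union_chain[OF _ _ ne ch] by metis
      have "f \<in> carrier (freemod K C)"
        by (rule freemodI) (use C freemodD(1,2)[OF f] in auto)
      then show ?thesis using sub[OF C(1)] z by (auto simp: \<A>_def lin_indep_def)
    qed
    moreover have "A \<subseteq> C \<and> C \<subseteq> carrier V" if "C \<in> \<C>" for C
      using sub[OF that] by (auto simp: \<A>_def lin_indep_def)
    then have "A \<subseteq> \<Union>\<C>" "\<Union>\<C> \<subseteq> carrier V" using ne by blast+
    ultimately show "\<Union>\<C> \<in> \<A>" by (auto simp: \<A>_def lin_indep_def)
  qed
  then obtain B where B: "A \<subseteq> B" "lin_indep K V B" and max: "\<And>X. \<lbrakk>A \<subseteq> X; lin_indep K V X; B \<subseteq> X\<rbrakk> \<Longrightarrow> X = B"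
    by (auto simp: \<A>_def)
  have Bc: "B \<subseteq> carrier V" using B by (simp add: lin_indep_def)
  then have Bf: "(\<lambda>v. v) \<in> B \<rightarrow> carrier V" by auto
  note ls = lsum_hom[OF V Bf]
  have "v \<in> lsum K V (\<lambda>v. v) ` carrier (freemod K B)" if v: "v \<in> carrier V" for v
  proof (rule ccontr)
    assume nv: "v \<notin> lsum K V (\<lambda>v. v) ` carrier (freemod K B)"
    have vB: "v \<notin> B"
    proof
      assume b: "v \<in> B"
      have "lsum K V (\<lambda>v. v) (single K \<one> v) = v"
        using lsum_single[OF V, of "\<lambda>v. v" v \<one>] v by (simp add: V.unit)
      then show False using nv single_closed[OF K.ring_axioms K.one_closed b] by (metis imageI)
    qed
    have insf: "(\<lambda>v. v) \<in> insert v B \<rightarrow> carrier V" using Bc v by auto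
    note ls' = lsum_hom[OF V insf]
    have "lin_indep K V (insert v B)"
      unfolding lin_indep_def
    proof (intro conjI ballI impI)
      show "insert v B \<subseteq> carrier V" using Bc v by auto
      fix f assume f: "f \<in> carrier (freemod K (insert v B))" and z: "lsum K V (\<lambda>v. v) f = \<zero>\<^bsub>V\<^esub>"
      have fc: "f i \<in> carrier K" for i using freemodD(1)[OF f] .
      define g where "g = f(v := \<zero>)"
      have g: "g \<in> carrier (freemod K B)"
      proof (rule freemodI)
        show "finite {i. g i \<noteq> \<zero>}"
          by (rule finite_subset[OF _ freemodD(2)[OF f]]) (auto simp: g_def)
      qed (use fc freemodD(4)[OF f] in \<open>auto simp: g_def\<close>)
      have g': "g \<in> carrier (freemod K (insert v B))" using g freemod_mono[OF K.ring_axioms, of B "insert v B"] by auto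
      have s: "single K (f v) v \<in> carrier (freemod K (insert v B))"
        using fc by (intro single_closed[OF K.ring_axioms]) auto
      have "f = single K (f v) v \<oplus>\<^bsub>freemod K (insert v B)\<^esub> g"
        using fc by (auto simp: g_def single_def freemod_simps)
      then have eq: "f v \<odot>\<^bsub>V\<^esub> v \<oplus>\<^bsub>V\<^esub> lsum K V (\<lambda>v. v) g = \<zero>\<^bsub>V\<^esub>"
        using z rmod_hom_add[OF ls' s g'] lsum_single[OF V, of "\<lambda>v. v" v "f v"] fc v by simp
      have lg: "lsum K V (\<lambda>v. v) g \<in> carrier V" using rmod_hom_closed[OF ls g] .
      \<comment> \<open>A relation with a nonzero coefficient at v could be solved for v, which is
        outside the span of B.\<close>
      have "f v = \<zero>"
      proof (rule ccontr)
        assume nz: "f v \<noteq> \<zero>"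
        then have u: "f v \<in> Units K" using fc K.field_Units by auto
        have ic: "inv (f v) \<in> carrier K" using u by simp
        have "v = inv (f v) \<odot>\<^bsub>V\<^esub> (f v \<odot>\<^bsub>V\<^esub> v)"
          using V.right_assoc[OF fc ic v, of v, symmetric] u v by (simp add: V.unit)
        moreover have "f v \<odot>\<^bsub>V\<^esub> v = \<ominus>\<^bsub>V\<^esub> lsum K V (\<lambda>v. v) g"
          using eq lg fc v by (metis V.M.minus_equality V.closed)
        moreover have "\<ominus>\<^bsub>V\<^esub> lsum K V (\<lambda>v. v) g = (\<ominus> \<one>) \<odot>\<^bsub>V\<^esub> lsum K V (\<lambda>v. v) g"
          using V.smult_neg_one[OF lg] by simp
        ultimately have "v = lsum K V (\<lambda>v. v) (inv (f v) \<odot>\<^bsub>freemod K B\<^esub> ((\<ominus> \<one>) \<odot>\<^bsub>freemod K B\<^esub> g))"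
          using rmod_hom_smult[OF ls _ g, of "\<ominus> \<one>"] ic
            rmod_hom_smult[OF ls ic right_module.closed[OF freemod_right_module[OF K.ring_axioms] _ g], of "\<ominus> \<one>"]
          by simp
        moreover have "inv (f v) \<odot>\<^bsub>freemod K B\<^esub> ((\<ominus> \<one>) \<odot>\<^bsub>freemod K B\<^esub> g) \<in> carrier (freemod K B)"
          by (intro right_module.closed[OF freemod_right_module[OF K.ring_axioms]] ic g) simp
        ultimately show False using nv by (metis imageI)
      qed
      then have "lsum K V (\<lambda>v. v) g = \<zero>\<^bsub>V\<^esub>" "f = g" using eq lg v by (auto simp: g_def)
      then show "f = (\<lambda>v. \<zero>)" using B(2) g by (auto simp: lin_indep_def)
    qed
    then show False using max[of "insert v B"] B(1) vB by auto
  qed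
  then have "lsum K V (\<lambda>v. v) ` carrier (freemod K B) = carrier V"
    using rmod_hom_closed[OF ls] by auto
  then show thesis using that B by blast
qed

lemma rmod_hom_inverse:
  assumes M: "right_module R M" and h: "h \<in> rmod_hom R M M'" and b: "bij_betw h (carrier M) (carrier M')"
  shows "inv_into (carrier M) h \<in> rmod_hom R M' M"
proof -
  interpret M: right_module R M by fact
  let ?i = "inv_into (carrier M) h"
  have inj: "inj_on h (carrier M)" and im: "h ` carrier M = carrier M'" using b by (auto simp: bij_betw_def)
  have c: "?i x \<in> carrier M" "h (?i x) = x" if "x \<in> carrier M'" for x
    using that im inv_into_into[of x h "carrier M"] f_inv_into_f[of x h "carrier M"] by auto
  have eqI: "?i x = y" if "y \<in> carrier M" "h y = x" for x y using that inj by (metis inv_into_f_f)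
  show ?thesis
  proof (rule rmod_homI)
    show "?i x \<in> carrier M" if "x \<in> carrier M'" for x using c that by auto
    show "?i (x \<oplus>\<^bsub>M'\<^esub> y) = ?i x \<oplus>\<^bsub>M\<^esub> ?i y" if "x \<in> carrier M'" "y \<in> carrier M'" for x y
      by (rule eqI) (use that c rmod_hom_add[OF h] in auto)
    show "?i (r \<odot>\<^bsub>M'\<^esub> x) = r \<odot>\<^bsub>M\<^esub> ?i x" if "r \<in> carrier R" "x \<in> carrier M'" for r x
      by (rule eqI) (use that c rmod_hom_smult[OF h] in auto)
  qed
qed

lemma lsum_bij:
  assumes V: "right_module K V" and B: "lin_indep K V B"
    and span: "lsum K V (\<lambda>v. v) ` carrier (freemod K B) = carrier V"
  shows "bij_betw (lsum K V (\<lambda>v. v)) (carrier (freemod K B)) (carrier V)"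
proof -
  interpret V: right_module K V by fact
  interpret F: right_module K "freemod K B" by (rule freemod_right_module[OF V.ring_R])
  have "(\<lambda>v. v) \<in> B \<rightarrow> carrier V" using B by (auto simp: lin_indep_def)
  note ls = lsum_hom[OF V this]
  have "f = g" if f: "f \<in> carrier (freemod K B)" and g: "g \<in> carrier (freemod K B)"
    and eq: "lsum K V (\<lambda>v. v) f = lsum K V (\<lambda>v. v) g" for f g
  proof -
    have "lsum K V (\<lambda>v. v) (f \<ominus>\<^bsub>freemod K B\<^esub> g) = \<zero>\<^bsub>V\<^esub>"
      using rmod_hom_diff[OF F.right_module_axioms V ls f g] eq rmod_hom_closed[OF ls g]
      by (simp add: a_minus_def V.M.r_neg)
    then have "f \<ominus>\<^bsub>freemod K B\<^esub> g = \<zero>\<^bsub>freemod K B\<^esub>"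
      using B f g by (simp add: lin_indep_def freemod_simps)
    then show ?thesis using F.M.diff_zero_imp_eq f g by blast
  qed
  then show ?thesis using span by (auto simp: bij_betw_def inj_on_def)
qed

lemma freemod_rmod_hom_eqI:
  fixes R (structure)
  assumes M: "right_module R M" and f: "f \<in> rmod_hom R (freemod R X) M" and g: "g \<in> rmod_hom R (freemod R X) M"
    and eq: "\<And>i. i \<in> X \<Longrightarrow> f (single R \<one> i) = g (single R \<one> i)"
    and y: "y \<in> carrier (freemod R X)"
  shows "f y = g y"
proof -
  interpret M: right_module R M by fact
  show ?thesis
  proof (rule freemod_hom_eqI[OF M.ring_R M.abelian_group_M rmod_hom_additive[OF f] rmod_hom_additive[OF g] _ y])
    fix a i assume a: "a \<in> carrier R" and i: "i \<in> X"
    have *: "single R a i = a \<odot>\<^bsub>freemod R X\<^esub> single R \<one> i"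
      using a by (auto simp: freemod_simps single_def)
    show "f (single R a i) = g (single R a i)"
      unfolding * using rmod_hom_smult[OF f a single_closed[OF M.ring_R M.R.one_closed i]]
        rmod_hom_smult[OF g a single_closed[OF M.ring_R M.R.one_closed i]] eq[OF i] by simp
  qed
qed

lemma freemod_submodule:
  assumes R: "ring R" and XY: "X \<subseteq> Y"
  shows "submodule (carrier (freemod R X)) R (freemod R Y)"
proof -
  interpret Y: right_module R "freemod R Y" by (rule freemod_right_module[OF R])
  interpret X: right_module R "freemod R X" by (rule freemod_right_module[OF R])
  show ?thesis
  proof (rule Y.submoduleI)
    show "\<zero>\<^bsub>freemod R Y\<^esub> \<in> carrier (freemod R X)" using X.M.zero_closed by (simp add: freemod_simps)
    show "x \<oplus>\<^bsub>freemod R Y\<^esub> y \<in> carrier (freemod R X)"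
      if "x \<in> carrier (freemod R X)" "y \<in> carrier (freemod R X)" for x y
      using X.M.a_closed[OF that] by (simp add: freemod_simps)
    show "r \<odot>\<^bsub>freemod R Y\<^esub> x \<in> carrier (freemod R X)"
      if "r \<in> carrier R" "x \<in> carrier (freemod R X)" for r x
      using X.closed[OF that] by (simp add: freemod_simps)
  qed (use freemod_mono[OF R XY] in auto)
qed

lemma lsum_in_submodule:
  assumes V: "right_module K V" and S: "submodule S K V" and f: "f \<in> carrier (freemod K X)"
    and x: "\<And>i. i \<in> X \<Longrightarrow> x i \<in> S"
  shows "lsum K V x f \<in> S"
proof -
  interpret V: right_module K V by fact
  show ?thesis unfolding lsum_def
    by (rule V.submodule_finsum[OF S]) (use V.submoduleD(4)[OF S freemodD(1)[OF f] x] freemodD(3)[OF f] in auto)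
qed

lemma lsum_cong:
  assumes V: "right_module K V" and f: "f \<in> carrier (freemod K X)"
    and y: "\<And>i. i \<in> X \<Longrightarrow> y i \<in> carrier V" and eq: "\<And>i. i \<in> X \<Longrightarrow> x i = y i"
  shows "lsum K V x f = lsum K V y f"
proof -
  interpret V: right_module K V by fact
  show ?thesis unfolding lsum_def
    by (rule V.M.finsum_cong') (use V.closed[OF freemodD(1)[OF f] y] eq freemodD(3)[OF f] in auto)
qed

text \<open>The coordinates of the tensor product of c and s in the product basis.\<close>

definition tens :: "('k, 'b) ring_scheme \<Rightarrow> ('i \<Rightarrow> 'k) \<Rightarrow> ('j \<Rightarrow> 'k) \<Rightarrow> 'i \<times> 'j \<Rightarrow> 'k" where
  "tens K c s = (\<lambda>(b, w). c b \<otimes>\<^bsub>K\<^esub> s w)"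

lemma tens_closed:
  fixes K (structure)
  assumes K: "ring K" and c: "c \<in> carrier (freemod K X)" and s: "s \<in> carrier (freemod K Y)"
  shows "tens K c s \<in> carrier (freemod K (X \<times> Y))"
proof -
  interpret ring K by fact
  have z: "c b \<otimes> s w = \<zero>" if "c b = \<zero> \<or> s w = \<zero>" for b w
    using that freemodD(1)[OF c] freemodD(1)[OF s] by auto
  show ?thesis
  proof (rule freemodI)
    show "tens K c s p \<in> carrier K" for p
      using freemodD(1)[OF c] freemodD(1)[OF s] by (cases p) (simp add: tens_def)
    show "finite {p. tens K c s p \<noteq> \<zero>}"
    proof (rule finite_subset)
      show "{p. tens K c s p \<noteq> \<zero>} \<subseteq> {b. c b \<noteq> \<zero>} \<times> {w. s w \<noteq> \<zero>}"
        using z by (auto simp: tens_def)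
      show "finite ({b. c b \<noteq> \<zero>} \<times> {w. s w \<noteq> \<zero>})" using freemodD(2)[OF c] freemodD(2)[OF s] by simp
    qed
    show "tens K c s p = \<zero>" if "p \<notin> X \<times> Y" for p
      using that z freemodD(4)[OF c] freemodD(4)[OF s] by (cases p) (auto simp: tens_def)
  qed
qed

section \<open>The Poincare-Birkhoff-Witt theorem\<close>

sublocale lie_algebra \<subseteq> env_setup K L
  by unfold_locales (auto intro: bracket_closed)

context lie_algebra
begin

lemma L_module: "module K L" ..

lemma vec_rm: "right_module K (vec L)" by (rule vec_right_module[OF L_module])

lemma bracket_zero_left: "x \<in> carrier L \<Longrightarrow> bracket L \<zero>\<^bsub>L\<^esub> x = \<zero>\<^bsub>L\<^esub>"
  using additive_map_zero[of L L "\<lambda>y. bracket L y x"] L.M.abelian_group_axioms bracket_add_left bracket_closed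
  by (auto simp: additive_map_def)

lemma bracket_skew:
  assumes "x \<in> carrier L" "y \<in> carrier L"
  shows "bracket L x y = \<ominus>\<^bsub>L\<^esub> bracket L y x"
proof -
  have "\<zero>\<^bsub>L\<^esub> = bracket L (x \<oplus>\<^bsub>L\<^esub> y) (x \<oplus>\<^bsub>L\<^esub> y)" using assms by (simp add: alternating)
  also have "\<dots> = (bracket L x x \<oplus>\<^bsub>L\<^esub> bracket L x y) \<oplus>\<^bsub>L\<^esub> (bracket L y x \<oplus>\<^bsub>L\<^esub> bracket L y y)"
    using assms by (simp add: bracket_add_left bracket_add_right bracket_closed L.M.a_ac)
  also have "\<dots> = bracket L x y \<oplus>\<^bsub>L\<^esub> bracket L y x"
    using assms by (simp add: alternating bracket_closed)
  finally have "bracket L x y \<oplus>\<^bsub>L\<^esub> bracket L y x = \<zero>\<^bsub>L\<^esub>" ..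
  then show ?thesis using assms by (simp add: L.M.minus_equality bracket_closed)
qed

end

text \<open>In the symmetric algebra this would be the product of the letter b with the monomial M.
  It is the leading term of the action of b on sorted words.\<close>

primrec ins :: "('l \<Rightarrow> 'l \<Rightarrow> bool) \<Rightarrow> 'l \<Rightarrow> 'l list \<Rightarrow> 'l list" where
  "ins lq b [] = [b]"
| "ins lq b (j # M) = (if lq b j then b # j # M else j # ins lq b M)"

lemma length_ins [simp]: "length (ins lq b M) = Suc (length M)"
  by (induction M) auto

lemma set_ins [simp]: "set (ins lq b M) = insert b (set M)"
  by (induction M) auto

text \<open>B is a vector space basis of L with coordinate map \<open>co\<close>. The order
  \<open>lq\<close> is total on the whole type, so that a single order can serve the bases of L and
  of N.\<close>

locale lie_basis = lie_algebra K L
  for K :: "('k, 'b) ring_scheme" (structure) and L :: "('k, 'l, 'm) lie_scheme" +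
  fixes B :: "'l set" and co :: "'l \<Rightarrow> 'l \<Rightarrow> 'k" and lq :: "'l \<Rightarrow> 'l \<Rightarrow> bool"
  assumes B_sub: "B \<subseteq> carrier L"
    and co_hom: "co \<in> rmod_hom K (vec L) (freemod K B)"
    and co_basis: "b \<in> B \<Longrightarrow> co b = single K \<one> b"
    and co_sum: "x \<in> carrier L \<Longrightarrow> lsum K (vec L) (\<lambda>b. b) (co x) = x"
    and le_total: "lq x y \<or> lq y x"
    and le_trans: "\<lbrakk>lq x y; lq y z\<rbrakk> \<Longrightarrow> lq x z"
    and le_antisym: "\<lbrakk>lq x y; lq y x\<rbrakk> \<Longrightarrow> x = y"
begin

abbreviation srt :: "'l list \<Rightarrow> bool" where "srt \<equiv> sorted_wrt lq"

definition "Ws = {w \<in> lists B. srt w}"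
definition "W n = {w \<in> lists B. srt w \<and> length w \<le> n}"
text \<open>An ambient module indexed by all words; the spans \<open>S n\<close> of the sorted words
  of length at most n form a filtration inside it.\<close>

abbreviation "V \<equiv> freemod K (UNIV :: 'l list set)"
abbreviation "S n \<equiv> carrier (freemod K (W n))"
abbreviation "z w \<equiv> single K \<one> w"

lemma srt_ins: "srt w \<Longrightarrow> srt (ins lq b w)"
proof (induction w)
  case (Cons a w)
  show ?case
  proof (cases "lq b a")
    case True
    then show ?thesis using Cons.prems le_trans by auto
  next
    case False
    then have "lq a b" using le_total by blast
    then show ?thesis using False Cons by auto
  qed
qed simp

lemma W_mono: "m \<le> n \<Longrightarrow> W m \<subseteq> W n" by (auto simp: W_def)

lemma S_mono: "m \<le> n \<Longrightarrow> s \<in> S m \<Longrightarrow> s \<in> S n"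
  using freemod_mono[OF K_ring W_mono] by blast

lemma ins_W: "\<lbrakk>b \<in> B; w \<in> W n\<rbrakk> \<Longrightarrow> ins lq b w \<in> W (Suc n)"
  by (auto simp: W_def srt_ins)

lemma z_S: "w \<in> W n \<Longrightarrow> z w \<in> S n" by (rule single_closed[OF K_ring]) auto

lemma srt_Cons_le: "\<lbrakk>lq b j; srt (j # M)\<rbrakk> \<Longrightarrow> srt (b # j # M)"
  using le_trans by auto

sublocale V: right_module K V by (rule freemod_right_module[OF K_ring])

lemma V_closed: "s \<in> S n \<Longrightarrow> s \<in> carrier V"
  using freemod_mono[OF K_ring, of "W n" UNIV] by blast

lemma S_sub: "submodule (S n) K V" by (rule freemod_submodule[OF K_ring]) auto

lemmas S_zero = V.submoduleD(2)[OF S_sub] and S_add = V.submoduleD(3)[OF S_sub]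
  and S_smult = V.submoduleD(4)[OF S_sub] and S_neg = V.submoduleD(5)[OF S_sub]
  and S_diff = V.submoduleD(6)[OF S_sub]

text \<open>The bilinear extension of a table \<rho>, given on basis letters and words, to arbitrary
  elements l of L and combinations s of words.\<close>

definition ext :: "('l \<Rightarrow> 'l list \<Rightarrow> 'l list \<Rightarrow> 'k) \<Rightarrow> 'l \<Rightarrow> ('l list \<Rightarrow> 'k) \<Rightarrow> 'l list \<Rightarrow> 'k" where
  "ext \<rho> l s = lsum K V (\<lambda>(b, w). \<rho> b w) (tens K (co l) s)"

lemma co_closed: "l \<in> carrier L \<Longrightarrow> co l \<in> carrier (freemod K B)"
  using rmod_hom_closed[OF co_hom] by simp

lemma ext_in:
  assumes "\<And>b w. \<lbrakk>b \<in> B; w \<in> Y\<rbrakk> \<Longrightarrow> \<rho> b w \<in> carrier (freemod K Z)" "l \<in> carrier L"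
    "s \<in> carrier (freemod K Y)"
  shows "ext \<rho> l s \<in> carrier (freemod K Z)"
  unfolding ext_def
  by (rule lsum_in_submodule[OF V.right_module_axioms _ tens_closed[OF K_ring co_closed[OF assms(2)] assms(3)]])
    (use assms(1) freemod_submodule[OF K_ring, of Z UNIV] in auto)

lemma ext_cong:
  assumes "\<And>b w. \<lbrakk>b \<in> B; w \<in> Y\<rbrakk> \<Longrightarrow> \<rho> b w = \<rho>' b w" "\<And>b w. \<lbrakk>b \<in> B; w \<in> Y\<rbrakk> \<Longrightarrow> \<rho>' b w \<in> carrier V"
    "l \<in> carrier L" "s \<in> carrier (freemod K Y)"
  shows "ext \<rho> l s = ext \<rho>' l s"
  unfolding ext_def
  by (rule lsum_cong[OF V.right_module_axioms tens_closed[OF K_ring co_closed[OF assms(3)] assms(4)]])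
    (use assms(1,2) in auto)

lemma ext_hom_s:
  assumes "\<And>b w. \<lbrakk>b \<in> B; w \<in> Y\<rbrakk> \<Longrightarrow> \<rho> b w \<in> carrier V" "l \<in> carrier L"
  shows "ext \<rho> l \<in> rmod_hom K (freemod K Y) V"
proof -
  have h: "lsum K V (\<lambda>(b, w). \<rho> b w) \<in> rmod_hom K (freemod K (B \<times> Y)) V"
    by (rule lsum_hom[OF V.right_module_axioms]) (use assms(1) in auto)
  note c [simp] = freemodD(1)[OF co_closed[OF assms(2)]]
  note t = tens_closed[OF K_ring co_closed[OF assms(2)]]
  show ?thesis
  proof (rule rmod_homI)
    fix s t' assume st: "s \<in> carrier (freemod K Y)" "t' \<in> carrier (freemod K Y)"
    show "ext \<rho> l s \<in> carrier V" unfolding ext_def by (rule rmod_hom_closed[OF h t[OF st(1)]])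
    have "tens K (co l) (s \<oplus>\<^bsub>freemod K Y\<^esub> t') = tens K (co l) s \<oplus>\<^bsub>freemod K (B \<times> Y)\<^esub> tens K (co l) t'"
      using freemodD(1)[OF st(1)] freemodD(1)[OF st(2)]
      by (auto simp: tens_def freemod_simps r_distr)
    then show "ext \<rho> l (s \<oplus>\<^bsub>freemod K Y\<^esub> t') = ext \<rho> l s \<oplus>\<^bsub>V\<^esub> ext \<rho> l t'"
      unfolding ext_def using rmod_hom_add[OF h t[OF st(1)] t[OF st(2)]] by simp
  next
    fix r s assume r: "r \<in> carrier K" and s: "s \<in> carrier (freemod K Y)"
    have "tens K (co l) (r \<odot>\<^bsub>freemod K Y\<^esub> s) = r \<odot>\<^bsub>freemod K (B \<times> Y)\<^esub> tens K (co l) s"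
      using freemodD(1)[OF s] r by (auto simp: tens_def freemod_simps m_assoc)
    then show "ext \<rho> l (r \<odot>\<^bsub>freemod K Y\<^esub> s) = r \<odot>\<^bsub>V\<^esub> ext \<rho> l s"
      unfolding ext_def using rmod_hom_smult[OF h r t[OF s]] by simp
  qed
qed

lemma ext_hom_l:
  assumes "\<And>b w. \<lbrakk>b \<in> B; w \<in> Y\<rbrakk> \<Longrightarrow> \<rho> b w \<in> carrier V" "s \<in> carrier (freemod K Y)"
  shows "(\<lambda>l. ext \<rho> l s) \<in> rmod_hom K (vec L) V"
proof -
  have h: "lsum K V (\<lambda>(b, w). \<rho> b w) \<in> rmod_hom K (freemod K (B \<times> Y)) V"
    by (rule lsum_hom[OF V.right_module_axioms]) (use assms(1) in auto)
  note t = tens_closed[OF K_ring co_closed assms(2)]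
  show ?thesis
  proof (rule rmod_homI)
    fix k l assume kl: "k \<in> carrier (vec L)" "l \<in> carrier (vec L)"
    then have kl': "k \<in> carrier L" "l \<in> carrier L" by auto
    show "ext \<rho> k s \<in> carrier V" unfolding ext_def by (rule rmod_hom_closed[OF h t[OF kl'(1)]])
    have "tens K (co (k \<oplus>\<^bsub>L\<^esub> l)) s = tens K (co k) s \<oplus>\<^bsub>freemod K (B \<times> Y)\<^esub> tens K (co l) s"
      using freemodD(1)[OF co_closed[OF kl'(1)]] freemodD(1)[OF co_closed[OF kl'(2)]] freemodD(1)[OF assms(2)]
        rmod_hom_add[OF co_hom kl]
      by (auto simp: tens_def freemod_simps l_distr)
    then show "ext \<rho> (k \<oplus>\<^bsub>vec L\<^esub> l) s = ext \<rho> k s \<oplus>\<^bsub>V\<^esub> ext \<rho> l s"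
      unfolding ext_def using rmod_hom_add[OF h t[OF kl'(1)] t[OF kl'(2)]] by simp
  next
    fix r l assume r: "r \<in> carrier K" and l: "l \<in> carrier (vec L)"
    then have l': "l \<in> carrier L" by simp
    have "tens K (co (r \<odot>\<^bsub>L\<^esub> l)) s = r \<odot>\<^bsub>freemod K (B \<times> Y)\<^esub> tens K (co l) s"
      using freemodD(1)[OF co_closed[OF l']] freemodD(1)[OF assms(2)] r rmod_hom_smult[OF co_hom r l]
      by (auto simp: tens_def freemod_simps m_ac)
    then show "ext \<rho> (r \<odot>\<^bsub>vec L\<^esub> l) s = r \<odot>\<^bsub>V\<^esub> ext \<rho> l s"
      unfolding ext_def using rmod_hom_smult[OF h r t[OF l']] by simp
  qed
qed

lemma ext_single:
  assumes "b \<in> B" "\<rho> b w \<in> carrier V"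
  shows "ext \<rho> b (z w) = \<rho> b w"
proof -
  have "tens K (co b) (z w) = single K \<one> (b, w)"
    using assms(1) by (auto simp: tens_def co_basis single_def)
  then show ?thesis
    unfolding ext_def using lsum_single[OF V.right_module_axioms, of "\<lambda>(b, w). \<rho> b w" "(b, w)" \<one>] assms(2)
    by (simp add: V.unit)
qed

text \<open>
  The left action of \<open>L\<close> on sorted words, following Serre: a letter \<open>b\<close> that cannot simply be
  put in front of \<open>j M\<close> is moved past \<open>j\<close> by \<open>b j = j b + [b, j]\<close>. The part \<open>j (b M)\<close> is split into the
  sorted word and a remainder of smaller length, so that only shorter words occur in the recursion.
  The first argument bounds the length of the word.
\<close>

primrec rho :: "nat \<Rightarrow> 'l \<Rightarrow> 'l list \<Rightarrow> 'l list \<Rightarrow> 'k" where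
  "rho 0 b w = z (ins lq b w)"
| "rho (Suc n) b w = (case w of [] \<Rightarrow> z [b]
     | j # M \<Rightarrow> if lq b j then z (b # j # M)
         else z (j # ins lq b M) \<oplus>\<^bsub>V\<^esub> (ext (rho n) j (rho n b M \<ominus>\<^bsub>V\<^esub> z (ins lq b M))
           \<oplus>\<^bsub>V\<^esub> ext (rho n) (bracket L b j) (z M)))"

text \<open>The bound in \<open>rho\<close> serves to make the recursion primitive. By
  \<open>rho_properties\<close> every bound not below the length of the word gives the same vector;
  here the least one is taken.\<close>

definition "arr b w = rho (length w) b w"
definition "A l s = ext arr l s"

text \<open>\<open>ext (rho n)\<close> may be replaced by \<open>A\<close> because both vectors it
  is applied to lie in \<open>S n\<close>, where \<open>rho n\<close> and \<open>arr\<close>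
  agree.\<close>

lemma rho_step:
  assumes arr: "\<And>b w. \<lbrakk>b \<in> B; w \<in> W n\<rbrakk> \<Longrightarrow> rho n b w = arr b w \<and> arr b w \<in> carrier V"
    and diff: "\<And>b w. \<lbrakk>b \<in> B; w \<in> W n\<rbrakk> \<Longrightarrow> arr b w \<ominus>\<^bsub>V\<^esub> z (ins lq b w) \<in> S n"
    and b: "b \<in> B" and jM: "j # M \<in> W (Suc n)" and nle: "\<not> lq b j"
  shows "rho (Suc n) b (j # M) = z (j # ins lq b M) \<oplus>\<^bsub>V\<^esub> (A j (arr b M \<ominus>\<^bsub>V\<^esub> z (ins lq b M))
           \<oplus>\<^bsub>V\<^esub> A (bracket L b j) (z M))"
proof -
  have M: "M \<in> W n" and j: "j \<in> B" using jM by (auto simp: W_def)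
  have jb: "j \<in> carrier L" "bracket L b j \<in> carrier L" using j b B_sub bracket_closed by auto
  have "ext (rho n) l s = A l s" if "l \<in> carrier L" "s \<in> S n" for l s
    unfolding A_def by (rule ext_cong[OF _ _ that]) (use arr in auto)
  then show ?thesis using nle arr[OF b M] diff[OF b M] jb z_S[OF M] by simp
qed

text \<open>Independence of the bound, the degree bound and the leading term are proved together.
  The recursion applies j to the difference between b M and its leading term, and this is harmless
  only because the difference lies in the span of words no longer than M.\<close>

lemma rho_properties:
  "m \<le> n \<Longrightarrow> b \<in> B \<Longrightarrow> w \<in> W m \<Longrightarrow> rho m b w = arr b w \<and>
     arr b w \<in> S (Suc (length w)) \<and> arr b w \<ominus>\<^bsub>V\<^esub> z (ins lq b w) \<in> S (length w)"
proof (induction n arbitrary: m b w)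
  case 0
  then have w: "w = []" "m = 0" by (auto simp: W_def)
  have "z [b] \<in> S (Suc 0)" using 0 by (intro z_S) (auto simp: W_def)
  then show ?case
    using w V_closed[of "z [b]" "Suc 0"] S_zero[of 0] by (simp add: arr_def a_minus_def V.M.r_neg)
next
  case (Suc n)
  show ?case
  proof (cases "m \<le> n")
    case True
    then show ?thesis using Suc.IH Suc.prems by blast
  next
    case False
    then have m: "m = Suc n" using Suc.prems by simp
    show ?thesis
    proof (cases w)
      case Nil
      have "z [b] \<in> S (Suc 0)" using Suc.prems by (intro z_S) (auto simp: W_def)
      then show ?thesis
        using m Nil V_closed[of "z [b]" "Suc 0"] S_zero[of 0] by (simp add: arr_def a_minus_def V.M.r_neg)
    next
      case (Cons j M)
      have wl: "w \<in> W (length w)" using Suc.prems by (auto simp: W_def)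
      have M: "M \<in> W (length M)" "j \<in> B" and lM: "length M \<le> n" and jMl: "j # M \<in> W (Suc (length M))"
        using Suc.prems m Cons by (auto simp: W_def)
      have IHn: "rho k b w = arr b w \<and> arr b w \<in> S (Suc k) \<and> arr b w \<ominus>\<^bsub>V\<^esub> z (ins lq b w) \<in> S k"
        if "k \<le> n" "b \<in> B" "w \<in> W k" for k b w
      proof -
        have "length w \<le> k" using that by (auto simp: W_def)
        then show ?thesis using Suc.IH[OF that] S_mono[of "Suc (length w)" "Suc k"] S_mono[of "length w" k]
          by blast
      qed
      show ?thesis
      proof (cases "lq b j")
        case True
        then have "z (b # j # M) \<in> S (Suc (length w))"
          using Suc.prems Cons srt_Cons_le[of b j M] by (intro z_S) (auto simp: W_def)
        then show ?thesis
          using m Cons True V_closed[of "z (b # j # M)"] S_zero[of "length w"]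
          by (simp add: arr_def a_minus_def V.M.r_neg)
      next
        case False
        \<comment> \<open>Used for two values of the bound, n and the length of M. The right-hand
          side does not mention the bound, which proves independence of it.\<close>
        have st: "rho (Suc k) b (j # M) = z (j # ins lq b M) \<oplus>\<^bsub>V\<^esub> (A j (arr b M \<ominus>\<^bsub>V\<^esub> z (ins lq b M))
           \<oplus>\<^bsub>V\<^esub> A (bracket L b j) (z M))" if "k \<le> n" "length M \<le> k" for k
        proof (rule rho_step[OF _ _ Suc.prems(2) _ False])
          show "rho k b w = arr b w \<and> arr b w \<in> carrier V" if "b \<in> B" "w \<in> W k" for b w
            using IHn[OF \<open>k \<le> n\<close> that] V_closed by blast
          show "arr b w \<ominus>\<^bsub>V\<^esub> z (ins lq b w) \<in> S k" if "b \<in> B" "w \<in> W k" for b w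
            using IHn[OF \<open>k \<le> n\<close> that] by blast
          show "j # M \<in> W (Suc k)" using Suc.prems Cons that by (auto simp: W_def)
        qed
        have eq: "rho (Suc n) b w = arr b w" unfolding arr_def Cons using st[of n] st[of "length M"] lM by simp
        have A_in: "A l s \<in> S (length w)" if "l \<in> carrier L" "s \<in> S (length M)" for l s
          unfolding A_def by (rule ext_in[OF _ that]) (use IHn[OF lM] Cons in auto)
        have "A j (arr b M \<ominus>\<^bsub>V\<^esub> z (ins lq b M)) \<oplus>\<^bsub>V\<^esub> A (bracket L b j) (z M) \<in> S (length w)"
          using IHn[OF lM Suc.prems(2) M(1)] Suc.prems(2) M B_sub
          by (intro S_add A_in z_S bracket_closed) auto
        moreover have zi: "z (j # ins lq b M) \<in> S (Suc (length w))"
          using ins_W[OF Suc.prems(2) wl] False Cons by (intro z_S) simp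
        moreover have "arr b w = z (j # ins lq b M) \<oplus>\<^bsub>V\<^esub> (A j (arr b M \<ominus>\<^bsub>V\<^esub> z (ins lq b M))
           \<oplus>\<^bsub>V\<^esub> A (bracket L b j) (z M))"
          using eq st[of n] lM Cons by simp
        ultimately show ?thesis
          using m eq False Cons S_add[of _ "Suc (length w)"] S_mono[of "length w" "Suc (length w)"]
            V_closed V.M.add_diff_cancel by auto
      qed
    qed
  qed
qed

lemma arr_S: "\<lbrakk>b \<in> B; w \<in> W n\<rbrakk> \<Longrightarrow> arr b w \<in> S (Suc n)"
  using rho_properties[of "length w" "length w" b w] S_mono[of "Suc (length w)" "Suc n"]
  by (auto simp: W_def)

lemma arr_V: "\<lbrakk>b \<in> B; w \<in> Ws\<rbrakk> \<Longrightarrow> arr b w \<in> carrier V"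
  using arr_S[of b w "length w"] V_closed by (auto simp: W_def Ws_def)

lemma arr_diff_S: "\<lbrakk>b \<in> B; w \<in> W n\<rbrakk> \<Longrightarrow> arr b w \<ominus>\<^bsub>V\<^esub> z (ins lq b w) \<in> S n"
  using rho_properties[of "length w" "length w" b w] S_mono[of "length w" n]
  by (auto simp: W_def)

lemma A_hom_s: "l \<in> carrier L \<Longrightarrow> A l \<in> rmod_hom K (freemod K Ws) V"
  unfolding A_def[abs_def] by (rule ext_hom_s) (auto intro: arr_V)

lemma S_Ws: "s \<in> S n \<Longrightarrow> s \<in> carrier (freemod K Ws)"
  using freemod_mono[OF K_ring, of "W n" Ws] by (auto simp: W_def Ws_def)

lemma A_hom_l: "s \<in> carrier (freemod K Ws) \<Longrightarrow> (\<lambda>l. A l s) \<in> rmod_hom K (vec L) V"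
  unfolding A_def[abs_def] by (rule ext_hom_l[where Y = Ws]) (auto intro: arr_V)

lemma A_basis: "\<lbrakk>b \<in> B; w \<in> Ws\<rbrakk> \<Longrightarrow> A b (z w) = arr b w"
  unfolding A_def by (rule ext_single) (auto intro: arr_V)

lemma arr_le:
  assumes "b \<in> B" "srt (b # w)"
  shows "arr b w = z (b # w)"
  using assms by (cases w) (auto simp: arr_def)

lemma arr_gt:
  assumes b: "b \<in> B" and jM: "j # M \<in> Ws" and nle: "\<not> lq b j"
  shows "arr b (j # M) = z (j # ins lq b M) \<oplus>\<^bsub>V\<^esub> (A j (arr b M \<ominus>\<^bsub>V\<^esub> z (ins lq b M))
           \<oplus>\<^bsub>V\<^esub> A (bracket L b j) (z M))"
proof -
  have "rho (Suc (length M)) b (j # M) = z (j # ins lq b M) \<oplus>\<^bsub>V\<^esub> (A j (arr b M \<ominus>\<^bsub>V\<^esub> z (ins lq b M))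
           \<oplus>\<^bsub>V\<^esub> A (bracket L b j) (z M))"
  proof (rule rho_step[OF _ _ b _ nle])
    show "j # M \<in> W (Suc (length M))" using jM by (auto simp: W_def Ws_def)
    fix b w assume "b \<in> B" "w \<in> W (length M)"
    then show "rho (length M) b w = arr b w \<and> arr b w \<in> carrier V"
      using rho_properties[of "length M" "length M" b w] V_closed by blast
  qed (rule arr_diff_S)
  then show ?thesis by (simp add: arr_def)
qed


section \<open>The action on sorted words respects brackets\<close>

abbreviation "Sw \<equiv> carrier (freemod K Ws)"

lemma Sw_sub: "submodule Sw K V" by (rule freemod_submodule[OF K_ring]) auto

lemma Sw_V: "s \<in> Sw \<Longrightarrow> s \<in> carrier V"
  using V.submoduleD(1)[OF Sw_sub] by blast

lemmas Sw_add = V.submoduleD(3)[OF Sw_sub] and Sw_smult = V.submoduleD(4)[OF Sw_sub]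
  and Sw_zero = V.submoduleD(2)[OF Sw_sub]

lemma z_Sw: "w \<in> Ws \<Longrightarrow> z w \<in> Sw" by (rule single_closed[OF K_ring]) auto

lemma W_Ws: "w \<in> W n \<Longrightarrow> w \<in> Ws" by (auto simp: W_def Ws_def)

lemma Ws_W: "w \<in> Ws \<Longrightarrow> w \<in> W (length w)" by (auto simp: W_def Ws_def)

lemma ins_Ws: "\<lbrakk>b \<in> B; w \<in> Ws\<rbrakk> \<Longrightarrow> ins lq b w \<in> Ws"
  by (auto simp: Ws_def srt_ins)

lemma A_Sw: "\<lbrakk>l \<in> carrier L; s \<in> Sw\<rbrakk> \<Longrightarrow> A l s \<in> Sw"
  unfolding A_def by (rule ext_in[where Y = Ws]) (auto intro: S_Ws arr_S Ws_W)

lemma A_V: "\<lbrakk>l \<in> carrier L; s \<in> Sw\<rbrakk> \<Longrightarrow> A l s \<in> carrier V"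
  using A_Sw Sw_V by blast

lemma A_add: "\<lbrakk>l \<in> carrier L; s \<in> Sw; t \<in> Sw\<rbrakk> \<Longrightarrow> A l (s \<oplus>\<^bsub>V\<^esub> t) = A l s \<oplus>\<^bsub>V\<^esub> A l t"
  using rmod_hom_add[OF A_hom_s, of l s t] by (simp add: freemod_simps)

lemma A_smult: "\<lbrakk>l \<in> carrier L; r \<in> carrier K; s \<in> Sw\<rbrakk> \<Longrightarrow> A l (r \<odot>\<^bsub>V\<^esub> s) = r \<odot>\<^bsub>V\<^esub> A l s"
  using rmod_hom_smult[OF A_hom_s, of l r s] by (simp add: freemod_simps)

lemma A_zero: "l \<in> carrier L \<Longrightarrow> A l \<zero>\<^bsub>V\<^esub> = \<zero>\<^bsub>V\<^esub>"
  using rmod_hom_zero[OF freemod_right_module[OF K_ring] V.right_module_axioms A_hom_s, of l]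
  by (simp add: freemod_simps)

lemma A_add_l: "\<lbrakk>k \<in> carrier L; l \<in> carrier L; s \<in> Sw\<rbrakk> \<Longrightarrow> A (k \<oplus>\<^bsub>L\<^esub> l) s = A k s \<oplus>\<^bsub>V\<^esub> A l s"
  using rmod_hom_add[OF A_hom_l, of s k l] by simp

lemma A_smult_l: "\<lbrakk>r \<in> carrier K; l \<in> carrier L; s \<in> Sw\<rbrakk> \<Longrightarrow> A (r \<odot>\<^bsub>L\<^esub> l) s = r \<odot>\<^bsub>V\<^esub> A l s"
  using rmod_hom_smult[OF A_hom_l, of s r l] by simp

lemma A_zero_l: "s \<in> Sw \<Longrightarrow> A \<zero>\<^bsub>L\<^esub> s = \<zero>\<^bsub>V\<^esub>"
  using rmod_hom_zero[OF vec_rm V.right_module_axioms A_hom_l, of s] by simp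

lemma A_neg_l:
  assumes "l \<in> carrier L" "s \<in> Sw"
  shows "A (\<ominus>\<^bsub>L\<^esub> l) s = \<ominus>\<^bsub>V\<^esub> A l s"
proof -
  have "additive_map L V (\<lambda>l. A l s)"
    using rmod_hom_additive[OF A_hom_l[OF assms(2)]] by (simp add: additive_map_def)
  then show ?thesis
    using additive_map_neg[OF L.M.abelian_group_axioms V.abelian_group_M _ assms(1)] by blast
qed

text \<open>The condition x y s = y x s + [x, y] s for \<open>A\<close> to be an action of L, stated
  for one vector s because the induction is on the length of the words in s.\<close>

definition rel where
  "rel x y s \<longleftrightarrow> A x (A y s) = A y (A x s) \<oplus>\<^bsub>V\<^esub> A (bracket L x y) s"

lemma relD: "rel x y s \<Longrightarrow> A x (A y s) = A y (A x s) \<oplus>\<^bsub>V\<^esub> A (bracket L x y) s"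
  by (simp add: rel_def)

lemma rel_swap:
  assumes "rel x y s" "x \<in> carrier L" "y \<in> carrier L" "s \<in> Sw"
  shows "rel y x s"
proof -
  have c: "A y (A x s) \<in> carrier V" "A (bracket L x y) s \<in> carrier V"
    using assms by (auto intro!: A_V A_Sw bracket_closed)
  have "A (bracket L y x) s = \<ominus>\<^bsub>V\<^esub> A (bracket L x y) s"
    using bracket_skew[of y x] A_neg_l[of "bracket L x y" s] assms bracket_closed by simp
  then show ?thesis using relD[OF assms(1)] c by (simp add: rel_def V.M.a_assoc V.M.r_neg)
qed

lemma rel_same: "\<lbrakk>x \<in> carrier L; s \<in> Sw\<rbrakk> \<Longrightarrow> rel x x s"
  by (simp add: rel_def alternating A_zero_l A_V A_Sw)

lemma rel_add:
  assumes "rel x y s" "rel x y t" "x \<in> carrier L" "y \<in> carrier L" "s \<in> Sw" "t \<in> Sw"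
  shows "rel x y (s \<oplus>\<^bsub>V\<^esub> t)"
  using assms(3-6) by (simp add: rel_def A_add A_Sw relD[OF assms(1)] relD[OF assms(2)] bracket_closed
      V.M.a_ac A_V)

lemma rel_smult:
  assumes "rel x y s" "x \<in> carrier L" "y \<in> carrier L" "s \<in> Sw" "r \<in> carrier K"
  shows "rel x y (r \<odot>\<^bsub>V\<^esub> s)"
  using assms(2-5) by (simp add: rel_def A_smult A_Sw relD[OF assms(1)] bracket_closed V.add_vector A_V)

lemma single_smult: "a \<in> carrier K \<Longrightarrow> single K a w = a \<odot>\<^bsub>V\<^esub> z w"
  by (auto simp: single_def freemod_simps)

text \<open>Together with \<open>rel_linear_xy\<close> this reduces the relation to basis letters b,
  c and single sorted words.\<close>

lemma rel_linear_s:
  assumes Y: "Y \<subseteq> Ws" and x: "x \<in> carrier L" and y: "y \<in> carrier L"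
    and rel: "\<And>w. w \<in> Y \<Longrightarrow> rel x y (z w)" and s: "s \<in> carrier (freemod K Y)"
  shows "rel x y s"
  using s
proof (rule freemod_induct[OF K_ring, where P = "rel x y"])
  have "rel x y \<zero>\<^bsub>V\<^esub>" using x y by (simp add: rel_def A_zero bracket_closed)
  then show "rel x y (\<lambda>i. \<zero>)" by (simp add: freemod_simps)
  show "rel x y (single K a w)" if "a \<in> carrier K" "w \<in> Y" for a w
    unfolding single_smult[OF that(1)] using that Y rel x y by (intro rel_smult z_Sw) auto
  show "rel x y (\<lambda>i. s i \<oplus> t i)"
    if "s \<in> carrier (freemod K Y)" "t \<in> carrier (freemod K Y)" "rel x y s" "rel x y t" for s t
    using rel_add[OF that(3,4) x y] that(1,2) freemod_mono[OF K_ring Y] by (auto simp: freemod_simps)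
qed

lemma L_spanned:
  assumes "submodule H K (vec L)" "B \<subseteq> H" "x \<in> carrier L"
  shows "x \<in> H"
  using lsum_in_submodule[OF vec_rm assms(1) co_closed[OF assms(3)], of "\<lambda>b. b"] assms(2,3) co_sum by auto

lemma rel_submodule:
  assumes y: "y \<in> carrier L" and s: "s \<in> Sw"
  shows "submodule {x \<in> carrier L. rel x y s} K (vec L)"
proof -
  interpret VL: right_module K "vec L" by (rule vec_rm)
  show ?thesis
  proof (rule VL.submoduleI)
    show "\<zero>\<^bsub>vec L\<^esub> \<in> {x \<in> carrier L. rel x y s}"
      using y s by (simp add: rel_def A_zero_l A_zero bracket_zero_left A_Sw)
    fix x x' assume "x \<in> {x \<in> carrier L. rel x y s}" "x' \<in> {x \<in> carrier L. rel x y s}"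
    then show "x \<oplus>\<^bsub>vec L\<^esub> x' \<in> {x \<in> carrier L. rel x y s}"
      using y s relD[of x y s] relD[of x' y s]
      by (simp add: rel_def A_add_l A_add A_Sw A_V bracket_add_left bracket_closed V.M.a_ac)
  next
    fix r x assume "r \<in> carrier K" "x \<in> {x \<in> carrier L. rel x y s}"
    then show "r \<odot>\<^bsub>vec L\<^esub> x \<in> {x \<in> carrier L. rel x y s}"
      using y s relD[of x y s]
      by (simp add: rel_def A_smult_l A_smult A_Sw A_V bracket_smult_left bracket_closed V.add_vector)
  qed auto
qed

lemma rel_linear_xy:
  assumes rel: "\<And>b c. \<lbrakk>b \<in> B; c \<in> B\<rbrakk> \<Longrightarrow> rel b c s" and s: "s \<in> Sw"
    and x: "x \<in> carrier L" and y: "y \<in> carrier L"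
  shows "rel x y s"
proof -
  have 1: "rel x c s" if "c \<in> B" "x \<in> carrier L" for c x
    using L_spanned[OF rel_submodule[OF _ s, of c] _ that(2)] rel that B_sub by auto
  have "y \<in> {y \<in> carrier L. rel y x s}"
    by (rule L_spanned[OF rel_submodule[OF x s] _ y]) (use 1 x s B_sub rel_swap in auto)
  then show ?thesis using rel_swap x y s by auto
qed

text \<open>Since c w is sorted, c acts on w by prefixing, and the clause of the recursion that
  moves b past c is precisely the claimed relation.\<close>

lemma rel_sorted:
  assumes b: "b \<in> B" and c: "c \<in> B" and cw: "c # w \<in> Ws" and nle: "\<not> lq b c"
  shows "rel b c (z w)"
proof -
  have w: "w \<in> Ws" "srt (c # w)" and cb: "lq c b" using cw nle le_total by (auto simp: Ws_def)
  have bL: "b \<in> carrier L" "c \<in> carrier L" using b c B_sub by auto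
  define d where "d = arr b w \<ominus>\<^bsub>V\<^esub> z (ins lq b w)"
  have d: "d \<in> Sw" unfolding d_def using S_Ws[OF arr_diff_S[OF b Ws_W[OF w(1)]]] .
  have zi: "z (ins lq b w) \<in> Sw" by (rule z_Sw[OF ins_Ws[OF b w(1)]])
  have "arr b w = z (ins lq b w) \<oplus>\<^bsub>V\<^esub> d"
    using Sw_V[OF zi] arr_V[OF b w(1)] unfolding d_def a_minus_def
    by (simp add: V.M.a_lcomm V.M.r_neg)
  moreover have "A c (z (ins lq b w)) = z (c # ins lq b w)"
    using A_basis[OF c ins_Ws[OF b w(1)]] arr_le[OF c, of "ins lq b w"] w(2) cb srt_ins[of w b] by simp
  ultimately have *: "A c (A b (z w)) = z (c # ins lq b w) \<oplus>\<^bsub>V\<^esub> A c d"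
    using A_basis[OF b w(1)] A_add[OF bL(2) zi d] by simp
  have "A b (A c (z w)) = z (c # ins lq b w) \<oplus>\<^bsub>V\<^esub> (A c d \<oplus>\<^bsub>V\<^esub> A (bracket L b c) (z w))"
    using A_basis[OF c w(1)] arr_le[OF c w(2)] A_basis[OF b cw] arr_gt[OF b cw nle] by (simp add: d_def)
  also have "\<dots> = (z (c # ins lq b w) \<oplus>\<^bsub>V\<^esub> A c d) \<oplus>\<^bsub>V\<^esub> A (bracket L b c) (z w)"
    using A_V[OF bL(2) d] A_V[OF bracket_closed[OF bL] z_Sw[OF w(1)]] single_closed[OF K_ring, of \<one> "c # ins lq b w" UNIV]
    by (simp add: V.M.a_assoc)
  finally show ?thesis using * by (simp add: rel_def)
qed

text \<open>y P is the sorted word \<open>ins lq y P\<close> plus a remainder in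
  \<open>S (length P)\<close>. All letters of the sorted word are at least k, so
  \<open>rel_sorted\<close> treats it; the remainder falls under the hypothesis on short
  words.\<close>

lemma rel_past_smaller:
  assumes x: "x \<in> B" and y: "y \<in> B" and k: "k # P \<in> Ws" and ky: "lq k y" and nle: "\<not> lq x k"
    and IH: "\<And>x y s. \<lbrakk>x \<in> carrier L; y \<in> carrier L; s \<in> S (length P)\<rbrakk> \<Longrightarrow> rel x y s"
  shows "rel x k (A y (z P))"
proof -
  have P: "P \<in> Ws" "srt (k # P)" "k \<in> B" using k by (auto simp: Ws_def)
  have L: "x \<in> carrier L" "k \<in> carrier L" using x P B_sub by auto
  define d where "d = arr y P \<ominus>\<^bsub>V\<^esub> z (ins lq y P)"
  have d: "d \<in> S (length P)" unfolding d_def by (rule arr_diff_S[OF y Ws_W[OF P(1)]])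
  have zi: "z (ins lq y P) \<in> Sw" by (rule z_Sw[OF ins_Ws[OF y P(1)]])
  have "A y (z P) = z (ins lq y P) \<oplus>\<^bsub>V\<^esub> d"
    using Sw_V[OF zi] arr_V[OF y P(1)] A_basis[OF y P(1)] unfolding d_def a_minus_def
    by (simp add: V.M.a_lcomm V.M.r_neg)
  moreover have "rel x k (z (ins lq y P))"
    by (rule rel_sorted[OF x P(3) _ nle]) (use P ky y srt_ins in \<open>auto simp: Ws_def\<close>)
  ultimately show ?thesis using rel_add[OF _ IH[OF L d] L zi S_Ws[OF d]] by simp
qed

text \<open>If c cannot be prefixed to w, then w = k P with k below both b and c. Writing w as k
  acting on P and moving b and c past k turns the claim into relations on P, linked by the Jacobi
  identity.\<close>

lemma rel_word:
  assumes b: "b \<in> B" and c: "c \<in> B" and w: "w \<in> Ws" and nle: "\<not> lq b c"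
    and IH: "\<And>k P x y s. \<lbrakk>w = k # P; x \<in> carrier L; y \<in> carrier L; s \<in> S (length P)\<rbrakk> \<Longrightarrow> rel x y s"
  shows "rel b c (z w)"
proof (cases "c # w \<in> Ws")
  case True
  then show ?thesis using rel_sorted b c nle by blast
next
  case False
  have L: "b \<in> carrier L" "c \<in> carrier L" using b c B_sub by auto
  obtain k P where kP: "w = k # P" using False c by (cases w) (auto simp: Ws_def)
  have ck: "\<not> lq c k" using False c w kP srt_Cons_le[of c k P] by (auto simp: Ws_def)
  have kc: "lq k c" "lq k b" "\<not> lq b k" using ck nle le_total le_trans by blast+
  have kPw: "k # P \<in> Ws" using w kP by simp
  have P: "P \<in> Ws" "k \<in> B" "srt (k # P)" using kPw by (auto simp: Ws_def)
  have kL: "k \<in> carrier L" using P B_sub by auto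
  define a where "a = z P"
  have aS: "a \<in> S (length P)" unfolding a_def by (rule z_S[OF Ws_W[OF P(1)]])
  have a: "a \<in> Sw" by (rule S_Ws[OF aS])
  note IH' = relD[OF IH[OF kP _ _ aS]]
  have zw: "z w = A k a" using A_basis[OF P(2,1)] arr_le[OF P(2,3)] kP by (simp add: a_def)
  note [simp] = L kL a bracket_closed A_Sw A_V A_add Sw_add
  have e1: "A c (A k a) = A k (A c a) \<oplus>\<^bsub>V\<^esub> A (bracket L c k) a" by (rule IH') simp_all
  have e2: "A b (A k a) = A k (A b a) \<oplus>\<^bsub>V\<^esub> A (bracket L b k) a" by (rule IH') simp_all
  \<comment> \<open>\<open>e3\<close> and \<open>e4\<close> concern the vectors c P and b P, which
    may contain words longer than P and so escape the induction hypothesis.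
    \<open>rel_past_smaller\<close> covers them because k is below both letters.\<close>
  have e3: "A b (A k (A c a)) = A k (A b (A c a)) \<oplus>\<^bsub>V\<^esub> A (bracket L b k) (A c a)"
    unfolding a_def by (rule relD, rule rel_past_smaller[OF b c kPw kc(1,3) IH[OF kP]])
  have e4: "A c (A k (A b a)) = A k (A c (A b a)) \<oplus>\<^bsub>V\<^esub> A (bracket L c k) (A b a)"
    unfolding a_def by (rule relD, rule rel_past_smaller[OF c b kPw kc(2) ck IH[OF kP]])
  have e5: "A b (A (bracket L c k) a) = A (bracket L c k) (A b a) \<oplus>\<^bsub>V\<^esub> A (bracket L b (bracket L c k)) a"
    by (rule IH') simp_all
  have e6: "A c (A (bracket L b k) a) = A (bracket L b k) (A c a) \<oplus>\<^bsub>V\<^esub> A (bracket L c (bracket L b k)) a"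
    by (rule IH') simp_all
  have e7: "A b (A c a) = A c (A b a) \<oplus>\<^bsub>V\<^esub> A (bracket L b c) a" by (rule IH') simp_all
  have e8: "A k (A (bracket L b c) a) = A (bracket L b c) (A k a) \<oplus>\<^bsub>V\<^esub> A (bracket L k (bracket L b c)) a"
    by (rule IH') simp_all
  \<comment> \<open>The Jacobi identity applied to P: it matches the triple brackets that remain on
    the two sides.\<close>
  have j: "A (bracket L k (bracket L b c)) a \<oplus>\<^bsub>V\<^esub> A (bracket L b (bracket L c k)) a
      = A (bracket L c (bracket L b k)) a"
  proof -
    have "bracket L c (bracket L b k) = \<ominus>\<^bsub>L\<^esub> bracket L c (bracket L k b)"
      using bracket_skew[of b k] additive_map_neg[of L L "bracket L c" "bracket L k b"]
        L.M.abelian_group_axioms bracket_add_right by (simp add: additive_map_def)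
    moreover have "bracket L k (bracket L b c) \<oplus>\<^bsub>L\<^esub> bracket L b (bracket L c k) = \<ominus>\<^bsub>L\<^esub> bracket L c (bracket L k b)"
      using jacobi[of k b c] by (intro L.M.minus_equality[symmetric]) simp_all
    ultimately have "bracket L c (bracket L b k) = bracket L k (bracket L b c) \<oplus>\<^bsub>L\<^esub> bracket L b (bracket L c k)"
      by simp
    then show ?thesis by (simp add: A_add_l)
  qed
  have "A b (A c (z w)) = A k (A c (A b a)) \<oplus>\<^bsub>V\<^esub> (A (bracket L b c) (A k a) \<oplus>\<^bsub>V\<^esub> A (bracket L k (bracket L b c)) a)
      \<oplus>\<^bsub>V\<^esub> A (bracket L b k) (A c a) \<oplus>\<^bsub>V\<^esub> (A (bracket L c k) (A b a) \<oplus>\<^bsub>V\<^esub> A (bracket L b (bracket L c k)) a)"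
    by (simp add: zw e1 e3 e5 e7 e8)
  also have "\<dots> = A k (A c (A b a)) \<oplus>\<^bsub>V\<^esub> A (bracket L c k) (A b a) \<oplus>\<^bsub>V\<^esub> (A (bracket L b k) (A c a) \<oplus>\<^bsub>V\<^esub>
      (A (bracket L k (bracket L b c)) a \<oplus>\<^bsub>V\<^esub> A (bracket L b (bracket L c k)) a)) \<oplus>\<^bsub>V\<^esub> A (bracket L b c) (A k a)"
    by (simp add: V.M.a_ac)
  also have "\<dots> = A c (A b (z w)) \<oplus>\<^bsub>V\<^esub> A (bracket L b c) (z w)"
    unfolding j by (simp add: zw e2 e4 e6 V.M.a_assoc)
  finally show ?thesis by (simp add: rel_def)
qed

text \<open>Strong induction on the length. The case of b below c follows from the opposite one by
  antisymmetry of the bracket, and equal letters by its alternation.\<close>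

lemma rel_S: "\<lbrakk>x \<in> carrier L; y \<in> carrier L; s \<in> S n\<rbrakk> \<Longrightarrow> rel x y s"
proof (induction n arbitrary: x y s rule: less_induct)
  case (less n)
  have lt: "rel b c (z w)" if bc: "b \<in> B" "c \<in> B" and w: "w \<in> W n" and nle: "\<not> lq b c" for b c w
  proof (rule rel_word[OF bc W_Ws[OF w] nle])
    fix k P x y s assume "w = k # P" "x \<in> carrier L" "y \<in> carrier L" "s \<in> S (length P)"
    moreover have "length P < n" using \<open>w = k # P\<close> w by (auto simp: W_def)
    ultimately show "rel x y s" using less.IH by blast
  qed
  have word: "rel b c (z w)" if bc: "b \<in> B" "c \<in> B" and w: "w \<in> W n" for b c w
  proof -
    have L: "b \<in> carrier L" "c \<in> carrier L" "z w \<in> Sw" using bc B_sub z_Sw[OF W_Ws[OF w]] by auto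
    consider "\<not> lq b c" | "\<not> lq c b" | "b = c" using le_antisym by blast
    then show ?thesis
    proof cases
      case 1
      then show ?thesis using lt bc w by blast
    next
      case 2
      then show ?thesis using rel_swap[OF lt[OF bc(2,1) w]] L by blast
    next
      case 3
      then show ?thesis using rel_same L by blast
    qed
  qed
  have "rel b c s" if "b \<in> B" "c \<in> B" for b c
    by (rule rel_linear_s[OF _ _ _ _ less.prems(3)]) (use that B_sub word in \<open>auto intro: W_Ws\<close>)
  then show ?case using rel_linear_xy less.prems S_Ws by blast
qed

lemma Sw_S:
  assumes "s \<in> Sw"
  obtains n where "s \<in> S n"
proof -
  define n where "n = Max (insert 0 (length ` {w. s w \<noteq> \<zero>}))"
  have fin: "finite {w. s w \<noteq> \<zero>}" using freemodD(2)[OF assms] .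
  have "s w = \<zero>" if "w \<notin> W n" for w
  proof (rule ccontr)
    assume nz: "s w \<noteq> \<zero>"
    then have "w \<in> Ws" using freemodD(3)[OF assms] by blast
    moreover have "length w \<le> n" unfolding n_def using fin nz by (intro Max_ge) auto
    ultimately show False using that by (auto simp: W_def Ws_def)
  qed
  then have "s \<in> S n" using freemodD(1)[OF assms] fin by (intro freemodI) auto
  then show thesis using that by blast
qed

lemma rel: "\<lbrakk>x \<in> carrier L; y \<in> carrier L; s \<in> Sw\<rbrakk> \<Longrightarrow> rel x y s"
  using rel_S Sw_S by metis

end

section \<open>The action of U(L) on sorted words and the linear bijection with U(L)\<close>

lemma equalizer_submodule:
  assumes M: "right_module R M" and M': "right_module R M'"
    and f: "f \<in> rmod_hom R M M'" and g: "g \<in> rmod_hom R M M'"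
  shows "submodule {x \<in> carrier M. f x = g x} R M"
proof -
  interpret M: right_module R M by fact
  show ?thesis
    by (rule M.submoduleI)
      (auto simp: rmod_hom_zero[OF M M' f] rmod_hom_zero[OF M M' g] rmod_hom_add[OF f] rmod_hom_add[OF g]
        rmod_hom_smult[OF f] rmod_hom_smult[OF g])
qed

context env_setup
begin

definition UK :: "('k, ('l list \<Rightarrow> 'k) set) module" where
  "UK = \<lparr>carrier = carrier U, mult = mult U, one = one U, zero = zero U, add = add U,
     smult = (\<lambda>a u. sca a \<otimes>\<^bsub>U\<^esub> u)\<rparr>"

lemma UK_simps [simp]:
  "carrier UK = carrier U" "zero UK = zero U" "add UK = add U" "a \<odot>\<^bsub>UK\<^esub> u = sca a \<otimes>\<^bsub>U\<^esub> u"
  by (simp_all add: UK_def)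

lemma UK_right_module: "right_module K UK"
proof (intro right_module.intro right_module_axioms.intro K_ring abelian_groupI)
  fix x assume "x \<in> carrier UK"
  then show "\<exists>y\<in>carrier UK. y \<oplus>\<^bsub>UK\<^esub> x = \<zero>\<^bsub>UK\<^esub>"
    by (auto intro!: bexI[of _ "\<ominus>\<^bsub>U\<^esub> x"] simp: U.l_neg)
next
  fix r s x assume *: "r \<in> carrier K" "s \<in> carrier K" "x \<in> carrier UK"
  have "r \<otimes> s = s \<otimes> r" using * m_comm by simp
  then show "r \<otimes> s \<odot>\<^bsub>UK\<^esub> x = s \<odot>\<^bsub>UK\<^esub> (r \<odot>\<^bsub>UK\<^esub> x)"
    using * by (simp add: ring_hom_mult[OF sca_hom] U.m_assoc)
qed (auto simp: U.a_assoc U.a_comm U.a_lcomm U.l_distr U.r_distr ring_hom_add[OF sca_hom] ring_hom_one[OF sca_hom])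

text \<open>Scaling coefficients by a is multiplication by the monomial with coefficient a at the
  empty word.\<close>

lemma cls_K_hom: "cls \<in> rmod_hom K (freemod K (lists (carrier L))) UK"
proof (rule rmod_homI)
  fix f g assume "f \<in> carrier (freemod K (lists (carrier L)))" "g \<in> carrier (freemod K (lists (carrier L)))"
  then show "cls f \<in> carrier UK" "cls (f \<oplus>\<^bsub>freemod K (lists (carrier L))\<^esub> g) = cls f \<oplus>\<^bsub>UK\<^esub> cls g"
    using cls_add[of f g] cls_closed[of f] by (simp_all add: free_algebra_simps freemod_simps)
next
  fix a f assume a: "a \<in> carrier K" and f: "f \<in> carrier (freemod K (lists (carrier L)))"
  have "single K a [] \<otimes>\<^bsub>F\<^esub> f = (\<lambda>w. f w \<otimes> a)"
  proof (rule freemod_induct[OF K_ring f])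
    show "single K a [] \<otimes>\<^bsub>F\<^esub> (\<lambda>i. \<zero>) = (\<lambda>w. \<zero> \<otimes> a)"
      using F.r_null[OF F_single[OF a, of "[]"]] a by (simp add: free_algebra_simps(2))
    show "single K a [] \<otimes>\<^bsub>F\<^esub> single K b w = (\<lambda>v. single K b w v \<otimes> a)" if "b \<in> carrier K" for b w
      unfolding F_single_mult[OF a that] using that a m_comm[of a b] by (auto simp: single_def)
    fix g h assume gh: "g \<in> carrier (freemod K (lists (carrier L)))" "h \<in> carrier (freemod K (lists (carrier L)))"
      "single K a [] \<otimes>\<^bsub>F\<^esub> g = (\<lambda>w. g w \<otimes> a)" "single K a [] \<otimes>\<^bsub>F\<^esub> h = (\<lambda>w. h w \<otimes> a)"
    show "single K a [] \<otimes>\<^bsub>F\<^esub> (\<lambda>i. g i \<oplus> h i) = (\<lambda>w. (g w \<oplus> h w) \<otimes> a)"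
      using F.r_distr[of g h "single K a []"] gh(1,2) F_single[OF a, of "[]"] a
        freemodD(1)[OF gh(1)] freemodD(1)[OF gh(2)]
      unfolding free_algebra_simps(4) gh(3,4) by (simp add: free_algebra_simps(1) l_distr)
  qed
  then show "cls (a \<odot>\<^bsub>freemod K (lists (carrier L))\<^esub> f) = a \<odot>\<^bsub>UK\<^esub> cls f"
    using cls_mult[of "single K a []" f] F_single[OF a, of "[]"] f
    by (simp add: freemod_simps sca_eq free_algebra_simps(1))
qed

lemma UK_mult_right_hom: "u \<in> carrier U \<Longrightarrow> (\<lambda>v. v \<otimes>\<^bsub>U\<^esub> u) \<in> rmod_hom K UK UK"
  by (rule rmod_homI) (simp_all add: U.l_distr U.m_assoc)

lemma UK_mult_left_hom: "u \<in> carrier U \<Longrightarrow> (\<lambda>v. u \<otimes>\<^bsub>U\<^esub> v) \<in> rmod_hom K UK UK"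
proof (rule rmod_homI)
  fix r x assume *: "u \<in> carrier U" "r \<in> carrier K" "x \<in> carrier UK"
  have "u \<otimes>\<^bsub>U\<^esub> (sca r \<otimes>\<^bsub>U\<^esub> x) = (sca r \<otimes>\<^bsub>U\<^esub> u) \<otimes>\<^bsub>U\<^esub> x"
    using * sca_central[of r u] by (simp add: U.m_assoc)
  then show "u \<otimes>\<^bsub>U\<^esub> (r \<odot>\<^bsub>UK\<^esub> x) = r \<odot>\<^bsub>UK\<^esub> (u \<otimes>\<^bsub>U\<^esub> x)" using * by (simp add: U.m_assoc)
qed (simp_all add: U.r_distr)

end

lemma (in lie_algebra) inc_K_hom: "inc \<in> rmod_hom K (vec L) UK"
  by (rule rmod_homI) (simp_all add: inc_add inc_smult)

context lie_basis
begin

lemma Ws_lists: "Ws \<subseteq> lists (carrier L)"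
  using B_sub by (auto simp: Ws_def)

lemma Sw_F: "s \<in> Sw \<Longrightarrow> s \<in> carrier (freemod K (lists (carrier L)))"
  using freemod_mono[OF K_ring Ws_lists] by blast

lemma cls_Sw_closed [simp]: "s \<in> Sw \<Longrightarrow> cls s \<in> carrier U"
  using cls_closed Sw_F by (simp add: free_algebra_simps)

lemma cls_Sw_hom: "cls \<in> rmod_hom K (freemod K Ws) UK"
  using cls_K_hom Sw_F by (auto simp: rmod_hom_def freemod_simps)

lemma cls_Sw_add: "\<lbrakk>s \<in> Sw; t \<in> Sw\<rbrakk> \<Longrightarrow> cls (s \<oplus>\<^bsub>V\<^esub> t) = cls s \<oplus>\<^bsub>U\<^esub> cls t"
  using rmod_hom_add[OF cls_Sw_hom, of s t] by (simp add: freemod_simps)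

lemma A_to_Sw_hom: "l \<in> carrier L \<Longrightarrow> A l \<in> rmod_hom K (freemod K Ws) (freemod K Ws)"
  using A_hom_s A_Sw by (auto simp: rmod_hom_def freemod_simps)

lemma A_to_Sw_hom_l: "s \<in> Sw \<Longrightarrow> (\<lambda>l. A l s) \<in> rmod_hom K (vec L) (freemod K Ws)"
  using A_hom_l A_Sw by (auto simp: rmod_hom_def freemod_simps)

text \<open>Both sides are linear in l and in s, so they are compared on basis letters first and
  then on words.\<close>

lemma cls_A_linear:
  assumes basis: "\<And>b w. \<lbrakk>b \<in> B; w \<in> W n\<rbrakk> \<Longrightarrow> cls (arr b w) = inc b \<otimes>\<^bsub>U\<^esub> cls (z w)"
    and l: "l \<in> carrier L" and s: "s \<in> S n"
  shows "cls (A l s) = inc l \<otimes>\<^bsub>U\<^esub> cls s"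
proof -
  have W: "W n \<subseteq> Ws" by (auto intro: W_Ws)
  have restr: "h \<in> rmod_hom K (freemod K (W n)) M" if "h \<in> rmod_hom K (freemod K Ws) M" for h M
    by (rule rmod_homI)
      (use freemod_mono[OF K_ring W] rmod_hom_closed[OF that] rmod_hom_add[OF that] rmod_hom_smult[OF that]
        in \<open>auto simp: freemod_simps subset_iff\<close>)
  have word: "cls (A l (z w)) = inc l \<otimes>\<^bsub>U\<^esub> cls (z w)" if w: "w \<in> W n" for w
  proof -
    have zw: "z w \<in> Sw" using z_Sw W w by blast
    have "submodule {x \<in> carrier (vec L). cls (A x (z w)) = inc x \<otimes>\<^bsub>U\<^esub> cls (z w)} K (vec L)"
      by (rule equalizer_submodule[OF vec_rm UK_right_module
            rmod_hom_comp[OF A_to_Sw_hom_l[OF zw] cls_Sw_hom]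
            rmod_hom_comp[OF inc_K_hom UK_mult_right_hom[OF cls_Sw_closed[OF zw]]]])
    moreover have "B \<subseteq> {x \<in> carrier (vec L). cls (A x (z w)) = inc x \<otimes>\<^bsub>U\<^esub> cls (z w)}"
      using B_sub basis w W A_basis by auto
    ultimately show ?thesis using L_spanned[OF _ _ l] by blast
  qed
  show ?thesis
    by (rule freemod_rmod_hom_eqI[OF UK_right_module
          restr[OF rmod_hom_comp[OF A_to_Sw_hom[OF l] cls_Sw_hom]]
          restr[OF rmod_hom_comp[OF cls_Sw_hom UK_mult_left_hom[OF inc_closed[OF l]]]] word s])
qed

text \<open>The recursion for \<open>arr\<close> mirrors the identity b j M = j b M + [b, j] M of
  U(L). The induction is on the length bound because \<open>cls_A_linear\<close> uses the claim for
  all words of \<open>W n\<close> at once.\<close>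

lemma cls_arr: "\<lbrakk>b \<in> B; w \<in> W n\<rbrakk> \<Longrightarrow> cls (arr b w) = inc b \<otimes>\<^bsub>U\<^esub> cls (z w)"
proof (induction n arbitrary: b w)
  case 0
  then have "w = []" by (auto simp: W_def)
  then show ?case using arr_le[OF 0(1), of w] 0 B_sub by (auto simp: cls_monomial_Cons)
next
  case (Suc n)
  have w: "w \<in> Ws" "w \<in> lists (carrier L)" using Suc.prems W_Ws Ws_lists by auto
  have bL: "b \<in> carrier L" using Suc.prems B_sub by auto
  show ?case
  proof (cases "srt (b # w)")
    case True
    then show ?thesis using arr_le[OF Suc.prems(1) True] bL w by (simp add: cls_monomial_Cons)
  next
    case False
    then obtain j M where jM: "w = j # M" by (cases w) auto
    have M: "M \<in> W n" "M \<in> Ws" "j \<in> B" "M \<in> lists (carrier L)" and nle: "\<not> lq b j"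
      using Suc.prems jM False srt_Cons_le[of b j M] w by (auto simp: W_def Ws_def)
    have jL: "j \<in> carrier L" using M B_sub by auto
    have brL: "bracket L b j \<in> carrier L" using bL jL by (rule bracket_closed)
    have il: "ins lq b M \<in> lists (carrier L)" using M bL by auto
    define d where "d = arr b M \<ominus>\<^bsub>V\<^esub> z (ins lq b M)"
    have dn: "d \<in> S n" unfolding d_def by (rule arr_diff_S[OF Suc.prems(1) M(1)])
    have d: "d \<in> Sw" by (rule S_Ws[OF dn])
    have zi: "z (ins lq b M) \<in> Sw" by (rule z_Sw[OF ins_Ws[OF Suc.prems(1) M(2)]])
    have zM: "z M \<in> S n" by (rule z_S[OF M(1)])
    have "arr b M = z (ins lq b M) \<oplus>\<^bsub>V\<^esub> d"
      using Sw_V[OF zi] arr_V[OF Suc.prems(1) M(2)] unfolding d_def a_minus_def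
      by (simp add: V.M.a_lcomm V.M.r_neg)
    then have bM: "inc b \<otimes>\<^bsub>U\<^esub> cls (z M) = cls (z (ins lq b M)) \<oplus>\<^bsub>U\<^esub> cls d"
      using Suc.IH[OF Suc.prems(1) M(1)] cls_Sw_add[OF zi d] by simp
    have zj: "z (j # ins lq b M) \<in> Sw"
      using ins_Ws[OF Suc.prems(1) w(1)] nle jM by (intro z_Sw) simp
    have Ad: "A j d \<in> Sw" "A (bracket L b j) (z M) \<in> Sw"
      using A_Sw[OF jL d] A_Sw[OF brL S_Ws[OF zM]] by auto
    have cM: "cls (z M) \<in> carrier U" using cls_Sw_closed[OF S_Ws[OF zM]] .
    have "cls (arr b w) = cls (z (j # ins lq b M)) \<oplus>\<^bsub>U\<^esub> (cls (A j d) \<oplus>\<^bsub>U\<^esub> cls (A (bracket L b j) (z M)))"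
      using arr_gt[OF Suc.prems(1) w(1)[unfolded jM] nle] cls_Sw_add[OF zj Sw_add[OF Ad]] cls_Sw_add[OF Ad]
      by (simp add: jM d_def)
    also have "\<dots> = inc j \<otimes>\<^bsub>U\<^esub> cls (z (ins lq b M)) \<oplus>\<^bsub>U\<^esub> (inc j \<otimes>\<^bsub>U\<^esub> cls d \<oplus>\<^bsub>U\<^esub> inc (bracket L b j) \<otimes>\<^bsub>U\<^esub> cls (z M))"
      using cls_A_linear[OF Suc.IH jL dn] cls_A_linear[OF Suc.IH brL zM] jL il
      by (simp add: cls_monomial_Cons)
    also have "\<dots> = inc j \<otimes>\<^bsub>U\<^esub> (inc b \<otimes>\<^bsub>U\<^esub> cls (z M)) \<oplus>\<^bsub>U\<^esub> inc (bracket L b j) \<otimes>\<^bsub>U\<^esub> cls (z M)"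
      unfolding bM using jL brL d zi cM by (simp add: U.r_distr U.a_assoc)
    also have "\<dots> = (inc j \<otimes>\<^bsub>U\<^esub> inc b \<oplus>\<^bsub>U\<^esub> inc (bracket L b j)) \<otimes>\<^bsub>U\<^esub> cls (z M)"
      using jL bL brL cM by (simp add: U.l_distr U.m_assoc)
    also have "inc j \<otimes>\<^bsub>U\<^esub> inc b \<oplus>\<^bsub>U\<^esub> inc (bracket L b j) = inc b \<otimes>\<^bsub>U\<^esub> inc j"
      using jL bL by (simp add: inc_bracket a_minus_def U.a_lcomm U.r_neg)
    also have "(inc b \<otimes>\<^bsub>U\<^esub> inc j) \<otimes>\<^bsub>U\<^esub> cls (z M) = inc b \<otimes>\<^bsub>U\<^esub> cls (z w)"
      using jL bL cM M by (simp add: jM U.m_assoc cls_monomial_Cons)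
    finally show ?thesis .
  qed
qed

lemma cls_A:
  assumes "l \<in> carrier L" "s \<in> Sw"
  shows "cls (A l s) = inc l \<otimes>\<^bsub>U\<^esub> cls s"
proof -
  obtain n where "s \<in> S n" using Sw_S assms(2) by blast
  then show ?thesis by (rule cls_A_linear[OF _ assms(1), rotated]) (rule cls_arr)
qed

definition "actw w s = foldr A w s"
definition "act f s = lsum K V (\<lambda>w. actw w s) f"

lemma actw_Sw: "\<lbrakk>w \<in> lists (carrier L); s \<in> Sw\<rbrakk> \<Longrightarrow> actw w s \<in> Sw"
  by (induction w) (auto simp: actw_def intro: A_Sw)

lemma actw_hom: "w \<in> lists (carrier L) \<Longrightarrow> actw w \<in> rmod_hom K (freemod K Ws) (freemod K Ws)"
proof (induction w)
  case Nil
  then show ?case using rmod_hom_id by (simp add: actw_def[abs_def])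
next
  case (Cons x w)
  then have "(\<lambda>s. A x (actw w s)) \<in> rmod_hom K (freemod K Ws) (freemod K Ws)"
    by (intro rmod_hom_comp[OF _ A_to_Sw_hom]) auto
  then show ?case by (simp add: actw_def[abs_def])
qed

lemma act_hom: "s \<in> Sw \<Longrightarrow> (\<lambda>f. act f s) \<in> rmod_hom K (freemod K (lists (carrier L))) V"
  unfolding act_def by (rule lsum_hom[OF V.right_module_axioms]) (auto intro: Sw_V actw_Sw)

lemma act_Sw: "\<lbrakk>f \<in> carrier F; s \<in> Sw\<rbrakk> \<Longrightarrow> act f s \<in> Sw"
  unfolding act_def free_algebra_simps
  by (rule lsum_in_submodule[OF V.right_module_axioms Sw_sub]) (auto intro: actw_Sw)

lemma act_add_f: "\<lbrakk>f \<in> carrier F; g \<in> carrier F; s \<in> Sw\<rbrakk> \<Longrightarrow> act (f \<oplus>\<^bsub>F\<^esub> g) s = act f s \<oplus>\<^bsub>V\<^esub> act g s"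
  using rmod_hom_add[OF act_hom, of s f g] by (simp add: free_algebra_simps(1,4) freemod_simps)

lemma act_additive: "s \<in> Sw \<Longrightarrow> additive_map F V (\<lambda>f. act f s)"
  by (rule additive_mapI) (auto simp: act_add_f intro: Sw_V act_Sw)

lemma act_zero_f: "s \<in> Sw \<Longrightarrow> act \<zero>\<^bsub>F\<^esub> s = \<zero>\<^bsub>V\<^esub>"
  using additive_map_zero[OF F.is_abelian_group V.abelian_group_M act_additive] .

lemma act_single: "\<lbrakk>a \<in> carrier K; w \<in> lists (carrier L); s \<in> Sw\<rbrakk> \<Longrightarrow> act (single K a w) s = a \<odot>\<^bsub>V\<^esub> actw w s"
  unfolding act_def using lsum_single[OF V.right_module_axioms, of "\<lambda>w. actw w s" w a] actw_Sw Sw_V by blast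

lemma actw_add: "\<lbrakk>w \<in> lists (carrier L); s \<in> Sw; t \<in> Sw\<rbrakk> \<Longrightarrow> actw w (s \<oplus>\<^bsub>V\<^esub> t) = actw w s \<oplus>\<^bsub>V\<^esub> actw w t"
  using rmod_hom_add[OF actw_hom, of w s t] by (simp add: freemod_simps)

lemma actw_smult: "\<lbrakk>w \<in> lists (carrier L); r \<in> carrier K; s \<in> Sw\<rbrakk> \<Longrightarrow> actw w (r \<odot>\<^bsub>V\<^esub> s) = r \<odot>\<^bsub>V\<^esub> actw w s"
  using rmod_hom_smult[OF actw_hom, of w r s] by (simp add: freemod_simps)

lemma actw_zero: "w \<in> lists (carrier L) \<Longrightarrow> actw w \<zero>\<^bsub>V\<^esub> = \<zero>\<^bsub>V\<^esub>"
  using rmod_hom_zero[OF freemod_right_module[OF K_ring] freemod_right_module[OF K_ring] actw_hom]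
  by (simp add: freemod_simps)

lemma act_mult:
  assumes f: "f \<in> carrier F" and g: "g \<in> carrier F" and s: "s \<in> Sw"
  shows "act (f \<otimes>\<^bsub>F\<^esub> g) s = act f (act g s)"
  using f
proof (induction rule: F_induct)
  case 1
  then show ?case using g s by (simp add: act_zero_f act_Sw)
next
  case (2 a u)
  note au = this
  show ?case using g
  proof (induction rule: F_induct)
    case 1
    then show ?case
      using au s Sw_zero by (simp add: act_zero_f F_single act_single actw_zero)
  next
    case (2 b v)
    have "act (single K a u \<otimes>\<^bsub>F\<^esub> single K b v) s = (a \<otimes> b) \<odot>\<^bsub>V\<^esub> actw u (actw v s)"
      using au 2 s by (simp add: F_single_mult act_single) (simp add: actw_def)
    also have "\<dots> = (b \<otimes> a) \<odot>\<^bsub>V\<^esub> actw u (actw v s)" using au 2 by (simp add: m_comm)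
    also have "\<dots> = a \<odot>\<^bsub>V\<^esub> actw u (b \<odot>\<^bsub>V\<^esub> actw v s)"
      using au 2 s by (simp add: V.right_assoc actw_Sw Sw_V actw_smult)
    finally show ?case using au 2 s by (simp add: act_single Sw_smult actw_Sw)
  next
    case (3 g h)
    then show ?case using au s
      by (simp add: F_single F.r_distr act_add_f act_single act_Sw Sw_add actw_add V.add_vector Sw_V actw_Sw)
  qed
next
  case (3 f h)
  then show ?case using g s by (simp add: F.l_distr act_add_f act_Sw)
qed

lemma act_letter: "\<lbrakk>x \<in> carrier L; s \<in> Sw\<rbrakk> \<Longrightarrow> act (z [x]) s = A x s"
  using act_single[of \<one> "[x]" s] by (simp add: actw_def V.unit A_V)

lemma act_diff: "\<lbrakk>f \<in> carrier F; g \<in> carrier F; s \<in> Sw\<rbrakk> \<Longrightarrow> act (f \<ominus>\<^bsub>F\<^esub> g) s = act f s \<ominus>\<^bsub>V\<^esub> act g s"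
  using additive_map_diff[OF F.is_abelian_group V.abelian_group_M act_additive] by blast

text \<open>The elements of the free algebra that act as zero form an ideal. It contains the bracket
  relations by \<open>rel\<close>, and the linear ones because \<open>A\<close> is linear in the
  letter.\<close>

lemma act_env_ideal:
  assumes "f \<in> env_ideal K L" "s \<in> Sw"
  shows "act f s = \<zero>\<^bsub>V\<^esub>"
proof -
  let ?T = "{f \<in> carrier F. \<forall>s\<in>Sw. act f s = \<zero>\<^bsub>V\<^esub>}"
  have "ideal ?T F"
  proof (rule idealI[OF F.ring_axioms])
    show "subgroup ?T (add_monoid F)"
    proof (rule subgroup.intro)
      show "inv\<^bsub>add_monoid F\<^esub> x \<in> ?T" if "x \<in> ?T" for x
      proof -
        have "\<ominus>\<^bsub>F\<^esub> x \<in> ?T"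
          using that additive_map_neg[OF F.is_abelian_group V.abelian_group_M act_additive, of _ x] by auto
        then show ?thesis by (simp add: a_inv_def)
      qed
    qed (auto simp: act_add_f act_zero_f)
    fix f g assume f: "f \<in> ?T" and g: "g \<in> carrier F"
    have "act g \<zero>\<^bsub>V\<^esub> = \<zero>\<^bsub>V\<^esub>"
      using act_mult[OF g F.zero_closed Sw_zero] act_zero_f[OF Sw_zero] g by simp
    then show "g \<otimes>\<^bsub>F\<^esub> f \<in> ?T" using f g by (auto simp: act_mult)
    show "f \<otimes>\<^bsub>F\<^esub> g \<in> ?T" using f g by (auto simp: act_mult act_Sw)
  qed
  moreover have "env_relations K L \<subseteq> ?T"
  proof
    fix f assume f: "f \<in> env_relations K L"
    have "act f s = \<zero>\<^bsub>V\<^esub>" if s: "s \<in> Sw" for s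
    proof -
      from f consider x y where "x \<in> carrier L" "y \<in> carrier L"
          "f = z [x \<oplus>\<^bsub>L\<^esub> y] \<ominus>\<^bsub>F\<^esub> (z [x] \<oplus>\<^bsub>F\<^esub> z [y])"
        | a x where "a \<in> carrier K" "x \<in> carrier L"
          "f = z [a \<odot>\<^bsub>L\<^esub> x] \<ominus>\<^bsub>F\<^esub> single K a [x]"
        | x y where "x \<in> carrier L" "y \<in> carrier L"
          "f = z [bracket L x y] \<ominus>\<^bsub>F\<^esub> (z [x] \<otimes>\<^bsub>F\<^esub> z [y] \<ominus>\<^bsub>F\<^esub> z [y] \<otimes>\<^bsub>F\<^esub> z [x])"
        by (auto simp: env_relations_def Let_def monomial_eq_single)
      then show ?thesis
      proof cases
        case 1
        then show ?thesis using s
          by (simp add: act_diff act_add_f act_letter F_single L_add A_add_l)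
            (simp add: a_minus_def V.M.r_neg A_V)
      next
        case 2
        have "act (single K a [x]) s = a \<odot>\<^bsub>V\<^esub> A x s" using 2 s by (simp add: act_single actw_def)
        then show ?thesis using s 2
          by (simp add: act_diff act_letter F_single L_smult A_smult_l)
            (simp add: a_minus_def V.M.r_neg A_V)
      next
        case 3
        have c: "A x (A y s) \<in> carrier V" "A y (A x s) \<in> carrier V" "A (bracket L x y) s \<in> carrier V"
          using 3 s by (auto intro!: A_V A_Sw bracket_closed)
        have "A x (A y s) = A y (A x s) \<oplus>\<^bsub>V\<^esub> A (bracket L x y) s" using relD[OF rel] 3 s by blast
        then have "A x (A y s) \<ominus>\<^bsub>V\<^esub> A y (A x s) = A (bracket L x y) s"
          using V.M.add_diff_cancel c by simp
        then show ?thesis using s 3 c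
          by (simp add: act_diff act_letter act_mult F_single L_bracket A_Sw F.minus_closed)
            (simp add: a_minus_def V.M.r_neg)
      qed
    qed
    then show "f \<in> ?T" using f env_relations_closed by blast
  qed
  ultimately have "env_ideal K L \<subseteq> ?T" unfolding env_ideal_def by (rule F.genideal_minimal)
  then show ?thesis using assms by blast
qed

lemma cls_act:
  assumes f: "f \<in> carrier F" and s: "s \<in> Sw"
  shows "cls (act f s) = cls f \<otimes>\<^bsub>U\<^esub> cls s"
  using f
proof (induction rule: F_induct)
  case 1
  then show ?case using s rmod_hom_zero[OF freemod_right_module[OF K_ring] UK_right_module cls_Sw_hom]
      additive_map_zero[OF F.is_abelian_group U.is_abelian_group cls_additive]
    by (simp add: act_zero_f freemod_simps)
next
  case (2 a w)
  have "cls (actw w s) = cls (z w) \<otimes>\<^bsub>U\<^esub> cls s" using 2(2)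
  proof (induction w)
    case Nil
    then show ?case using s cls_one by (simp add: actw_def free_algebra_simps(3))
  next
    case (Cons x w)
    then have "cls (actw (x # w) s) = inc x \<otimes>\<^bsub>U\<^esub> cls (actw w s)"
      using cls_A[of x "actw w s"] actw_Sw[of w s] s by (simp add: actw_def)
    then show ?case using Cons s by (simp add: cls_monomial_Cons U.m_assoc F_single)
  qed
  moreover have "cls (a \<odot>\<^bsub>V\<^esub> actw w s) = sca a \<otimes>\<^bsub>U\<^esub> cls (actw w s)"
    using rmod_hom_smult[OF cls_Sw_hom 2(1) actw_Sw[OF 2(2) s]] by (simp add: freemod_simps)
  ultimately show ?case using 2 s cls_monomial_scalar[of a w] by (simp add: act_single U.m_assoc F_single)
next
  case (3 f g)
  then show ?case using s by (simp add: act_add_f cls_Sw_add act_Sw cls_add U.l_distr)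
qed

text \<open>A sorted word is rebuilt from the empty word letter by letter, each step being a mere
  prefixing.\<close>

lemma act_unit:
  assumes "s \<in> Sw"
  shows "act s (z []) = s"
proof (rule freemod_rmod_hom_eqI[OF V.right_module_axioms _ _ _ assms])
  have e: "z [] \<in> Sw" by (rule z_Sw) (simp add: Ws_def)
  show "(\<lambda>s. act s (z [])) \<in> rmod_hom K (freemod K Ws) V"
    using act_hom[OF e] Sw_F by (auto simp: rmod_hom_def freemod_simps)
  show "(\<lambda>s. s) \<in> rmod_hom K (freemod K Ws) V" using Sw_V by (auto simp: rmod_hom_def freemod_simps)
  fix w assume w: "w \<in> Ws"
  have "actw w (z []) = z w" using w
  proof (induction w)
    case (Cons b w)
    then have "b \<in> B" "w \<in> Ws" "srt (b # w)" by (auto simp: Ws_def)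
    then show ?case using Cons.IH A_basis arr_le by (simp add: actw_def)
  qed (simp add: actw_def)
  then show "act (z w) (z []) = z w"
    using act_single[of \<one> w "z []"] w Ws_lists e Sw_V[OF z_Sw[OF w]] by (auto simp: V.unit)
qed

text \<open>Since the action factors through U(L), a combination s of sorted words is recovered from
  its class by acting on the empty word; this gives injectivity. For surjectivity, the result of
  letting f act on the empty word is a combination of sorted words with the same class as f.\<close>

theorem pbw: "bij_betw cls Sw (carrier U)"
proof -
  have e: "z [] \<in> Sw" by (rule z_Sw) (simp add: Ws_def)
  have SwF: "s \<in> carrier F" if "s \<in> Sw" for s using Sw_F[OF that] by (simp add: free_algebra_simps)
  have inj: "s = t" if s: "s \<in> Sw" and t: "t \<in> Sw" and eq: "cls s = cls t" for s t
  proof -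
    have "act (s \<ominus>\<^bsub>F\<^esub> t) (z []) = \<zero>\<^bsub>V\<^esub>"
      using act_env_ideal[OF _ e] eq cls_eq_iff[OF SwF SwF] s t by blast
    then have "s \<ominus>\<^bsub>V\<^esub> t = \<zero>\<^bsub>V\<^esub>" using act_diff[OF SwF[OF s] SwF[OF t] e] act_unit s t by simp
    then show ?thesis using V.M.diff_zero_imp_eq Sw_V s t by blast
  qed
  have "u \<in> cls ` Sw" if u: "u \<in> carrier U" for u
  proof -
    obtain f where f: "f \<in> carrier F" "u = cls f" using cls_surj[OF u] .
    have "cls (act f (z [])) = u" using cls_act[OF f(1) e] f cls_one by (simp add: free_algebra_simps(3))
    then show ?thesis using act_Sw[OF f(1) e] by (metis imageI)
  qed
  then show ?thesis using inj by (auto simp: bij_betw_def inj_on_def)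
qed

end

section \<open>Restriction to an ideal\<close>

lemma restrict_scalars_simps [simp]:
  "carrier (restrict_scalars \<theta> M) = carrier M" "zero (restrict_scalars \<theta> M) = zero M"
  "add (restrict_scalars \<theta> M) = add M" "r \<odot>\<^bsub>restrict_scalars \<theta> M\<^esub> x = \<theta> r \<odot>\<^bsub>M\<^esub> x"
  by (simp_all add: restrict_scalars_def)

lemma restrict_scalars_right_module:
  assumes S: "ring S" and M: "right_module R M" and \<theta>: "\<theta> \<in> ring_hom S R"
  shows "right_module S (restrict_scalars \<theta> M)"
proof -
  interpret M: right_module R M by fact
  note [simp] = ring_hom_closed[OF \<theta>]
  show ?thesis
  proof (intro right_module.intro right_module_axioms.intro S abelian_groupI)
    fix x assume "x \<in> carrier (restrict_scalars \<theta> M)"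
    then show "\<exists>y\<in>carrier (restrict_scalars \<theta> M). y \<oplus>\<^bsub>restrict_scalars \<theta> M\<^esub> x = \<zero>\<^bsub>restrict_scalars \<theta> M\<^esub>"
      by (auto intro!: bexI[of _ "\<ominus>\<^bsub>M\<^esub> x"] simp: M.M.l_neg)
  qed (auto simp: M.M.a_assoc M.M.a_comm M.M.a_lcomm ring_hom_add[OF \<theta>] ring_hom_mult[OF \<theta>] ring_hom_one[OF \<theta>]
      M.add_scalar M.add_vector M.right_assoc M.unit)
qed

lemma restrict_scalars_hom:
  assumes "\<theta> \<in> ring_hom S R" "h \<in> rmod_hom R M M'"
  shows "h \<in> rmod_hom S (restrict_scalars \<theta> M) (restrict_scalars \<theta> M')"
  using assms ring_hom_closed[OF assms(1)] by (auto simp: rmod_hom_def)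

text \<open>Each R-coordinate of the free module on X is expanded over S along W, so a summand of it
  becomes a summand of the free S-module on X \<times> W.\<close>

lemma free_retract_restrict:
  assumes S: "ring S" and R: "ring R" and \<theta>: "\<theta> \<in> ring_hom S R" and P: "right_module R P"
    and fP: "free_retract R P X s e"
    and fR: "free_retract S (restrict_scalars \<theta> (regmod R)) W sW eW"
  shows "free_retract S (restrict_scalars \<theta> P) (X \<times> W)
    (\<lambda>p (x, w). sW (s p x) w) (\<lambda>g. e (\<lambda>x. eW (\<lambda>w. g (x, w))))"
proof -
  interpret S: ring S by fact
  interpret R: ring R by fact
  let ?RR = "restrict_scalars \<theta> (regmod R)"
  have RR: "right_module S ?RR"
    by (rule restrict_scalars_right_module[OF S regmod_right_module[OF R] \<theta>])
  have FW: "right_module S (freemod S W)" by (rule freemod_right_module[OF S])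
  have s: "s \<in> rmod_hom R P (freemod R X)" and e: "e \<in> rmod_hom R (freemod R X) P"
    and es: "\<And>p. p \<in> carrier P \<Longrightarrow> e (s p) = p" using fP by (auto simp: free_retract_def)
  have sW: "sW \<in> rmod_hom S ?RR (freemod S W)" and eW: "eW \<in> rmod_hom S (freemod S W) ?RR"
    and eWs: "\<And>r. r \<in> carrier R \<Longrightarrow> eW (sW r) = r" using fR by (auto simp: free_retract_def)
  note sWc = rmod_hom_closed[OF sW, simplified] and eWc = rmod_hom_closed[OF eW, simplified]
  have sW0: "sW \<zero>\<^bsub>R\<^esub> = (\<lambda>w. \<zero>\<^bsub>S\<^esub>)"
    using rmod_hom_zero[OF RR FW sW] by (simp add: freemod_simps)
  have eW0: "eW (\<lambda>w. \<zero>\<^bsub>S\<^esub>) = \<zero>\<^bsub>R\<^esub>"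
    using rmod_hom_zero[OF FW RR eW] by (simp add: freemod_simps)
  note spc = rmod_hom_closed[OF s]
  have sp: "s p x \<in> carrier R" if "p \<in> carrier P" for p x using freemodD(1)[OF spc[OF that]] .
  have row: "(\<lambda>w. g (x, w)) \<in> carrier (freemod S W)" if g: "g \<in> carrier (freemod S (X \<times> W))" for g x
  proof (rule freemodI)
    have "finite (snd ` {p. g p \<noteq> \<zero>\<^bsub>S\<^esub>})" using freemodD(2)[OF g] by simp
    moreover have "{w. g (x, w) \<noteq> \<zero>\<^bsub>S\<^esub>} \<subseteq> snd ` {p. g p \<noteq> \<zero>\<^bsub>S\<^esub>}" by force
    ultimately show "finite {w. g (x, w) \<noteq> \<zero>\<^bsub>S\<^esub>}" by (rule finite_subset[rotated])
  qed (use freemodD(1)[OF g] freemodD(4)[OF g] in auto)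
  have e_in: "(\<lambda>x. eW (\<lambda>w. g (x, w))) \<in> carrier (freemod R X)" if g: "g \<in> carrier (freemod S (X \<times> W))" for g
  proof (rule freemodI)
    have fin: "finite (fst ` {p. g p \<noteq> \<zero>\<^bsub>S\<^esub>})" using freemodD(2)[OF g] by simp
    have mem: "x \<in> fst ` {p. g p \<noteq> \<zero>\<^bsub>S\<^esub>}" if "eW (\<lambda>w. g (x, w)) \<noteq> \<zero>\<^bsub>R\<^esub>" for x
    proof (rule ccontr)
      assume "x \<notin> fst ` {p. g p \<noteq> \<zero>\<^bsub>S\<^esub>}"
      then have "g (x, w) = \<zero>\<^bsub>S\<^esub>" for w by (metis (mono_tags) fst_conv image_eqI mem_Collect_eq)
      then show False using that eW0 by simp
    qed
    show "finite {x. eW (\<lambda>w. g (x, w)) \<noteq> \<zero>\<^bsub>R\<^esub>}"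
      by (rule finite_subset[OF _ fin]) (use mem in blast)
    show "eW (\<lambda>w. g (x, w)) = \<zero>\<^bsub>R\<^esub>" if "x \<notin> X" for x
      using that freemodD(4)[OF g] eW0 by simp
  qed (use eWc row[OF g] in auto)
  have s_in: "(\<lambda>(x, w). sW (s p x) w) \<in> carrier (freemod S (X \<times> W))" if p: "p \<in> carrier P" for p
  proof (rule freemodI)
    show "(case y of (x, w) \<Rightarrow> sW (s p x) w) \<in> carrier S" for y
      using freemodD(1)[OF sWc[OF sp[OF p]]] by (cases y) simp
    have "finite (Sigma {x. s p x \<noteq> \<zero>\<^bsub>R\<^esub>} (\<lambda>x. {w. sW (s p x) w \<noteq> \<zero>\<^bsub>S\<^esub>}))"
      using freemodD(2)[OF spc[OF p]] freemodD(2)[OF sWc[OF sp[OF p]]] by (intro finite_SigmaI) auto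
    then show "finite {y. (case y of (x, w) \<Rightarrow> sW (s p x) w) \<noteq> \<zero>\<^bsub>S\<^esub>}"
      by (rule finite_subset[rotated]) (use sW0 in force)
    show "(case y of (x, w) \<Rightarrow> sW (s p x) w) = \<zero>\<^bsub>S\<^esub>" if "y \<notin> X \<times> W" for y
      using that freemodD(4)[OF spc[OF p]] freemodD(4)[OF sWc[OF sp[OF p]]] sW0 by (cases y) auto
  qed
  show ?thesis unfolding free_retract_def
  proof (intro conjI ballI)
    show "(\<lambda>p (x, w). sW (s p x) w) \<in> rmod_hom S (restrict_scalars \<theta> P) (freemod S (X \<times> W))"
    proof (rule rmod_homI)
      fix p q assume pq: "p \<in> carrier (restrict_scalars \<theta> P)" "q \<in> carrier (restrict_scalars \<theta> P)"
      have "s (p \<oplus>\<^bsub>P\<^esub> q) = (\<lambda>x. s p x \<oplus>\<^bsub>R\<^esub> s q x)" using pq rmod_hom_add[OF s] by (simp add: freemod_simps)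
      moreover have "sW (s p x \<oplus>\<^bsub>R\<^esub> s q x) = (\<lambda>w. sW (s p x) w \<oplus>\<^bsub>S\<^esub> sW (s q x) w)" for x
        using rmod_hom_add[OF sW, of "s p x" "s q x"] sp pq by (simp add: freemod_simps)
      ultimately show "(\<lambda>(x, w). sW (s (p \<oplus>\<^bsub>restrict_scalars \<theta> P\<^esub> q) x) w) =
          (\<lambda>(x, w). sW (s p x) w) \<oplus>\<^bsub>freemod S (X \<times> W)\<^esub> (\<lambda>(x, w). sW (s q x) w)"
        by (auto simp: freemod_simps)
    next
      fix r p assume r: "r \<in> carrier S" and p: "p \<in> carrier (restrict_scalars \<theta> P)"
      have "s (\<theta> r \<odot>\<^bsub>P\<^esub> p) = (\<lambda>x. s p x \<otimes>\<^bsub>R\<^esub> \<theta> r)"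
        using p rmod_hom_smult[OF s ring_hom_closed[OF \<theta> r]] by (simp add: freemod_simps)
      moreover have "sW (s p x \<otimes>\<^bsub>R\<^esub> \<theta> r) = (\<lambda>w. sW (s p x) w \<otimes>\<^bsub>S\<^esub> r)" for x
        using rmod_hom_smult[OF sW r, of "s p x"] sp p by (simp add: freemod_simps)
      ultimately show "(\<lambda>(x, w). sW (s (r \<odot>\<^bsub>restrict_scalars \<theta> P\<^esub> p) x) w) =
          r \<odot>\<^bsub>freemod S (X \<times> W)\<^esub> (\<lambda>(x, w). sW (s p x) w)"
        by (auto simp: freemod_simps)
    qed (use s_in in simp)
    show "(\<lambda>g. e (\<lambda>x. eW (\<lambda>w. g (x, w)))) \<in> rmod_hom S (freemod S (X \<times> W)) (restrict_scalars \<theta> P)"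
    proof (rule rmod_homI)
      fix g h assume gh: "g \<in> carrier (freemod S (X \<times> W))" "h \<in> carrier (freemod S (X \<times> W))"
      have "eW (\<lambda>w. g (x, w) \<oplus>\<^bsub>S\<^esub> h (x, w)) = eW (\<lambda>w. g (x, w)) \<oplus>\<^bsub>R\<^esub> eW (\<lambda>w. h (x, w))" for x
        using rmod_hom_add[OF eW row[OF gh(1)] row[OF gh(2)], of x x] by (simp add: freemod_simps)
      then show "e (\<lambda>x. eW (\<lambda>w. (g \<oplus>\<^bsub>freemod S (X \<times> W)\<^esub> h) (x, w))) =
          e (\<lambda>x. eW (\<lambda>w. g (x, w))) \<oplus>\<^bsub>restrict_scalars \<theta> P\<^esub> e (\<lambda>x. eW (\<lambda>w. h (x, w)))"
        using rmod_hom_add[OF e e_in[OF gh(1)] e_in[OF gh(2)]] by (simp add: freemod_simps)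
    next
      fix r g assume r: "r \<in> carrier S" and g: "g \<in> carrier (freemod S (X \<times> W))"
      have "eW (\<lambda>w. g (x, w) \<otimes>\<^bsub>S\<^esub> r) = eW (\<lambda>w. g (x, w)) \<otimes>\<^bsub>R\<^esub> \<theta> r" for x
        using rmod_hom_smult[OF eW r row[OF g], of x] by (simp add: freemod_simps)
      then show "e (\<lambda>x. eW (\<lambda>w. (r \<odot>\<^bsub>freemod S (X \<times> W)\<^esub> g) (x, w))) =
          r \<odot>\<^bsub>restrict_scalars \<theta> P\<^esub> e (\<lambda>x. eW (\<lambda>w. g (x, w)))"
        using rmod_hom_smult[OF e ring_hom_closed[OF \<theta> r] e_in[OF g]] by (simp add: freemod_simps)
    qed (use e_in rmod_hom_closed[OF e] in simp)
    fix p assume p: "p \<in> carrier (restrict_scalars \<theta> P)"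
    have "(\<lambda>x. eW (\<lambda>w. case (x, w) of (x, w) \<Rightarrow> sW (s p x) w)) = s p"
      using eWs sp p by (simp add: fun_eq_iff)
    then show "e (\<lambda>x. eW (\<lambda>w. case (x, w) of (x, w) \<Rightarrow> sW (s p x) w)) = p" using es p by simp
  qed
qed

section \<open>A basis of L adapted to the ideal\<close>

lemma (in lie_algebra) lie_ideal_lie_algebra:
  assumes N: "lie_ideal N K L"
  shows "lie_algebra K (L\<lparr>carrier := N\<rparr>)"
proof -
  have sub: "submodule N K L" and br: "\<And>x n. \<lbrakk>x \<in> carrier L; n \<in> N\<rbrakk> \<Longrightarrow> bracket L x n \<in> N"
    using N by (auto simp: lie_ideal_def)
  have NL: "N \<subseteq> carrier L" using submoduleE(1)[OF sub] .
  have M: "module K (L\<lparr>carrier := N\<rparr>)" by (rule submodule.submodule_is_module[OF sub L_module])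
  show ?thesis
  proof (intro lie_algebra.intro lie_algebra_axioms.intro M)
    show "field K" ..
  qed (use NL br in \<open>auto simp: bracket_add_left bracket_add_right bracket_smult_left bracket_smult_right
      alternating jacobi subset_iff\<close>)
qed

text \<open>A well-order of the type, rearranged so that N comes after everything else. A sorted
  word is then a word outside N followed by a word in N, as is right for U(L) as a right module over
  U(N).\<close>

lemma linear_order_prefix:
  fixes N :: "'a set"
  obtains lq :: "'a \<Rightarrow> 'a \<Rightarrow> bool" where "\<And>x y. lq x y \<or> lq y x"
    "\<And>x y z. \<lbrakk>lq x y; lq y z\<rbrakk> \<Longrightarrow> lq x z" "\<And>x y. \<lbrakk>lq x y; lq y x\<rbrakk> \<Longrightarrow> x = y"
    "\<And>x y. \<lbrakk>lq x y; x \<in> N\<rbrakk> \<Longrightarrow> y \<in> N" "\<And>x y. \<lbrakk>x \<notin> N; y \<in> N\<rbrakk> \<Longrightarrow> lq x y"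
proof -
  obtain r :: "'a rel" where "well_order_on UNIV r" using well_order_on[of UNIV] by (rule exE)
  then have r: "total_on UNIV r" "trans r" "antisym r" "refl_on UNIV r"
    by (simp_all add: well_order_on_def linear_order_on_def partial_order_on_def preorder_on_def)
  have t: "(x, y) \<in> r \<or> (y, x) \<in> r" for x y
    using r(1,4) by (cases "x = y") (auto simp: total_on_def refl_on_def)
  have tr: "\<lbrakk>(x, y) \<in> r; (y, z) \<in> r\<rbrakk> \<Longrightarrow> (x, z) \<in> r" for x y z using r(2) by (rule transD)
  have an: "\<lbrakk>(x, y) \<in> r; (y, x) \<in> r\<rbrakk> \<Longrightarrow> x = y" for x y using r(3) by (rule antisymD)
  define lq where "lq x y \<longleftrightarrow> (if x \<in> N then y \<in> N \<and> (x, y) \<in> r else y \<in> N \<or> (x, y) \<in> r)" for x y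
  show thesis
  proof (rule that[of lq])
    show "lq x y \<or> lq y x" for x y using t by (auto simp: lq_def)
    show "\<lbrakk>lq x y; lq y z\<rbrakk> \<Longrightarrow> lq x z" for x y z using tr[of x y z] by (auto simp: lq_def split: if_splits)
    show "\<lbrakk>lq x y; lq y x\<rbrakk> \<Longrightarrow> x = y" for x y using an by (auto simp: lq_def split: if_splits)
  qed (auto simp: lq_def split: if_splits)
qed

lemma (in lie_algebra) adapted_basis:
  assumes N: "lie_ideal N K L"
  obtains B BN co coN lq where "lie_basis K L B co lq" "lie_basis K (L\<lparr>carrier := N\<rparr>) BN coN lq"
    "BN \<subseteq> B" "\<And>x y. \<lbrakk>lq x y; x \<in> BN\<rbrakk> \<Longrightarrow> y \<in> BN" "\<And>x y. \<lbrakk>x \<notin> BN; y \<in> BN\<rbrakk> \<Longrightarrow> lq x y"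
proof -
  let ?LN = "L\<lparr>carrier := N\<rparr>"
  interpret N: lie_algebra K ?LN by (rule lie_ideal_lie_algebra[OF N])
  have NL: "N \<subseteq> carrier L" using N submoduleE(1) by (auto simp: lie_ideal_def)
  have fld: "field K" ..
  note VN = N.vec_rm and VL = vec_rm
  interpret VL: right_module K "vec L" by (rule VL)
  have "lin_indep K (vec ?LN) {}"
    by (auto simp: lin_indep_def freemod_def)
  then obtain BN where BN: "lin_indep K (vec ?LN) BN"
    "lsum K (vec ?LN) (\<lambda>v. v) ` carrier (freemod K BN) = carrier (vec ?LN)"
    using basis_extension[OF fld VN] by metis
  have BNN: "BN \<subseteq> N" using BN(1) by (simp add: lin_indep_def)
  then have BNf: "(\<lambda>v. v) \<in> BN \<rightarrow> carrier (vec ?LN)" "(\<lambda>v. v) \<in> BN \<rightarrow> carrier (vec L)" using NL by auto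
  \<comment> \<open>Sums formed in N and in L belong to records with different carriers. They are
    compared on multiples of basis vectors, so that independence over N gives independence over
    L.\<close>
  have eq: "lsum K (vec ?LN) (\<lambda>v. v) f = lsum K (vec L) (\<lambda>v. v) f" if f: "f \<in> carrier (freemod K BN)" for f
  proof (rule freemod_hom_eqI[OF K_ring VL.abelian_group_M _ rmod_hom_additive[OF lsum_hom[OF VL BNf(2)]] _ f])
    show "additive_map (freemod K BN) (vec L) (lsum K (vec ?LN) (\<lambda>v. v))"
      using rmod_hom_additive[OF lsum_hom[OF VN BNf(1)]] NL by (auto simp: additive_map_def)
    fix a i assume a: "a \<in> carrier K" and "i \<in> BN"
    then have "i \<in> N" "i \<in> carrier L" using BNN NL by auto
    then show "lsum K (vec ?LN) (\<lambda>v. v) (single K a i) = lsum K (vec L) (\<lambda>v. v) (single K a i)"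
      using lsum_single[OF VN, of "\<lambda>v. v" i a] lsum_single[OF VL, of "\<lambda>v. v" i a] a by simp
  qed
  have "lin_indep K (vec L) BN" using BN(1) eq NL by (auto simp: lin_indep_def)
  then obtain B where B: "BN \<subseteq> B" "lin_indep K (vec L) B"
    "lsum K (vec L) (\<lambda>v. v) ` carrier (freemod K B) = carrier (vec L)"
    using basis_extension[OF fld VL] by metis
  obtain lq :: "'l \<Rightarrow> 'l \<Rightarrow> bool" where lq: "\<And>x y. lq x y \<or> lq y x"
    "\<And>x y z. \<lbrakk>lq x y; lq y z\<rbrakk> \<Longrightarrow> lq x z" "\<And>x y. \<lbrakk>lq x y; lq y x\<rbrakk> \<Longrightarrow> x = y"
    "\<And>x y. \<lbrakk>lq x y; x \<in> BN\<rbrakk> \<Longrightarrow> y \<in> BN" "\<And>x y. \<lbrakk>x \<notin> BN; y \<in> BN\<rbrakk> \<Longrightarrow> lq x y"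
    by (rule linear_order_prefix[of BN]) (rule that)
  have mk: "lie_basis K M X (inv_into (carrier (freemod K X)) (lsum K (vec M) (\<lambda>v. v))) lq"
    if M: "lie_algebra K M" and X: "lin_indep K (vec M) X"
      "lsum K (vec M) (\<lambda>v. v) ` carrier (freemod K X) = carrier (vec M)"
    for M :: "('k, 'l, 'm) lie_scheme" and X
  proof -
    interpret M: lie_algebra K M by (rule M)
    have Xf: "(\<lambda>v. v) \<in> X \<rightarrow> carrier (vec M)" using X(1) by (auto simp: lin_indep_def)
    note bij = lsum_bij[OF M.vec_rm X]
    show ?thesis
    proof (intro lie_basis.intro M lie_basis_axioms.intro)
      show "X \<subseteq> carrier M" using X(1) by (simp add: lin_indep_def)
      show "inv_into (carrier (freemod K X)) (lsum K (vec M) (\<lambda>v. v)) \<in> rmod_hom K (vec M) (freemod K X)"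
        by (rule rmod_hom_inverse[OF freemod_right_module[OF K_ring] lsum_hom[OF M.vec_rm Xf] bij])
      show "inv_into (carrier (freemod K X)) (lsum K (vec M) (\<lambda>v. v)) b = single K \<one> b" if "b \<in> X" for b
      proof (rule inv_into_f_eq)
        show "inj_on (lsum K (vec M) (\<lambda>v. v)) (carrier (freemod K X))" using bij by (simp add: bij_betw_def)
        show "single K \<one> b \<in> carrier (freemod K X)" using that by (intro single_closed[OF K_ring]) auto
        show "lsum K (vec M) (\<lambda>v. v) (single K \<one> b) = b"
          using lsum_single[OF M.vec_rm, of "\<lambda>v. v" b \<one>] that Xf by auto
      qed
      show "lsum K (vec M) (\<lambda>b. b) (inv_into (carrier (freemod K X)) (lsum K (vec M) (\<lambda>v. v)) x) = x"
        if "x \<in> carrier M" for x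
        using that X(2) f_inv_into_f[of x "lsum K (vec M) (\<lambda>v. v)" "carrier (freemod K X)"] by simp
    qed (use lq(1-3) in blast)+
  qed
  show thesis
    by (rule that[OF mk[OF lie_algebra_axioms B(2,3)] mk[OF N.lie_algebra_axioms BN] B(1) lq(4,5)])
qed


section \<open>Freeness of U(L) over U(N)\<close>

locale adapted_lie_basis =
  BL: lie_basis K L B co lq + BN: lie_basis K "L\<lparr>carrier := N\<rparr>" BN coN lq
  for K :: "('k, 'b) ring_scheme" (structure) and L :: "('k, 'l, 'm) lie_scheme"
    and B co lq N BN coN +
  assumes N_ideal: "lie_ideal N K L"
    and BN_sub: "BN \<subseteq> B"
    and lq_up: "\<lbrakk>lq x y; x \<in> BN\<rbrakk> \<Longrightarrow> y \<in> BN"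
    and lq_less: "\<lbrakk>x \<notin> BN; y \<in> BN\<rbrakk> \<Longrightarrow> lq x y"
begin

abbreviation "\<iota> \<equiv> env_map K L (\<lambda>x. x)"

lemma N_sub: "N \<subseteq> carrier L"
  using N_ideal BL.submoduleE(1) by (auto simp: lie_ideal_def)

sublocale mor: env_morphism K "L\<lparr>carrier := N\<rparr>" L "\<lambda>x. x"
  by unfold_locales (use N_sub in auto)

lemma iota_cls:
  assumes f: "f \<in> carrier BN.F"
  shows "\<iota> (BN.cls f) = BL.cls f"
proof (rule freemod_hom_eqI[OF BL.K_ring BL.U.is_abelian_group _ _ _ f[unfolded free_algebra_simps]])
  have LN: "lists (carrier (L\<lparr>carrier := N\<rparr>)) \<subseteq> lists (carrier L)" using N_sub by auto
  have sub: "f \<in> carrier BL.F" if "f \<in> carrier (freemod K (lists (carrier (L\<lparr>carrier := N\<rparr>))))" for f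
    using that freemod_mono[OF BL.K_ring LN] by (auto simp: free_algebra_simps)
  show "additive_map (freemod K (lists (carrier (L\<lparr>carrier := N\<rparr>)))) BL.U (\<lambda>f. \<iota> (BN.cls f))"
    using rmod_hom_additive[OF BN.cls_K_hom] ring_hom_add[OF mor.env_map_hom] ring_hom_closed[OF mor.env_map_hom]
    by (auto simp: additive_map_def Pi_iff)
  show "additive_map (freemod K (lists (carrier (L\<lparr>carrier := N\<rparr>)))) BL.U BL.cls"
    using BL.cls_add BL.cls_closed sub by (auto simp: additive_map_def freemod_simps free_algebra_simps)
  fix a w assume a: "a \<in> carrier K" and w: "w \<in> lists (carrier (L\<lparr>carrier := N\<rparr>))"
  show "\<iota> (BN.cls (single K a w)) = BL.cls (single K a w)" using w
  proof (induction w)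
    case Nil
    then show ?case using mor.env_map_scalar[OF a] by (simp add: BN.sca_eq BL.sca_eq)
  next
    case (Cons x w)
    have xw: "x \<in> N" "x \<in> carrier L" "w \<in> lists N" "w \<in> lists (carrier L)" using Cons.hyps N_sub by auto
    have c: "BN.cls (single K a w) \<in> carrier BN.U" using a xw by (intro BN.cls_closed BN.F_single) auto
    show ?case
      using Cons.IH xw a ring_hom_mult[OF mor.env_map_hom _ c, of "BN.inc x"] mor.env_map_incl[of x]
      by (simp add: BL.cls_monomial_Cons BN.cls_monomial_Cons)
  qed
qed

text \<open>The sorted words in basis letters outside N. They become a basis of U(L) as a right
  U(N)-module, with \<open>ev\<close> as the isomorphism from the free module.\<close>

definition "CW = {w \<in> lists (B - BN). sorted_wrt lq w}"
definition "M = restrict_scalars \<iota> (regmod BL.U)"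
definition "ev = lsum BN.U M (\<lambda>w. BL.cls (BL.z w))"
definition "nf = inv_into BN.Sw BN.cls"
definition "hd_part = takeWhile (\<lambda>b. b \<notin> BN)"
definition "tl_part = dropWhile (\<lambda>b. b \<notin> BN)"
text \<open>Cuts a sorted word at its first letter in N and reads the coefficient of the tail in the
  normal form of the U(N)-coefficient at the head. This lifts \<open>ev\<close> to combinations of
  sorted words of L, as \<open>cls_glue\<close> shows.\<close>

definition "glue f x = (if x \<in> BL.Ws then nf (f (hd_part x)) (tl_part x) else \<zero>)"

lemma hd_tl_append: "hd_part x @ tl_part x = x"
  by (simp add: hd_part_def tl_part_def)

lemma srt_tail: "sorted_wrt lq (y # v) \<Longrightarrow> y \<in> BN \<Longrightarrow> set v \<subseteq> BN"
  using lq_up by auto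

lemma parts_in:
  assumes "x \<in> BL.Ws"
  shows "hd_part x \<in> CW" "tl_part x \<in> BN.Ws"
proof -
  have x: "set x \<subseteq> B" "sorted_wrt lq x" using assms by (auto simp: BL.Ws_def)
  have s: "sorted_wrt lq (hd_part x @ tl_part x)" using x by (simp add: hd_tl_append)
  have "set (hd_part x) \<subseteq> B - BN"
    using x(1) by (auto simp: hd_part_def dest: set_takeWhileD)
  then show "hd_part x \<in> CW" using s by (auto simp: CW_def sorted_wrt_append)
  have "set (tl_part x) \<subseteq> BN"
  proof (cases "tl_part x")
    case (Cons y v)
    then have "y \<in> BN" by (simp add: tl_part_def dropWhile_eq_Cons_conv)
    moreover have "sorted_wrt lq (y # v)" using s Cons by (simp add: sorted_wrt_append)
    ultimately show ?thesis using srt_tail[of y v] Cons by auto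
  qed simp
  then show "tl_part x \<in> BN.Ws" using s by (auto simp: BN.Ws_def sorted_wrt_append)
qed

lemma append_in:
  assumes w: "w \<in> CW" and v: "v \<in> BN.Ws"
  shows "w @ v \<in> BL.Ws" "hd_part (w @ v) = w" "tl_part (w @ v) = v"
proof -
  have s: "set w \<subseteq> B - BN" "set v \<subseteq> BN" "sorted_wrt lq w" "sorted_wrt lq v"
    using w v by (auto simp: CW_def BN.Ws_def)
  then show "w @ v \<in> BL.Ws"
    using BN_sub by (auto simp: BL.Ws_def sorted_wrt_append intro!: lq_less)
  have "hd_part (w @ v) = w @ hd_part v" "tl_part (w @ v) = tl_part v"
    using s(1) by (auto simp: hd_part_def tl_part_def takeWhile_append2 dropWhile_append2 subset_iff)
  moreover have "hd_part v = []" "tl_part v = v" using s(2) by (cases v, simp_all add: hd_part_def tl_part_def)+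
  ultimately show "hd_part (w @ v) = w" "tl_part (w @ v) = v" by simp_all
qed

lemma M_module: "right_module BN.U M"
  unfolding M_def
  by (rule restrict_scalars_right_module[OF BN.U.ring_axioms regmod_right_module[OF BL.U.ring_axioms] mor.env_map_hom])

lemma M_simps [simp]: "carrier M = carrier BL.U" "zero M = zero BL.U" "add M = add BL.U"
  "n \<odot>\<^bsub>M\<^esub> u = u \<otimes>\<^bsub>BL.U\<^esub> \<iota> n"
  by (simp_all add: M_def)

lemma CW_lists: "w \<in> CW \<Longrightarrow> w \<in> lists (carrier L)"
  using BL.B_sub by (auto simp: CW_def)

lemma ev_hom: "ev \<in> rmod_hom BN.U (freemod BN.U CW) M"
  unfolding ev_def by (rule lsum_hom[OF M_module]) (use CW_lists in \<open>auto intro!: BL.cls_closed BL.F_single\<close>)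

lemma nf_closed: "n \<in> carrier BN.U \<Longrightarrow> nf n \<in> BN.Sw"
  and cls_nf: "n \<in> carrier BN.U \<Longrightarrow> BN.cls (nf n) = n"
  and nf_cls: "s \<in> BN.Sw \<Longrightarrow> nf (BN.cls s) = s"
  using BN.pbw inv_into_into[of n BN.cls BN.Sw] f_inv_into_f[of n BN.cls BN.Sw] inv_into_f_f[of BN.cls BN.Sw s]
  by (auto simp: nf_def bij_betw_def)

lemma nf_hom: "nf \<in> rmod_hom K BN.UK (freemod K BN.Ws)"
  unfolding nf_def
  by (rule rmod_hom_inverse[OF freemod_right_module[OF BL.K_ring] BN.cls_Sw_hom]) (use BN.pbw in simp)

lemma nf_add: "\<lbrakk>m \<in> carrier BN.U; n \<in> carrier BN.U\<rbrakk> \<Longrightarrow> nf (m \<oplus>\<^bsub>BN.U\<^esub> n) v = nf m v \<oplus> nf n v"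
  using rmod_hom_add[OF nf_hom, of m n] by (simp add: freemod_simps)

lemma nf_zero: "nf \<zero>\<^bsub>BN.U\<^esub> v = \<zero>"
  using rmod_hom_zero[OF BN.UK_right_module freemod_right_module[OF BL.K_ring] nf_hom] by (simp add: freemod_simps)

lemma glue_Sw:
  assumes f: "f \<in> carrier (freemod BN.U CW)"
  shows "glue f \<in> BL.Sw"
proof (rule freemodI)
  note fc = freemodD(1)[OF f] and nc = freemodD(1)[OF nf_closed[OF freemodD(1)[OF f]]]
  show "glue f x \<in> carrier K" for x using nc by (simp add: glue_def)
  let ?T = "Sigma {w. f w \<noteq> \<zero>\<^bsub>BN.U\<^esub>} (\<lambda>w. {v. nf (f w) v \<noteq> \<zero>})"
  have "finite ?T"
    using freemodD(2)[OF f] freemodD(2)[OF nf_closed[OF fc]] by (intro finite_SigmaI) auto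
  moreover have "{x. glue f x \<noteq> \<zero>} \<subseteq> (\<lambda>(w, v). w @ v) ` ?T"
  proof
    fix x assume "x \<in> {x. glue f x \<noteq> \<zero>}"
    then have "nf (f (hd_part x)) (tl_part x) \<noteq> \<zero>" by (auto simp: glue_def split: if_splits)
    moreover then have "f (hd_part x) \<noteq> \<zero>\<^bsub>BN.U\<^esub>" using nf_zero by metis
    ultimately show "x \<in> (\<lambda>(w, v). w @ v) ` ?T"
      by (intro image_eqI[of _ _ "(hd_part x, tl_part x)"]) (simp_all add: hd_tl_append)
  qed
  ultimately show "finite {x. glue f x \<noteq> \<zero>}" by (metis finite_imageI finite_subset)
qed (simp add: glue_def)

lemma glue_add:
  assumes "f \<in> carrier (freemod BN.U CW)" "g \<in> carrier (freemod BN.U CW)"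
  shows "glue (f \<oplus>\<^bsub>freemod BN.U CW\<^esub> g) = glue f \<oplus>\<^bsub>BL.V\<^esub> glue g"
  using freemodD(1)[OF assms(1)] freemodD(1)[OF assms(2)] by (auto simp: glue_def freemod_simps nf_add)

lemma glue_single:
  assumes a: "a \<in> carrier K" and v: "v \<in> BN.Ws" and w: "w \<in> CW"
  shows "glue (single BN.U (BN.cls (single K a v)) w) = single K a (w @ v)"
proof
  fix x
  have sv: "nf (BN.cls (single K a v)) = single K a v"
    by (rule nf_cls[OF single_closed[OF BL.K_ring a v]])
  show "glue (single BN.U (BN.cls (single K a v)) w) x = single K a (w @ v) x"
  proof (cases "x = w @ v")
    case True
    then show ?thesis using append_in[OF w v] sv by (simp add: glue_def) (simp add: single_def)
  next
    case False
    then have "\<not> (hd_part x = w \<and> tl_part x = v)" using hd_tl_append[of x] by auto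
    then have "nf (single BN.U (BN.cls (single K a v)) w (hd_part x)) (tl_part x) = \<zero>"
      using sv nf_zero by (cases "hd_part x = w") (simp_all add: single_def)
    then show ?thesis using False by (simp add: glue_def) (simp add: single_def)
  qed
qed

lemma cls_glue:
  assumes f: "f \<in> carrier (freemod BN.U CW)"
  shows "BL.cls (glue f) = ev f"
proof (rule freemod_hom_eqI[OF BN.U.ring_axioms BL.U.is_abelian_group _ _ _ f])
  have clsglue: "additive_map (freemod BN.U CW) BL.U (\<lambda>f. BL.cls (glue f))"
    by (rule additive_mapI) (simp_all add: glue_add glue_Sw BL.cls_Sw_add)
  then show "additive_map (freemod BN.U CW) BL.U (\<lambda>f. BL.cls (glue f))" .
  show "additive_map (freemod BN.U CW) BL.U ev"
    using rmod_hom_additive[OF ev_hom] by (simp add: additive_map_def)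
  fix n w assume n: "n \<in> carrier BN.U" and w: "w \<in> CW"
  have zw: "BL.cls (BL.z w) \<in> carrier BL.U" using CW_lists[OF w] by (intro BL.cls_closed BL.F_single) auto
  have "BL.cls (glue (single BN.U (BN.cls t) w)) = BL.cls (BL.z w) \<otimes>\<^bsub>BL.U\<^esub> \<iota> (BN.cls t)"
    if t: "t \<in> BN.Sw" for t
  proof (rule freemod_hom_eqI[OF BL.K_ring BL.U.is_abelian_group _ _ _ t])
    have sg: "single BN.U (BN.cls t) w \<in> carrier (freemod BN.U CW)" if "t \<in> BN.Sw" for t
      by (rule single_closed[OF BN.U.ring_axioms BN.cls_Sw_closed[OF that] w])
    have sa: "single BN.U (BN.cls (s \<oplus>\<^bsub>freemod K BN.Ws\<^esub> t)) w =
        single BN.U (BN.cls s) w \<oplus>\<^bsub>freemod BN.U CW\<^esub> single BN.U (BN.cls t) w"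
      if "s \<in> BN.Sw" "t \<in> BN.Sw" for s t
      using single_add[OF BN.U.ring_axioms BN.cls_Sw_closed[OF that(1)] BN.cls_Sw_closed[OF that(2)], of w]
        BN.cls_Sw_add[OF that] by (simp add: freemod_simps)
    show "additive_map (freemod K BN.Ws) BL.U (\<lambda>t. BL.cls (glue (single BN.U (BN.cls t) w)))"
      by (rule additive_mapI) (simp_all add: sa sg glue_Sw glue_add BL.cls_Sw_add)
    show "additive_map (freemod K BN.Ws) BL.U (\<lambda>t. BL.cls (BL.z w) \<otimes>\<^bsub>BL.U\<^esub> \<iota> (BN.cls t))"
    proof (rule additive_mapI)
      note [simp] = ring_hom_closed[OF mor.env_map_hom]
      show "BL.cls (BL.z w) \<otimes>\<^bsub>BL.U\<^esub> \<iota> (BN.cls t) \<in> carrier BL.U" if "t \<in> BN.Sw" for t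
        using that zw by simp
      show "BL.cls (BL.z w) \<otimes>\<^bsub>BL.U\<^esub> \<iota> (BN.cls (s \<oplus>\<^bsub>freemod K BN.Ws\<^esub> t)) =
          BL.cls (BL.z w) \<otimes>\<^bsub>BL.U\<^esub> \<iota> (BN.cls s) \<oplus>\<^bsub>BL.U\<^esub> BL.cls (BL.z w) \<otimes>\<^bsub>BL.U\<^esub> \<iota> (BN.cls t)"
        if "s \<in> BN.Sw" "t \<in> BN.Sw" for s t
        using that zw BN.cls_Sw_add[OF that] ring_hom_add[OF mor.env_map_hom, of "BN.cls s" "BN.cls t"]
        by (simp add: freemod_simps BL.U.r_distr)
    qed
    fix a v assume a: "a \<in> carrier K" and v: "v \<in> BN.Ws"
    have vN: "v \<in> lists N" "v \<in> lists (carrier L)" using v BN.B_sub N_sub by (auto simp: BN.Ws_def)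
    have "BL.cls (single K a (w @ v)) = BL.cls (BL.z w) \<otimes>\<^bsub>BL.U\<^esub> BL.cls (single K a v)"
      using BL.F_single_mult[of \<one> a w v] a vN CW_lists[OF w]
      by (simp add: BL.cls_mult[symmetric] BL.F_single)
    moreover have "\<iota> (BN.cls (single K a v)) = BL.cls (single K a v)"
      using vN by (intro iota_cls BN.F_single[OF a]) simp
    ultimately show "BL.cls (glue (single BN.U (BN.cls (single K a v)) w)) =
        BL.cls (BL.z w) \<otimes>\<^bsub>BL.U\<^esub> \<iota> (BN.cls (single K a v))"
      by (simp add: glue_single[OF a v w])
  qed
  from this[OF nf_closed[OF n]] show "BL.cls (glue (single BN.U n w)) = ev (single BN.U n w)"
    using n zw lsum_single[OF M_module, of "\<lambda>w. BL.cls (BL.z w)" w n] by (simp add: cls_nf ev_def)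
qed

text \<open>By \<open>cls_glue\<close>, \<open>ev\<close> is \<open>glue\<close> followed by the
  class map, which is injective on sorted combinations by the theorem for L. The normal forms, and
  by the theorem for N the coefficients, can be read off from the glued function. Every sorted word
  is reached by cutting it into its two parts.\<close>

lemma ev_bij: "bij_betw ev (carrier (freemod BN.U CW)) (carrier M)"
proof -
  have inj: "f = g" if f: "f \<in> carrier (freemod BN.U CW)" and g: "g \<in> carrier (freemod BN.U CW)"
    and eq: "ev f = ev g" for f g
  proof
    fix w
    show "f w = g w"
    proof (cases "w \<in> CW")
      case True
      have "glue f = glue g"
        using BL.pbw glue_Sw[OF f] glue_Sw[OF g] eq cls_glue[OF f] cls_glue[OF g]
        by (auto simp: bij_betw_def inj_on_def)
      then have "nf (f w) v = nf (g w) v" if "v \<in> BN.Ws" for v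
        using append_in[OF True that] by (auto simp: glue_def dest!: fun_cong[of _ _ "w @ v"])
      moreover have "nf (f w) v = nf (g w) v" if "v \<notin> BN.Ws" for v
        using that freemodD(4)[OF nf_closed[OF freemodD(1)[OF f]]] freemodD(4)[OF nf_closed[OF freemodD(1)[OF g]]]
        by simp
      ultimately have "nf (f w) = nf (g w)" by blast
      then show ?thesis using cls_nf freemodD(1)[OF f] freemodD(1)[OF g] by metis
    next
      case False
      then show ?thesis using freemodD(4)[OF f] freemodD(4)[OF g] by simp
    qed
  qed
  have surj: "BL.cls s \<in> ev ` carrier (freemod BN.U CW)" if s: "s \<in> BL.Sw" for s
    using s
  proof (rule freemod_induct[OF BL.K_ring, where P = "\<lambda>s. BL.cls s \<in> ev ` carrier (freemod BN.U CW)"])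
    interpret FU: right_module BN.U "freemod BN.U CW" by (rule freemod_right_module[OF BN.U.ring_axioms])
    have "BL.cls (\<lambda>i. \<zero>) = ev \<zero>\<^bsub>freemod BN.U CW\<^esub>"
      using rmod_hom_zero[OF FU.right_module_axioms M_module ev_hom]
        additive_map_zero[OF BL.F.is_abelian_group BL.U.is_abelian_group BL.cls_additive]
      by (simp add: free_algebra_simps(2))
    then show "BL.cls (\<lambda>i. \<zero>) \<in> ev ` carrier (freemod BN.U CW)" by (metis FU.M.zero_closed imageI)
    show "BL.cls (single K a x) \<in> ev ` carrier (freemod BN.U CW)" if a: "a \<in> carrier K" and x: "x \<in> BL.Ws" for a x
    proof -
      let ?n = "single BN.U (BN.cls (single K a (tl_part x))) (hd_part x)"
      have n: "?n \<in> carrier (freemod BN.U CW)"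
        by (rule single_closed[OF BN.U.ring_axioms BN.cls_Sw_closed[OF single_closed[OF BL.K_ring a parts_in(2)[OF x]]]
              parts_in(1)[OF x]])
      have "ev ?n = BL.cls (single K a x)"
        unfolding cls_glue[OF n, symmetric] glue_single[OF a parts_in(2)[OF x] parts_in(1)[OF x]] hd_tl_append ..
      then show ?thesis using n by (metis imageI)
    qed
    fix s t assume st: "s \<in> BL.Sw" "t \<in> BL.Sw" "BL.cls s \<in> ev ` carrier (freemod BN.U CW)"
      "BL.cls t \<in> ev ` carrier (freemod BN.U CW)"
    then obtain f g where fg: "f \<in> carrier (freemod BN.U CW)" "g \<in> carrier (freemod BN.U CW)"
      "BL.cls s = ev f" "BL.cls t = ev g" by auto
    have "BL.cls (\<lambda>i. s i \<oplus> t i) = ev (f \<oplus>\<^bsub>freemod BN.U CW\<^esub> g)"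
      using BL.cls_Sw_add[OF st(1,2)] rmod_hom_add[OF ev_hom fg(1,2)] fg by (simp add: freemod_simps)
    then show "BL.cls (\<lambda>i. s i \<oplus> t i) \<in> ev ` carrier (freemod BN.U CW)"
      using imageI[OF FU.M.a_closed[OF fg(1,2)], of ev] by (simp only:)
  qed
  have "u \<in> ev ` carrier (freemod BN.U CW)" if "u \<in> carrier BL.U" for u
  proof -
    have "u \<in> BL.cls ` BL.Sw" using that BL.pbw by (simp add: bij_betw_def)
    then obtain s where s: "u = BL.cls s" "s \<in> BL.Sw" by (rule imageE)
    show ?thesis unfolding s(1) by (rule surj[OF s(2)])
  qed
  then have "carrier M \<subseteq> ev ` carrier (freemod BN.U CW)" by (simp add: subset_iff)
  moreover have "ev ` carrier (freemod BN.U CW) \<subseteq> carrier M"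
    using rmod_hom_closed[OF ev_hom] by (rule image_subsetI)
  moreover have "inj_on ev (carrier (freemod BN.U CW))" by (rule inj_onI) (rule inj)
  ultimately show ?thesis unfolding bij_betw_def by blast
qed

lemma free_retract_U: "free_retract BN.U M CW (inv_into (carrier (freemod BN.U CW)) ev) ev"
  unfolding free_retract_def
  using rmod_hom_inverse[OF freemod_right_module[OF BN.U.ring_axioms] ev_hom ev_bij] ev_hom
    f_inv_into_f[of _ ev "carrier (freemod BN.U CW)"] ev_bij
  by (auto simp: bij_betw_def)

end

lemma (in lie_algebra) restrict_projective:
  assumes N: "lie_ideal N K L" and P: "right_module (env K L) P" and fP: "free_retract (env K L) P X s e"
  shows "projective (env K (L\<lparr>carrier := N\<rparr>)) (restrict_scalars (env_map K L (\<lambda>x. x)) P)"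
proof -
  obtain B BN co coN lq where b: "lie_basis K L B co lq" "lie_basis K (L\<lparr>carrier := N\<rparr>) BN coN lq"
    "BN \<subseteq> B" "\<And>x y. \<lbrakk>lq x y; x \<in> BN\<rbrakk> \<Longrightarrow> y \<in> BN" "\<And>x y. \<lbrakk>x \<notin> BN; y \<in> BN\<rbrakk> \<Longrightarrow> lq x y"
    using adapted_basis[OF N] by metis
  interpret A: adapted_lie_basis K L B co lq N BN coN
    by (rule adapted_lie_basis.intro[OF b(1,2) adapted_lie_basis_axioms.intro[OF N b(3-5)]])
  show ?thesis
    by (rule projectiveI[OF restrict_scalars_right_module[OF A.BN.U.ring_axioms P A.mor.env_map_hom]
          free_retract_restrict[OF A.BN.U.ring_axioms U.ring_axioms A.mor.env_map_hom P fP
            A.free_retract_U[unfolded A.M_def]]])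
qed

section \<open>Gradings\<close>

text \<open>The index set is a parameter because a Lie algebra is graded from degree 1, and rings
  and modules from degree 0.\<close>

locale direct_sum = abelian_group M for M :: "('a, 'm) ring_scheme" (structure) +
  fixes I :: "nat set" and A :: "nat \<Rightarrow> 'a set"
  assumes ids: "internal_direct_sum M I A"
begin

definition decomposes :: "'a \<Rightarrow> (nat \<Rightarrow> 'a) \<Rightarrow> bool" where
  "decomposes x c \<longleftrightarrow> (\<forall>i\<in>I. c i \<in> A i) \<and> (\<forall>i. i \<notin> I \<longrightarrow> c i = \<zero>) \<and>
     finite {i. c i \<noteq> \<zero>} \<and> x = (\<Oplus>i\<in>{i. c i \<noteq> \<zero>}. c i)"

definition cmp :: "'a \<Rightarrow> nat \<Rightarrow> 'a" where "cmp x = (THE c. decomposes x c)"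

lemma A_subgroup: "i \<in> I \<Longrightarrow> additive_subgroup (A i) M"
  using ids by (auto simp: internal_direct_sum_def)

lemma A_sub: "i \<in> I \<Longrightarrow> x \<in> A i \<Longrightarrow> x \<in> carrier M"
  using additive_subgroup.a_subset[OF A_subgroup] by blast

lemma A_zero: "i \<in> I \<Longrightarrow> \<zero> \<in> A i"
  using additive_subgroup.zero_closed[OF A_subgroup] .

lemma A_add: "\<lbrakk>i \<in> I; x \<in> A i; y \<in> A i\<rbrakk> \<Longrightarrow> x \<oplus> y \<in> A i"
  using additive_subgroup.a_closed[OF A_subgroup] .

lemma ex1: "x \<in> carrier M \<Longrightarrow> \<exists>!c. decomposes x c"
  using ids unfolding internal_direct_sum_def decomposes_def by blast

lemma decomposes_cmp: "x \<in> carrier M \<Longrightarrow> decomposes x (cmp x)"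
  unfolding cmp_def by (rule theI'[OF ex1])

lemma cmp_eqI: "\<lbrakk>x \<in> carrier M; decomposes x c\<rbrakk> \<Longrightarrow> cmp x = c"
  unfolding cmp_def by (rule the1_equality[OF ex1])

lemma decomposes_closed: "decomposes x c \<Longrightarrow> c i \<in> carrier M"
  by (cases "i \<in> I") (auto simp: decomposes_def A_sub)

lemma finsum_support:
  assumes "finite S" "{i. c i \<noteq> \<zero>} \<subseteq> S" "\<And>i. c i \<in> carrier M"
  shows "(\<Oplus>i\<in>{i. c i \<noteq> \<zero>}. c i) = (\<Oplus>i\<in>S. c i)"
  by (rule add.finprod_mono_neutral_cong_left) (use assms in \<open>simp_all add: Pi_iff\<close>)

lemma cmp_in: "\<lbrakk>x \<in> carrier M; i \<in> I\<rbrakk> \<Longrightarrow> cmp x i \<in> A i"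
  using decomposes_cmp by (auto simp: decomposes_def)

lemma cmp_closed [simp]: "x \<in> carrier M \<Longrightarrow> cmp x i \<in> carrier M"
  using decomposes_closed[OF decomposes_cmp] .

lemma cmp_finite: "x \<in> carrier M \<Longrightarrow> finite {i. cmp x i \<noteq> \<zero>}"
  using decomposes_cmp by (auto simp: decomposes_def)

lemma cmp_sum: "x \<in> carrier M \<Longrightarrow> (\<Oplus>i\<in>{i. cmp x i \<noteq> \<zero>}. cmp x i) = x"
  using decomposes_cmp by (auto simp: decomposes_def)

lemma cmp_outside: "\<lbrakk>x \<in> carrier M; i \<notin> I\<rbrakk> \<Longrightarrow> cmp x i = \<zero>"
  using decomposes_cmp by (auto simp: decomposes_def)

lemma cmp_add:
  assumes x: "x \<in> carrier M" and y: "y \<in> carrier M"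
  shows "cmp (x \<oplus> y) i = cmp x i \<oplus> cmp y i"
proof -
  let ?c = "\<lambda>i. cmp x i \<oplus> cmp y i" and ?S = "{i. cmp x i \<noteq> \<zero>} \<union> {i. cmp y i \<noteq> \<zero>}"
  have fin: "finite ?S" using cmp_finite[OF x] cmp_finite[OF y] by simp
  have sup: "{i. ?c i \<noteq> \<zero>} \<subseteq> ?S" by auto
  have "decomposes (x \<oplus> y) ?c"
    unfolding decomposes_def
  proof (intro conjI allI ballI impI)
    show "finite {i. ?c i \<noteq> \<zero>}" using finite_subset[OF sup fin] .
    have "(\<Oplus>i\<in>{i. ?c i \<noteq> \<zero>}. ?c i) = (\<Oplus>i\<in>?S. ?c i)" by (rule finsum_support[OF fin sup]) (use x y in simp)
    also have "\<dots> = (\<Oplus>i\<in>?S. cmp x i) \<oplus> (\<Oplus>i\<in>?S. cmp y i)" by (rule finsum_addf) (use x y in auto)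
    also have "(\<Oplus>i\<in>?S. cmp x i) = x" using finsum_support[OF fin, of "cmp x"] cmp_sum[OF x] x by simp
    also have "(\<Oplus>i\<in>?S. cmp y i) = y" using finsum_support[OF fin, of "cmp y"] cmp_sum[OF y] y by simp
    finally show "x \<oplus> y = (\<Oplus>i\<in>{i. ?c i \<noteq> \<zero>}. ?c i)" ..
  qed (use x y in \<open>simp_all add: A_add cmp_in cmp_outside\<close>)
  from cmp_eqI[OF a_closed[OF x y] this] show ?thesis by simp
qed

lemma cmp_additive: "additive_map M M (\<lambda>x. cmp x i)"
  by (rule additive_mapI) (simp_all add: cmp_add)

lemma cmp_zero: "cmp \<zero> i = \<zero>"
  using additive_map_zero[OF abelian_group_axioms abelian_group_axioms cmp_additive] .

lemma decomposes_homogeneous: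
  assumes "i \<in> I" "x \<in> A i"
  shows "decomposes x (\<lambda>j. if j = i then x else \<zero>)"
proof -
  have x: "x \<in> carrier M" using A_sub assms by blast
  have "(\<Oplus>j\<in>{j. (if j = i then x else \<zero>) \<noteq> \<zero>}. if j = i then x else \<zero>) = (\<Oplus>j\<in>{i}. if j = i then x else \<zero>)"
    by (rule finsum_support) (use x in auto)
  then show ?thesis using assms x A_zero
    by (auto simp: decomposes_def intro!: finite_subset[of _ "{i}"])
qed

lemma cmp_homogeneous: "\<lbrakk>i \<in> I; x \<in> A i\<rbrakk> \<Longrightarrow> cmp x j = (if j = i then x else \<zero>)"
  using cmp_eqI[OF A_sub decomposes_homogeneous] by simp

lemma induct_homogeneous [consumes 1, case_names zero homogeneous add]:
  assumes x: "x \<in> carrier M" and zero: "P \<zero>" and hom: "\<And>i x. \<lbrakk>i \<in> I; x \<in> A i\<rbrakk> \<Longrightarrow> P x"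
    and add: "\<And>x y. \<lbrakk>x \<in> carrier M; y \<in> carrier M; P x; P y\<rbrakk> \<Longrightarrow> P (x \<oplus> y)"
  shows "P x"
proof -
  have "P (\<Oplus>i\<in>S. cmp x i)" if "finite S" for S
    using that
  proof (induction S)
    case (insert i S)
    have "P (cmp x i)" using hom[OF _ cmp_in[OF x]] zero cmp_outside[OF x] by (cases "i \<in> I") auto
    moreover have "(\<Oplus>i\<in>S. cmp x i) \<in> carrier M" using x by (intro finsum_closed) auto
    ultimately show ?case using insert add x by (simp add: Pi_iff)
  qed (simp add: zero)
  then show ?thesis using cmp_finite[OF x] cmp_sum[OF x] by metis
qed

end

lemma direct_sum_map_cmp:
  assumes A: "direct_sum M UNIV A" and B: "direct_sum M' UNIV B" and h: "additive_map M M' h"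
    and AB: "\<And>i x. x \<in> A i \<Longrightarrow> h x \<in> B i" and x: "x \<in> carrier M"
  shows "h (direct_sum.cmp M UNIV A x i) = direct_sum.cmp M' UNIV B (h x) i"
proof -
  interpret A: direct_sum M UNIV A by fact
  interpret B: direct_sum M' UNIV B by fact
  show ?thesis using x
  proof (induction rule: A.induct_homogeneous)
    case zero
    then show ?case
      using additive_map_zero[OF A.abelian_group_axioms B.abelian_group_axioms h] A.cmp_zero B.cmp_zero by simp
  next
    case (homogeneous j x)
    then show ?case
      using additive_map_zero[OF A.abelian_group_axioms B.abelian_group_axioms h] AB[of x j]
      by (simp add: A.cmp_homogeneous B.cmp_homogeneous)
  next
    case (add x y)
    then show ?case using additive_map_add[OF h] additive_map_closed[OF h]
      by (simp add: A.cmp_add B.cmp_add)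
  qed
qed

text \<open>The existence half of a direct sum decomposition over all degrees; unlike uniqueness it
  is stable under sums.\<close>

definition decomposable :: "('a, 'm) ring_scheme \<Rightarrow> (nat \<Rightarrow> 'a set) \<Rightarrow> 'a set" where
  "decomposable M A = {x. \<exists>c. (\<forall>i. c i \<in> A i) \<and> finite {i. c i \<noteq> \<zero>\<^bsub>M\<^esub>} \<and> x = (\<Oplus>\<^bsub>M\<^esub>i\<in>{i. c i \<noteq> \<zero>\<^bsub>M\<^esub>}. c i)}"

context abelian_group
begin

lemma decomposable_homogeneous:
  assumes A: "\<And>i. additive_subgroup (A i) G" and x: "x \<in> A i"
  shows "x \<in> decomposable G A"
proof -
  have xc: "x \<in> carrier G" using additive_subgroup.a_subset[OF A] x by blast
  have "(\<Oplus>j\<in>{j. (if j = i then x else \<zero>) \<noteq> \<zero>}. if j = i then x else \<zero>) = x"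
  proof (cases "x = \<zero>")
    case False
    then have "{j. (if j = i then x else \<zero>) \<noteq> \<zero>} = {i}" by auto
    then show ?thesis using xc by simp
  qed simp
  then show ?thesis using x additive_subgroup.zero_closed[OF A]
    by (auto simp: decomposable_def intro!: exI[of _ "\<lambda>j. if j = i then x else \<zero>"] finite_subset[of _ "{i}"]
        split: if_splits)
qed

lemma decomposable_add:
  assumes A: "\<And>i. additive_subgroup (A i) G" and x: "x \<in> decomposable G A" and y: "y \<in> decomposable G A"
  shows "x \<oplus> y \<in> decomposable G A"
proof -
  obtain c d where c: "\<And>i. c i \<in> A i" "finite {i. c i \<noteq> \<zero>}" "x = (\<Oplus>i\<in>{i. c i \<noteq> \<zero>}. c i)"
    and d: "\<And>i. d i \<in> A i" "finite {i. d i \<noteq> \<zero>}" "y = (\<Oplus>i\<in>{i. d i \<noteq> \<zero>}. d i)"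
    using x y by (auto simp: decomposable_def)
  have cc: "c i \<in> carrier G" "d i \<in> carrier G" for i
    using additive_subgroup.a_subset[OF A] c(1) d(1) by blast+
  let ?S = "{i. c i \<noteq> \<zero>} \<union> {i. d i \<noteq> \<zero>}"
  have fin: "finite ?S" using c d by simp
  have sup: "(\<Oplus>i\<in>{i. f i \<noteq> \<zero>}. f i) = (\<Oplus>i\<in>?S. f i)" if "{i. f i \<noteq> \<zero>} \<subseteq> ?S" "\<And>i. f i \<in> carrier G" for f
    by (rule add.finprod_mono_neutral_cong_left) (use fin that in \<open>simp_all add: Pi_iff\<close>)
  have sub: "{i. c i \<oplus> d i \<noteq> \<zero>} \<subseteq> ?S" by auto
  have "x \<oplus> y = (\<Oplus>i\<in>?S. c i) \<oplus> (\<Oplus>i\<in>?S. d i)" using c(3) d(3) sup[of c] sup[of d] cc by simp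
  also have "\<dots> = (\<Oplus>i\<in>?S. c i \<oplus> d i)" using cc by (intro finsum_addf[symmetric]) auto
  also have "\<dots> = (\<Oplus>i\<in>{i. c i \<oplus> d i \<noteq> \<zero>}. c i \<oplus> d i)" using sup[OF sub] cc by simp
  finally have "x \<oplus> y = (\<Oplus>i\<in>{i. c i \<oplus> d i \<noteq> \<zero>}. c i \<oplus> d i)" .
  moreover have "c i \<oplus> d i \<in> A i" for i using additive_subgroup.a_closed[OF A c(1) d(1)] .
  ultimately show ?thesis unfolding decomposable_def using finite_subset[OF sub fin]
    by (intro CollectI exI[of _ "\<lambda>i. c i \<oplus> d i"]) auto
qed

lemma decomposable_finsum:
  assumes A: "\<And>i. additive_subgroup (A i) G" and f: "\<And>i. i \<in> S \<Longrightarrow> f i \<in> decomposable G A \<and> f i \<in> carrier G"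
  shows "(\<Oplus>i\<in>S. f i) \<in> decomposable G A"
  using f
proof (induction S rule: infinite_finite_induct)
  case (insert i S)
  then show ?case using decomposable_add[OF A] by (simp add: Pi_iff)
qed (use decomposable_homogeneous[OF A additive_subgroup.zero_closed[OF A]] in \<open>auto simp: finsum_def finprod_def\<close>)

text \<open>Applying the projection p j to any decomposition of x returns its j-th component, so the
  components are determined by x.\<close>

lemma internal_direct_sumI:
  assumes A: "\<And>i. additive_subgroup (A i) G" and p: "\<And>i. additive_map G G (p i)"
    and pA: "\<And>i j x. x \<in> A i \<Longrightarrow> p j x = (if i = j then x else \<zero>)"
    and dec: "\<And>x. x \<in> carrier G \<Longrightarrow> x \<in> decomposable G A"
  shows "internal_direct_sum G UNIV A"
proof -
  have uniq: "c j = p j x"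
    if c: "\<And>i. c i \<in> A i" "finite {i. c i \<noteq> \<zero>}" "x = (\<Oplus>i\<in>{i. c i \<noteq> \<zero>}. c i)" for c x j
  proof -
    have cc: "c i \<in> carrier G" for i using additive_subgroup.a_subset[OF A] c(1) by blast
    have "p j x = (\<Oplus>i\<in>{i. c i \<noteq> \<zero>}. p j (c i))"
      unfolding c(3) by (rule additive_map_finsum[OF abelian_group_axioms abelian_group_axioms p]) (use cc in auto)
    also have "\<dots> = (\<Oplus>i\<in>{i. c i \<noteq> \<zero>}. if j = i then c i else \<zero>)"
      by (rule finsum_cong') (use pA[OF c(1)] cc in auto)
    also have "\<dots> = c j"
    proof (cases "c j = \<zero>")
      case True
      then have "(\<Oplus>i\<in>{i. c i \<noteq> \<zero>}. if j = i then c i else \<zero>) = (\<Oplus>i\<in>{i. c i \<noteq> \<zero>}. \<zero>)"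
        by (intro finsum_cong') auto
      then show ?thesis using True by simp
    next
      case False
      then show ?thesis using finsum_singleton[of j "{i. c i \<noteq> \<zero>}" c] c(2) cc by auto
    qed
    finally show ?thesis ..
  qed
  show ?thesis unfolding internal_direct_sum_def
  proof (intro conjI ballI)
    fix x assume x: "x \<in> carrier G"
    obtain c where c: "\<And>i. c i \<in> A i" "finite {i. c i \<noteq> \<zero>}" "x = (\<Oplus>i\<in>{i. c i \<noteq> \<zero>}. c i)"
      using dec[OF x] by (auto simp: decomposable_def)
    show "\<exists>!c. (\<forall>i\<in>UNIV. c i \<in> A i) \<and> (\<forall>i. i \<notin> UNIV \<longrightarrow> c i = \<zero>) \<and> finite {i. c i \<noteq> \<zero>} \<and>
        x = (\<Oplus>i\<in>{i. c i \<noteq> \<zero>}. c i)"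
    proof (rule ex1I[of _ c])
      show "(\<forall>i\<in>UNIV. c i \<in> A i) \<and> (\<forall>i. i \<notin> UNIV \<longrightarrow> c i = \<zero>) \<and> finite {i. c i \<noteq> \<zero>} \<and>
        x = (\<Oplus>i\<in>{i. c i \<noteq> \<zero>}. c i)" using c by simp
      fix c' assume c': "(\<forall>i\<in>UNIV. c' i \<in> A i) \<and> (\<forall>i. i \<notin> UNIV \<longrightarrow> c' i = \<zero>) \<and> finite {i. c' i \<noteq> \<zero>} \<and>
        x = (\<Oplus>i\<in>{i. c' i \<noteq> \<zero>}. c' i)"
      show "c' = c"
      proof
        fix j
        have "c' j = p j x" by (rule uniq) (use c' in auto)
        then show "c' j = c j" using uniq[OF c] by simp
      qed
    qed
  qed (rule A)
qed

end

section \<open>Graded covers\<close>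

locale graded_ring = ring R for R :: "('r, 'b) ring_scheme" (structure) +
  fixes Rgr :: "nat \<Rightarrow> 'r set"
  assumes R_sum: "internal_direct_sum R UNIV Rgr"
    and R_mult: "\<lbrakk>r \<in> Rgr i; s \<in> Rgr j\<rbrakk> \<Longrightarrow> r \<otimes> s \<in> Rgr (i + j)"
    and R_one: "\<one> \<in> Rgr 0"
begin

sublocale RD: direct_sum R UNIV Rgr by unfold_locales (rule R_sum)

text \<open>The basis vector at x is placed in degree \<open>dg x\<close>. The case distinction
  guards against truncated subtraction of degrees.\<close>

definition free_grading :: "'i set \<Rightarrow> ('i \<Rightarrow> nat) \<Rightarrow> nat \<Rightarrow> ('i \<Rightarrow> 'r) set" where
  "free_grading X dg j = {f \<in> carrier (freemod R X). \<forall>x. if dg x \<le> j then f x \<in> Rgr (j - dg x) else f x = \<zero>}"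

lemma free_grading_subgroup: "additive_subgroup (free_grading X dg j) (freemod R X)"
proof -
  interpret F: right_module R "freemod R X" by (rule freemod_right_module[OF ring_axioms])
  show ?thesis
  proof (intro additive_subgroupI subgroup.intro)
    show "free_grading X dg j \<subseteq> carrier (add_monoid (freemod R X))" by (auto simp: free_grading_def)
    show "\<one>\<^bsub>add_monoid (freemod R X)\<^esub> \<in> free_grading X dg j"
      using F.M.zero_closed RD.A_zero by (auto simp: free_grading_def freemod_simps)
    show "x \<otimes>\<^bsub>add_monoid (freemod R X)\<^esub> y \<in> free_grading X dg j"
      if "x \<in> free_grading X dg j" "y \<in> free_grading X dg j" for x y
      using that F.M.a_closed[of x y] RD.A_add by (auto simp: free_grading_def freemod_simps)
    show "inv\<^bsub>add_monoid (freemod R X)\<^esub> x \<in> free_grading X dg j" if x: "x \<in> free_grading X dg j" for x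
    proof -
      have xc: "x \<in> carrier (freemod R X)" using x by (simp add: free_grading_def)
      have ev: "additive_map (freemod R X) R (\<lambda>f. f i)" for i
        by (rule additive_mapI) (auto simp: freemod_simps freemodD(1))
      have "(\<ominus>\<^bsub>freemod R X\<^esub> x) i = \<ominus> x i" for i
        using additive_map_neg[OF F.abelian_group_M is_abelian_group ev xc] .
      then have "\<ominus>\<^bsub>freemod R X\<^esub> x \<in> free_grading X dg j"
        using x F.M.a_inv_closed[OF xc] additive_subgroup.a_inv_closed[OF RD.A_subgroup]
        by (auto simp: free_grading_def)
      then show ?thesis by (simp add: a_inv_def)
    qed
  qed
qed

lemma single_homogeneous:
  assumes "r \<in> Rgr i" "x \<in> X"
  shows "single R r x \<in> free_grading X dg (i + dg x)"
  using assms RD.A_zero single_closed[OF ring_axioms RD.A_sub[OF UNIV_I assms(1)] assms(2)]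
  by (auto simp: free_grading_def single_def)

lemma free_graded:
  fixes X :: "'i set" and dg :: "'i \<Rightarrow> nat"
  shows "graded_module R Rgr (freemod R X) (free_grading X dg)"
proof -
  let ?F = "freemod R X" and ?G = "free_grading X dg"
  note Fm = freemod_right_module[OF ring_axioms, of X]
  interpret F: right_module R ?F by (rule Fm)
  note dh = F.M.decomposable_homogeneous[of ?G, OF free_grading_subgroup]
    and da = F.M.decomposable_add[of ?G, OF free_grading_subgroup]
  define p where "p j f = (\<lambda>x. if dg x \<le> j then RD.cmp (f x) (j - dg x) else \<zero>)" for j and f :: "'i \<Rightarrow> 'r"
  have pc: "p j f \<in> carrier ?F" if f: "f \<in> carrier ?F" for j f
  proof (rule freemodI)
    show "finite {i. p j f i \<noteq> \<zero>}"
      by (rule finite_subset[OF _ freemodD(2)[OF f]]) (auto simp: p_def RD.cmp_zero split: if_splits)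
  qed (use freemodD(1,4)[OF f] in \<open>auto simp: p_def RD.cmp_zero\<close>)
  have "internal_direct_sum ?F UNIV ?G"
  proof (rule F.M.internal_direct_sumI[where p = p])
    show "additive_subgroup (?G i) ?F" for i by (rule free_grading_subgroup)
    show "additive_map ?F ?F (p i)" for i
    proof (rule additive_mapI[OF pc])
      fix f g assume fg: "f \<in> carrier ?F" "g \<in> carrier ?F"
      show "p i (f \<oplus>\<^bsub>?F\<^esub> g) = p i f \<oplus>\<^bsub>?F\<^esub> p i g"
        using freemodD(1)[OF fg(1)] freemodD(1)[OF fg(2)] by (auto simp: p_def freemod_simps RD.cmp_add)
    qed
    show "p j f = (if i = j then f else \<zero>\<^bsub>?F\<^esub>)" if f: "f \<in> ?G i" for i j f
    proof
      fix x
      have *: "dg x \<le> i \<Longrightarrow> f x \<in> Rgr (i - dg x)" "\<not> dg x \<le> i \<Longrightarrow> f x = \<zero>"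
        using f by (auto simp: free_grading_def split: if_splits)
      show "p j f x = (if i = j then f else \<zero>\<^bsub>?F\<^esub>) x"
        using * by (cases "dg x \<le> i") (auto simp: p_def freemod_simps RD.cmp_zero RD.cmp_homogeneous)
    qed
    show "f \<in> decomposable ?F ?G" if "f \<in> carrier ?F" for f
      using that
    proof (rule freemod_induct[OF ring_axioms])
      show "(\<lambda>i. \<zero>) \<in> decomposable ?F ?G"
        using dh[OF additive_subgroup.zero_closed[OF free_grading_subgroup, of X dg 0]]
        by (simp add: freemod_simps)
      show "single R a x \<in> decomposable ?F ?G" if a: "a \<in> carrier R" and x: "x \<in> X" for a x
        using a
      proof (induction rule: RD.induct_homogeneous)
        case zero
        have "single R \<zero> x = \<zero>\<^bsub>?F\<^esub>" by (auto simp: single_def freemod_simps)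
        then show ?case
          using dh[OF additive_subgroup.zero_closed[OF free_grading_subgroup, of X dg 0]] by simp
      next
        case (homogeneous i a)
        show ?case by (rule dh[OF single_homogeneous[OF homogeneous(2) x]])
      next
        case (add a b)
        then show ?case
          using da[of "single R a x" "single R b x"] single_add[OF ring_axioms, of a b x]
          by (simp add: freemod_simps)
      qed
      show "(\<lambda>i. f i \<oplus> g i) \<in> decomposable ?F ?G" if "f \<in> decomposable ?F ?G" "g \<in> decomposable ?F ?G" for f g
        using da[OF that] by (simp add: freemod_simps)
    qed
  qed
  moreover have "r \<odot>\<^bsub>?F\<^esub> f \<in> ?G (i + j)" if f: "f \<in> ?G i" and r: "r \<in> Rgr j" for i j f r
  proof -
    have rc: "r \<in> carrier R" using RD.A_sub r by blast
    have fc: "f \<in> carrier ?F" using f by (simp add: free_grading_def)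
    have "if dg x \<le> i + j then f x \<otimes> r \<in> Rgr (i + j - dg x) else f x \<otimes> r = \<zero>" for x
    proof (cases "dg x \<le> i")
      case True
      then have "f x \<otimes> r \<in> Rgr ((i - dg x) + j)" using f r by (intro R_mult) (auto simp: free_grading_def)
      then show ?thesis using True by (simp add: add.commute)
    next
      case False
      then have "f x = \<zero>" using f by (auto simp: free_grading_def)
      then show ?thesis using rc RD.A_zero by simp
    qed
    then show ?thesis using F.closed[OF rc fc] by (simp add: free_grading_def freemod_simps)
  qed
  ultimately show ?thesis using Fm by (auto simp: graded_module_def)
qed

lemma graded_module_transfer:
  assumes M: "graded_module R Rgr M Mgr" and M': "right_module R M'"
    and h: "h \<in> rmod_hom R M M'" and b: "bij_betw h (carrier M) (carrier M')"
  shows "graded_module R Rgr M' (\<lambda>j. h ` Mgr j)"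
proof -
  have Mm: "right_module R M" and ids: "internal_direct_sum M UNIV Mgr"
    and act': "\<And>i j x r. \<lbrakk>x \<in> Mgr i; r \<in> Rgr j\<rbrakk> \<Longrightarrow> r \<odot>\<^bsub>M\<^esub> x \<in> Mgr (i + j)"
    using M by (auto simp: graded_module_def)
  interpret M: right_module R M by (rule Mm)
  interpret M': right_module R M' by (rule M')
  interpret D: direct_sum M UNIV Mgr by unfold_locales (rule ids)
  let ?i = "inv_into (carrier M) h"
  note inv = rmod_hom_inverse[OF Mm h b]
  have ih: "?i (h x) = x" if "x \<in> carrier M" for x
    using b that by (simp add: bij_betw_def inv_into_f_f)
  have hi: "h (?i x) = x" if "x \<in> carrier M'" for x
    using b that by (auto simp: bij_betw_def f_inv_into_f)
  have sg: "additive_subgroup (h ` Mgr i) M'" for i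
  proof (intro additive_subgroupI subgroup.intro)
    show "h ` Mgr i \<subseteq> carrier (add_monoid M')" using D.A_sub rmod_hom_closed[OF h] by auto
    show "\<one>\<^bsub>add_monoid M'\<^esub> \<in> h ` Mgr i"
      using rmod_hom_zero[OF Mm M' h] D.A_zero by (auto intro!: image_eqI[of _ _ "\<zero>\<^bsub>M\<^esub>"])
    show "x \<otimes>\<^bsub>add_monoid M'\<^esub> y \<in> h ` Mgr i" if x: "x \<in> h ` Mgr i" and y: "y \<in> h ` Mgr i" for x y
    proof -
      obtain u v where uv: "u \<in> Mgr i" "v \<in> Mgr i" "x = h u" "y = h v" using x y by blast
      then have "h (u \<oplus>\<^bsub>M\<^esub> v) = x \<oplus>\<^bsub>M'\<^esub> y" using rmod_hom_add[OF h] D.A_sub by auto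
      then show ?thesis using imageI[OF D.A_add[OF UNIV_I uv(1,2)], of h] by simp
    qed
    show "inv\<^bsub>add_monoid M'\<^esub> x \<in> h ` Mgr i" if x: "x \<in> h ` Mgr i" for x
    proof -
      obtain u where u: "u \<in> Mgr i" "x = h u" using x by blast
      have "h (\<ominus>\<^bsub>M\<^esub> u) = \<ominus>\<^bsub>M'\<^esub> x"
        using additive_map_neg[OF M.abelian_group_M M'.abelian_group_M rmod_hom_additive[OF h]] D.A_sub u by auto
      then show ?thesis
        using imageI[OF additive_subgroup.a_inv_closed[OF D.A_subgroup[OF UNIV_I] u(1)], of h] by (simp add: a_inv_def)
    qed
  qed
  note dh = M'.M.decomposable_homogeneous[of "\<lambda>i. h ` Mgr i", OF sg]
    and da = M'.M.decomposable_add[of "\<lambda>i. h ` Mgr i", OF sg]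
  have "internal_direct_sum M' UNIV (\<lambda>i. h ` Mgr i)"
  proof (rule M'.M.internal_direct_sumI[OF sg, where p = "\<lambda>j x. h (D.cmp (?i x) j)"])
    show "additive_map M' M' (\<lambda>x. h (D.cmp (?i x) i))" for i
      using rmod_hom_closed[OF inv] rmod_hom_add[OF inv] rmod_hom_closed[OF h] rmod_hom_add[OF h]
      by (intro additive_mapI) (simp_all add: D.cmp_add)
    show "h (D.cmp (?i x) j) = (if i = j then x else \<zero>\<^bsub>M'\<^esub>)" if "x \<in> h ` Mgr i" for i j x
      using that rmod_hom_zero[OF Mm M' h] D.A_sub by (auto simp: ih D.cmp_homogeneous)
    show "x \<in> decomposable M' (\<lambda>i. h ` Mgr i)" if x: "x \<in> carrier M'" for x
    proof -
      have "h y \<in> decomposable M' (\<lambda>i. h ` Mgr i)" if "y \<in> carrier M" for y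
        using that
      proof (induction rule: D.induct_homogeneous)
        case zero
        show ?case by (rule dh[OF imageI[OF D.A_zero[OF UNIV_I, of 0], of h]])
      next
        case (homogeneous i y)
        show ?case by (rule dh[OF imageI[OF homogeneous(2), of h]])
      next
        case (add y z)
        then show ?case using da rmod_hom_add[OF h] by simp
      qed
      then show ?thesis using hi[OF x] rmod_hom_closed[OF inv x] by metis
    qed
  qed
  moreover have "r \<odot>\<^bsub>M'\<^esub> x \<in> h ` Mgr (i + j)" if x: "x \<in> h ` Mgr i" and r: "r \<in> Rgr j" for i j x r
  proof -
    have rc: "r \<in> carrier R" using RD.A_sub r by blast
    obtain u where u: "u \<in> Mgr i" "x = h u" using x by blast
    have "r \<odot>\<^bsub>M'\<^esub> x = h (r \<odot>\<^bsub>M\<^esub> u)" using rmod_hom_smult[OF h rc] u D.A_sub by auto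
    then show ?thesis using act'[OF u(1) r] by simp
  qed
  ultimately show ?thesis using M' by (auto simp: graded_module_def)
qed

end

text \<open>
  An injective encoding of the elements of a free module by lists over the ring, needed because
  the resolutions in \<^const>\<open>graded_type_FP\<close> consist of modules over that type. The letter \<open>a\<close> announces an entry
  and \<open>b\<close> ends a list.
\<close>

primrec list_code :: "'a \<Rightarrow> 'a \<Rightarrow> 'a list list \<Rightarrow> 'a list" where
  "list_code a b [] = []"
| "list_code a b (xs # xss) = concat (map (\<lambda>x. [a, x]) xs) @ b # list_code a b xss"

text \<open>At every position where an entry may start, the letter a or b found there tells an entry
  from the end of the list.\<close>

lemma list_code_inject:
  assumes "a \<noteq> b"
  shows "list_code a b xss = list_code a b yss \<Longrightarrow> xss = yss"
proof (induction xss arbitrary: yss)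
  case Nil
  then show ?case by (cases yss) auto
next
  case (Cons xs xss)
  have step: "xs = ys \<and> u = v"
    if "concat (map (\<lambda>x. [a, x]) xs) @ b # u = concat (map (\<lambda>x. [a, x]) ys) @ b # v" for xs ys u v
    using that
  proof (induction xs arbitrary: ys)
    case Nil
    then show ?case using assms by (cases ys) auto
  next
    case (Cons x xs)
    then show ?case using assms by (cases ys) auto
  qed
  show ?case
  proof (cases yss)
    case Nil
    then show ?thesis using Cons.prems by simp
  next
    case (Cons ys yss')
    then have "xs = ys \<and> list_code a b xss = list_code a b yss'" using Cons.prems by (intro step) simp
    then show ?thesis using Cons.IH Cons by simp
  qed
qed

text \<open>A finitely supported function is determined by the set of its entries
  \<open>f x # x\<close>, so any enumeration of the support yields an injective code.\<close>

definition fun_code :: "('r, 'b) ring_scheme \<Rightarrow> 'r \<Rightarrow> 'r \<Rightarrow> ('r list \<Rightarrow> 'r) \<Rightarrow> 'r list" where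
  "fun_code R a b f = list_code a b (map (\<lambda>x. f x # x) (SOME xs. set xs = {x. f x \<noteq> \<zero>\<^bsub>R\<^esub>}))"

lemma fun_code_inj:
  assumes "a \<noteq> b"
  shows "inj_on (fun_code R a b) (carrier (freemod R X))"
proof (rule inj_onI)
  let ?l = "\<lambda>f. SOME xs. set xs = {x. f x \<noteq> \<zero>\<^bsub>R\<^esub>}"
  fix f g assume f: "f \<in> carrier (freemod R X)" and g: "g \<in> carrier (freemod R X)"
    and eq: "fun_code R a b f = fun_code R a b g"
  have l: "set (?l f) = {x. f x \<noteq> \<zero>\<^bsub>R\<^esub>}" if "f \<in> carrier (freemod R X)" for f
    using finite_list[OF freemodD(2)[OF that]] by (rule someI_ex)
  have "map (\<lambda>x. f x # x) (?l f) = map (\<lambda>x. g x # x) (?l g)"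
    using eq list_code_inject[OF assms] unfolding fun_code_def by blast
  then have "set (map (\<lambda>x. f x # x) (?l f)) = set (map (\<lambda>x. g x # x) (?l g))" by simp
  then have im: "(\<lambda>x. f x # x) ` {x. f x \<noteq> \<zero>\<^bsub>R\<^esub>} = (\<lambda>x. g x # x) ` {x. g x \<noteq> \<zero>\<^bsub>R\<^esub>}"
    using l[OF f] l[OF g] by simp
  have half: "f x = g x" if "f x \<noteq> \<zero>\<^bsub>R\<^esub>"
    "(\<lambda>x. f x # x) ` {x. f x \<noteq> \<zero>\<^bsub>R\<^esub>} = (\<lambda>x. g x # x) ` {x. g x \<noteq> \<zero>\<^bsub>R\<^esub>}" for f g :: "'a list \<Rightarrow> 'a" and x
  proof -
    have "f x # x \<in> (\<lambda>x. g x # x) ` {x. g x \<noteq> \<zero>\<^bsub>R\<^esub>}" using that by (auto simp: set_eq_iff)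
    then show ?thesis by auto
  qed
  show "f = g"
  proof
    fix x show "f x = g x"
    proof (cases "f x = \<zero>\<^bsub>R\<^esub>")
      case True
      then show ?thesis using half[OF _ im[symmetric], of x] by metis
    next
      case False
      then show ?thesis by (rule half[OF _ im])
    qed
  qed
qed

section \<open>Transport of structure and finite generation\<close>

definition transport :: "('r, 'v) module \<Rightarrow> ('v \<Rightarrow> 'w) \<Rightarrow> ('r, 'w) module" where
  "transport M h = \<lparr>carrier = h ` carrier M, mult = undefined, one = undefined, zero = h \<zero>\<^bsub>M\<^esub>,
     add = (\<lambda>u v. h (inv_into (carrier M) h u \<oplus>\<^bsub>M\<^esub> inv_into (carrier M) h v)),
     smult = (\<lambda>r u. h (r \<odot>\<^bsub>M\<^esub> inv_into (carrier M) h u))\<rparr>"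

lemma transport_right_module:
  assumes M: "right_module R M" and inj: "inj_on h (carrier M)"
  shows "right_module R (transport M h)" "h \<in> rmod_hom R M (transport M h)"
    "bij_betw h (carrier M) (carrier (transport M h))"
proof -
  interpret M: right_module R M by fact
  let ?T = "transport M h"
  have car: "carrier ?T = h ` carrier M" and zero: "\<zero>\<^bsub>?T\<^esub> = h \<zero>\<^bsub>M\<^esub>" by (simp_all add: transport_def)
  have add: "h x \<oplus>\<^bsub>?T\<^esub> h y = h (x \<oplus>\<^bsub>M\<^esub> y)" if "x \<in> carrier M" "y \<in> carrier M" for x y
    using that inj by (simp add: transport_def)
  have smult: "r \<odot>\<^bsub>?T\<^esub> h x = h (r \<odot>\<^bsub>M\<^esub> x)" if "x \<in> carrier M" for r x
    using that inj by (simp add: transport_def)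
  show "right_module R ?T"
  proof (intro right_module.intro right_module_axioms.intro M.ring_R abelian_groupI)
    fix x assume "x \<in> carrier ?T"
    then obtain u where u: "u \<in> carrier M" "x = h u" using car by auto
    then have "h (\<ominus>\<^bsub>M\<^esub> u) \<oplus>\<^bsub>?T\<^esub> x = \<zero>\<^bsub>?T\<^esub>" by (simp add: add zero M.M.l_neg)
    then show "\<exists>y\<in>carrier ?T. y \<oplus>\<^bsub>?T\<^esub> x = \<zero>\<^bsub>?T\<^esub>" using u car by auto
  qed (auto simp: car zero add smult M.M.a_assoc M.M.a_comm M.M.a_lcomm M.add_scalar M.add_vector M.right_assoc M.unit)
  show "h \<in> rmod_hom R M ?T" by (rule rmod_homI) (simp_all add: car add smult)
  show "bij_betw h (carrier M) (carrier ?T)" using inj by (simp add: bij_betw_def car)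
qed

lemma fin_gen_image:
  assumes M: "right_module R M" and M': "right_module R M'" and h: "h \<in> rmod_hom R M M'"
    and surj: "h ` carrier M = carrier M'" and fg: "fin_gen R M"
  shows "fin_gen R M'"
proof -
  obtain S where S: "finite S" "S \<subseteq> carrier M" "carrier M = rspan R M S" using fg by (auto simp: fin_gen_iff)
  have sub: "h ` S \<subseteq> carrier M'" using S(2) surj by auto
  have "h ` rspan R M S \<subseteq> rspan R M' (h ` S)" by (rule rspan_image[OF M M' h S(2) sub rspan_incl])
  then have "carrier M' \<subseteq> rspan R M' (h ` S)" using S(3) surj by simp
  then have "carrier M' = rspan R M' (h ` S)" using rspan_subset[OF M' sub] by blast
  then show ?thesis using S(1) sub unfolding fin_gen_iff by blast
qed

lemma lsum_image:
  assumes W: "right_module R W" and \<tau>: "\<tau> \<in> X \<rightarrow> carrier W"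
  shows "lsum R W \<tau> ` carrier (freemod R X) = rspan R W (\<tau> ` X)"
proof
  interpret W: right_module R W by fact
  have sub: "\<tau> ` X \<subseteq> carrier W" using \<tau> by auto
  show "lsum R W \<tau> ` carrier (freemod R X) \<subseteq> rspan R W (\<tau> ` X)"
  proof (rule image_subsetI)
    fix f assume f: "f \<in> carrier (freemod R X)"
    show "lsum R W \<tau> f \<in> rspan R W (\<tau> ` X)"
      by (rule lsum_in_submodule[OF W rspan_submodule[OF W sub] f]) (rule subsetD[OF rspan_incl], simp)
  qed
  note Fm = freemod_right_module[OF W.ring_R, of X]
  have "\<tau> x \<in> lsum R W \<tau> ` carrier (freemod R X)" if x: "x \<in> X" for x
  proof -
    have "lsum R W \<tau> (single R \<one>\<^bsub>R\<^esub> x) = \<tau> x"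
      using lsum_single[OF W, of \<tau> x "\<one>\<^bsub>R\<^esub>"] \<tau> x by (auto simp: W.unit)
    then show ?thesis using imageI[OF single_closed[OF W.ring_R W.R.one_closed x], of "lsum R W \<tau>"] by simp
  qed
  then show "rspan R W (\<tau> ` X) \<subseteq> lsum R W \<tau> ` carrier (freemod R X)"
    by (intro rspan_least[OF submodule_image[OF Fm W lsum_hom[OF W \<tau>] right_module.carrier_submodule[OF Fm]]]) auto
qed

lemma fin_gen_freemod:
  assumes R: "ring R" and X: "finite X"
  shows "fin_gen R (freemod R X)"
proof -
  interpret ring R by fact
  note Fm = freemod_right_module[OF R, of X]
  have s: "single R \<one>\<^bsub>R\<^esub> \<in> X \<rightarrow> carrier (freemod R X)" using single_closed[OF R one_closed] by auto
  have "lsum R (freemod R X) (single R \<one>\<^bsub>R\<^esub>) f = f" if f: "f \<in> carrier (freemod R X)" for f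
  proof (rule freemod_rmod_hom_eqI[OF Fm lsum_hom[OF Fm s] rmod_hom_id _ f])
    fix i assume i: "i \<in> X"
    show "lsum R (freemod R X) (single R \<one>\<^bsub>R\<^esub>) (single R \<one>\<^bsub>R\<^esub> i) = single R \<one>\<^bsub>R\<^esub> i"
      using lsum_single[OF Fm, of "single R \<one>\<^bsub>R\<^esub>" i "\<one>\<^bsub>R\<^esub>"] single_closed[OF R one_closed i] right_module.unit[OF Fm]
      by simp
  qed
  then have "lsum R (freemod R X) (single R \<one>\<^bsub>R\<^esub>) ` carrier (freemod R X) = carrier (freemod R X)" by simp
  then have "carrier (freemod R X) = rspan R (freemod R X) (single R \<one>\<^bsub>R\<^esub> ` X)"
    using lsum_image[OF Fm s] by simp
  then show ?thesis using X s unfolding fin_gen_iff by blast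
qed

lemma additive_subgroup_finsum:
  assumes M: "abelian_group M" and A: "additive_subgroup A M" and f: "\<And>i. i \<in> S \<Longrightarrow> f i \<in> A"
  shows "finsum M f S \<in> A"
proof -
  interpret M: abelian_group M by fact
  interpret A: additive_subgroup A M by fact
  show ?thesis using f
  proof (induction S rule: infinite_finite_induct)
    case (insert i S)
    have "f i \<in> carrier M" "f \<in> S \<rightarrow> carrier M" using insert.prems A.a_subset by auto
    then show ?case using insert by simp
  qed simp_all
qed

section \<open>Graded free covers, the Nakayama lemma and graded resolutions\<close>

context graded_ring
begin

text \<open>The graded free module with a basis vector of degree \<open>dg x\<close> for every x in
  X, moved into the type of lists by \<open>fun_code\<close>; a and b are the two letters of that
  code.\<close>

lemma graded_cover:
  fixes X :: "'r list set" and a b :: 'r and W :: "('r, 'w) module"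
  assumes two: "a \<noteq> b" and W: "right_module R W" and Wsub: "\<And>i. additive_subgroup (Wgr i) W"
    and Wact: "\<And>i j x r. \<lbrakk>x \<in> Wgr i; r \<in> Rgr j\<rbrakk> \<Longrightarrow> r \<odot>\<^bsub>W\<^esub> x \<in> Wgr (i + j)"
    and \<tau>: "\<And>x. x \<in> X \<Longrightarrow> \<tau> x \<in> Wgr (dg x)"
  obtains P :: "('r, 'r list) module" and Pgr s e d where "graded_module R Rgr P Pgr"
    "free_retract R P X s e" "d \<in> rmod_hom R P W" "d ` carrier P = rspan R W (\<tau> ` X)"
    "\<And>j. d ` Pgr j \<subseteq> Wgr j" "finite X \<Longrightarrow> fin_gen R P"
proof -
  interpret W: right_module R W by fact
  let ?F = "freemod R X" and ?h = "fun_code R a b"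
  define P where "P = transport ?F ?h"
  note Fm = freemod_right_module[OF ring_axioms, of X]
  note T = transport_right_module[OF Fm fun_code_inj[OF two], folded P_def]
  let ?i = "inv_into (carrier ?F) ?h"
  note inv = rmod_hom_inverse[OF Fm T(2,3)]
  have \<tau>c: "\<tau> \<in> X \<rightarrow> carrier W" 
  proof
    fix x assume x: "x \<in> X"
    show "\<tau> x \<in> carrier W" using subsetD[OF additive_subgroup.a_subset[OF Wsub] \<tau>[OF x]] .
  qed
  note ls = lsum_hom[OF W \<tau>c]
  have surj: "?h ` carrier ?F = carrier P" using T(3) by (simp add: bij_betw_def)
  have ih: "?i (?h f) = f" if "f \<in> carrier ?F" for f using T(3) that by (simp add: bij_betw_def inv_into_f_f)
  have hi: "?h (?i p) = p" if "p \<in> carrier P" for p using surj that by (auto simp: f_inv_into_f)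
  have isurj: "?i ` carrier P = carrier ?F"
  proof
    show "?i ` carrier P \<subseteq> carrier ?F" using rmod_hom_closed[OF inv] by auto
    show "carrier ?F \<subseteq> ?i ` carrier P"
    proof
      fix f assume f: "f \<in> carrier ?F"
      then show "f \<in> ?i ` carrier P" using imageI[OF rmod_hom_closed[OF T(2) f], of ?i] ih by simp
    qed
  qed
  have gr: "lsum R W \<tau> f \<in> Wgr j" if f: "f \<in> free_grading X dg j" for f j
    unfolding lsum_def
  proof (rule additive_subgroup_finsum[OF W.abelian_group_M Wsub])
    have fc: "f \<in> carrier ?F" using f by (simp add: free_grading_def)
    fix x assume x: "x \<in> {i. f i \<noteq> \<zero>}"
    then have xX: "x \<in> X" using freemodD(3)[OF fc] by blast
    have "dg x \<le> j" "f x \<in> Rgr (j - dg x)" using f x by (auto simp: free_grading_def split: if_splits)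
    then show "f x \<odot>\<^bsub>W\<^esub> \<tau> x \<in> Wgr j" using Wact[OF \<tau>[OF xX], of "f x" "j - dg x"] by simp
  qed
  show thesis
  proof (rule that[of P "\<lambda>j. ?h ` free_grading X dg j" ?i ?h "\<lambda>p. lsum R W \<tau> (?i p)"])
    show "graded_module R Rgr P (\<lambda>j. ?h ` free_grading X dg j)"
      by (rule graded_module_transfer[OF free_graded T])
    show "free_retract R P X ?i ?h" using inv T(2) hi by (simp add: free_retract_def)
    show "(\<lambda>p. lsum R W \<tau> (?i p)) \<in> rmod_hom R P W" by (rule rmod_hom_comp[OF inv ls])
    have "(\<lambda>p. lsum R W \<tau> (?i p)) ` carrier P = lsum R W \<tau> ` ?i ` carrier P"
      by (rule image_image[symmetric])
    also have "\<dots> = lsum R W \<tau> ` carrier ?F" by (simp only: isurj)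
    finally show "(\<lambda>p. lsum R W \<tau> (?i p)) ` carrier P = rspan R W (\<tau> ` X)" using lsum_image[OF W \<tau>c] by simp
    show "(\<lambda>p. lsum R W \<tau> (?i p)) ` ?h ` free_grading X dg j \<subseteq> Wgr j" for j
      using gr by (auto simp: free_grading_def ih)
    show "fin_gen R P" if "finite X"
      by (rule fin_gen_image[OF Fm T(1,2) surj fin_gen_freemod[OF ring_axioms that]])
  qed
qed

text \<open>The homogeneous components of the elements of T generate. By induction on the degree,
  homogeneous elements of Z lie in their span Q: modulo T, an element of degree j comes from
  products of J with Z, and the factor from J has positive degree, so only components of Z of degree
  below j contribute.\<close>

lemma nakayama:
  fixes V :: "('r, 'v) module"
  assumes V: "graded_module R Rgr V Vgr" and Z: "submodule Z R V"
    and Zgr: "\<And>z i. z \<in> Z \<Longrightarrow> direct_sum.cmp V UNIV Vgr z i \<in> Z"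
    and J: "J \<subseteq> carrier R" "\<And>r. r \<in> J \<Longrightarrow> RD.cmp r 0 = \<zero>"
    and T: "finite T" "T \<subseteq> Z" "Z \<subseteq> rspan R V (T \<union> ideal_mult R V J Z)"
  obtains T' where "finite T'" "T' \<subseteq> Z" "\<And>t. t \<in> T' \<Longrightarrow> \<exists>i. t \<in> Vgr i" "Z = rspan R V T'"
proof -
  have Vm: "right_module R V" and ids: "internal_direct_sum V UNIV Vgr"
    and act: "\<And>i j x r. \<lbrakk>x \<in> Vgr i; r \<in> Rgr j\<rbrakk> \<Longrightarrow> r \<odot>\<^bsub>V\<^esub> x \<in> Vgr (i + j)"
    using V by (auto simp: graded_module_def)
  interpret V: right_module R V by (rule Vm)
  interpret D: direct_sum V UNIV Vgr by unfold_locales (rule ids)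
  note Z' = V.submoduleD[OF Z]
  define T' where "T' = (\<Union>t\<in>T. D.cmp t ` {i. D.cmp t i \<noteq> \<zero>\<^bsub>V\<^esub>})"
  have Tc: "T \<subseteq> carrier V" using T(2) Z'(1) by blast
  have finT': "finite T'" unfolding T'_def using T(1) Tc D.cmp_finite by (intro finite_UN_I finite_imageI) auto
  have T'Z: "T' \<subseteq> Z" using Zgr T(2) by (auto simp: T'_def)
  then have T'c: "T' \<subseteq> carrier V" using Z'(1) by blast
  define Q where "Q = rspan R V T'"
  have Q: "submodule Q R V" unfolding Q_def by (rule rspan_submodule[OF Vm T'c])
  note Q' = V.submoduleD[OF Q]
  have QZ: "Q \<subseteq> Z" unfolding Q_def by (rule rspan_least[OF Z T'Z])
  have T'Q: "t \<in> T' \<Longrightarrow> t \<in> Q" for t unfolding Q_def by (rule subsetD[OF rspan_incl])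
  \<comment> \<open>All degrees up to j are required because the action raises degrees: the
    component of r y in degree j involves every component of y up to that degree.\<close>
  define H where "H j = {y \<in> carrier V. \<forall>k\<le>j. D.cmp y k \<in> Q}" for j
  have H0: "\<zero>\<^bsub>V\<^esub> \<in> H j" for j using Q'(2) by (simp add: H_def D.cmp_zero)
  have Hadd: "x \<oplus>\<^bsub>V\<^esub> y \<in> H j" if "x \<in> H j" "y \<in> H j" for x y j
    using that Q'(3) by (simp add: H_def D.cmp_add)
  have Hsum: "finsum V f S \<in> H j" if "\<And>i. i \<in> S \<Longrightarrow> f i \<in> H j" for f :: "nat \<Rightarrow> 'v" and S j
    using that
  proof (induction S rule: infinite_finite_induct)
    case (insert i S)
    have "f i \<in> carrier V" "f \<in> S \<rightarrow> carrier V" using insert.prems by (auto simp: H_def)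
    then show ?case using insert Hadd by simp
  qed (use H0 in \<open>auto simp: finsum_def finprod_def\<close>)
  have key: "r \<odot>\<^bsub>V\<^esub> y \<in> H j" if r: "r \<in> carrier R" and y: "y \<in> carrier V"
    and low: "\<And>i l. i + l \<le> j \<Longrightarrow> RD.cmp r l \<odot>\<^bsub>V\<^esub> D.cmp y i \<in> Q" for r y j
  proof -
    have hom: "RD.cmp r l \<odot>\<^bsub>V\<^esub> D.cmp y i \<in> H j" for i l
    proof -
      have "RD.cmp r l \<odot>\<^bsub>V\<^esub> D.cmp y i \<in> Vgr (i + l)"
        using act[OF D.cmp_in[OF y UNIV_I] RD.cmp_in[OF r UNIV_I]] .
      then show ?thesis using r y low[of i l] Q'(2) by (auto simp: H_def D.cmp_homogeneous)
    qed
    have add_r: "additive_map R V (\<lambda>r. r \<odot>\<^bsub>V\<^esub> u)" if "u \<in> carrier V" for u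
      using that by (intro additive_mapI) (auto simp: V.add_scalar)
    have 1: "r \<odot>\<^bsub>V\<^esub> D.cmp y i \<in> H j" for i
    proof -
      have "r \<odot>\<^bsub>V\<^esub> D.cmp y i = (\<Oplus>l\<in>{l. RD.cmp r l \<noteq> \<zero>}. RD.cmp r l) \<odot>\<^bsub>V\<^esub> D.cmp y i"
        using RD.cmp_sum[OF r] by simp
      also have "\<dots> = (\<Oplus>\<^bsub>V\<^esub>l\<in>{l. RD.cmp r l \<noteq> \<zero>}. RD.cmp r l \<odot>\<^bsub>V\<^esub> D.cmp y i)"
        by (rule additive_map_finsum[OF is_abelian_group V.abelian_group_M add_r]) (use r y in auto)
      finally show ?thesis using Hsum[OF hom] by simp
    qed
    have "r \<odot>\<^bsub>V\<^esub> y = r \<odot>\<^bsub>V\<^esub> (\<Oplus>\<^bsub>V\<^esub>i\<in>{i. D.cmp y i \<noteq> \<zero>\<^bsub>V\<^esub>}. D.cmp y i)" using D.cmp_sum[OF y] by simp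
    also have "\<dots> = (\<Oplus>\<^bsub>V\<^esub>i\<in>{i. D.cmp y i \<noteq> \<zero>\<^bsub>V\<^esub>}. r \<odot>\<^bsub>V\<^esub> D.cmp y i)"
      by (rule additive_map_finsum[OF V.abelian_group_M V.abelian_group_M V.smult_additive[OF r]]) (use y in auto)
    finally show ?thesis using Hsum[OF 1] by simp
  qed
  have Hsub: "submodule (H j) R V" for j
  proof (rule V.submoduleI[OF _ H0 Hadd])
    show "H j \<subseteq> carrier V" by (auto simp: H_def)
    show "r \<odot>\<^bsub>V\<^esub> y \<in> H j" if "r \<in> carrier R" "y \<in> H j" for r y
      by (rule key) (use that Q'(4) in \<open>auto simp: H_def\<close>)
  qed auto
  have hom: "z \<in> Q" if "z \<in> Z" "z \<in> Vgr j" for z j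
    using that
  proof (induction j arbitrary: z rule: less_induct)
    case (less j)
    have "T \<subseteq> H j"
    proof
      fix t assume t: "t \<in> T"
      have "D.cmp t k \<in> Q" for k
        using t Q'(2) T'Q by (cases "D.cmp t k = \<zero>\<^bsub>V\<^esub>") (auto simp: T'_def)
      then show "t \<in> H j" using t Tc by (auto simp: H_def)
    qed
    moreover have "ideal_mult R V J Z \<subseteq> H j"
    proof (rule ideal_mult_least[OF Hsub])
      fix r y assume r: "r \<in> J" and y: "y \<in> Z"
      have rc: "r \<in> carrier R" and yc: "y \<in> carrier V" using r J(1) y Z'(1) by auto
      show "r \<odot>\<^bsub>V\<^esub> y \<in> H j"
      proof (rule key[OF rc yc])
        fix i l assume il: "i + l \<le> j"
        \<comment> \<open>For l = 0 the factor from J vanishes; otherwise i is smaller than j and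
          the induction hypothesis applies to the component of y.\<close>
        show "RD.cmp r l \<odot>\<^bsub>V\<^esub> D.cmp y i \<in> Q"
        proof (cases "l = 0")
          case True
          then show ?thesis using J(2)[OF r] yc Q'(2) by simp
        next
          case False
          then have "D.cmp y i \<in> Q" using less.IH[of i "D.cmp y i"] il Zgr[OF y] D.cmp_in[OF yc] by simp
          then show ?thesis using Q'(4) rc by simp
        qed
      qed
    qed
    ultimately have "rspan R V (T \<union> ideal_mult R V J Z) \<subseteq> H j" by (intro rspan_least[OF Hsub]) simp
    then have "z \<in> H j" using T(3) less.prems by blast
    then show ?case using less.prems by (auto simp: H_def D.cmp_homogeneous)
  qed
  have "Z \<subseteq> Q"
  proof
    fix z assume z: "z \<in> Z"
    have zc: "z \<in> carrier V" using z Z'(1) by blast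
    have "(\<Oplus>\<^bsub>V\<^esub>i\<in>{i. D.cmp z i \<noteq> \<zero>\<^bsub>V\<^esub>}. D.cmp z i) \<in> Q"
      by (rule V.submodule_finsum[OF Q]) (use hom Zgr[OF z] D.cmp_in[OF zc] in auto)
    then show "z \<in> Q" using D.cmp_sum[OF zc] by simp
  qed
  then have "Z = rspan R V T'" using QZ by (auto simp: Q_def)
  moreover have "\<exists>i. t \<in> Vgr i" if "t \<in> T'" for t
    using that Tc D.cmp_in by (auto simp: T'_def)
  ultimately show thesis using that finT' T'Z by blast
qed

lemma graded_submodule_generated:
  assumes V: "graded_module R Rgr V Vgr" and Z: "submodule Z R V"
    and Zgr: "\<And>z i. z \<in> Z \<Longrightarrow> direct_sum.cmp V UNIV Vgr z i \<in> Z"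
  shows "rspan R V {z \<in> Z. \<exists>i. z \<in> Vgr i} = Z"
proof -
  have Vm: "right_module R V" and ids: "internal_direct_sum V UNIV Vgr"
    using V by (auto simp: graded_module_def)
  interpret V: right_module R V by (rule Vm)
  interpret D: direct_sum V UNIV Vgr by unfold_locales (rule ids)
  let ?X = "{z \<in> Z. \<exists>i. z \<in> Vgr i}"
  have Xc: "?X \<subseteq> carrier V" using V.submoduleD(1)[OF Z] by auto
  have "z \<in> rspan R V ?X" if z: "z \<in> Z" for z
  proof -
    have zc: "z \<in> carrier V" using z V.submoduleD(1)[OF Z] by blast
    have "(\<Oplus>\<^bsub>V\<^esub>i\<in>{i. D.cmp z i \<noteq> \<zero>\<^bsub>V\<^esub>}. D.cmp z i) \<in> rspan R V ?X"
      by (rule V.submodule_finsum[OF rspan_submodule[OF Vm Xc]])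
        (use Zgr[OF z] D.cmp_in[OF zc] in \<open>auto intro!: subsetD[OF rspan_incl]\<close>)
    then show ?thesis using D.cmp_sum[OF zc] by simp
  qed
  then show ?thesis using rspan_least[OF Z, of ?X] by blast
qed

text \<open>The last conclusion is conditional, so that a resolution can be built before anything is
  known about finiteness and the same one be used under different hypotheses.\<close>

lemma resolution_step:
  fixes a b :: 'r and V :: "('r, 'r list) module"
  assumes two: "a \<noteq> b" and V: "graded_module R Rgr V Vgr" and Z: "submodule Z R V"
    and Zgr: "\<And>z i. z \<in> Z \<Longrightarrow> direct_sum.cmp V UNIV Vgr z i \<in> Z"
    and J: "J \<subseteq> carrier R" "\<And>r. r \<in> J \<Longrightarrow> RD.cmp r 0 = \<zero>"
  obtains P :: "('r, 'r list) module" and Pgr d and X :: "'r list set" and s e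
    where "graded_module R Rgr P Pgr" "free_retract R P X s e"
      "d \<in> rmod_hom R P V" "d ` carrier P = Z" "\<And>j. d ` Pgr j \<subseteq> Vgr j"
      "\<And>T. \<lbrakk>finite T; T \<subseteq> Z; Z \<subseteq> rspan R V (T \<union> ideal_mult R V J Z)\<rbrakk> \<Longrightarrow> fin_gen R P"
proof -
  have Vm: "right_module R V" and ids: "internal_direct_sum V UNIV Vgr"
    and act: "\<And>i j x r. \<lbrakk>x \<in> Vgr i; r \<in> Rgr j\<rbrakk> \<Longrightarrow> r \<odot>\<^bsub>V\<^esub> x \<in> Vgr (i + j)"
    using V by (auto simp: graded_module_def)
  interpret V: right_module R V by (rule Vm)
  interpret D: direct_sum V UNIV Vgr by unfold_locales (rule ids)
  let ?good = "\<lambda>X. finite X \<and> X \<subseteq> Z \<and> (\<forall>x\<in>X. \<exists>i. x \<in> Vgr i) \<and> Z = rspan R V X"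
  \<comment> \<open>A finite homogeneous generating set is taken if one exists, and all homogeneous
    elements of Z otherwise. By \<open>nakayama\<close>, finiteness modulo Z J already leads to the
    first case.\<close>
  define X where "X = (if \<exists>X. ?good X then SOME X. ?good X else {z \<in> Z. \<exists>i. z \<in> Vgr i})"
  have good: "?good X" if "\<exists>X. ?good X"
    using someI_ex[OF that] that by (simp add: X_def)
  have X: "(\<forall>x\<in>X. \<exists>i. x \<in> Vgr i) \<and> Z = rspan R V X"
  proof (cases "\<exists>X. ?good X")
    case True
    then show ?thesis using good by blast
  next
    case False
    then have "X = {z \<in> Z. \<exists>i. z \<in> Vgr i}" unfolding X_def by (rule if_not_P)
    then show ?thesis using graded_submodule_generated[OF V Z Zgr] by simp
  qed
  obtain dg where dg: "\<And>x. x \<in> X \<Longrightarrow> x \<in> Vgr (dg x)" using X by metis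
  obtain P :: "('r, 'r list) module" and Pgr s e d where P: "graded_module R Rgr P Pgr"
    "free_retract R P X s e" "d \<in> rmod_hom R P V" "d ` carrier P = rspan R V ((\<lambda>x. x) ` X)"
    "\<And>j. d ` Pgr j \<subseteq> Vgr j" "finite X \<Longrightarrow> fin_gen R P"
    by (rule graded_cover[where \<tau> = "\<lambda>x. x" and X = X and dg = dg and Wgr = Vgr,
          OF two Vm D.A_subgroup[OF UNIV_I] act dg], assumption+) (rule that)
  have fin: "fin_gen R P" if T: "finite T" "T \<subseteq> Z" "Z \<subseteq> rspan R V (T \<union> ideal_mult R V J Z)" for T
  proof -
    obtain T' where "finite T'" "T' \<subseteq> Z" "\<And>t. t \<in> T' \<Longrightarrow> \<exists>i. t \<in> Vgr i" "Z = rspan R V T'"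
      by (rule nakayama[OF V Z Zgr J T], assumption+) (rule that)
    then have "finite X" using good by blast
    then show ?thesis by (rule P(6))
  qed
  have "d ` carrier P = Z" using P(4) X by simp
  then show thesis by (rule that[OF P(1-3) _ P(5) fin])
qed

lemma kernel_graded:
  assumes M: "graded_module R Rgr M Mgr" and M': "graded_module R Rgr M' Mgr'"
    and h: "h \<in> rmod_hom R M M'" and gr: "\<And>j. h ` Mgr j \<subseteq> Mgr' j" and z: "z \<in> rmod_kernel M M' h"
  shows "direct_sum.cmp M UNIV Mgr z i \<in> rmod_kernel M M' h"
proof -
  have m: "right_module R M" "right_module R M'" and ids: "internal_direct_sum M UNIV Mgr" "internal_direct_sum M' UNIV Mgr'"
    using M M' by (auto simp: graded_module_def)
  interpret M: right_module R M by (rule m)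
  interpret M': right_module R M' by (rule m)
  interpret D: direct_sum M UNIV Mgr by unfold_locales (rule ids)
  interpret D': direct_sum M' UNIV Mgr' by unfold_locales (rule ids)
  have zc: "z \<in> carrier M" "h z = \<zero>\<^bsub>M'\<^esub>" using z by (auto simp: rmod_kernel_def)
  have "h (D.cmp z i) = D'.cmp (h z) i"
    by (rule direct_sum_map_cmp[OF D.direct_sum_axioms D'.direct_sum_axioms rmod_hom_additive[OF h] _ zc(1)])
      (use gr in auto)
  then show ?thesis using zc by (simp add: rmod_kernel_def D'.cmp_zero)
qed

lemma graded_resolution:
  fixes a b :: 'r and T :: "('r, 't) module"
  assumes two: "a \<noteq> b" and T: "graded_module R Rgr T Tgr"
    and t0: "t0 \<in> Tgr 0" "rspan R T {t0} = carrier T"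
    and J: "J \<subseteq> carrier R" "\<And>r. r \<in> J \<Longrightarrow> RD.cmp r 0 = \<zero>"
  obtains P :: "nat \<Rightarrow> ('r, 'r list) module" and Pgr d e
    where "projective_resolution R T P d e" "\<And>i. graded_module R Rgr (P i) (Pgr i)"
      "\<And>i j. d i ` Pgr (Suc i) j \<subseteq> Pgr i j" "\<And>j. e ` Pgr 0 j \<subseteq> Tgr j"
      "\<And>i. \<exists>(X :: 'r list set) s e. free_retract R (P i) X s e" "fin_gen R (P 0)"
      "\<And>i S. \<lbrakk>finite S; S \<subseteq> d i ` carrier (P (Suc i)); d i ` carrier (P (Suc i)) \<subseteq>
         rspan R (P i) (S \<union> ideal_mult R (P i) J (d i ` carrier (P (Suc i))))\<rbrakk> \<Longrightarrow> fin_gen R (P (Suc i))"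
proof -
  have Tm: "right_module R T" and Tids: "internal_direct_sum T UNIV Tgr"
    and Tact: "\<And>i j x r. \<lbrakk>x \<in> Tgr i; r \<in> Rgr j\<rbrakk> \<Longrightarrow> r \<odot>\<^bsub>T\<^esub> x \<in> Tgr (i + j)"
    using T by (auto simp: graded_module_def)
  interpret T: right_module R T by (rule Tm)
  interpret TD: direct_sum T UNIV Tgr by unfold_locales (rule Tids)
  \<comment> \<open>T is generated by t0 in degree 0, so a single basis vector suffices; the empty
    list is its index.\<close>
  obtain P0 :: "('r, 'r list) module" and Pgr0 s0 f0 e where P0: "graded_module R Rgr P0 Pgr0"
    "free_retract R P0 {[] :: 'r list} s0 f0" "e \<in> rmod_hom R P0 T"
    "e ` carrier P0 = rspan R T ((\<lambda>x. t0) ` {[] :: 'r list})"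
    "\<And>j. e ` Pgr0 j \<subseteq> Tgr j" "finite {[] :: 'r list} \<Longrightarrow> fin_gen R P0"
    by (rule graded_cover[where \<tau> = "\<lambda>x. t0" and dg = "\<lambda>x. 0" and X = "{[] :: 'r list}" and Wgr = Tgr,
          OF two Tm TD.A_subgroup[OF UNIV_I] Tact t0(1)], assumption+) (rule that)
  have gm: "right_module R M" if "graded_module R Rgr M Mgr" for M :: "('r, 'r list) module" and Mgr
    using that by (simp add: graded_module_def)
  define st0 where "st0 = (P0, Pgr0, rmod_kernel P0 T e)"
  \<comment> \<open>A state consists of a graded module and the kernel that the next module has to
    cover. The clause for n = 0 pins down the start, which dependent choice would leave
    open.\<close>
  define A where "A n st \<longleftrightarrow> (case st of (P, Pgr, Z) \<Rightarrow> graded_module R Rgr P Pgr \<and>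
      (\<exists>(X :: 'r list set) s e. free_retract R P X s e) \<and> submodule Z R P \<and>
      (\<forall>z\<in>Z. \<forall>i. direct_sum.cmp P UNIV Pgr z i \<in> Z)) \<and> (n = 0 \<longrightarrow> st = st0)"
    for n :: nat and st :: "('r, 'r list) module \<times> (nat \<Rightarrow> 'r list set) \<times> 'r list set"
  define C where "C st st' d \<longleftrightarrow> (case st of (P, Pgr, Z) \<Rightarrow> case st' of (P', Pgr', Z') \<Rightarrow>
      d \<in> rmod_hom R P' P \<and> d ` carrier P' = Z \<and> (\<forall>j. d ` Pgr' j \<subseteq> Pgr j) \<and> Z' = rmod_kernel P' P d \<and>
      (\<forall>S. finite S \<longrightarrow> S \<subseteq> Z \<longrightarrow> Z \<subseteq> rspan R P (S \<union> ideal_mult R P J Z) \<longrightarrow> fin_gen R P'))"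
    for st st' :: "('r, 'r list) module \<times> (nat \<Rightarrow> 'r list set) \<times> 'r list set" and d
  have "\<exists>st. \<forall>n. A n (st n) \<and> (\<exists>d. C (st n) (st (Suc n)) d)"
  proof (rule dependent_nat_choice)
    have "A 0 st0"
      using P0 rmod_kernel_submodule[OF gm[OF P0(1)] Tm P0(3)] kernel_graded[OF P0(1) T P0(3,5)]
      by (auto simp: A_def st0_def)
    then show "\<exists>st. A 0 st" by blast
  next
    fix st n assume An: "A n st"
    obtain P Pgr Z where st: "st = (P, Pgr, Z)" by (cases st) auto
    have P: "graded_module R Rgr P Pgr" "submodule Z R P" "\<And>z i. z \<in> Z \<Longrightarrow> direct_sum.cmp P UNIV Pgr z i \<in> Z"
      using An by (auto simp: A_def st)
    obtain P' :: "('r, 'r list) module" and Pgr' d and X :: "'r list set" and s e where P':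
      "graded_module R Rgr P' Pgr'" "free_retract R P' X s e"
      "d \<in> rmod_hom R P' P" "d ` carrier P' = Z" "\<And>j. d ` Pgr' j \<subseteq> Pgr j"
      "\<And>T. \<lbrakk>finite T; T \<subseteq> Z; Z \<subseteq> rspan R P (T \<union> ideal_mult R P J Z)\<rbrakk> \<Longrightarrow> fin_gen R P'"
      by (rule resolution_step[OF two P J], assumption+) (rule that)
    let ?st' = "(P', Pgr', rmod_kernel P' P d)"
    have "A (Suc n) ?st'"
      using P'(1,2) rmod_kernel_submodule[OF gm[OF P'(1)] gm[OF P(1)] P'(3)]
        kernel_graded[OF P'(1) P(1) P'(3,5)] by (auto simp: A_def)
    moreover have "C st ?st' d" using P' by (auto simp: C_def st)
    ultimately show "\<exists>st'. A (Suc n) st' \<and> (\<exists>d. C st st' d)" by blast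
  qed
  then obtain st where A: "\<And>n. A n (st n)" and "\<forall>n. \<exists>d. C (st n) (st (Suc n)) d" by blast
  then obtain d where C: "\<And>n. C (st n) (st (Suc n)) (d n)" by metis
  define P where "P n = fst (st n)" for n
  define Pgr where "Pgr n = fst (snd (st n))" for n
  define Z where "Z n = snd (snd (st n))" for n
  have st: "st n = (P n, Pgr n, Z n)" for n by (simp add: P_def Pgr_def Z_def)
  have z0: "P 0 = P0" "Pgr 0 = Pgr0" "Z 0 = rmod_kernel P0 T e"
    using A[of 0] st[of 0] by (auto simp: A_def st0_def)
  have An: "graded_module R Rgr (P n) (Pgr n)" "\<exists>(X :: 'r list set) s e. free_retract R (P n) X s e" for n
    using A[of n] by (auto simp: A_def st)
  have Cn: "d n \<in> rmod_hom R (P (Suc n)) (P n)" "d n ` carrier (P (Suc n)) = Z n"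
    "\<And>j. d n ` Pgr (Suc n) j \<subseteq> Pgr n j" "Z (Suc n) = rmod_kernel (P (Suc n)) (P n) (d n)"
    "\<And>S. \<lbrakk>finite S; S \<subseteq> Z n; Z n \<subseteq> rspan R (P n) (S \<union> ideal_mult R (P n) J (Z n))\<rbrakk> \<Longrightarrow> fin_gen R (P (Suc n))" for n
    using C[of n] by (auto simp: C_def st)
  show thesis
  proof (rule that[of P d e Pgr])
    show "projective_resolution R T P d e"
      unfolding projective_resolution_def
    proof (intro conjI allI)
      show "projective R (P i)" for i using An(2)[of i] projectiveI[OF gm[OF An(1)[of i]]] by blast
      show "e ` carrier (P 0) = carrier T" using P0(4) t0(2) by (simp add: z0)
    qed (use Cn P0(3) z0 in auto)
  qed (use An Cn P0 z0 in simp_all)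
qed

end

section \<open>The grading of the enveloping algebra\<close>

lemma additive_subgroup_generate:
  assumes "abelian_group M" "X \<subseteq> carrier M"
  shows "additive_subgroup (generate (add_monoid M) X) M"
proof -
  interpret abelian_group M by fact
  show ?thesis using add.generate_is_subgroup assms(2) by (simp add: additive_subgroup_def)
qed

lemma generate_subset_additive_subgroup:
  assumes "abelian_group M" "additive_subgroup H M" "X \<subseteq> H"
  shows "generate (add_monoid M) X \<subseteq> H"
proof -
  interpret abelian_group M by fact
  show ?thesis using add.generate_subgroup_incl assms(2,3) by (simp add: additive_subgroup_def)
qed

lemma additive_subgroup_vimage:
  assumes A: "abelian_group A" and B: "abelian_group B" and h: "additive_map A B h" and H: "additive_subgroup H B"
  shows "additive_subgroup {x \<in> carrier A. h x \<in> H} A"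
proof -
  interpret A: abelian_group A by fact
  interpret B: abelian_group B by fact
  interpret H: additive_subgroup H B by fact
  note neg = additive_map_neg[OF A B h]
  show ?thesis
  proof (intro additive_subgroupI subgroup.intro)
    fix x assume "x \<in> {x \<in> carrier A. h x \<in> H}"
    then show "inv\<^bsub>add_monoid A\<^esub> x \<in> {x \<in> carrier A. h x \<in> H}"
      using neg[of x] H.a_inv_closed by (simp add: a_inv_def[symmetric])
  qed (use additive_map_zero[OF A B h] H.zero_closed additive_map_add[OF h] H.a_closed in auto)
qed

lemma additive_subgroup_image:
  assumes A: "abelian_group A" and B: "abelian_group B" and h: "additive_map A B h"
  shows "additive_subgroup (h ` carrier A) B"
proof -
  interpret A: abelian_group A by fact
  interpret B: abelian_group B by fact
  show ?thesis
  proof (intro additive_subgroupI subgroup.intro)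
    fix x assume "x \<in> h ` carrier A"
    then obtain a where "a \<in> carrier A" "x = h a" by auto
    then have "\<ominus>\<^bsub>B\<^esub> x = h (\<ominus>\<^bsub>A\<^esub> a)" "\<ominus>\<^bsub>A\<^esub> a \<in> carrier A" using additive_map_neg[OF A B h] by simp_all
    then show "inv\<^bsub>add_monoid B\<^esub> x \<in> h ` carrier A" by (simp add: a_inv_def[symmetric])
  next
    fix x y assume "x \<in> h ` carrier A" "y \<in> h ` carrier A"
    then obtain a b where "a \<in> carrier A" "x = h a" "b \<in> carrier A" "y = h b" by auto
    then have "x \<oplus>\<^bsub>B\<^esub> y = h (a \<oplus>\<^bsub>A\<^esub> b)" "a \<oplus>\<^bsub>A\<^esub> b \<in> carrier A" using additive_map_add[OF h] by simp_all
    then show "x \<otimes>\<^bsub>add_monoid B\<^esub> y \<in> h ` carrier A" by simp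
  qed (use additive_map_zero[OF A B h, symmetric] additive_map_closed[OF h] in auto)
qed

lemma additive_subgroup_zero: "abelian_group M \<Longrightarrow> additive_subgroup {\<zero>\<^bsub>M\<^esub>} M"
  using group.triv_subgroup[OF abelian_group.a_group] by (simp add: additive_subgroup_def)

locale graded_lie = lie_algebra K L for K :: "('k, 'b) ring_scheme" (structure)
    and L :: "('k, 'l, 'm) lie_scheme" +
  fixes G :: "nat \<Rightarrow> 'l set"
  assumes graded: "graded_lie_algebra K L G"
begin

lemma L_ids: "internal_direct_sum L {1..} G"
  and G_bracket: "\<lbrakk>1 \<le> i; 1 \<le> j; x \<in> G i; y \<in> G j\<rbrakk> \<Longrightarrow> bracket L x y \<in> G (i + j)"
  using graded by (auto simp: graded_lie_algebra_def)

sublocale LD: direct_sum L "{1..}" G by unfold_locales (rule L_ids)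

lemma G_sub: "\<lbrakk>1 \<le> i; x \<in> G i\<rbrakk> \<Longrightarrow> x \<in> carrier L"
  using LD.A_sub[of i x] by simp

lemma G_smult: "\<lbrakk>1 \<le> i; a \<in> carrier K; x \<in> G i\<rbrakk> \<Longrightarrow> a \<odot>\<^bsub>L\<^esub> x \<in> G i"
  using graded submodule.smult_closed[of "G i" K L a x] by (auto simp: graded_lie_algebra_def)

abbreviation Ugr where "Ugr \<equiv> env_grading K L G"
abbreviation prd where "prd ps \<equiv> foldr (\<lambda>p u. inc (fst p) \<otimes>\<^bsub>U\<^esub> u) ps \<one>\<^bsub>U\<^esub>"
abbreviation hom_list where "hom_list ps \<equiv> (\<forall>(x, j)\<in>set ps. 1 \<le> j \<and> x \<in> G j)"
abbreviation weight where "weight ps \<equiv> sum_list (map snd ps)"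

lemma inc_additive: "additive_map L U inc"
  by (rule additive_mapI) (auto simp: inc_add)

lemma inc_zero: "inc \<zero>\<^bsub>L\<^esub> = \<zero>\<^bsub>U\<^esub>"
  by (rule additive_map_zero[OF L.M.abelian_group_axioms U.is_abelian_group inc_additive])

lemma sca_additive: "additive_map K U sca"
  using ring_hom_add[OF sca_hom] by (intro additive_mapI) auto

lemma prd_closed: "hom_list ps \<Longrightarrow> prd ps \<in> carrier U"
  by (induction ps) (auto intro!: U.m_closed inc_closed intro: G_sub[simplified, rotated])

lemma prd_append:
  assumes "hom_list ps" "hom_list qs"
  shows "prd (ps @ qs) = prd ps \<otimes>\<^bsub>U\<^esub> prd qs"
  using assms(1)
proof (induction ps)
  case Nil
  then show ?case using prd_closed[OF assms(2)] by simp
next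
  case (Cons p ps)
  have "hom_list ps" "inc (fst p) \<in> carrier U" using Cons.prems by (auto intro!: inc_closed intro: G_sub[simplified, rotated])
  then show ?case using Cons.IH prd_closed assms(2) by (simp add: U.m_assoc)
qed

lemma Ugr_0: "Ugr 0 = sca ` carrier K"
  by (simp add: env_grading_def)

lemma Ugr_pos: "0 < i \<Longrightarrow> Ugr i = generate (add_monoid U) {prd ps |ps. ps \<noteq> [] \<and> hom_list ps \<and> weight ps = i}"
  by (simp add: env_grading_def)

lemma Ugr_subgroup: "additive_subgroup (Ugr i) U"
proof (cases "i = 0")
  case True
  then show ?thesis
    using additive_subgroup_image[OF is_abelian_group U.is_abelian_group sca_additive] by (simp add: Ugr_0)
next
  case False
  show ?thesis unfolding Ugr_pos[OF False[unfolded neq0_conv]]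
    by (rule additive_subgroup_generate[OF U.is_abelian_group]) (use prd_closed in auto)
qed

lemma Ugr_closed: "u \<in> Ugr i \<Longrightarrow> u \<in> carrier U"
  using additive_subgroup.a_subset[OF Ugr_subgroup] by blast

lemma prd_in: "\<lbrakk>ps \<noteq> []; hom_list ps\<rbrakk> \<Longrightarrow> prd ps \<in> Ugr (weight ps)"
proof -
  assume ps: "ps \<noteq> []" "hom_list ps"
  then obtain p qs where "ps = p # qs" by (cases ps) auto
  then have pos: "0 < weight ps" using ps(2) by auto
  show ?thesis unfolding Ugr_pos[OF pos] by (rule generate.incl) (use ps in blast)
qed

lemma Ugr_subset:
  assumes H: "additive_subgroup H U" and "0 < i"
    and "\<And>ps. \<lbrakk>ps \<noteq> []; hom_list ps; weight ps = i\<rbrakk> \<Longrightarrow> prd ps \<in> H"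
  shows "Ugr i \<subseteq> H"
  unfolding Ugr_pos[OF assms(2)]
  by (rule generate_subset_additive_subgroup[OF U.is_abelian_group H]) (use assms(3) in blast)

lemma inc_in: "\<lbrakk>1 \<le> i; x \<in> G i\<rbrakk> \<Longrightarrow> inc x \<in> Ugr i"
  using prd_in[of "[(x, i)]"] G_sub by simp

lemma left_mult_additive: "u \<in> carrier U \<Longrightarrow> additive_map U U (\<lambda>v. u \<otimes>\<^bsub>U\<^esub> v)"
  and right_mult_additive: "u \<in> carrier U \<Longrightarrow> additive_map U U (\<lambda>v. v \<otimes>\<^bsub>U\<^esub> u)"
  by (auto intro!: additive_mapI simp: U.r_distr U.l_distr)

text \<open>In positive degree the products are nonempty, and the scalar is absorbed into the first
  letter, whose homogeneous component is a subspace.\<close>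

lemma Ugr_scalar:
  assumes a: "a \<in> carrier K" and u: "u \<in> Ugr i"
  shows "sca a \<otimes>\<^bsub>U\<^esub> u \<in> Ugr i"
proof (cases "i = 0")
  case True
  then obtain b where "b \<in> carrier K" "u = sca b" using u Ugr_0 by auto
  then show ?thesis using a True Ugr_0 ring_hom_mult[OF sca_hom a, of b, symmetric] by simp
next
  case False
  have "Ugr i \<subseteq> {u \<in> carrier U. sca a \<otimes>\<^bsub>U\<^esub> u \<in> Ugr i}"
  proof (rule Ugr_subset)
    show "additive_subgroup {u \<in> carrier U. sca a \<otimes>\<^bsub>U\<^esub> u \<in> Ugr i} U"
      by (rule additive_subgroup_vimage[OF U.is_abelian_group U.is_abelian_group left_mult_additive Ugr_subgroup])
        (use a in simp)
    fix ps assume ps: "ps \<noteq> []" "hom_list ps" "weight ps = i"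
    then obtain x j qs where q: "ps = (x, j) # qs" by (cases ps) auto
    have x: "1 \<le> j" "x \<in> G j" "hom_list qs" using ps(2) q by auto
    have "sca a \<otimes>\<^bsub>U\<^esub> prd ps = prd ((a \<odot>\<^bsub>L\<^esub> x, j) # qs)"
      using a x G_sub prd_closed[OF x(3)] by (simp add: q inc_smult U.m_assoc)
    moreover have "prd ((a \<odot>\<^bsub>L\<^esub> x, j) # qs) \<in> Ugr (weight ((a \<odot>\<^bsub>L\<^esub> x, j) # qs))"
      by (rule prd_in) (use x G_smult a in auto)
    ultimately show "prd ps \<in> {u \<in> carrier U. sca a \<otimes>\<^bsub>U\<^esub> u \<in> Ugr i}"
      using ps(3) q prd_closed[OF ps(2)] by simp
  qed (use False in simp)
  then show ?thesis using u by blast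
qed

text \<open>In positive degrees products are concatenated, one factor being reduced to generators at
  a time. Degree 0 consists of the scalars and is treated apart.\<close>

lemma Ugr_mult:
  assumes u: "u \<in> Ugr i" and v: "v \<in> Ugr j"
  shows "u \<otimes>\<^bsub>U\<^esub> v \<in> Ugr (i + j)"
proof -
  have uc: "u \<in> carrier U" and vc: "v \<in> carrier U" using u v Ugr_closed by auto
  consider "i = 0" | "j = 0" | "0 < i" "0 < j" by blast
  then show ?thesis
  proof cases
    case 1
    then obtain a where "a \<in> carrier K" "u = sca a" using u Ugr_0 by auto
    then show ?thesis using Ugr_scalar[OF _ v] 1 by simp
  next
    case 2
    then obtain a where "a \<in> carrier K" "v = sca a" using v Ugr_0 by auto
    then show ?thesis using Ugr_scalar[OF _ u] 2 sca_central[OF _ uc] by simp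
  next
    case 3
    have left: "prd ps \<otimes>\<^bsub>U\<^esub> v \<in> Ugr (i + j)" if ps: "ps \<noteq> []" "hom_list ps" "weight ps = i" for ps
    proof -
      have "Ugr j \<subseteq> {v \<in> carrier U. prd ps \<otimes>\<^bsub>U\<^esub> v \<in> Ugr (i + j)}"
      proof (rule Ugr_subset[OF additive_subgroup_vimage[OF U.is_abelian_group U.is_abelian_group
              left_mult_additive[OF prd_closed[OF ps(2)]] Ugr_subgroup] 3(2)])
        fix qs assume qs: "qs \<noteq> []" "hom_list qs" "weight qs = j"
        have "prd (ps @ qs) \<in> Ugr (weight (ps @ qs))" by (rule prd_in) (use ps qs in auto)
        then show "prd qs \<in> {v \<in> carrier U. prd ps \<otimes>\<^bsub>U\<^esub> v \<in> Ugr (i + j)}"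
          unfolding prd_append[OF ps(2) qs(2)] using ps(3) qs prd_closed[OF qs(2)] by simp
      qed
      then show ?thesis using v by blast
    qed
    have "Ugr i \<subseteq> {u \<in> carrier U. u \<otimes>\<^bsub>U\<^esub> v \<in> Ugr (i + j)}"
      by (rule Ugr_subset[OF additive_subgroup_vimage[OF U.is_abelian_group U.is_abelian_group
              right_mult_additive[OF vc] Ugr_subgroup] 3(1)]) (use left prd_closed in blast)
    then show ?thesis using u by blast
  qed
qed

text \<open>The coefficient function of the polynomial in t whose i-th coefficient is the component
  of x in degree i, viewed in U(L).\<close>

definition grade_poly :: "'l \<Rightarrow> nat \<Rightarrow> ('l list \<Rightarrow> 'k) set" where
  "grade_poly x i = inc (LD.cmp x i)"

text \<open>Sending x in degree i to x t^i respects brackets, so it extends to a ring homomorphism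
  \<Phi> from U(L) to the polynomials over U(L). On the i-th part, \<Phi> u = u t^i, hence the i-th
  coefficient of \<Phi> is a projection onto that part and the sum is direct. That the parts span
  follows from their closure under products.\<close>

lemma env_graded_ring: "graded_ring U Ugr"
proof -
  let ?P = "UP U"
  interpret P: UP_ring U ?P by (unfold_locales)
  have car: "carrier ?P = up U" by (simp add: UP_def)
  have coeff: "coeff ?P p n = p n" if "p \<in> carrier ?P" for p n using that by (simp add: UP_def)
  have gc: "grade_poly x \<in> carrier ?P" if x: "x \<in> carrier L" for x
    unfolding car
  proof (rule mem_upI)
    show "grade_poly x n \<in> carrier U" for n unfolding grade_poly_def by (rule inc_closed[OF LD.cmp_closed[OF x]])
    obtain n where "\<And>i. LD.cmp x i \<noteq> \<zero>\<^bsub>L\<^esub> \<Longrightarrow> i \<le> n"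
      using LD.cmp_finite[OF x] unfolding finite_nat_set_iff_bounded_le by blast
    then have "grade_poly x i = \<zero>\<^bsub>U\<^esub>" if "n < i" for i
      using that inc_zero by (metis grade_poly_def not_le)
    then show "\<exists>n. bound \<zero>\<^bsub>U\<^esub> n (grade_poly x)" by blast
  qed
  have gadd: "grade_poly (x \<oplus>\<^bsub>L\<^esub> y) = grade_poly x \<oplus>\<^bsub>?P\<^esub> grade_poly y"
    if "x \<in> carrier L" "y \<in> carrier L" for x y
  proof (rule P.up_eqI)
    fix n
    have "grade_poly (x \<oplus>\<^bsub>L\<^esub> y) n = grade_poly x n \<oplus>\<^bsub>U\<^esub> grade_poly y n"
      unfolding grade_poly_def LD.cmp_add[OF that] by (rule inc_add[OF LD.cmp_closed[OF that(1)] LD.cmp_closed[OF that(2)]])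
    then show "coeff ?P (grade_poly (x \<oplus>\<^bsub>L\<^esub> y)) n = coeff ?P (grade_poly x \<oplus>\<^bsub>?P\<^esub> grade_poly y) n"
      using that by (simp only: P.coeff_add gc coeff L.M.a_closed)
  qed (use that gc in simp_all)
  have ghom: "grade_poly x = monom ?P (inc x) i" if "1 \<le> i" "x \<in> G i" for x i
  proof (rule P.up_eqI)
    note x = G_sub[OF that]
    have "i \<in> {1..}" using that(1) by simp
    then have "grade_poly x n = (if i = n then inc x else \<zero>\<^bsub>U\<^esub>)" for n
      unfolding grade_poly_def LD.cmp_homogeneous[OF \<open>i \<in> {1..}\<close> that(2)] by (simp add: inc_zero)
    then show "coeff ?P (grade_poly x) n = coeff ?P (monom ?P (inc x) i) n" for n
      using x by (simp add: gc coeff[OF gc])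
  qed (use gc G_sub[OF that] in simp_all)
  have gsm: "grade_poly (a \<odot>\<^bsub>L\<^esub> x) = monom ?P (sca a) 0 \<otimes>\<^bsub>?P\<^esub> grade_poly x"
    if "a \<in> carrier K" "x \<in> carrier L" for a x
    using that(2)
  proof (induction x rule: LD.induct_homogeneous)
    case zero
    have "\<zero>\<^bsub>L\<^esub> \<in> G 1" using LD.A_zero by simp
    then show ?case using ghom[of 1 "\<zero>\<^bsub>L\<^esub>"] that(1) inc_zero by simp
  next
    case (homogeneous i x)
    have i: "1 \<le> i" using homogeneous by simp
    have x: "x \<in> carrier L" using G_sub i homogeneous by blast
    have "monom ?P (sca a \<otimes>\<^bsub>U\<^esub> inc x) (0 + i) = monom ?P (sca a) 0 \<otimes>\<^bsub>?P\<^esub> monom ?P (inc x) i"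
      by (rule P.monom_mult) (use that(1) x in auto)
    then show ?case using ghom[OF i homogeneous(2)] ghom[OF i G_smult[OF i that(1) homogeneous(2)]] that(1) x
      by (simp add: inc_smult del: P.monom_mult)
  next
    case (add x y)
    then show ?case using that(1) gadd gc by (simp add: L.smult_r_distr P.UP_r_distr)
  qed
  \<comment> \<open>Both sides are additive in x and in y. On elements of degrees i and j the claim
    is the bracket relation of U(L) multiplied by t^(i+j).\<close>
  have gbr: "grade_poly (bracket L x y) =
      grade_poly x \<otimes>\<^bsub>?P\<^esub> grade_poly y \<ominus>\<^bsub>?P\<^esub> grade_poly y \<otimes>\<^bsub>?P\<^esub> grade_poly x"
    if "x \<in> carrier L" "y \<in> carrier L" for x y
  proof -
    let ?B = "\<lambda>x y. grade_poly x \<otimes>\<^bsub>?P\<^esub> grade_poly y \<ominus>\<^bsub>?P\<^esub> grade_poly y \<otimes>\<^bsub>?P\<^esub> grade_poly x"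
    have z: "grade_poly \<zero>\<^bsub>L\<^esub> = \<zero>\<^bsub>?P\<^esub>"
      using ghom[of 1 "\<zero>\<^bsub>L\<^esub>"] LD.A_zero inc_zero by simp
    have Bl: "?B (x \<oplus>\<^bsub>L\<^esub> x') y = ?B x y \<oplus>\<^bsub>?P\<^esub> ?B x' y"
      and Br: "?B y (x \<oplus>\<^bsub>L\<^esub> x') = ?B y x \<oplus>\<^bsub>?P\<^esub> ?B y x'"
      if "x \<in> carrier L" "x' \<in> carrier L" "y \<in> carrier L" for x x' y
      using gc[OF that(1)] gc[OF that(2)] gc[OF that(3)] that
      by (simp_all add: gadd P.UP_l_distr P.UP_r_distr P.P.add.m_ac P.P.minus_add a_minus_def P.P.a_assoc)
    have hh: "grade_poly (bracket L x y) = ?B x y" if "1 \<le> i" "1 \<le> j" "x \<in> G i" "y \<in> G j" for i j x y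
    proof -
      have c: "x \<in> carrier L" "y \<in> carrier L" using G_sub that by blast+
      have "grade_poly (bracket L x y) = monom ?P (inc (bracket L x y)) (i + j)"
        by (rule ghom[OF _ G_bracket[OF that]]) (use that in simp)
      also have "\<dots> = monom ?P (inc x \<otimes>\<^bsub>U\<^esub> inc y) (i + j) \<oplus>\<^bsub>?P\<^esub> \<ominus>\<^bsub>?P\<^esub> monom ?P (inc y \<otimes>\<^bsub>U\<^esub> inc x) (j + i)"
        using c by (simp add: inc_bracket a_minus_def add.commute del: P.monom_mult)
      also have "\<dots> = ?B x y"
        using c by (simp add: ghom[OF that(1,3)] ghom[OF that(2,4)] a_minus_def)
      finally show ?thesis .
    qed
    have h1: "grade_poly (bracket L x y) = ?B x y" if i: "1 \<le> i" "x \<in> G i" and y: "y \<in> carrier L" for i x y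
    proof -
      have x: "x \<in> carrier L" using G_sub i by blast
      show ?thesis using y
      proof (induction y rule: LD.induct_homogeneous)
        case zero
        then show ?case using hh[OF i(1) _ i(2), of 1 "\<zero>\<^bsub>L\<^esub>"] LD.A_zero by simp
      next
        case (homogeneous j y)
        then show ?case using hh i by simp
      next
        case (add y y')
        then show ?case using Br[of y y' x] x gadd by (simp add: bracket_add_right bracket_closed)
      qed
    qed
    show ?thesis using that(1)
    proof (induction x rule: LD.induct_homogeneous)
      case zero
      then show ?case using h1[of 1 "\<zero>\<^bsub>L\<^esub>" y] LD.A_zero that(2) by simp
    next
      case (homogeneous j x)
      then show ?case using h1 that(2) by simp
    next
      case (add x x')
      then show ?case using Bl[of x x' y] that(2) gadd by (simp add: bracket_add_left bracket_closed)
    qed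
  qed
  have sh: "(\<lambda>a. monom ?P (sca a) 0) \<in> ring_hom K ?P"
    using ring_hom_trans[OF sca_hom P.const_ring_hom] by (simp add: comp_def)
  have comm: "monom ?P (sca a) 0 \<otimes>\<^bsub>?P\<^esub> grade_poly x = grade_poly x \<otimes>\<^bsub>?P\<^esub> monom ?P (sca a) 0"
    if a: "a \<in> carrier K" and x: "x \<in> carrier L" for a x
    using x
  proof (induction x rule: LD.induct_homogeneous)
    case zero
    show ?case using ghom[of 1 "\<zero>\<^bsub>L\<^esub>"] LD.A_zero inc_zero a by simp
  next
    case (homogeneous i x)
    then have x: "x \<in> carrier L" using G_sub by simp
    have "monom ?P (sca a \<otimes>\<^bsub>U\<^esub> inc x) (0 + i) = monom ?P (inc x \<otimes>\<^bsub>U\<^esub> sca a) (i + 0)"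
      using inc_sca_commute[OF a x] by simp
    then have "monom ?P (sca a) 0 \<otimes>\<^bsub>?P\<^esub> monom ?P (inc x) i = monom ?P (inc x) i \<otimes>\<^bsub>?P\<^esub> monom ?P (sca a) 0"
      using P.monom_mult[of "sca a" "inc x" 0 i] P.monom_mult[of "inc x" "sca a" i 0] x a
      by (simp only: inc_closed sca_closed)
    then show ?case using homogeneous ghom by simp
  next
    case (add x y)
    then show ?case using a gc by (simp add: gadd P.UP_r_distr P.UP_l_distr)
  qed
  obtain \<Phi> where \<Phi>: "\<Phi> \<in> ring_hom U ?P" "\<And>a. a \<in> carrier K \<Longrightarrow> \<Phi> (sca a) = monom ?P (sca a) 0"
    "\<And>x. x \<in> carrier L \<Longrightarrow> \<Phi> (inc x) = grade_poly x"
    by (rule env_universal[OF P.UP_ring sh gc comm gadd gsm gbr]) (assumption | rule that)+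
  have \<Phi>_add: "additive_map U ?P \<Phi>" using \<Phi>(1) by (auto simp: additive_map_def ring_hom_def)
  have \<Phi>_prd: "\<Phi> (prd ps) = monom ?P (prd ps) (weight ps)" if "hom_list ps" for ps
    using that
  proof (induction ps)
    case Nil
    then show ?case using ring_hom_one[OF \<Phi>(1)] by (simp add: P.monom_one)
  next
    case (Cons p ps)
    have p: "1 \<le> snd p" "fst p \<in> G (snd p)" "hom_list ps" using Cons.prems by auto
    have pc: "fst p \<in> carrier L" using G_sub p by blast
    then show ?case using Cons.IH[OF p(3)] ring_hom_mult[OF \<Phi>(1), of "inc (fst p)" "prd ps"] prd_closed[OF p(3)]
      by (simp add: \<Phi>(3) ghom[OF p(1,2)])
  qed
  have mono_add: "additive_map U ?P (\<lambda>u. monom ?P u i)" for i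
    by (rule additive_mapI) simp_all
  have \<Phi>_hom: "\<Phi> u = monom ?P u i" if u: "u \<in> Ugr i" for u i
  proof (cases "i = 0")
    case True
    then show ?thesis using u \<Phi>(2) Ugr_0 by auto
  next
    case False
    have d: "additive_map U ?P (\<lambda>u. \<Phi> u \<ominus>\<^bsub>?P\<^esub> monom ?P u i)"
      by (rule additive_mapI) (use additive_map_closed[OF \<Phi>_add] additive_map_add[OF \<Phi>_add] in
        \<open>simp_all add: a_minus_def P.P.minus_add P.P.a_ac\<close>)
    note z = additive_subgroup_zero[OF P.P.is_abelian_group]
    have "Ugr i \<subseteq> {u \<in> carrier U. \<Phi> u \<ominus>\<^bsub>?P\<^esub> monom ?P u i \<in> {\<zero>\<^bsub>?P\<^esub>}}"
      by (rule Ugr_subset[OF additive_subgroup_vimage[OF U.is_abelian_group P.P.is_abelian_group d z]])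
        (use False prd_closed \<Phi>_prd in \<open>auto simp: a_minus_def P.P.r_neg\<close>)
    then have "\<Phi> u \<ominus>\<^bsub>?P\<^esub> monom ?P u i = \<zero>\<^bsub>?P\<^esub>" using u by blast
    then show ?thesis
      using P.P.diff_zero_imp_eq[OF additive_map_closed[OF \<Phi>_add] P.monom_closed] Ugr_closed[OF u] by blast
  qed
  \<comment> \<open>The candidate projections, whose values on homogeneous elements are given by
    \<open>\<Phi>_hom\<close>.\<close>
  define p where "p i u = coeff ?P (\<Phi> u) i" for i u
  have one: "\<one>\<^bsub>U\<^esub> \<in> Ugr 0" using ring_hom_one[OF sca_hom] unfolding Ugr_0 by (metis imageI one_closed)
  note dec_hom = U.decomposable_homogeneous[of Ugr, OF Ugr_subgroup]
  note dec_add = U.decomposable_add[of Ugr, OF Ugr_subgroup]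
  note dec_sum = U.decomposable_finsum[of Ugr, OF Ugr_subgroup]
  have dec: "u \<in> decomposable U Ugr" if "u \<in> carrier U" for u
    using that
  proof (induction u rule: env_induct)
    case (scalar a)
    then show ?case using dec_hom[of _ 0] Ugr_0 by auto
  next
    case (incl x)
    then show ?case
    proof (induction x rule: LD.induct_homogeneous)
      case zero
      show ?case using dec_hom[OF additive_subgroup.zero_closed[OF Ugr_subgroup]] by (simp add: inc_zero)
    next
      case (homogeneous i x)
      then show ?case using dec_hom[OF inc_in[of i x]] by simp
    next
      case (add x y)
      then show ?case using dec_add by (simp add: inc_add)
    qed
  next
    case (add u v)
    then show ?case using dec_add by simp
  next
    case (mult u v)
    obtain c d where c: "\<And>i. c i \<in> Ugr i" "finite {i. c i \<noteq> \<zero>\<^bsub>U\<^esub>}" "u = (\<Oplus>\<^bsub>U\<^esub>i\<in>{i. c i \<noteq> \<zero>\<^bsub>U\<^esub>}. c i)"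
      and d: "\<And>i. d i \<in> Ugr i" "finite {i. d i \<noteq> \<zero>\<^bsub>U\<^esub>}" "v = (\<Oplus>\<^bsub>U\<^esub>i\<in>{i. d i \<noteq> \<zero>\<^bsub>U\<^esub>}. d i)"
      using mult(3,4) by (auto simp: decomposable_def)
    have cc: "c i \<in> carrier U" "d i \<in> carrier U" for i using c(1) d(1) Ugr_closed by blast+
    have i: "c i \<otimes>\<^bsub>U\<^esub> v \<in> decomposable U Ugr" for i
    proof -
      have eq: "c i \<otimes>\<^bsub>U\<^esub> v = (\<Oplus>\<^bsub>U\<^esub>j\<in>{i. d i \<noteq> \<zero>\<^bsub>U\<^esub>}. c i \<otimes>\<^bsub>U\<^esub> d j)"
        unfolding d(3) by (rule U.finsum_rdistr) (use d(2) cc in auto)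
      have "c i \<otimes>\<^bsub>U\<^esub> d j \<in> decomposable U Ugr" for j
        by (rule dec_hom[OF Ugr_mult[OF c(1) d(1)]])
      then show ?thesis unfolding eq using cc by (intro dec_sum) simp
    qed
    have eq: "u \<otimes>\<^bsub>U\<^esub> v = (\<Oplus>\<^bsub>U\<^esub>i\<in>{i. c i \<noteq> \<zero>\<^bsub>U\<^esub>}. c i \<otimes>\<^bsub>U\<^esub> v)"
      unfolding c(3) by (rule U.finsum_ldistr) (use c(2) cc mult(2) in auto)
    show ?case unfolding eq using i cc mult(2) by (intro dec_sum) simp
  qed
  show ?thesis
  proof (intro graded_ring.intro graded_ring_axioms.intro U.ring_axioms Ugr_mult one)
    show "internal_direct_sum U UNIV Ugr"
    proof (rule U.internal_direct_sumI[OF Ugr_subgroup _ _ dec])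
      show "additive_map U U (p i)" for i
        by (rule additive_mapI) (use additive_map_closed[OF \<Phi>_add] additive_map_add[OF \<Phi>_add] in
          \<open>simp_all add: p_def\<close>)
      show "p j u = (if i = j then u else \<zero>\<^bsub>U\<^esub>)" if "u \<in> Ugr i" for i j u
        using \<Phi>_hom[OF that] Ugr_closed[OF that] by (simp add: p_def)
    qed
  qed
qed

sublocale UG: graded_ring U Ugr by (rule env_graded_ring)

lemma augmentation_Ugr:
  assumes i: "0 < i" and u: "u \<in> Ugr i"
  shows "env_augmentation u = \<zero>"
proof -
  have add: "additive_map U K env_augmentation"
    using augmentation_hom by (auto simp: additive_map_def ring_hom_def)
  note z = additive_subgroup_zero[OF is_abelian_group]
  have "Ugr i \<subseteq> {u \<in> carrier U. env_augmentation u \<in> {\<zero>}}"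
  proof (rule Ugr_subset[OF additive_subgroup_vimage[OF U.is_abelian_group is_abelian_group add z] i])
    fix ps assume ps: "ps \<noteq> []" "hom_list ps" "weight ps = i"
    then obtain p qs where q: "ps = p # qs" by (cases ps) auto
    have "fst p \<in> carrier L" "hom_list qs" using ps(2) q by (auto intro: G_sub[simplified, rotated])
    then show "prd ps \<in> {u \<in> carrier U. env_augmentation u \<in> {\<zero>}}"
      using prd_closed[OF ps(2)] prd_closed[of qs] ring_hom_mult[OF augmentation_hom, of "inc (fst p)" "prd qs"]
        ring_hom_closed[OF augmentation_hom] by (simp add: q augmentation_inc)
  qed
  then show ?thesis using u by blast
qed

text \<open>The augmentation, followed by the inclusion of scalars, is the projection onto degree 0:
  both fix scalars and kill the positive degrees.\<close>

lemma augmentation_kernel_cmp: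
  assumes u: "u \<in> carrier U" and e: "env_augmentation u = \<zero>"
  shows "UG.RD.cmp u 0 = \<zero>\<^bsub>U\<^esub>"
proof -
  have "sca (env_augmentation v) = UG.RD.cmp v 0" if "v \<in> carrier U" for v
    using that
  proof (induction v rule: UG.RD.induct_homogeneous)
    case zero
    have "env_augmentation \<zero>\<^bsub>U\<^esub> = \<zero>" using augmentation_sca[of \<zero>] sca_zero by simp
    then show ?case by (simp add: UG.RD.cmp_zero sca_zero)
  next
    case (homogeneous i v)
    show ?case
    proof (cases "i = 0")
      case True
      then obtain a where "a \<in> carrier K" "v = sca a" using homogeneous(2) Ugr_0 by auto
      then show ?thesis using UG.RD.cmp_homogeneous[OF homogeneous(1,2), of 0] True by (simp add: augmentation_sca)
    next
      case False
      then show ?thesis using UG.RD.cmp_homogeneous[OF homogeneous(1,2), of 0] augmentation_Ugr[OF _ homogeneous(2)]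
        by (simp add: sca_zero)
    qed
  next
    case (add v w)
    then show ?case
      using ring_hom_add[OF augmentation_hom, of v w] ring_hom_add[OF sca_hom] ring_hom_closed[OF augmentation_hom]
      by (simp add: UG.RD.cmp_add)
  qed
  then show ?thesis using u e sca_zero by metis
qed

abbreviation Kgr where "Kgr \<equiv> (\<lambda>j :: nat. if j = 0 then carrier K else {\<zero>})"

lemma trivial_graded: "graded_module U Ugr (trivial_module K) Kgr"
proof -
  let ?T = "trivial_module K :: (('l list \<Rightarrow> 'k) set, 'k) module"
  note [simp] = trivial_module_simps
  interpret T: right_module U ?T by (rule trivial_right_module)
  have sub: "additive_subgroup (Kgr i) ?T" for i
  proof (intro additive_subgroupI)
    show "subgroup (Kgr i) (add_monoid ?T)"
      using T.M.add.triv_subgroup T.M.add.subgroup_self by simp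
  qed
  have "internal_direct_sum ?T UNIV Kgr"
  proof (rule T.M.internal_direct_sumI[OF sub, where p = "\<lambda>i x. if i = 0 then x else \<zero>"])
    show "additive_map ?T ?T (\<lambda>x. if i = 0 then x else \<zero>)" for i :: nat
      by (rule additive_mapI) auto
    show "x \<in> decomposable ?T Kgr" if "x \<in> carrier ?T" for x
      by (rule T.M.decomposable_homogeneous[of Kgr _ 0, OF sub]) (use that in simp)
  qed (auto split: if_splits)
  moreover have "r \<odot>\<^bsub>?T\<^esub> x \<in> Kgr (i + j)" if "x \<in> Kgr i" "r \<in> Ugr j" for i j x r
    using that ring_hom_closed[OF augmentation_hom Ugr_closed[OF that(2)]] augmentation_Ugr[OF _ that(2)]
    by (auto split: if_splits)
  ultimately show ?thesis using T.right_module_axioms by (simp add: graded_module_def)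
qed

end

section \<open>Cosets and quotient modules\<close>

lemma coset_mem:
  assumes M: "abelian_group M" and H: "additive_subgroup H M" and x: "x \<in> carrier M"
  shows "z \<in> H +>\<^bsub>M\<^esub> x \<longleftrightarrow> z \<in> carrier M \<and> z \<ominus>\<^bsub>M\<^esub> x \<in> H"
proof -
  interpret M: abelian_group M by fact
  interpret H: additive_subgroup H M by fact
  have "h \<oplus>\<^bsub>M\<^esub> x \<ominus>\<^bsub>M\<^esub> x = h" if "h \<in> H" for h
    using that H.a_subset x by (auto simp: a_minus_def M.a_assoc M.r_neg)
  moreover have "z = (z \<ominus>\<^bsub>M\<^esub> x) \<oplus>\<^bsub>M\<^esub> x" if "z \<in> carrier M"
    using that x by (simp add: a_minus_def M.a_assoc M.l_neg)
  ultimately show ?thesis using x H.a_subset by (auto simp: a_r_coset_def')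
qed

lemma coset_self:
  assumes "abelian_group M" "additive_subgroup H M" "x \<in> carrier M"
  shows "x \<in> H +>\<^bsub>M\<^esub> x"
  using abelian_subgroup.a_rcos_self[OF abelian_subgroupI3[OF assms(2,1)] assms(3)] .

lemma coset_eq_iff:
  assumes M: "abelian_group M" and H: "additive_subgroup H M" and x: "x \<in> carrier M" and y: "y \<in> carrier M"
  shows "H +>\<^bsub>M\<^esub> x = H +>\<^bsub>M\<^esub> y \<longleftrightarrow> x \<ominus>\<^bsub>M\<^esub> y \<in> H"
proof
  show "x \<ominus>\<^bsub>M\<^esub> y \<in> H" if "H +>\<^bsub>M\<^esub> x = H +>\<^bsub>M\<^esub> y"
    using coset_self[OF M H x] coset_mem[OF M H y] that by blast
  assume "x \<ominus>\<^bsub>M\<^esub> y \<in> H"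
  then have "x \<in> H +>\<^bsub>M\<^esub> y" using coset_mem[OF M H y] x by blast
  then show "H +>\<^bsub>M\<^esub> x = H +>\<^bsub>M\<^esub> y"
    using abelian_group.a_repr_independence[OF M _ y additive_subgroup.a_subgroup[OF H]] by simp
qed

lemma coset_add:
  assumes "abelian_group M" "additive_subgroup H M" "x \<in> carrier M" "y \<in> carrier M"
  shows "set_add M (H +>\<^bsub>M\<^esub> x) (H +>\<^bsub>M\<^esub> y) = H +>\<^bsub>M\<^esub> (x \<oplus>\<^bsub>M\<^esub> y)"
  by (rule abelian_subgroup.a_rcos_sum[OF abelian_subgroupI3[OF assms(2,1)] assms(3,4)])

lemma coset_zero:
  assumes "abelian_group M" "additive_subgroup H M"
  shows "H +>\<^bsub>M\<^esub> \<zero>\<^bsub>M\<^esub> = H"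
proof -
  interpret M: abelian_group M by fact
  interpret H: additive_subgroup H M by fact
  show ?thesis by (rule M.a_coset_join2[OF M.zero_closed H.a_subgroup H.zero_closed])
qed

text \<open>All representatives are sent to the same coset, so the unions in the definitions of
  quotient operations and induced maps are single cosets.\<close>

lemma coset_map:
  assumes M: "abelian_group M" and H: "additive_subgroup H M" and M': "abelian_group M'"
    and H': "additive_subgroup H' M'" and h: "additive_map M M' h" and HH: "h ` H \<subseteq> H'" and x: "x \<in> carrier M"
  shows "(\<Union>z\<in>H +>\<^bsub>M\<^esub> x. H' +>\<^bsub>M'\<^esub> h z) = H' +>\<^bsub>M'\<^esub> h x"
proof -
  have "H' +>\<^bsub>M'\<^esub> h z = H' +>\<^bsub>M'\<^esub> h x" if "z \<in> H +>\<^bsub>M\<^esub> x" for z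
  proof -
    have z: "z \<in> carrier M" "z \<ominus>\<^bsub>M\<^esub> x \<in> H" using that coset_mem[OF M H x] by auto
    then have "h z \<ominus>\<^bsub>M'\<^esub> h x \<in> H'" using HH additive_map_diff[OF M M' h z(1) x] by auto
    then show ?thesis using coset_eq_iff[OF M' H'] additive_map_closed[OF h] z(1) x by blast
  qed
  then show ?thesis using coset_self[OF M H x] by blast
qed

lemma quot_module_simps:
  "carrier (quot_module M H) = (\<lambda>x. H +>\<^bsub>M\<^esub> x) ` carrier M" "zero (quot_module M H) = H"
  "add (quot_module M H) = set_add M"
  by (auto simp: quot_module_def A_RCOSETS_def')

lemma submodule_additive: "submodule H R M \<Longrightarrow> additive_subgroup H M"
  by (simp add: submodule_def additive_subgroup_def)

lemma quot_module_smult: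
  assumes M: "right_module R M" and H: "submodule H R M" and r: "r \<in> carrier R" and x: "x \<in> carrier M"
  shows "r \<odot>\<^bsub>quot_module M H\<^esub> (H +>\<^bsub>M\<^esub> x) = H +>\<^bsub>M\<^esub> (r \<odot>\<^bsub>M\<^esub> x)"
proof -
  interpret M: right_module R M by fact
  note A = M.abelian_group_M submodule_additive[OF H]
  show ?thesis unfolding quot_module_def
    using coset_map[OF A A M.smult_additive[OF r] _ x] M.submoduleD(4)[OF H r] by auto
qed

text \<open>
  Homology and coinvariants are modules over a quotient ring \<open>S\<close> of \<open>R\<close>, defined through choices of
  representatives. All that matters about them is that they receive a semilinear surjection from
  an \<open>R\<close>-module.
\<close>

locale semilinear = right_module R M
  for R :: "('r, 'b) ring_scheme" (structure) and M :: "('r, 'v) module" +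
  fixes S :: "('s, 'c) ring_scheme" and \<pi> :: "'r \<Rightarrow> 's" and Z :: "'v set"
    and C :: "('s, 'w) module" and p :: "'v \<Rightarrow> 'w"
  assumes S: "ring S" and pi: "\<pi> \<in> ring_hom R S" and pi_surj: "\<pi> ` carrier R = carrier S"
    and Z: "submodule Z R M" and p_surj: "p ` Z = carrier C"
    and p_add: "\<lbrakk>x \<in> Z; y \<in> Z\<rbrakk> \<Longrightarrow> p (x \<oplus>\<^bsub>M\<^esub> y) = p x \<oplus>\<^bsub>C\<^esub> p y"
    and p_zero: "p \<zero>\<^bsub>M\<^esub> = \<zero>\<^bsub>C\<^esub>"
    and p_smult: "\<lbrakk>r \<in> carrier R; x \<in> Z\<rbrakk> \<Longrightarrow> p (r \<odot>\<^bsub>M\<^esub> x) = \<pi> r \<odot>\<^bsub>C\<^esub> p x"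
begin

lemmas Z' = submoduleD[OF Z]

lemma p_closed: "x \<in> Z \<Longrightarrow> p x \<in> carrier C" using p_surj by blast

lemma lift: assumes "c \<in> carrier C" obtains x where "x \<in> Z" "c = p x"
  using assms p_surj by blast

lemma lift_scalar: assumes "s \<in> carrier S" obtains r where "r \<in> carrier R" "s = \<pi> r"
  using assms pi_surj by blast

text \<open>Elements and scalars are lifted through p and \<pi>, so every module law is inherited
  from M.\<close>

lemma C_right_module: "right_module S C"
proof (intro right_module.intro right_module_axioms.intro S abelian_groupI)
  show "\<zero>\<^bsub>C\<^esub> \<in> carrier C" using p_closed[OF Z'(2)] p_zero by simp
  note Zc = subsetD[OF Z'(1)]
  {
    fix x y z assume "x \<in> carrier C" "y \<in> carrier C" "z \<in> carrier C"
    then obtain a b c where abc: "a \<in> Z" "x = p a" "b \<in> Z" "y = p b" "c \<in> Z" "z = p c" by (meson lift)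
    note [simp] = abc(2,4,6) p_add[symmetric] Z'(3) abc(1,3,5) Zc[OF abc(1)] Zc[OF abc(3)] Zc[OF abc(5)] p_zero[symmetric]
    show "x \<oplus>\<^bsub>C\<^esub> y \<in> carrier C" by (simp add: p_closed)
    show "x \<oplus>\<^bsub>C\<^esub> y \<oplus>\<^bsub>C\<^esub> z = x \<oplus>\<^bsub>C\<^esub> (y \<oplus>\<^bsub>C\<^esub> z)" by (simp add: M.a_assoc)
    show "x \<oplus>\<^bsub>C\<^esub> y = y \<oplus>\<^bsub>C\<^esub> x" by (simp add: M.a_comm)
    show "\<zero>\<^bsub>C\<^esub> \<oplus>\<^bsub>C\<^esub> x = x" using Z'(2) by simp
    have "p (\<ominus>\<^bsub>M\<^esub> a) \<oplus>\<^bsub>C\<^esub> x = \<zero>\<^bsub>C\<^esub>" using Z'(5)[OF abc(1)] by (simp add: M.l_neg)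
    then show "\<exists>y\<in>carrier C. y \<oplus>\<^bsub>C\<^esub> x = \<zero>\<^bsub>C\<^esub>" using p_closed[OF Z'(5)[OF abc(1)]] by blast
    show "\<one>\<^bsub>S\<^esub> \<odot>\<^bsub>C\<^esub> x = x" using p_smult[of \<one> a] ring_hom_one[OF pi] by (simp add: unit)
  }
  {
    fix s t x y assume "s \<in> carrier S" "t \<in> carrier S" "x \<in> carrier C" "y \<in> carrier C"
    then obtain r q a b where abc: "r \<in> carrier R" "s = \<pi> r" "q \<in> carrier R" "t = \<pi> q" "a \<in> Z" "x = p a" "b \<in> Z" "y = p b"
      by (meson lift lift_scalar)
    note [simp] = abc(2,4,6,8) p_add[symmetric] p_smult[symmetric] Z'(3,4) abc(1,3,5,7) Zc[OF abc(5)] Zc[OF abc(7)]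
      ring_hom_add[OF pi, symmetric] ring_hom_mult[OF pi, symmetric]
    show "s \<odot>\<^bsub>C\<^esub> x \<in> carrier C" by (simp add: p_closed)
    show "(s \<oplus>\<^bsub>S\<^esub> t) \<odot>\<^bsub>C\<^esub> x = s \<odot>\<^bsub>C\<^esub> x \<oplus>\<^bsub>C\<^esub> t \<odot>\<^bsub>C\<^esub> x" by (simp add: add_scalar)
    show "s \<odot>\<^bsub>C\<^esub> (x \<oplus>\<^bsub>C\<^esub> y) = s \<odot>\<^bsub>C\<^esub> x \<oplus>\<^bsub>C\<^esub> s \<odot>\<^bsub>C\<^esub> y" by (simp add: add_vector)
    show "(s \<otimes>\<^bsub>S\<^esub> t) \<odot>\<^bsub>C\<^esub> x = t \<odot>\<^bsub>C\<^esub> (s \<odot>\<^bsub>C\<^esub> x)" by (simp add: right_assoc)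
  }
qed

lemma p_diff: "\<lbrakk>x \<in> Z; y \<in> Z\<rbrakk> \<Longrightarrow> p (x \<ominus>\<^bsub>M\<^esub> y) = p x \<ominus>\<^bsub>C\<^esub> p y"
proof -
  assume xy: "x \<in> Z" "y \<in> Z"
  interpret C: right_module S C by (rule C_right_module)
  have "p (\<ominus>\<^bsub>M\<^esub> y) \<oplus>\<^bsub>C\<^esub> p y = \<zero>\<^bsub>C\<^esub>"
    using p_add[OF Z'(5)[OF xy(2)] xy(2)] subsetD[OF Z'(1) xy(2)] by (simp add: M.l_neg p_zero)
  then have "\<ominus>\<^bsub>C\<^esub> p y = p (\<ominus>\<^bsub>M\<^esub> y)"
    by (intro C.M.minus_equality) (simp_all add: p_closed Z'(5) xy)
  then show ?thesis using p_add[OF xy(1) Z'(5)[OF xy(2)]] by (simp add: a_minus_def)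
qed

lemma p_eq_iff:
  assumes "x \<in> Z" "y \<in> Z"
  shows "p x = p y \<longleftrightarrow> p (x \<ominus>\<^bsub>M\<^esub> y) = \<zero>\<^bsub>C\<^esub>"
proof -
  interpret C: right_module S C by (rule C_right_module)
  show ?thesis unfolding p_diff[OF assms]
    using C.M.diff_zero_imp_eq[of "p x" "p y"] p_closed assms by (auto simp: a_minus_def C.M.r_neg)
qed

lemma image_submodule:
  assumes W: "submodule W R M" "W \<subseteq> Z"
  shows "submodule (p ` W) S C"
proof -
  interpret C: right_module S C by (rule C_right_module)
  note W' = submoduleD[OF W(1)]
  show ?thesis
  proof (rule C.submoduleI)
    show "p ` W \<subseteq> carrier C" using W(2) p_closed by blast
    show "\<zero>\<^bsub>C\<^esub> \<in> p ` W" using W'(2) p_zero[symmetric] by blast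
  next
    fix x y assume "x \<in> p ` W" "y \<in> p ` W"
    then obtain a b where ab: "a \<in> W" "x = p a" "b \<in> W" "y = p b" by blast
    then have "x \<oplus>\<^bsub>C\<^esub> y = p (a \<oplus>\<^bsub>M\<^esub> b)" using p_add[OF subsetD[OF W(2) ab(1)] subsetD[OF W(2) ab(3)]] by simp
    then show "x \<oplus>\<^bsub>C\<^esub> y \<in> p ` W" using W'(3)[OF ab(1,3)] by simp
  next
    fix s x assume "s \<in> carrier S" "x \<in> p ` W"
    obtain r where r: "r \<in> carrier R" "s = \<pi> r" using \<open>s \<in> carrier S\<close> by (rule lift_scalar)
    obtain a where a: "a \<in> W" "x = p a" using \<open>x \<in> p ` W\<close> by blast
    note ra = r a
    then have "s \<odot>\<^bsub>C\<^esub> x = p (r \<odot>\<^bsub>M\<^esub> a)" using p_smult[OF ra(1) subsetD[OF W(2) ra(3)]] by simp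
    then show "s \<odot>\<^bsub>C\<^esub> x \<in> p ` W" using W'(4)[OF ra(1,3)] by simp
  qed
qed

lemma vimage_submodule:
  assumes H: "submodule H S C"
  shows "submodule {x \<in> Z. p x \<in> H} R M"
proof -
  interpret C: right_module S C by (rule C_right_module)
  note H' = C.submoduleD[OF H]
  show ?thesis
    by (rule submoduleI) (use Z' H' p_zero p_add p_smult ring_hom_closed[OF pi] in auto)
qed

text \<open>Turns finite generation over S into a statement inside M: generators of C lift to Z, and
  elements of Z with equal images differ by the kernel of p.\<close>

lemma fin_gen_iff_lift:
  "fin_gen S C \<longleftrightarrow> (\<exists>T. finite T \<and> T \<subseteq> Z \<and> Z \<subseteq> rspan R M (T \<union> {x \<in> Z. p x = \<zero>\<^bsub>C\<^esub>}))"
proof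
  let ?N = "{x \<in> Z. p x = \<zero>\<^bsub>C\<^esub>}"
  note C = C_right_module
  show "fin_gen S C" if asm: "\<exists>T. finite T \<and> T \<subseteq> Z \<and> Z \<subseteq> rspan R M (T \<union> ?N)"
  proof -
    obtain T where T: "finite T" "T \<subseteq> Z" "Z \<subseteq> rspan R M (T \<union> ?N)" using asm by blast
    have sub: "p ` T \<subseteq> carrier C" using T(2) p_closed by blast
    have H: "submodule (rspan S C (p ` T)) S C" by (rule rspan_submodule[OF C sub])
    have "\<zero>\<^bsub>C\<^esub> \<in> rspan S C (p ` T)" using right_module.submoduleD(2)[OF C H] .
    moreover have "p t \<in> rspan S C (p ` T)" if "t \<in> T" for t
      using subsetD[OF rspan_incl imageI[OF that]] .
    ultimately have "T \<union> ?N \<subseteq> {x \<in> Z. p x \<in> rspan S C (p ` T)}"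
      using T(2) by (intro Un_least subsetI CollectI conjI) (simp_all add: subset_iff)
    from rspan_least[OF vimage_submodule[OF H] this] have "Z \<subseteq> {x \<in> Z. p x \<in> rspan S C (p ` T)}"
      using T(3) by blast
    then have "carrier C \<subseteq> rspan S C (p ` T)" unfolding p_surj[symmetric] by (intro image_subsetI) auto
    then have "carrier C = rspan S C (p ` T)" using rspan_subset[OF C sub] by blast
    then show ?thesis using T(1) sub unfolding fin_gen_iff by blast
  qed
  assume "fin_gen S C"
  then obtain F where F: "finite F" "F \<subseteq> p ` Z" "carrier C = rspan S C F"
    unfolding p_surj fin_gen_iff by (elim exE conjE)
  obtain T where T: "T \<subseteq> Z" "finite T" "F = p ` T" using finite_subset_image[OF F(1,2)] by blast
  let ?W = "rspan R M (T \<union> ?N)"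
  have sub: "T \<union> ?N \<subseteq> carrier M" using T(1) Z'(1) by blast
  have W: "submodule ?W R M" by (rule rspan_submodule[OF right_module_axioms sub])
  have WZ: "?W \<subseteq> Z" by (rule rspan_least[OF Z]) (use T(1) in blast)
  have "F \<subseteq> p ` ?W" unfolding T(3) by (rule image_mono[OF subset_trans[OF Un_upper1 rspan_incl]])
  then have pW: "carrier C \<subseteq> p ` ?W" using rspan_least[OF image_submodule[OF W WZ]] F(3) by blast
  have "z \<in> ?W" if z: "z \<in> Z" for z
  proof -
    obtain w where w: "w \<in> ?W" "p z = p w" using pW p_closed[OF z] by blast
    have wZ: "w \<in> Z" using w(1) WZ by blast
    have "z \<ominus>\<^bsub>M\<^esub> w \<in> T \<union> ?N" using p_eq_iff[OF z wZ] w(2) Z'(6)[OF z wZ] by simp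
    then have "z \<ominus>\<^bsub>M\<^esub> w \<in> ?W" by (rule subsetD[OF rspan_incl])
    then have "(z \<ominus>\<^bsub>M\<^esub> w) \<oplus>\<^bsub>M\<^esub> w \<in> ?W" using submoduleD(3)[OF W _ w(1)] by blast
    moreover have "(z \<ominus>\<^bsub>M\<^esub> w) \<oplus>\<^bsub>M\<^esub> w = z"
      using subsetD[OF Z'(1) z] subsetD[OF Z'(1) wZ] by (simp add: a_minus_def M.a_assoc M.l_neg)
    ultimately show ?thesis by simp
  qed
  then show "\<exists>T. finite T \<and> T \<subseteq> Z \<and> Z \<subseteq> rspan R M (T \<union> ?N)" using T by blast
qed

end

lemma semilinear_quot:
  assumes "semilinear R M S \<pi> Z C p" and H: "submodule H S C"
  shows "semilinear R M S \<pi> Z (quot_module C H) (\<lambda>x. H +>\<^bsub>C\<^esub> p x)"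
proof -
  interpret semilinear R M S \<pi> Z C p by fact
  interpret C: right_module S C by (rule C_right_module)
  note A = C.abelian_group_M submodule_additive[OF H]
  show ?thesis
  proof (intro semilinear.intro semilinear_axioms.intro right_module_axioms S pi pi_surj Z)
    show "(\<lambda>x. H +>\<^bsub>C\<^esub> p x) ` Z = carrier (quot_module C H)" by (auto simp: quot_module_simps p_surj[symmetric])
    show "H +>\<^bsub>C\<^esub> p \<zero>\<^bsub>M\<^esub> = \<zero>\<^bsub>quot_module C H\<^esub>" by (simp add: p_zero coset_zero[OF A] quot_module_simps)
    show "H +>\<^bsub>C\<^esub> p (x \<oplus>\<^bsub>M\<^esub> y) = (H +>\<^bsub>C\<^esub> p x) \<oplus>\<^bsub>quot_module C H\<^esub> (H +>\<^bsub>C\<^esub> p y)"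
      if "x \<in> Z" "y \<in> Z" for x y
      using coset_add[OF A p_closed p_closed] that by (simp add: p_add quot_module_simps)
    show "H +>\<^bsub>C\<^esub> p (r \<odot>\<^bsub>M\<^esub> x) = \<pi> r \<odot>\<^bsub>quot_module C H\<^esub> (H +>\<^bsub>C\<^esub> p x)" if "r \<in> carrier R" "x \<in> Z" for r x
      using quot_module_smult[OF C_right_module H ring_hom_closed[OF pi that(1)] p_closed[OF that(2)]]
      by (simp add: p_smult that)
  qed
qed

text \<open>A right ideal above the kernel maps to a right ideal of S. Lifts of finitely many
  generators of the image generate it together with the kernel.\<close>

lemma noetherian_over_kernel:
  fixes R (structure)
  assumes R: "ring R" and noe: "right_noetherian S" and \<pi>: "\<pi> \<in> ring_hom R S" and surj: "\<pi> ` carrier R = carrier S"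
  shows "noetherian_over R {r \<in> carrier R. \<pi> r = \<zero>\<^bsub>S\<^esub>}"
  unfolding noetherian_over_def
proof (intro allI impI)
  let ?J = "{r \<in> carrier R. \<pi> r = \<zero>\<^bsub>S\<^esub>}"
  fix I assume I: "submodule I R (regmod R)" and JI: "?J \<subseteq> I"
  have S: "ring S" and noeS: "\<And>I. right_ideal I S \<Longrightarrow> \<exists>F. finite F \<and> F \<subseteq> carrier S \<and> I = \<Inter>{J. right_ideal J S \<and> F \<subseteq> J}"
    using noe by (auto simp: right_noetherian_def)
  interpret R: ring R by fact
  interpret S: ring S by fact
  note Rm = regmod_right_module[OF R]
  interpret Rm: right_module R "regmod R" by (rule Rm)
  interpret sl: semilinear R "regmod R" S \<pi> "carrier R" "regmod S" \<pi>
  proof (intro semilinear.intro semilinear_axioms.intro Rm S \<pi>)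
    show "submodule (carrier R) R (regmod R)" using Rm.carrier_submodule by simp
    show "\<pi> \<zero>\<^bsub>regmod R\<^esub> = \<zero>\<^bsub>regmod S\<^esub>"
      using additive_map_zero[OF R.is_abelian_group S.is_abelian_group, of \<pi>] \<pi>
      by (simp add: additive_map_def ring_hom_def)
    show "\<pi> ` carrier R = carrier S" "\<pi> ` carrier R = carrier (regmod S)" using surj by simp_all
    show "\<pi> (x \<oplus>\<^bsub>regmod R\<^esub> y) = \<pi> x \<oplus>\<^bsub>regmod S\<^esub> \<pi> y" if "x \<in> carrier R" "y \<in> carrier R" for x y
      using ring_hom_add[OF \<pi> that] by simp
    show "\<pi> (r \<odot>\<^bsub>regmod R\<^esub> x) = \<pi> r \<odot>\<^bsub>regmod S\<^esub> \<pi> x" if "r \<in> carrier R" "x \<in> carrier R" for r x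
      using ring_hom_mult[OF \<pi> that(2,1)] by simp
  qed
  have right: "right_ideal W S" if "submodule W S (regmod S)" for W
  proof -
    note W = right_module.submoduleD[OF regmod_right_module[OF S] that]
    have neg: "\<ominus>\<^bsub>S\<^esub> x \<in> W" if x: "x \<in> W" for x
      using W(4)[of "\<ominus>\<^bsub>S\<^esub> \<one>\<^bsub>S\<^esub>" x] W(1) x by (auto simp: S.r_minus)
    show ?thesis unfolding right_ideal_def
    proof (intro conjI additive_subgroupI subgroup.intro)
      show "inv\<^bsub>add_monoid S\<^esub> x \<in> W" if "x \<in> W" for x using neg[OF that] by (simp add: a_inv_def)
    qed (use W in auto)
  qed
  note I' = Rm.submoduleD[OF I]
  have Ic: "I \<subseteq> carrier R" using I'(1) by simp
  obtain F where F: "finite F" "\<pi> ` I = \<Inter>{J. right_ideal J S \<and> F \<subseteq> J}"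
    using noeS[OF right[OF sl.image_submodule[OF I Ic]]] by blast
  then have FI: "F \<subseteq> \<pi> ` I" by blast
  obtain T where T: "T \<subseteq> I" "finite T" "F = \<pi> ` T" using finite_subset_image[OF F(1) FI] by blast
  let ?W = "rspan R (regmod R) (T \<union> ?J)"
  have sub: "T \<union> ?J \<subseteq> carrier (regmod R)" using T(1) Ic by auto
  have W: "submodule ?W R (regmod R)" by (rule rspan_submodule[OF Rm sub])
  have WI: "?W \<subseteq> I" by (rule rspan_least[OF I]) (use T(1) JI in blast)
  have Wc: "?W \<subseteq> carrier R" using WI Ic by blast
  have "F \<subseteq> \<pi> ` ?W" unfolding T(3) by (rule image_mono[OF subset_trans[OF Un_upper1 rspan_incl]])
  then have pW: "\<pi> ` I \<subseteq> \<pi> ` ?W" using right[OF sl.image_submodule[OF W Wc]] unfolding F(2) by blast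
  have "u \<in> ?W" if u: "u \<in> I" for u
  proof -
    obtain w where w: "w \<in> ?W" "\<pi> u = \<pi> w" using pW u by blast
    have c: "u \<in> carrier R" "w \<in> carrier R" using u w(1) Ic Wc by auto
    have "u \<ominus>\<^bsub>regmod R\<^esub> w \<in> T \<union> ?J"
      using sl.p_eq_iff[OF c] w(2) sl.Z'(6)[OF c] by simp
    then have "u \<ominus>\<^bsub>regmod R\<^esub> w \<in> ?W" by (rule subsetD[OF rspan_incl])
    then have "(u \<ominus>\<^bsub>regmod R\<^esub> w) \<oplus>\<^bsub>regmod R\<^esub> w \<in> ?W" using Rm.submoduleD(3)[OF W _ w(1)] by blast
    moreover have "(u \<ominus>\<^bsub>regmod R\<^esub> w) \<oplus>\<^bsub>regmod R\<^esub> w = u"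
      using c Rm.M.a_assoc[of u "\<ominus>\<^bsub>regmod R\<^esub> w" w] Rm.M.l_neg[of w] Rm.M.a_inv_closed[of w]
      by (simp add: a_minus_def)
    ultimately show ?thesis by simp
  qed
  then show "\<exists>T. finite T \<and> T \<subseteq> I \<and> I \<subseteq> rspan R (regmod R) (T \<union> ?J)" using T by blast
qed

lemma field_right_noetherian:
  fixes K (structure)
  assumes "field K"
  shows "right_noetherian K"
  unfolding right_noetherian_def
proof (intro conjI allI impI)
  interpret field K by fact
  show "ring K" ..
  fix I assume I: "right_ideal I K"
  then interpret I: additive_subgroup I K by (simp add: right_ideal_def)
  show "\<exists>S. finite S \<and> S \<subseteq> carrier K \<and> I = \<Inter>{J. right_ideal J K \<and> S \<subseteq> J}"
  proof (cases "I \<subseteq> {\<zero>}")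
    case True
    then have "I = {\<zero>}" using I.zero_closed by blast
    moreover have "\<zero> \<in> J" if "right_ideal J K" for J
      using that additive_subgroup.zero_closed by (auto simp: right_ideal_def)
    ultimately have "I = \<Inter>{J. right_ideal J K \<and> {} \<subseteq> J}" using I by blast
    then show ?thesis by blast
  next
    case False
    then obtain x where x: "x \<in> I" "x \<noteq> \<zero>" by blast
    then have xc: "x \<in> carrier K" using I.a_subset by blast
    have gen: "carrier K \<subseteq> J" if J: "right_ideal J K" "x \<in> J" for J
    proof
      fix y assume y: "y \<in> carrier K"
      have "x \<otimes> (inv x \<otimes> y) \<in> J" using J y xc x(2) by (simp add: right_ideal_def field_Units)
      then show "y \<in> J" using xc x(2) y by (simp add: m_assoc[symmetric] field_Units)
    qed
    have "I = carrier K" using gen[OF I x(1)] I.a_subset by blast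
    then have "I = \<Inter>{J. right_ideal J K \<and> {x} \<subseteq> J}" using gen I x by auto
    then show ?thesis using xc by (intro exI[of _ "{x}"]) simp
  qed
qed

section \<open>Coinvariants of an ideal\<close>

locale lie_with_ideal = lie_algebra K L for K :: "('k, 'b) ring_scheme" (structure)
    and L :: "('k, 'l, 'm) lie_scheme" +
  fixes N :: "'l set"
  assumes N_ideal: "lie_ideal N K L"
begin

abbreviation LQ where "LQ \<equiv> lie_quotient L N"
abbreviation proj where "proj \<equiv> (\<lambda>x. N +>\<^bsub>L\<^esub> x)"
abbreviation V where "V \<equiv> env K LQ"

lemma N_submodule: "submodule N K L" and N_bracket: "\<lbrakk>x \<in> carrier L; n \<in> N\<rbrakk> \<Longrightarrow> bracket L x n \<in> N"
  using N_ideal by (auto simp: lie_ideal_def)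

lemma L_group: "abelian_group L" ..
lemma N_add: "additive_subgroup N L" by (rule submodule_additive[OF N_submodule])

lemma N_sub: "n \<in> N \<Longrightarrow> n \<in> carrier L"
  using additive_subgroup.a_subset[OF N_add] by blast

lemmas proj_self = coset_self[OF L_group N_add]
lemmas proj_zero = coset_zero[OF L_group N_add]

lemma bracket_N: "\<lbrakk>n \<in> N; x \<in> carrier L\<rbrakk> \<Longrightarrow> bracket L n x \<in> N"
  using bracket_skew[of n x] N_sub N_bracket additive_subgroup.a_inv_closed[OF N_add] by simp

lemma LQ_simps: "carrier LQ = proj ` carrier L" "add LQ = set_add L"
  by (auto simp: lie_quotient_def A_RCOSETS_def')

lemma proj_add: "\<lbrakk>x \<in> carrier L; y \<in> carrier L\<rbrakk> \<Longrightarrow> proj (x \<oplus>\<^bsub>L\<^esub> y) = proj x \<oplus>\<^bsub>LQ\<^esub> proj y"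
  by (simp add: LQ_simps coset_add[OF L_group N_add])

lemma proj_smult:
  assumes a: "a \<in> carrier K" and x: "x \<in> carrier L"
  shows "proj (a \<odot>\<^bsub>L\<^esub> x) = a \<odot>\<^bsub>LQ\<^esub> proj x"
proof -
  have "additive_map L L (\<lambda>x. a \<odot>\<^bsub>L\<^esub> x)" using a by (intro additive_mapI) (simp_all add: L.smult_r_distr)
  moreover have "(\<lambda>x. a \<odot>\<^bsub>L\<^esub> x) ` N \<subseteq> N" using submodule.smult_closed[OF N_submodule a] by blast
  ultimately show ?thesis using coset_map[OF L_group N_add L_group N_add _ _ x] by (simp add: lie_quotient_def)
qed

lemma proj_bracket:
  assumes x: "x \<in> carrier L" and y: "y \<in> carrier L"
  shows "proj (bracket L x y) = bracket LQ (proj x) (proj y)"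
proof -
  have add: "additive_map L L (bracket L z)" "additive_map L L (\<lambda>w. bracket L w z)" if "z \<in> carrier L" for z
    using that by (auto intro!: additive_mapI simp: bracket_add_right bracket_add_left bracket_closed)
  have "(\<Union>w\<in>proj y. proj (bracket L z w)) = proj (bracket L z y)" if "z \<in> carrier L" for z
    by (rule coset_map[OF L_group N_add L_group N_add add(1)[OF that] _ y]) (use N_bracket[OF that] in blast)
  moreover have "proj x \<subseteq> carrier L" using coset_mem[OF L_group N_add x] by blast
  ultimately have "(\<Union>z\<in>proj x. \<Union>w\<in>proj y. proj (bracket L z w)) = (\<Union>z\<in>proj x. proj (bracket L z y))"
    by (intro SUP_cong) auto
  also have "\<dots> = proj (bracket L x y)"
    by (rule coset_map[OF L_group N_add L_group N_add add(2)[OF y] _ x]) (use bracket_N y in blast)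
  finally show ?thesis by (simp add: lie_quotient_def)
qed

lemma LQ_env_setup: "env_setup K LQ"
proof (intro env_setup.intro env_setup_axioms.intro)
  show "cring K" ..
  fix X Y assume "X \<in> carrier LQ" "Y \<in> carrier LQ"
  then obtain x y where xy: "x \<in> carrier L" "X = proj x" "y \<in> carrier L" "Y = proj y" by (auto simp: LQ_simps)
  have in_LQ: "z \<in> carrier L \<Longrightarrow> proj z \<in> carrier LQ" for z by (simp add: LQ_simps)
  show "X \<oplus>\<^bsub>LQ\<^esub> Y \<in> carrier LQ" using proj_add[OF xy(1,3)] in_LQ[OF L.M.a_closed[OF xy(1,3)]] xy by simp
  show "bracket LQ X Y \<in> carrier LQ" using proj_bracket[OF xy(1,3)] in_LQ[OF bracket_closed[OF xy(1,3)]] xy by simp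
  show "a \<odot>\<^bsub>LQ\<^esub> X \<in> carrier LQ" if "a \<in> carrier K" for a
    using proj_smult[OF that xy(1)] in_LQ[OF L.smult_closed[OF that xy(1)]] xy by simp
qed

sublocale Q: env_setup K LQ by (rule LQ_env_setup)

sublocale pr: env_morphism K L LQ proj
proof (intro env_morphism.intro env_morphism_axioms.intro env_setup_axioms Q.env_setup_axioms)
  show "x \<in> carrier L \<Longrightarrow> proj x \<in> carrier LQ" for x by (simp add: LQ_simps)
qed (rule proj_add proj_smult proj_bracket; assumption)+

abbreviation pi where "pi \<equiv> env_map K LQ proj"
definition J where "J = {u \<in> carrier U. pi u = \<zero>\<^bsub>V\<^esub>}"

lemma J_sub: "J \<subseteq> carrier U" by (auto simp: J_def)

lemmas pi_hom = pr.env_map_hom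
lemmas pi_sca = pr.env_map_scalar
lemmas pi_inc = pr.env_map_incl

lemma pi_surj: "pi ` carrier U = carrier V"
proof
  show "pi ` carrier U \<subseteq> carrier V" using ring_hom_closed[OF pi_hom] by blast
  have "v \<in> pi ` carrier U" if "v \<in> carrier V" for v
    using that
  proof (induction v rule: Q.env_induct)
    case (scalar a)
    then show ?case using imageI[OF sca_closed[OF scalar], of pi] by (simp add: pi_sca)
  next
    case (incl X)
    then obtain x where x: "x \<in> carrier L" "X = proj x" by (auto simp: LQ_simps)
    then show ?case using imageI[OF inc_closed[OF x(1)], of pi] by (simp add: pi_inc)
  next
    case (add u v)
    then obtain a b where ab: "a \<in> carrier U" "b \<in> carrier U" "u = pi a" "v = pi b" by blast
    show ?case using imageI[OF U.a_closed[OF ab(1,2)], of pi] ring_hom_add[OF pi_hom ab(1,2)] ab by simp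
  next
    case (mult u v)
    then obtain a b where ab: "a \<in> carrier U" "b \<in> carrier U" "u = pi a" "v = pi b" by blast
    show ?case using imageI[OF U.m_closed[OF ab(1,2)], of pi] ring_hom_mult[OF pi_hom ab(1,2)] ab by simp
  qed
  then show "carrier V \<subseteq> pi ` carrier U" by blast
qed

lemma inc_N_in_J: "n \<in> N \<Longrightarrow> inc n \<in> J"
proof -
  assume n: "n \<in> N"
  have z: "proj \<zero>\<^bsub>L\<^esub> \<oplus>\<^bsub>LQ\<^esub> proj \<zero>\<^bsub>L\<^esub> = proj \<zero>\<^bsub>L\<^esub>" "proj \<zero>\<^bsub>L\<^esub> \<in> carrier LQ"
    using proj_add[of "\<zero>\<^bsub>L\<^esub>" "\<zero>\<^bsub>L\<^esub>"] by (simp_all add: LQ_simps)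
  then have "Q.inc (proj \<zero>\<^bsub>L\<^esub>) \<oplus>\<^bsub>V\<^esub> Q.inc (proj \<zero>\<^bsub>L\<^esub>) = Q.inc (proj \<zero>\<^bsub>L\<^esub>)"
    using Q.inc_add[OF z(2,2)] by simp
  then have "Q.inc (proj \<zero>\<^bsub>L\<^esub>) = \<zero>\<^bsub>V\<^esub>" using Q.inc_closed[OF z(2)] by simp
  moreover have "proj n = proj \<zero>\<^bsub>L\<^esub>"
    using abelian_group.a_coset_join2[OF L_group N_sub[OF n] additive_subgroup.a_subgroup[OF N_add] n] proj_zero
    by simp
  ultimately show ?thesis using pi_inc[OF N_sub[OF n]] N_sub[OF n] by (simp add: J_def)
qed

text \<open>M N is generated only as an additive group. It is stable under a letter l because x n l
  = x l n + x [n, l] with [n, l] again in N.\<close>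

lemma lie_times_submodule:
  assumes M: "right_module U M"
  shows "submodule (lie_times K L N M) U M"
proof -
  interpret M: right_module U M by fact
  let ?G = "{inc n \<odot>\<^bsub>M\<^esub> x |n x. n \<in> N \<and> x \<in> carrier M}" and ?H = "lie_times K L N M"
  have G: "?G \<subseteq> carrier M" using N_sub by auto
  have H: "additive_subgroup ?H M"
    unfolding lie_times_def by (rule additive_subgroup_generate[OF M.abelian_group_M G])
  note Hs = additive_subgroup.a_subset[OF H] and Ha = additive_subgroup.a_closed[OF H]
  have gen: "inc n \<odot>\<^bsub>M\<^esub> x \<in> ?H" if "n \<in> N" "x \<in> carrier M" for n x
    unfolding lie_times_def by (rule generate.incl) (use that in blast)
  have to_gens: "\<forall>h\<in>?H. u \<odot>\<^bsub>M\<^esub> h \<in> ?H"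
    if u: "u \<in> carrier U" and g: "\<And>n x. \<lbrakk>n \<in> N; x \<in> carrier M\<rbrakk> \<Longrightarrow> u \<odot>\<^bsub>M\<^esub> (inc n \<odot>\<^bsub>M\<^esub> x) \<in> ?H" for u
  proof -
    have "?G \<subseteq> {h \<in> carrier M. u \<odot>\<^bsub>M\<^esub> h \<in> ?H}" using g N_sub by auto
    from generate_subset_additive_subgroup[OF M.abelian_group_M
        additive_subgroup_vimage[OF M.abelian_group_M M.abelian_group_M M.smult_additive[OF u] H] this]
    show ?thesis unfolding lie_times_def by blast
  qed
  have act: "\<forall>h\<in>?H. u \<odot>\<^bsub>M\<^esub> h \<in> ?H" if "u \<in> carrier U" for u
    using that
  proof (induction u rule: env_induct)
    case (scalar a)
    show ?case
    proof (rule to_gens)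
      fix n x assume nx: "n \<in> N" "x \<in> carrier M"
      have n: "n \<in> carrier L" using N_sub nx by blast
      have "sca a \<odot>\<^bsub>M\<^esub> (inc n \<odot>\<^bsub>M\<^esub> x) = inc n \<odot>\<^bsub>M\<^esub> (sca a \<odot>\<^bsub>M\<^esub> x)"
        using M.right_assoc[of "inc n" "sca a" x] M.right_assoc[of "sca a" "inc n" x]
          inc_sca_commute[OF scalar n] n nx scalar by (simp add: sca_closed inc_closed)
      then show "sca a \<odot>\<^bsub>M\<^esub> (inc n \<odot>\<^bsub>M\<^esub> x) \<in> ?H" using gen nx scalar by (simp add: sca_closed)
    qed (use scalar in \<open>simp add: sca_closed\<close>)
  next
    case (incl l)
    show ?case
    proof (rule to_gens)
      fix n x assume nx: "n \<in> N" "x \<in> carrier M"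
      have n: "n \<in> carrier L" using N_sub nx by blast
      note c = inc_closed[OF n] inc_closed[OF incl] inc_closed[OF bracket_closed[OF n incl]]
      have "inc n \<otimes>\<^bsub>U\<^esub> inc l = inc l \<otimes>\<^bsub>U\<^esub> inc n \<oplus>\<^bsub>U\<^esub> inc (bracket L n l)"
        using c(1,2) U.a_lcomm[of "inc l \<otimes>\<^bsub>U\<^esub> inc n" "inc n \<otimes>\<^bsub>U\<^esub> inc l"]
        by (simp add: inc_bracket[OF n incl] a_minus_def U.r_neg)
      then have "inc l \<odot>\<^bsub>M\<^esub> (inc n \<odot>\<^bsub>M\<^esub> x) = inc n \<odot>\<^bsub>M\<^esub> (inc l \<odot>\<^bsub>M\<^esub> x) \<oplus>\<^bsub>M\<^esub> inc (bracket L n l) \<odot>\<^bsub>M\<^esub> x"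
        using M.right_assoc[of "inc n" "inc l" x] M.right_assoc[of "inc l" "inc n" x] c nx
        by (simp add: M.add_scalar)
      then show "inc l \<odot>\<^bsub>M\<^esub> (inc n \<odot>\<^bsub>M\<^esub> x) \<in> ?H"
        using gen[OF nx(1), of "inc l \<odot>\<^bsub>M\<^esub> x"] gen[OF bracket_N[OF nx(1) incl] nx(2)] Ha c nx by simp
    qed (use incl in simp)
  next
    case (add u v)
    show ?case
    proof
      fix h assume h: "h \<in> ?H"
      show "(u \<oplus>\<^bsub>U\<^esub> v) \<odot>\<^bsub>M\<^esub> h \<in> ?H"
        unfolding M.add_scalar[OF add(1,2) subsetD[OF Hs h]] by (rule Ha[OF bspec[OF add(3) h] bspec[OF add(4) h]])
    qed
  next
    case (mult u v)
    show ?case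
    proof
      fix h assume h: "h \<in> ?H"
      show "(u \<otimes>\<^bsub>U\<^esub> v) \<odot>\<^bsub>M\<^esub> h \<in> ?H"
        unfolding M.right_assoc[OF mult(1,2) subsetD[OF Hs h]] by (rule bspec[OF mult(4) bspec[OF mult(3) h]])
    qed
  qed
  show ?thesis
    by (rule M.submoduleI[OF Hs additive_subgroup.zero_closed[OF H] Ha bspec[OF act]])
qed

text \<open>
  The annihilator of \<open>M / M N\<close> is a two-sided ideal containing \<open>N\<close>, so by the universal property
  \<open>U(L) \<rightarrow> U(L) / Ann\<close> factors through \<open>U(L/N)\<close>, that is, the annihilator contains \<open>J\<close>.
\<close>

lemma lie_times_eq:
  assumes M: "right_module U M"
  shows "lie_times K L N M = ideal_mult U M J (carrier M)"
proof
  interpret M: right_module U M by fact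
  let ?H = "lie_times K L N M"
  note Hsub = lie_times_submodule[OF M]
  note H' = M.submoduleD[OF Hsub]
  show "?H \<subseteq> ideal_mult U M J (carrier M)"
    unfolding lie_times_def
    by (rule generate_subset_additive_subgroup[OF M.abelian_group_M
          submodule_additive[OF ideal_mult_submodule[OF M J_sub subset_refl]]])
      (auto intro!: ideal_multI inc_N_in_J)
  define A where "A = {u \<in> carrier U. \<forall>x\<in>carrier M. u \<odot>\<^bsub>M\<^esub> x \<in> ?H}"
  have neg: "(\<ominus>\<^bsub>U\<^esub> u) \<odot>\<^bsub>M\<^esub> x = \<ominus>\<^bsub>M\<^esub> (u \<odot>\<^bsub>M\<^esub> x)" if "u \<in> carrier U" "x \<in> carrier M" for u x
  proof -
    have "additive_map U M (\<lambda>u. u \<odot>\<^bsub>M\<^esub> x)" using that(2) by (intro additive_mapI) (simp_all add: M.add_scalar)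
    from additive_map_neg[OF U.is_abelian_group M.abelian_group_M this that(1)] show ?thesis .
  qed
  have ideal: "ideal A U"
  proof (intro idealI U.ring_axioms subgroup.intro)
    show "inv\<^bsub>add_monoid U\<^esub> u \<in> A" if "u \<in> A" for u
    proof -
      have "\<ominus>\<^bsub>U\<^esub> u \<in> A" using that neg H'(5) by (auto simp: A_def)
      then show ?thesis by (simp add: a_inv_def)
    qed
  qed (use H' in \<open>auto simp: A_def M.add_scalar M.right_assoc\<close>)
  interpret A: ideal A U by (rule ideal)
  have incA: "inc n \<in> A" if n: "n \<in> N" for n
  proof -
    have "inc n \<odot>\<^bsub>M\<^esub> x \<in> ?H" if "x \<in> carrier M" for x
      unfolding lie_times_def by (rule generate.incl) (use n that in blast)
    then show ?thesis unfolding A_def using inc_closed[OF N_sub[OF n]] by blast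
  qed
  note Aadd = ideal.axioms(1)[OF ideal]
  note A_eq = coset_eq_iff[OF U.is_abelian_group Aadd]
  let ?q = "\<lambda>u. A +>\<^bsub>U\<^esub> u" and ?Q = "U Quot A"
  have qhom: "?q \<in> ring_hom U ?Q" by (rule A.rcos_ring_hom)
  have Qring: "ring ?Q" by (rule A.quotient_is_ring)
  \<comment> \<open>Defined through a representative of the coset. Two representatives differ by an
    element of N, which lies in the annihilator A.\<close>
  define \<phi> where "\<phi> X = ?q (inc (SOME x. x \<in> X))" for X
  have \<phi>: "\<phi> (proj x) = ?q (inc x)" if x: "x \<in> carrier L" for x
  proof -
    define z where "z = (SOME z. z \<in> proj x)"
    have "z \<in> proj x" unfolding z_def using proj_self[OF x] by (rule someI)
    then have z: "z \<in> carrier L" "z \<ominus>\<^bsub>L\<^esub> x \<in> N" using coset_mem[OF L_group N_add x] by auto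
    have "inc (z \<ominus>\<^bsub>L\<^esub> x) = inc z \<ominus>\<^bsub>U\<^esub> inc x"
      by (rule additive_map_diff[OF L_group U.is_abelian_group _ z(1) x]) (simp add: additive_mapI inc_add)
    then have "inc z \<ominus>\<^bsub>U\<^esub> inc x \<in> A" using incA[OF z(2)] by simp
    then show ?thesis using A_eq z x by (simp add: \<phi>_def z_def[symmetric])
  qed
  have qs: "(\<lambda>a. ?q (sca a)) \<in> ring_hom K ?Q" using ring_hom_trans[OF sca_hom qhom] by (simp add: comp_def)
  have qadd: "?q (u \<oplus>\<^bsub>U\<^esub> v) = ?q u \<oplus>\<^bsub>?Q\<^esub> ?q v" and qmult: "?q (u \<otimes>\<^bsub>U\<^esub> v) = ?q u \<otimes>\<^bsub>?Q\<^esub> ?q v"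
    and qdiff: "?q (u \<ominus>\<^bsub>U\<^esub> v) = ?q u \<ominus>\<^bsub>?Q\<^esub> ?q v" if "u \<in> carrier U" "v \<in> carrier U" for u v
    using that ring_hom_add[OF qhom] ring_hom_mult[OF qhom] ring_hom_closed[OF qhom]
      additive_map_diff[OF U.is_abelian_group ring.is_abelian_group[OF Qring], of ?q u v]
    by (simp_all add: additive_map_def)
  obtain h where h: "h \<in> ring_hom V ?Q" "\<And>a. a \<in> carrier K \<Longrightarrow> h (Q.sca a) = ?q (sca a)"
    "\<And>X. X \<in> carrier LQ \<Longrightarrow> h (Q.inc X) = \<phi> X"
  proof (rule Q.env_universal[OF Qring qs, of \<phi>])
    fix X Y assume "X \<in> carrier LQ" "Y \<in> carrier LQ"
    then obtain x y where xy: "x \<in> carrier L" "X = proj x" "y \<in> carrier L" "Y = proj y" by (auto simp: LQ_simps)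
    show "\<phi> (X \<oplus>\<^bsub>LQ\<^esub> Y) = \<phi> X \<oplus>\<^bsub>?Q\<^esub> \<phi> Y"
      using xy proj_add[OF xy(1,3)] by (simp add: \<phi> inc_add qadd flip: proj_add)
    show "\<phi> (bracket LQ X Y) = \<phi> X \<otimes>\<^bsub>?Q\<^esub> \<phi> Y \<ominus>\<^bsub>?Q\<^esub> \<phi> Y \<otimes>\<^bsub>?Q\<^esub> \<phi> X"
      using xy by (simp add: \<phi> inc_bracket qdiff qmult bracket_closed flip: proj_bracket)
  next
    fix a X assume a: "a \<in> carrier K" and "X \<in> carrier LQ"
    then obtain x where x: "x \<in> carrier L" "X = proj x" by (auto simp: LQ_simps)
    show "\<phi> (a \<odot>\<^bsub>LQ\<^esub> X) = ?q (sca a) \<otimes>\<^bsub>?Q\<^esub> \<phi> X"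
      using x a by (simp add: \<phi> inc_smult qmult sca_closed flip: proj_smult)
    show "?q (sca a) \<otimes>\<^bsub>?Q\<^esub> \<phi> X = \<phi> X \<otimes>\<^bsub>?Q\<^esub> ?q (sca a)"
      using x a inc_sca_commute[OF a x(1)] by (simp add: \<phi> sca_closed flip: qmult)
  next
    fix X assume "X \<in> carrier LQ"
    then obtain x where x: "x \<in> carrier L" "X = proj x" by (auto simp: LQ_simps)
    show "\<phi> X \<in> carrier ?Q" using x by (simp add: \<phi> ring_hom_closed[OF qhom])
  qed (rule that)
  \<comment> \<open>Both sides are ring homomorphisms that agree on the generators of U(L); the
    factorization gives J \<subseteq> A.\<close>
  have hq: "h (pi u) = ?q u" if "u \<in> carrier U" for u
    using that
  proof (induction u rule: env_induct)
    case (add u v)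
    then show ?case using ring_hom_add[OF pi_hom] ring_hom_add[OF h(1)] ring_hom_closed[OF pi_hom] by (simp add: qadd)
  next
    case (mult u v)
    then show ?case using ring_hom_mult[OF pi_hom] ring_hom_mult[OF h(1)] ring_hom_closed[OF pi_hom] by (simp add: qmult)
  qed (simp_all add: pi_sca pi_inc h(2,3) \<phi> LQ_simps)
  have "J \<subseteq> A"
  proof
    fix u assume u: "u \<in> J"
    then have uc: "u \<in> carrier U" "pi u = \<zero>\<^bsub>V\<^esub>" by (auto simp: J_def)
    have "pi \<zero>\<^bsub>U\<^esub> = \<zero>\<^bsub>V\<^esub>"
      by (rule additive_map_zero[OF U.is_abelian_group Q.U.is_abelian_group])
        (use ring_hom_add[OF pi_hom] ring_hom_closed[OF pi_hom] in \<open>auto intro: additive_mapI\<close>)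
    then have "?q u = ?q \<zero>\<^bsub>U\<^esub>" using hq[OF uc(1)] hq[of "\<zero>\<^bsub>U\<^esub>"] uc(2) by simp
    then have "u \<ominus>\<^bsub>U\<^esub> \<zero>\<^bsub>U\<^esub> \<in> A" using A_eq uc(1) by blast
    then show "u \<in> A" using uc(1) by (simp add: a_minus_def)
  qed
  then show "ideal_mult U M J (carrier M) \<subseteq> ?H"
    by (intro ideal_mult_least[OF Hsub]) (unfold A_def, blast)
qed

lemma noetherian_over_J: "right_noetherian V \<Longrightarrow> noetherian_over U J"
  using noetherian_over_kernel[OF U.ring_axioms _ pi_hom pi_surj] by (simp add: J_def)

lemma coinvariants_simps:
  "carrier (coinvariants K L N M) = (\<lambda>x. lie_times K L N M +>\<^bsub>M\<^esub> x) ` carrier M"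
  "zero (coinvariants K L N M) = lie_times K L N M"
  "add (coinvariants K L N M) = set_add M"
  by (simp_all add: coinvariants_def quot_module_simps)

text \<open>The action of s is defined through a chosen preimage. For s = \<open>pi r\<close> the
  choice differs from r by an element of J, which sends M into M N by \<open>lie_times_eq\<close>
  and so does not affect the coset.\<close>

lemma coinvariants_semilinear:
  assumes M: "right_module U M"
  shows "semilinear U M V pi (carrier M) (coinvariants K L N M) (\<lambda>x. lie_times K L N M +>\<^bsub>M\<^esub> x)"
proof -
  interpret M: right_module U M by fact
  let ?H = "lie_times K L N M"
  note Hsub = lie_times_submodule[OF M]
  note A = M.abelian_group_M submodule_additive[OF Hsub]
  let ?\<sigma> = "\<lambda>s. SOME u. u \<in> carrier U \<and> pi u = s"
  have \<sigma>: "?\<sigma> s \<in> carrier U \<and> pi (?\<sigma> s) = s" if s: "s \<in> carrier V" for s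
  proof -
    have "\<exists>u. u \<in> carrier U \<and> pi u = s" using s unfolding pi_surj[symmetric] by blast
    then show ?thesis by (rule someI_ex)
  qed
  show ?thesis
  proof (intro semilinear.intro semilinear_axioms.intro M Q.U.ring_axioms pi_hom pi_surj M.carrier_submodule)
    show "(\<lambda>x. ?H +>\<^bsub>M\<^esub> x) ` carrier M = carrier (coinvariants K L N M)" by (simp add: coinvariants_simps)
    show "?H +>\<^bsub>M\<^esub> \<zero>\<^bsub>M\<^esub> = \<zero>\<^bsub>coinvariants K L N M\<^esub>" by (simp add: coinvariants_simps coset_zero[OF A])
    show "?H +>\<^bsub>M\<^esub> (x \<oplus>\<^bsub>M\<^esub> y) = (?H +>\<^bsub>M\<^esub> x) \<oplus>\<^bsub>coinvariants K L N M\<^esub> (?H +>\<^bsub>M\<^esub> y)"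
      if "x \<in> carrier M" "y \<in> carrier M" for x y
      using coset_add[OF A that] by (simp add: coinvariants_simps)
    fix r x assume r: "r \<in> carrier U" and x: "x \<in> carrier M"
    define t where "t = ?\<sigma> (pi r)"
    have t: "t \<in> carrier U" "pi t = pi r" using \<sigma>[OF ring_hom_closed[OF pi_hom r]] by (auto simp: t_def)
    have "pi (r \<ominus>\<^bsub>U\<^esub> t) = pi r \<ominus>\<^bsub>V\<^esub> pi t"
      by (rule additive_map_diff[OF U.is_abelian_group Q.U.is_abelian_group _ r t(1)])
        (use ring_hom_add[OF pi_hom] ring_hom_closed[OF pi_hom] in \<open>auto intro: additive_mapI\<close>)
    then have "r \<ominus>\<^bsub>U\<^esub> t \<in> J"
      using t r ring_hom_closed[OF pi_hom r] by (simp add: J_def a_minus_def Q.U.r_neg)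
    then have "(r \<ominus>\<^bsub>U\<^esub> t) \<odot>\<^bsub>M\<^esub> x \<in> ?H" using x unfolding lie_times_eq[OF M] by (intro ideal_multI)
    moreover have "(r \<ominus>\<^bsub>U\<^esub> t) \<odot>\<^bsub>M\<^esub> x = r \<odot>\<^bsub>M\<^esub> x \<ominus>\<^bsub>M\<^esub> t \<odot>\<^bsub>M\<^esub> x"
      by (rule additive_map_diff[OF U.is_abelian_group M.abelian_group_M _ r t(1)])
        (use x in \<open>auto intro!: additive_mapI simp: M.add_scalar\<close>)
    ultimately have "?H +>\<^bsub>M\<^esub> (r \<odot>\<^bsub>M\<^esub> x) = ?H +>\<^bsub>M\<^esub> (t \<odot>\<^bsub>M\<^esub> x)"
      using coset_eq_iff[OF A M.closed[OF r x] M.closed[OF t(1) x]] by simp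
    then show "?H +>\<^bsub>M\<^esub> (r \<odot>\<^bsub>M\<^esub> x) = pi r \<odot>\<^bsub>coinvariants K L N M\<^esub> (?H +>\<^bsub>M\<^esub> x)"
      using quot_module_smult[OF M Hsub t(1) x] by (simp add: coinvariants_def t_def)
  qed
qed

end

section \<open>Homology of an ideal\<close>

context lie_with_ideal
begin

lemma coinvariants_map_proj:
  assumes M: "right_module U M" and M': "right_module U M'" and h: "h \<in> rmod_hom U M M'" and x: "x \<in> carrier M"
  shows "coinvariants_map K L N M' h (lie_times K L N M +>\<^bsub>M\<^esub> x) = lie_times K L N M' +>\<^bsub>M'\<^esub> h x"
proof -
  interpret M: right_module U M by fact
  interpret M': right_module U M' by fact
  have "h ` carrier M \<subseteq> carrier M'" using rmod_hom_closed[OF h] by blast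
  from ideal_mult_image[OF M M' J_sub h subset_refl this subset_refl]
  have "h ` lie_times K L N M \<subseteq> lie_times K L N M'" unfolding lie_times_eq[OF M] lie_times_eq[OF M'] .
  from coset_map[OF M.abelian_group_M submodule_additive[OF lie_times_submodule[OF M]]
      M'.abelian_group_M submodule_additive[OF lie_times_submodule[OF M']] rmod_hom_additive[OF h] this x]
  show ?thesis by (simp add: coinvariants_map_def)
qed

text \<open>The homology receives a semilinear surjection from the relative cycles Z of P, through
  the cycles of the coinvariants. Its kernel is spanned by P J and the boundaries, so
  \<open>fin_gen_iff_lift\<close> turns finite generation into \<open>homology_fg\<close>.\<close>

lemma homology_fin_gen_iff:
  assumes P: "\<And>i. right_module U (P i)" and d: "\<And>i. d i \<in> rmod_hom U (P (Suc i)) (P i)"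
    and dd: "\<And>i x. x \<in> carrier (P (Suc (Suc i))) \<Longrightarrow> d i (d (Suc i) x) = \<zero>\<^bsub>P i\<^esub>"
  shows "fin_gen V (homology (\<lambda>j. coinvariants K L N (P j)) (\<lambda>j. coinvariants_map K L N (P j) (d j)) i) \<longleftrightarrow>
    homology_fg U J P d i"
proof -
  define H where "H j = lie_times K L N (P j)" for j
  define C where "C j = coinvariants K L N (P j)" for j
  define D where "D j = coinvariants_map K L N (P j) (d j)" for j
  define pr where "pr j x = H j +>\<^bsub>P j\<^esub> x" for j x
  define Z where "Z = rel_cycles U J P d i"
  have H: "submodule (H j) U (P j)" for j unfolding H_def by (rule lie_times_submodule[OF P])
  have Heq: "H j = ideal_mult U (P j) J (carrier (P j))" for j unfolding H_def by (rule lie_times_eq[OF P])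
  note Pg = right_module.abelian_group_M[OF P] and Ha = submodule_additive[OF H]
  interpret Pi: right_module U "P i" by (rule P)
  have sl0: "semilinear U (P j) V pi (carrier (P j)) (C j) (pr j)" for j
    using coinvariants_semilinear[OF P] unfolding C_def pr_def[abs_def] H_def .
  have Cc: "carrier (C j) = pr j ` carrier (P j)" for j by (simp add: C_def pr_def H_def coinvariants_simps)
  have Cz: "\<zero>\<^bsub>C j\<^esub> = H j" for j by (simp add: C_def H_def coinvariants_simps)
  have Dpr: "D j (pr (Suc j) x) = pr j (d j x)" if "x \<in> carrier (P (Suc j))" for j x
    unfolding D_def pr_def H_def by (rule coinvariants_map_proj[OF P P d that])
  have pr_eq: "pr j x = pr j y \<longleftrightarrow> x \<ominus>\<^bsub>P j\<^esub> y \<in> H j" if "x \<in> carrier (P j)" "y \<in> carrier (P j)" for j x y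
    unfolding pr_def by (rule coset_eq_iff[OF Pg Ha that])
  have pr_zero: "pr j x = H j \<longleftrightarrow> x \<in> H j" if x: "x \<in> carrier (P j)" for j x
  proof
    show "pr j x = H j" if "x \<in> H j"
      unfolding pr_def by (rule abelian_group.a_coset_join2[OF Pg x additive_subgroup.a_subgroup[OF Ha] that])
    show "x \<in> H j" if "pr j x = H j" using coset_self[OF Pg Ha x] that by (simp add: pr_def)
  qed
  have Zsub: "submodule Z U (P i)" unfolding Z_def by (rule rel_cycles_submodule[of U P d J i, OF P d J_sub])
  note Z' = Pi.submoduleD[OF Zsub]
  \<comment> \<open>In positive degree, the coset of x is a cycle exactly when d x lies in P
    J.\<close>
  have cyc: "cycles C D i = pr i ` Z"
  proof (cases i)
    case 0
    then show ?thesis by (simp add: cycles_def Z_def rel_cycles_def Cc)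
  next
    case (Suc j)
    have "pr (Suc j) x \<in> rmod_kernel (C (Suc j)) (C j) (D j) \<longleftrightarrow> d j x \<in> H j" if x: "x \<in> carrier (P (Suc j))" for x
      using imageI[OF x, of "pr (Suc j)"] pr_zero[OF rmod_hom_closed[OF d x]] by (simp add: rmod_kernel_def Dpr[OF x] Cz Cc)
    moreover have "rmod_kernel (C (Suc j)) (C j) (D j) \<subseteq> pr (Suc j) ` carrier (P (Suc j))"
      by (auto simp: rmod_kernel_def Cc)
    ultimately show ?thesis by (auto simp: Suc cycles_def Z_def rel_cycles_def Heq)
  qed
  define C' where "C' = (C i)\<lparr>carrier := cycles C D i\<rparr>"
  interpret s0: semilinear U "P i" V pi "carrier (P i)" "C i" "pr i" by (rule sl0)
  interpret sl: semilinear U "P i" V pi Z C' "pr i"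
  proof (intro semilinear.intro semilinear_axioms.intro P s0.S s0.pi s0.pi_surj Zsub)
    show "pr i ` Z = carrier C'" by (simp add: C'_def cyc)
    show "pr i \<zero>\<^bsub>P i\<^esub> = \<zero>\<^bsub>C'\<^esub>" using s0.p_zero by (simp add: C'_def)
    show "pr i (x \<oplus>\<^bsub>P i\<^esub> y) = pr i x \<oplus>\<^bsub>C'\<^esub> pr i y" if "x \<in> Z" "y \<in> Z" for x y
      using s0.p_add that Z'(1) by (simp add: C'_def subset_iff)
    show "pr i (r \<odot>\<^bsub>P i\<^esub> x) = pi r \<odot>\<^bsub>C'\<^esub> pr i x" if "r \<in> carrier U" "x \<in> Z" for r x
      using s0.p_smult that Z'(1) by (simp add: C'_def subset_iff)
  qed
  interpret C': right_module V C' by (rule sl.C_right_module)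
  let ?E = "d i ` carrier (P (Suc i))"
  define B where "B = D i ` carrier (C (Suc i))"
  have E: "submodule ?E U (P i)"
    by (rule submodule_image[OF P P d right_module.carrier_submodule[OF P]])
  have EZ: "?E \<subseteq> Z"
  proof (rule image_subsetI)
    fix x assume x: "x \<in> carrier (P (Suc i))"
    show "d i x \<in> Z"
    proof (cases i)
      case 0
      then show ?thesis using rmod_hom_closed[OF d x] by (simp add: Z_def rel_cycles_def)
    next
      case (Suc j)
      then have "d j (d i x) = \<zero>\<^bsub>P j\<^esub>" using dd[of x j] x by simp
      then have "d j (d i x) \<in> H j" using right_module.submoduleD(2)[OF P H] by simp
      then show ?thesis using rmod_hom_closed[OF d x] by (simp add: Z_def rel_cycles_def Suc Heq)
    qed
  qed
  have BE: "B = pr i ` ?E"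
    unfolding B_def Cc image_image by (rule image_cong[OF refl Dpr])
  have B: "submodule B V C'" unfolding BE by (rule sl.image_submodule[OF E EZ])
  have hom: "homology C D i = quot_module C' B" by (simp add: homology_def C'_def B_def)
  interpret q: semilinear U "P i" V pi Z "homology C D i" "\<lambda>x. B +>\<^bsub>C'\<^esub> pr i x"
    unfolding hom by (rule semilinear_quot[OF sl.semilinear_axioms B])
  note Ba = submodule_additive[OF B]
  let ?K = "{x \<in> Z. B +>\<^bsub>C'\<^esub> pr i x = \<zero>\<^bsub>homology C D i\<^esub>}"
  have Kiff: "x \<in> ?K \<longleftrightarrow> pr i x \<in> B" if x: "x \<in> Z" for x
  proof -
    have "B +>\<^bsub>C'\<^esub> pr i x = B \<longleftrightarrow> pr i x \<in> B"
      using coset_self[OF C'.abelian_group_M Ba sl.p_closed[OF x]]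
        C'.M.a_coset_join2[OF sl.p_closed[OF x] additive_subgroup.a_subgroup[OF Ba]] by blast
    then show ?thesis using x by (simp add: hom quot_module_simps)
  qed
  have HZ: "H i \<subseteq> Z"
  proof (cases i)
    case 0
    then show ?thesis using right_module.submoduleD(1)[OF P H, of 0] by (simp add: Z_def rel_cycles_def)
  next
    case (Suc j)
    have "d j ` carrier (P (Suc j)) \<subseteq> carrier (P j)" using rmod_hom_closed[OF d] by blast
    from ideal_mult_image[OF P P J_sub d subset_refl this subset_refl] have "d j ` H (Suc j) \<subseteq> H j"
      unfolding Heq .
    then show ?thesis using right_module.submoduleD(1)[OF P H, of i] by (auto simp: Z_def rel_cycles_def Suc Heq)
  qed
  have KHE: "H i \<union> ?E \<subseteq> ?K"
  proof
    fix x assume x: "x \<in> H i \<union> ?E"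
    then have xZ: "x \<in> Z" using HZ EZ by blast
    have "pr i x \<in> B"
    proof (cases "x \<in> H i")
      case True
      then have "pr i x = H i" using pr_zero Z'(1) xZ by blast
      moreover have "H i \<in> B" using C'.submoduleD(2)[OF B] by (simp add: C'_def Cz)
      ultimately show ?thesis by simp
    next
      case False
      then show ?thesis using x by (simp add: BE)
    qed
    then show "x \<in> ?K" using Kiff[OF xZ] by simp
  qed
  have KR: "?K \<subseteq> rspan U (P i) (H i \<union> ?E)"
  proof
    fix x assume xK: "x \<in> ?K"
    then have xZ: "x \<in> Z" by blast
    have "pr i x \<in> B" using Kiff[OF xZ] xK by simp
    then obtain y where y: "y \<in> ?E" "pr i x = pr i y" unfolding BE by (rule imageE)
    have c: "x \<in> carrier (P i)" "y \<in> carrier (P i)" using xZ y(1) EZ Z'(1) by blast+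
    let ?R = "rspan U (P i) (H i \<union> ?E)"
    have sub: "H i \<union> ?E \<subseteq> carrier (P i)" using HZ EZ Z'(1) by blast
    have R: "submodule ?R U (P i)" by (rule rspan_submodule[OF P sub])
    have "x \<ominus>\<^bsub>P i\<^esub> y \<in> H i" using pr_eq[OF c] y(2) by simp
    then have 1: "x \<ominus>\<^bsub>P i\<^esub> y \<in> ?R" by (intro subsetD[OF rspan_incl] UnI1)
    have 2: "y \<in> ?R" using y(1) by (intro subsetD[OF rspan_incl] UnI2)
    have "(x \<ominus>\<^bsub>P i\<^esub> y) \<oplus>\<^bsub>P i\<^esub> y \<in> ?R" by (rule Pi.submoduleD(3)[OF R 1 2])
    moreover have "(x \<ominus>\<^bsub>P i\<^esub> y) \<oplus>\<^bsub>P i\<^esub> y = x" using c by (simp add: a_minus_def Pi.M.a_assoc Pi.M.l_neg)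
    ultimately show "x \<in> ?R" by simp
  qed
  have span: "rspan U (P i) (T \<union> ?K) = rspan U (P i) (T \<union> H i \<union> ?E)" if T: "T \<subseteq> Z" for T
  proof
    have sub: "T \<union> H i \<union> ?E \<subseteq> carrier (P i)" using T HZ EZ Z'(1) by blast
    have "rspan U (P i) (H i \<union> ?E) \<subseteq> rspan U (P i) (T \<union> H i \<union> ?E)" by (rule rspan_mono) blast
    then have "?K \<subseteq> rspan U (P i) (T \<union> H i \<union> ?E)" by (rule subset_trans[OF KR])
    moreover have "T \<subseteq> rspan U (P i) (T \<union> H i \<union> ?E)"
      by (rule subset_trans[OF _ rspan_incl]) blast
    ultimately show "rspan U (P i) (T \<union> ?K) \<subseteq> rspan U (P i) (T \<union> H i \<union> ?E)"
      by (intro rspan_sub_rspan[OF P sub] Un_least)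
    show "rspan U (P i) (T \<union> H i \<union> ?E) \<subseteq> rspan U (P i) (T \<union> ?K)"
      by (rule rspan_mono) (use KHE in blast)
  qed
  have "finite T \<and> T \<subseteq> Z \<and> Z \<subseteq> rspan U (P i) (T \<union> ?K) \<longleftrightarrow>
      finite T \<and> T \<subseteq> Z \<and> Z \<subseteq> rspan U (P i) (T \<union> H i \<union> ?E)" for T
  proof (cases "T \<subseteq> Z")
    case True
    show ?thesis unfolding span[OF True] ..
  qed (simp only: simp_thms)
  then have "fin_gen V (homology C D i) \<longleftrightarrow> (\<exists>T. finite T \<and> T \<subseteq> Z \<and> Z \<subseteq> rspan U (P i) (T \<union> H i \<union> ?E))"
    unfolding q.fin_gen_iff_lift by (simp only:)
  then show ?thesis unfolding homology_fg_def C_def D_def Z_def Heq .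
qed

text \<open>Restriction of scalars leaves sets and maps unchanged, so exactness persists. The
  augmentation stays linear because it is compatible with U(N) \<rightarrow> U(L), and projectivity
  is \<open>restrict_projective\<close>.\<close>

lemma lie_resolutionI:
  assumes P: "projective_resolution U (trivial_module K) P d e"
  shows "lie_resolution K L N P d e"
proof -
  let ?LN = "L\<lparr>carrier := N\<rparr>" and ?\<theta> = "env_map K L (\<lambda>x. x) :: ('l list \<Rightarrow> 'k) set \<Rightarrow> _"
  interpret LN: lie_algebra K ?LN by (rule lie_ideal_lie_algebra[OF N_ideal])
  interpret m: env_morphism K ?LN L "\<lambda>x. x"
    by (intro env_morphism.intro env_morphism_axioms.intro LN.env_setup_axioms env_setup_axioms) (auto intro: N_sub)
  note D = resolutionD[OF P]
  have proj: "projective (env K ?LN) (restrict_scalars ?\<theta> (P i))" for i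
  proof -
    obtain s e where "free_retract U (P i) (carrier (P i)) s e" using projectiveD[OF D(1)] by blast
    then show ?thesis by (rule restrict_projective[OF N_ideal D(2)])
  qed
  have e: "e \<in> rmod_hom (env K ?LN) (restrict_scalars ?\<theta> (P 0)) (trivial_module K)"
  proof (rule rmod_homI)
    show "e x \<in> carrier (trivial_module K)" if "x \<in> carrier (restrict_scalars ?\<theta> (P 0))" for x
      using rmod_hom_closed[OF D(4)] that by (simp add: trivial_module_simps)
    show "e (x \<oplus>\<^bsub>restrict_scalars ?\<theta> (P 0)\<^esub> y) = e x \<oplus>\<^bsub>trivial_module K\<^esub> e y"
      if "x \<in> carrier (restrict_scalars ?\<theta> (P 0))" "y \<in> carrier (restrict_scalars ?\<theta> (P 0))" for x y
      using rmod_hom_add[OF D(4)] that by (simp add: trivial_module_simps)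
    show "e (r \<odot>\<^bsub>restrict_scalars ?\<theta> (P 0)\<^esub> x) = r \<odot>\<^bsub>trivial_module K\<^esub> e x"
      if "r \<in> carrier (env K ?LN)" "x \<in> carrier (restrict_scalars ?\<theta> (P 0))" for r x
      using rmod_hom_smult[OF D(4) ring_hom_closed[OF m.env_map_hom that(1)], of x] that
      by (simp add: trivial_module_simps m.augmentation_env_map)
  qed
  have ker: "rmod_kernel (restrict_scalars ?\<theta> M) M' f = rmod_kernel M M' f"
    "rmod_kernel M (restrict_scalars ?\<theta> M') f = rmod_kernel M M' f" for M M' f
    by (simp_all add: rmod_kernel_def)
  have "projective_resolution (env K ?LN) (trivial_module K) (\<lambda>i. restrict_scalars ?\<theta> (P i)) d e"
    unfolding projective_resolution_def
    using proj e restrict_scalars_hom[OF m.env_map_hom D(3)] D(5-7) by (simp add: rmod_kernel_def)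
  then show ?thesis using P by (simp add: lie_resolution_def)
qed

text \<open>P witnesses, in the list type of the definition, that the choice in
  \<open>lie_homology\<close> is made from a nonempty set. The chosen resolution is then traded for
  P by \<open>homology_fg_transfer\<close>.\<close>

lemma lie_homology_fin_gen_iff:
  fixes P :: "nat \<Rightarrow> (('l list \<Rightarrow> 'k) set, ('l list \<Rightarrow> 'k) set list) module"
  assumes P: "projective_resolution U (trivial_module K) P d e"
  shows "fin_gen V (lie_homology K L N i) \<longleftrightarrow> homology_fg U J P d i"
proof -
  define c where "c = (SOME (P :: nat \<Rightarrow> (('l list \<Rightarrow> 'k) set, ('l list \<Rightarrow> 'k) set list) module, d, e).
    lie_resolution K L N P d e)"
  obtain P' d' e' where c: "c = (P', d', e')" by (cases c) auto
  have "case (P, d, e) of (P, d, e) \<Rightarrow> lie_resolution K L N P d e" using lie_resolutionI[OF P] by simp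
  from someI[of "\<lambda>(P, d, e). lie_resolution K L N P d e", OF this]
  have "lie_resolution K L N P' d' e'" using c by (simp add: c_def)
  then have P': "projective_resolution U (trivial_module K) P' d' e'" by (simp add: lie_resolution_def)
  note D' = resolutionD[OF P']
  have "lie_homology K L N i =
      homology (\<lambda>j. coinvariants K L N (P' j)) (\<lambda>j. coinvariants_map K L N (P' j) (d' j)) i"
    using c by (simp add: lie_homology_def c_def)
  then have "fin_gen V (lie_homology K L N i) \<longleftrightarrow> homology_fg U J P' d' i"
    using homology_fin_gen_iff[of P' d' i, OF D'(2,3) resolution_complex(2)[OF P']] by simp
  also have "\<dots> \<longleftrightarrow> homology_fg U J P d i"
    using homology_fg_transfer[OF trivial_right_module P' P J_sub] homology_fg_transfer[OF trivial_right_module P P' J_sub]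
    by blast
  finally show ?thesis .
qed

lemma J_augmentation: "J \<subseteq> {u \<in> carrier U. env_augmentation u = \<zero>}"
proof
  fix u assume "u \<in> J"
  then have u: "u \<in> carrier U" "pi u = \<zero>\<^bsub>V\<^esub>" by (auto simp: J_def)
  have "env_augmentation (\<zero>\<^bsub>V\<^esub> :: ('l set list \<Rightarrow> 'k) set) = \<zero>"
    using Q.augmentation_sca[of \<zero>] Q.sca_zero by simp
  then show "u \<in> {u \<in> carrier U. env_augmentation u = \<zero>}" using u pr.augmentation_env_map[OF u(1)] by simp
qed

end

section \<open>The finiteness criterion\<close>

context graded_lie
begin

lemma trivial_module_generated:
  "rspan U (trivial_module K) {\<one>} = carrier (trivial_module K :: (('l list \<Rightarrow> 'k) set, 'k) module)"
proof -
  let ?T = "trivial_module K :: (('l list \<Rightarrow> 'k) set, 'k) module"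
  interpret T: right_module U ?T by (rule trivial_right_module)
  have sub: "{\<one>} \<subseteq> carrier ?T" by (simp add: trivial_module_simps)
  note R = T.submoduleD[OF rspan_submodule[OF T.right_module_axioms sub]]
  have "a \<in> rspan U ?T {\<one>}" if a: "a \<in> carrier K" for a
  proof -
    have "\<one> \<in> rspan U ?T {\<one>}" by (rule subsetD[OF rspan_incl]) simp
    from R(4)[OF sca_closed[OF a] this] show ?thesis using a by (simp add: trivial_module_simps augmentation_sca)
  qed
  then show ?thesis using R(1) by (auto simp: trivial_module_simps)
qed

text \<open>J is left open, as this is applied both to the kernel of U(L) \<rightarrow> U(L/N) and
  to the augmentation ideal.\<close>

lemma FP_iff_homology_fg:
  assumes J: "J \<subseteq> {u \<in> carrier U. env_augmentation u = \<zero>}" and noe: "noetherian_over U J"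
  obtains P :: "nat \<Rightarrow> (('l list \<Rightarrow> 'k) set, ('l list \<Rightarrow> 'k) set list) module" and d e
  where "projective_resolution U (trivial_module K) P d e"
    "graded_lie_FP K L G m \<longleftrightarrow> (\<forall>i\<le>m. homology_fg U J P d i)"
    "lie_FP K L m \<longleftrightarrow> (\<forall>i\<le>m. homology_fg U J P d i)"
proof -
  let ?T = "trivial_module K :: (('l list \<Rightarrow> 'k) set, 'k) module"
  \<comment> \<open>The two letters for the code: any two distinct values of the type over which the
    lists are formed will do, and the elements of U(L) are sets.\<close>
  have two: "{} \<noteq> (UNIV :: ('l list \<Rightarrow> 'k) set)" by simp
  have Jc: "J \<subseteq> carrier U" and Jz: "\<And>r. r \<in> J \<Longrightarrow> UG.RD.cmp r 0 = \<zero>\<^bsub>U\<^esub>"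
    using J augmentation_kernel_cmp by auto
  have one: "\<one> \<in> Kgr 0" by simp
  obtain P :: "nat \<Rightarrow> (('l list \<Rightarrow> 'k) set, ('l list \<Rightarrow> 'k) set list) module" and Pgr d e
    where P: "projective_resolution U ?T P d e" "\<And>i. graded_module U Ugr (P i) (Pgr i)"
      "\<And>i j. d i ` Pgr (Suc i) j \<subseteq> Pgr i j" "\<And>j. e ` Pgr 0 j \<subseteq> Kgr j"
      "\<And>i. \<exists>(X :: ('l list \<Rightarrow> 'k) set list set) s e. free_retract U (P i) X s e" "fin_gen U (P 0)"
      "\<And>i S. \<lbrakk>finite S; S \<subseteq> d i ` carrier (P (Suc i)); d i ` carrier (P (Suc i)) \<subseteq>
         rspan U (P i) (S \<union> ideal_mult U (P i) J (d i ` carrier (P (Suc i))))\<rbrakk> \<Longrightarrow> fin_gen U (P (Suc i))"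
    by (rule UG.graded_resolution[OF two trivial_graded one trivial_module_generated Jc Jz]; (assumption | rule that))
  note Tm = trivial_right_module
  have graded_FP: "graded_lie_FP K L G m" if h: "\<forall>i\<le>m. homology_fg U J P d i"
  proof -
    have "fin_gen U (P i)" if "i \<le> m" for i
      using that
    proof (induction i)
      case 0
      show ?case by (rule P(6))
    next
      case (Suc i)
      then have "fin_gen U (P i)" "homology_fg U J P d (Suc i)" using h by simp_all
      \<comment> \<open>Finite generation climbs one degree: it bounds the kernel modulo J in degree
        i, and the conditional clause of the resolution then applies in degree i + 1.\<close>
      from image_fg_mod_ideal[OF P(1) Jc noe this] show ?case using P(7) by blast
    qed
    then show ?thesis unfolding graded_lie_FP_def graded_type_FP_def using P(1-4) by blast
  qed
  have FP: "lie_FP K L m" if "graded_lie_FP K L G m"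
    using that unfolding graded_lie_FP_def graded_type_FP_def lie_FP_def type_FP_def
    by (elim exE conjE) (intro exI conjI; assumption)
  have hom: "\<forall>i\<le>m. homology_fg U J P d i" if FP: "lie_FP K L m"
  proof (intro allI impI)
    fix i assume i: "i \<le> m"
    obtain P' :: "nat \<Rightarrow> (('l list \<Rightarrow> 'k) set, ('l list \<Rightarrow> 'k) set list) module" and d' e'
      where P': "projective_resolution U ?T P' d' e'" "\<forall>i\<le>m. fin_gen U (P' i)"
      using FP unfolding lie_FP_def type_FP_def by (elim exE conjE)
    have "homology_fg U J P' d' i"
      by (rule fin_gen_homology_fg[of U P' d' J i, OF resolutionD(2,3)[OF P'(1)] Jc noe]) (use P'(2) i in blast)
    then show "homology_fg U J P d i" by (rule homology_fg_transfer[OF Tm P'(1) P(1) Jc])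
  qed
  show thesis using that[OF P(1)] graded_FP FP hom by blast
qed

lemma graded_FP_iff_FP: "graded_lie_FP K L G m \<longleftrightarrow> lie_FP K L m"
proof -
  have surj: "env_augmentation ` carrier U = carrier K"
  proof
    show "env_augmentation ` carrier U \<subseteq> carrier K" using ring_hom_closed[OF augmentation_hom] by blast
    show "carrier K \<subseteq> env_augmentation ` carrier U"
    proof
      fix a assume a: "a \<in> carrier K"
      show "a \<in> env_augmentation ` carrier U"
        using imageI[OF sca_closed[OF a], of env_augmentation] by (simp add: augmentation_sca a)
    qed
  qed
  have "field K" ..
  from noetherian_over_kernel[OF U.ring_axioms field_right_noetherian[OF this] augmentation_hom surj]
  have noe: "noetherian_over U {u \<in> carrier U. env_augmentation u = \<zero>}" .
  show ?thesis by (rule FP_iff_homology_fg[OF subset_refl noe, of m]) blast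
qed

lemma graded_FP_iff_homology:
  assumes N: "lie_ideal N K L" and noe: "right_noetherian (env K (lie_quotient L N))"
  shows "graded_lie_FP K L G m \<longleftrightarrow> (\<forall>i\<le>m. fin_gen (env K (lie_quotient L N)) (lie_homology K L N i))"
proof -
  interpret NI: lie_with_ideal K L N
    by (intro lie_with_ideal.intro lie_with_ideal_axioms.intro lie_algebra_axioms N)
  show ?thesis
    by (rule FP_iff_homology_fg[OF NI.J_augmentation NI.noetherian_over_J[OF noe], of m])
      (simp add: NI.lie_homology_fin_gen_iff)
qed

end

theorem proposition2p2:
  fixes K :: "'k ring" and L :: "('k, 'l) lie" and G :: "nat \<Rightarrow> 'l set" and m :: nat
  assumes "graded_lie_algebra K L G"
  shows "(\<forall>N. graded_lie_ideal N K L G \<and>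
            left_noetherian (env K (lie_quotient L N)) \<and>
            right_noetherian (env K (lie_quotient L N)) \<longrightarrow>
            (graded_lie_FP K L G m \<longleftrightarrow>
              (\<forall>i\<le>m. fin_gen (env K (lie_quotient L N)) (lie_homology K L N i))))
       \<and> (graded_lie_FP K L G m \<longleftrightarrow> lie_FP K L m)"
proof -
  have "lie_algebra K L" using assms by (simp add: graded_lie_algebra_def)
  then interpret graded_lie K L G
    by (intro graded_lie.intro graded_lie_axioms.intro assms)
  show ?thesis
    using graded_FP_iff_homology graded_FP_iff_FP unfolding graded_lie_ideal_def by blast
qed

end
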